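(* Let $n\ge 2$. There is a $\mathbb{Z}[\delta^{\pm1}]$-algebra isomorphism $$\phi:\mathrm{Br}(\mathrm{C}_n)\longrightarrow \mathrm{SBr}(\mathrm{A}_{2n-1})$$ determined by $\phi(r_0)=R_n$, $\phi(e_0)=E_n$, and $\phi(r_i)=R_{n-i}R_{n+i}$, $\phi(e_i)=E_{n-i}E_{n+i}$ for $0<i<n$. In particular, $\mathrm{Br}(\mathrm{C}_n)$ is a free $\mathbb{Z}[\delta^{\pm1}]$-module of rank $a_{2n}$, where the sequence $(a_m)_{m\ge0}$ is defined by $a_0=a_1=1$ and $a_m=a_{m-1}+2(m-1)a_{m-2}$ for $m>1$.
   Context: Let $R$ be a commutative ring with an invertible element $\delta$, and $n\ge1$. The Brauer algebra of type $\mathrm{C}_n$, $\mathrm{Br}(\mathrm{C}_n,R,\delta)$, is the unital associative $R$-algebra generated by $r_0,\dots,r_{n-1},e_0,\dots,e_{n-1}$ subject to the following relations, where for distinct $i,j\in\{0,\dots,n-1\}$ we write $i\sim j$ if $|i-j|=1$ and $i\nsim j$ otherwise: $r_i^2=1$ and $r_ie_i=e_ir_i=e_i$ for all $i$; $e_i^2=\delta^2e_i$ for $i>0$; $e_0^2=\delta e_0$; $r_ir_j=r_jr_i$, $e_ir_j=r_je_i$, $e_ie_j=e_je_i$ for $i\nsim j$; $r_ir_jr_i=r_jr_ir_j$, $r_jr_ie_j=e_ie_j$, $r_ie_jr_i=r_je_ir_j$ for $i\sim j$ with $i,j>0$; and $r_1r_0r_1r_0=r_0r_1r_0r_1$, $r_1r_0e_1=r_0e_1$,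 $r_1e_0r_1e_0=e_0e_1e_0$, $r_1r_0r_1e_0=e_0r_1r_0r_1$, $e_1r_0e_1=\delta e_1$, $e_1e_0e_1=\delta e_1$, $e_1r_0r_1=e_1r_0$, $e_1e_0r_1=e_1e_0$. Write $\mathrm{Br}(\mathrm{C}_n)=\mathrm{Br}(\mathrm{C}_n,\mathbb{Z}[\delta^{\pm1}],\delta)$. $\mathrm{Br}(\mathrm{A}_{2n-1})$ denotes the classical Brauer algebra on $2n$ strands over $\mathbb{Z}[\delta^{\pm1}]$: it is free with basis the Brauer diagrams, i.e. perfect matchings of the $4n$ dots $(j,1),(j,0)$, $1\le j\le 2n$, with multiplication by concatenation (placing one diagram on top of the other) where each closed loop formed is replaced by a factor $\delta$. $R_j$ ($1\le j\le 2n-1$) is the diagram joining $(j,1)$ to $(j+1,0)$, $(j+1,1)$ to $(j,0)$ and $(k,1)$ to $(k,0)$ for $k\ne j,j+1$; $E_j$ is the diagram joining $(j,1)$ to $(j+1,1)$, $(j,0)$ to $(j+1,0)$ and $(k,1)$ to $(k,0)$ for $k\neq j,j+1$. A Brauer diagram is symmetric if it is invariant under the reflection $(j,\epsilon)\mapsto(2n+1-j,\epsilon)$ of the dots. $\mathrm{SBr}(\mathrm{A}_{2n-1})$ is the $\mathbb{Z}[\delta^{\pm1}]$-linear span of the symmetric Brauer diagrams. *)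

theory Defs
  imports Main "HOL-Library.Poly_Mapping"
begin

text \<open>Laurent polynomials over Z as the group ring of (int,+): finitely supported
  int-valued functions on exponents, with convolution product.\<close>
type_synonym laurent = "int \<Rightarrow>\<^sub>0 int"

definition delta :: laurent where
  "delta = Poly_Mapping.single 1 1"

text \<open>A dot (j, eps) with eps = True meaning (j,1) (top) and False meaning (j,0) (bottom).\<close>
type_synonym dot = "nat \<times> bool"
type_synonym diagram = "dot set set"

definition dots :: "nat \<Rightarrow> dot set" where
  "dots N = {1..N} \<times> UNIV"

definition perfect_matching :: "'a set \<Rightarrow> 'a set set \<Rightarrow> bool" where
  "perfect_matching V M \<longleftrightarrow>
     (\<forall>e\<in>M. \<exists>x y. x \<noteq> y \<and> x \<in> V \<and> y \<in> V \<and> e = {x, y}) \<and>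
     (\<forall>v\<in>V. \<exists>!e. e \<in> M \<and> v \<in> e)"

definition brauer_diagram :: "nat \<Rightarrow> diagram \<Rightarrow> bool" where
  "brauer_diagram N D \<longleftrightarrow> perfect_matching (dots N) D"

text \<open>Concatenation a.b: a is placed on top of b; the bottom row of a is identified with
  the top row of b.  Layers: 2 = top of a, 1 = middle, 0 = bottom of b.\<close>
definition lay_top :: "dot \<Rightarrow> nat \<times> nat" where
  "lay_top p = (fst p, if snd p then 2 else 1)"

definition lay_bot :: "dot \<Rightarrow> nat \<times> nat" where
  "lay_bot p = (fst p, if snd p then 1 else 0)"

definition comp_graph :: "diagram \<Rightarrow> diagram \<Rightarrow> (nat \<times> nat) set set" where
  "comp_graph a b = (\<lambda>e. lay_top ` e) ` a \<union> (\<lambda>e. lay_bot ` e) ` b"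

definition comp_conn :: "diagram \<Rightarrow> diagram \<Rightarrow> ((nat \<times> nat) \<times> (nat \<times> nat)) set" where
  "comp_conn a b = {(x, y). \<exists>e\<in>comp_graph a b. x \<in> e \<and> y \<in> e}\<^sup>*"

definition unlayer :: "nat \<times> nat \<Rightarrow> dot" where
  "unlayer x = (fst x, snd x = 2)"

definition diagram_comp :: "diagram \<Rightarrow> diagram \<Rightarrow> diagram" where
  "diagram_comp a b =
     {{unlayer x, unlayer y} | x y. x \<noteq> y \<and> snd x \<noteq> 1 \<and> snd y \<noteq> 1 \<and> (x, y) \<in> comp_conn a b}"

definition num_loops :: "diagram \<Rightarrow> diagram \<Rightarrow> nat" where
  "num_loops a b = card {comp_conn a b `` {x} | x.
      x \<in> \<Union>(comp_graph a b) \<and> snd x = 1 \<and> (\<forall>y. (x, y) \<in> comp_conn a b \<longrightarrow> snd y = 1)}"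

type_synonym brauer_elt = "diagram \<Rightarrow>\<^sub>0 laurent"

definition bmult :: "brauer_elt \<Rightarrow> brauer_elt \<Rightarrow> brauer_elt" where
  "bmult x y = (\<Sum>a\<in>Poly_Mapping.keys x. \<Sum>b\<in>Poly_Mapping.keys y.
      Poly_Mapping.single (diagram_comp a b) (Poly_Mapping.lookup x a * Poly_Mapping.lookup y b * delta ^ num_loops a b))"

definition bscale :: "laurent \<Rightarrow> brauer_elt \<Rightarrow> brauer_elt" where
  "bscale c x = Poly_Mapping.map (\<lambda>a. c * a) x"

definition id_diag :: "nat \<Rightarrow> diagram" where
  "id_diag N = {{(k, True), (k, False)} | k. k \<in> {1..N}}"

definition brauer_one :: "nat \<Rightarrow> brauer_elt" where
  "brauer_one N = Poly_Mapping.single (id_diag N) 1"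

definition R_diag :: "nat \<Rightarrow> nat \<Rightarrow> diagram" where
  "R_diag N j = {{(j, True), (j + 1, False)}, {(j + 1, True), (j, False)}} \<union>
     {{(k, True), (k, False)} | k. k \<in> {1..N} \<and> k \<noteq> j \<and> k \<noteq> j + 1}"

definition E_diag :: "nat \<Rightarrow> nat \<Rightarrow> diagram" where
  "E_diag N j = {{(j, True), (j + 1, True)}, {(j, False), (j + 1, False)}} \<union>
     {{(k, True), (k, False)} | k. k \<in> {1..N} \<and> k \<noteq> j \<and> k \<noteq> j + 1}"

definition R_el :: "nat \<Rightarrow> nat \<Rightarrow> brauer_elt" where
  "R_el N j = Poly_Mapping.single (R_diag N j) 1"

definition E_el :: "nat \<Rightarrow> nat \<Rightarrow> brauer_elt" where
  "E_el N j = Poly_Mapping.single (E_diag N j) 1"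

definition reflect :: "nat \<Rightarrow> dot \<Rightarrow> dot" where
  "reflect N p = (N + 1 - fst p, snd p)"

definition symmetric_diagram :: "nat \<Rightarrow> diagram \<Rightarrow> bool" where
  "symmetric_diagram N D \<longleftrightarrow> (\<lambda>e. reflect N ` e) ` D = D"

definition SBr :: "nat \<Rightarrow> brauer_elt set" where
  "SBr N = {x. Poly_Mapping.keys x \<subseteq> {D. brauer_diagram N D \<and> symmetric_diagram N D}}"

datatype genC = gr nat | ge nat

fun gen_idx :: "genC \<Rightarrow> nat" where
  "gen_idx (gr i) = i" | "gen_idx (ge i) = i"

type_synonym free_elt = "genC list \<Rightarrow>\<^sub>0 laurent"

definition fmult :: "free_elt \<Rightarrow> free_elt \<Rightarrow> free_elt" where
  "fmult x y = (\<Sum>u\<in>Poly_Mapping.keys x. \<Sum>v\<in>Poly_Mapping.keys y. Poly_Mapping.single (u @ v) (Poly_Mapping.lookup x u * Poly_Mapping.lookup y v))"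

abbreviation W :: "genC list \<Rightarrow> free_elt" where
  "W u \<equiv> Poly_Mapping.single u 1"

definition freeC :: "nat \<Rightarrow> free_elt set" where
  "freeC n = {x. \<forall>u\<in>Poly_Mapping.keys x. \<forall>g\<in>set u. gen_idx g < n}"

definition adj :: "nat \<Rightarrow> nat \<Rightarrow> bool" where
  "adj i j \<longleftrightarrow> i = j + 1 \<or> j = i + 1"

definition relC :: "nat \<Rightarrow> (free_elt \<times> free_elt) set" where
  "relC n =
     {(W [gr i, gr i], W []) | i. i < n}
   \<union> {(W [gr i, ge i], W [ge i]) | i. i < n}
   \<union> {(W [ge i, gr i], W [ge i]) | i. i < n}
   \<union> {(W [ge i, ge i], Poly_Mapping.single [ge i] (delta ^ 2)) | i. 0 < i \<and> i < n}
   \<union> {(W [ge 0, ge 0], Poly_Mapping.single [ge 0] delta)}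
   \<union> {(W [gr i, gr j], W [gr j, gr i]) | i j. i < n \<and> j < n \<and> i \<noteq> j \<and> \<not> adj i j}
   \<union> {(W [ge i, gr j], W [gr j, ge i]) | i j. i < n \<and> j < n \<and> i \<noteq> j \<and> \<not> adj i j}
   \<union> {(W [ge i, ge j], W [ge j, ge i]) | i j. i < n \<and> j < n \<and> i \<noteq> j \<and> \<not> adj i j}
   \<union> {(W [gr i, gr j, gr i], W [gr j, gr i, gr j]) | i j. i < n \<and> j < n \<and> adj i j \<and> 0 < i \<and> 0 < j}
   \<union> {(W [gr j, gr i, ge j], W [ge i, ge j]) | i j. i < n \<and> j < n \<and> adj i j \<and> 0 < i \<and> 0 < j}
   \<union> {(W [gr i, ge j, gr i], W [gr j, ge i, gr j]) | i j. i < n \<and> j < n \<and> adj i j \<and> 0 < i \<and> 0 < j}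
   \<union> {(W [gr 1, gr 0, gr 1, gr 0], W [gr 0, gr 1, gr 0, gr 1]),
      (W [gr 1, gr 0, ge 1], W [gr 0, ge 1]),
      (W [gr 1, ge 0, gr 1, ge 0], W [ge 0, ge 1, ge 0]),
      (W [gr 1, gr 0, gr 1, ge 0], W [ge 0, gr 1, gr 0, gr 1]),
      (W [ge 1, gr 0, ge 1], Poly_Mapping.single [ge 1] delta),
      (W [ge 1, ge 0, ge 1], Poly_Mapping.single [ge 1] delta),
      (W [ge 1, gr 0, gr 1], W [ge 1, gr 0]),
      (W [ge 1, ge 0, gr 1], W [ge 1, ge 0])}"

inductive_set idealC :: "nat \<Rightarrow> free_elt set" for n where
  rel: "(x, y) \<in> relC n \<Longrightarrow> x - y \<in> idealC n"
| zero: "0 \<in> idealC n"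
| add: "x \<in> idealC n \<Longrightarrow> y \<in> idealC n \<Longrightarrow> x + y \<in> idealC n"
| lmul: "x \<in> idealC n \<Longrightarrow> z \<in> freeC n \<Longrightarrow> fmult z x \<in> idealC n"
| rmul: "x \<in> idealC n \<Longrightarrow> z \<in> freeC n \<Longrightarrow> fmult x z \<in> idealC n"

fun phi_gen :: "nat \<Rightarrow> genC \<Rightarrow> brauer_elt" where
  "phi_gen n (gr i) = (if i = 0 then R_el (2 * n) n
                       else bmult (R_el (2 * n) (n - i)) (R_el (2 * n) (n + i)))"
| "phi_gen n (ge i) = (if i = 0 then E_el (2 * n) n
                       else bmult (E_el (2 * n) (n - i)) (E_el (2 * n) (n + i)))"

definition phi_word :: "nat \<Rightarrow> genC list \<Rightarrow> brauer_elt" where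
  "phi_word n u = foldr (\<lambda>g acc. bmult (phi_gen n g) acc) u (brauer_one (2 * n))"

definition phi :: "nat \<Rightarrow> free_elt \<Rightarrow> brauer_elt" where
  "phi n x = (\<Sum>u\<in>Poly_Mapping.keys x. bscale (Poly_Mapping.lookup x u) (phi_word n u))"

fun a_seq :: "nat \<Rightarrow> nat" where
  "a_seq 0 = 1"
| "a_seq (Suc 0) = 1"
| "a_seq (Suc (Suc m)) = a_seq (Suc m) + 2 * (Suc m) * a_seq m"

end

theory Submission imports Defs begin

text \<open>
  A diagram is a fixed-point free involution of the dots; it is symmetric if it commutes with the
  reflection.  That \<open>phi\<close> respects the relations is checked in a faithful linear representation:
  colour every dot by a Boolean and let a diagram act by the 0-1 matrix of colourings of its two rows
  that are constant on strands.  A closed loop then contributes a factor 2, so this action sees both the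
  composite diagram and the exponent of \<open>\<delta>\<close>.

  Injectivity is a statement about monoids: all relations equate words up to powers of \<open>\<delta>\<close>, so
  put \<open>\<delta> = 1\<close>.  In a monoid satisfying the relations, the \<open>r i\<close> represent the signed
  permutations, and the conjugates \<open>cup a b\<close> of the \<open>e i\<close> depend only on the dots \<open>a\<close>, \<open>b\<close>.  Every word
  equals a product of \<open>cup\<close>s for the top arcs, the self-mirrored \<open>cup\<close>s on the same dots, a signed
  permutation, and \<open>cup\<close>s for the bottom arcs; this product depends only on the diagram of the word, since
  left multiplication by a generator changes both in the same way.  So two words with the same diagram
  differ, modulo the relations, by a unit \<open>\<delta>\<^sup>k\<close>.

  Conversely every symmetric diagram is reached from a signed permutation by joining top dots, and the
  recursion for the number of symmetric diagrams comes from deleting the strands at a dot and at its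
  mirror image: either one self-mirrored pair of dots, or two mirrored strands.
\<close>

section \<open>Normal forms for words in Coxeter generators of type B\<close>

text \<open>Two facts about \<open>\<delta>\<close> link algebra and monoid. It is a unit, so it may
  be set to 1 in the relations and its exponent restored afterwards by a power, possibly a negative
  one. And the image of a word under \<open>phi\<close> fixes that exponent, so it is never tracked
  through the normal form. Injectivity then needs no count: words chosen one per diagram span modulo
  the ideal, and their images are unit multiples of distinct diagrams.

  The obstacle in the normal form is that a diagram determines the signed permutation only on its
  vertical strands. The self-mirrored factors absorb this ambiguity: two of them swallow the
  reflection exchanging their dots. The same mechanism rearranges strands: next to
  \<open>cup a b\<close>, a factor \<open>cup b c\<close> sharing a dot becomes a permutation, which
  is then absorbed.

  Relations are checked at the innermost dots and carried elsewhere by conjugation. The definition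
  of \<open>cup\<close>, however, starts from the outermost dots, because their stabilizers are
  generated by simple reflections.\<close>

locale typeB_generators = monoid f z for f :: "'a \<Rightarrow> 'a \<Rightarrow> 'a" (infixl \<open>\<cdot>\<close> 70) and z :: 'a +
  fixes r :: "nat \<Rightarrow> 'a" and M :: nat
  assumes r_inv: "i < M \<Longrightarrow> r i \<cdot> r i = z"
    and r_comm: "i + 1 < j \<Longrightarrow> j < M \<Longrightarrow> r i \<cdot> r j = r j \<cdot> r i"
    and r_braid: "0 < i \<Longrightarrow> i + 1 < M \<Longrightarrow> r i \<cdot> r (i + 1) \<cdot> r i = r (i + 1) \<cdot> r i \<cdot> r (i + 1)"
    and r_braid0: "1 < M \<Longrightarrow> r 0 \<cdot> r 1 \<cdot> r 0 \<cdot> r 1 = r 1 \<cdot> r 0 \<cdot> r 1 \<cdot> r 0"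
begin

lemma r_inv_assoc: "i < M \<Longrightarrow> r i \<cdot> (r i \<cdot> x) = x"
  by (metis assoc left_neutral r_inv)

lemma r_comm_assoc: "i + 1 < j \<Longrightarrow> j < M \<Longrightarrow> r i \<cdot> (r j \<cdot> x) = r j \<cdot> (r i \<cdot> x)"
  by (metis assoc r_comm)

lemma r_braid_assoc:
  "0 < i \<Longrightarrow> i + 1 < M \<Longrightarrow> r i \<cdot> (r (i + 1) \<cdot> (r i \<cdot> x)) = r (i + 1) \<cdot> (r i \<cdot> (r (i + 1) \<cdot> x))"
  by (metis assoc r_braid)

lemma r_braid0_assoc:
  "1 < M \<Longrightarrow> r 0 \<cdot> (r 1 \<cdot> (r 0 \<cdot> (r 1 \<cdot> x))) = r 1 \<cdot> (r 0 \<cdot> (r 1 \<cdot> (r 0 \<cdot> x)))"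
  by (metis assoc r_braid0)

text \<open>The suffix of length \<open>l\<close> of the word \<open>r m \<dots> r 1 r 0 r 1 \<dots> r m\<close>; these suffixes
  represent the cosets of the subgroup generated by \<open>r 0, \<dots>, r (m - 1)\<close>.  The truncated
  subtractions give the distance between \<open>m\<close> and \<open>l\<close>.\<close>
fun chain :: "nat \<Rightarrow> nat \<Rightarrow> 'a" where
  "chain m 0 = z"
| "chain m (Suc l) = r ((m - l) + (l - m)) \<cdot> chain m l"

fun eval :: "nat list \<Rightarrow> 'a" where
  "eval [] = z"
| "eval (i # w) = r i \<cdot> eval w"

lemma eval_append: "eval (u @ v) = eval u \<cdot> eval v"
  by (induction u) (simp_all add: assoc)

lemma chain_comm_low: "i + l < m \<Longrightarrow> m < M \<Longrightarrow> r i \<cdot> chain m l = chain m l \<cdot> r i"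
proof (induction l)
  case (Suc l)
  then have "i + 1 < m - l" "m - l < M" by linarith+
  from r_comm_assoc[OF this] have "r i \<cdot> chain m (Suc l) = r (m - l) \<cdot> (r i \<cdot> chain m l)"
    using Suc by simp
  then show ?case using Suc by (simp add: assoc)
qed simp

text \<open>For \<open>l \<le> m\<close> the chain is the ascending word from
  \<open>r (m - l + 1)\<close> to \<open>r m\<close>. The letter \<open>r i\<close> commutes with
  its initial letters and meets the pair \<open>r (i - 1)\<close>, \<open>r i\<close>, where the
  braid relation turns it into \<open>r (i - 1)\<close>; this commutes with the rest.\<close>

lemma chain_shift_low:
  assumes "l \<le> m" "m + 1 < i + l" "i \<le> m" "m < M"
  shows "r i \<cdot> chain m l = chain m l \<cdot> r (i - 1)"
  using assms
proof (induction l)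
  case (Suc l)
  show ?case
  proof (cases "i + l = m + 1")
    case True
    then obtain l' where l: "l = Suc l'" using Suc by (cases l) auto
    define k where "k = m - l"
    have i: "i = k + 1" "m - l' = k + 1" "0 < k" "k + 1 < M"
      using True Suc l by (auto simp: k_def)
    have "r i \<cdot> chain m (Suc l) = r (k + 1) \<cdot> (r k \<cdot> (r (k + 1) \<cdot> chain m l'))"
      using Suc l i by (simp add: k_def)
    also have "\<dots> = r k \<cdot> (r (k + 1) \<cdot> (r k \<cdot> chain m l'))"
      using i by (simp only: r_braid_assoc)
    also have "r k \<cdot> chain m l' = chain m l' \<cdot> r k"
      using i l True Suc by (intro chain_comm_low) auto
    finally show ?thesis using Suc l i by (simp add: k_def assoc)
  next
    case False
    then have "m - l + 1 < i" "i < M" using Suc.prems by linarith+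
    from r_comm_assoc[OF this] have "r i \<cdot> chain m (Suc l) = r (m - l) \<cdot> (r i \<cdot> chain m l)"
      using Suc by simp
    also have "r i \<cdot> chain m l = chain m l \<cdot> r (i - 1)"
      using Suc False by (intro Suc.IH) auto
    finally show ?thesis using Suc by (simp add: assoc)
  qed
qed simp

text \<open>The chain of length \<open>m + 1 + j\<close> descends from \<open>r j\<close> to
  \<open>r 0\<close> and then ascends from \<open>r 1\<close> to \<open>r m\<close>. An index above
  \<open>j + 1\<close> commutes with the descending half and is lowered in the ascending
  one.\<close>

lemma chain_shift_high:
  assumes "j + 1 < i" "i \<le> m" "m < M"
  shows "r i \<cdot> chain m (m + 1 + j) = chain m (m + 1 + j) \<cdot> r (i - 1)"
  using assms
proof (induction j)
  case 0
  have "r i \<cdot> chain m (Suc m) = r 0 \<cdot> (r i \<cdot> chain m m)"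
    using 0 r_comm_assoc[of 0 i "chain m m"] by simp
  also have "r i \<cdot> chain m m = chain m m \<cdot> r (i - 1)"
    using 0 by (intro chain_shift_low) auto
  finally show ?case by (simp add: assoc)
next
  case (Suc j)
  have "r i \<cdot> chain m (Suc (m + 1 + j)) = r (Suc j) \<cdot> (r i \<cdot> chain m (m + 1 + j))"
    using Suc r_comm_assoc[of "Suc j" i "chain m (m + 1 + j)"] by simp
  then show ?case using Suc by (simp add: assoc)
qed

text \<open>The index is raised by one in the descending half and lowered again in the ascending
  half, so it survives. For \<open>i = 0\<close> the turning point is crossed by the braid relation
  of length four.\<close>

lemma chain_comm_high:
  assumes "i < j" "j \<le> m" "m < M"
  shows "r i \<cdot> chain m (m + 1 + j) = chain m (m + 1 + j) \<cdot> r i"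
  using assms
proof (induction j)
  case (Suc j)
  show ?case
  proof (cases "i = j")
    case True
    have a: "chain m (m + 1 + Suc j) = r (j + 1) \<cdot> (r j \<cdot> chain m (m + j))"
      by simp
    show ?thesis
    proof (cases j)
      case 0
      obtain m' where m: "m = Suc m'" using Suc by (cases m) auto
      have c: "chain m m = r 1 \<cdot> chain m m'" using m by simp
      have "r i \<cdot> chain m (m + 1 + Suc j) = r 0 \<cdot> (r 1 \<cdot> (r 0 \<cdot> (r 1 \<cdot> chain m m')))"
        using a 0 True c by simp
      also have "\<dots> = r 1 \<cdot> (r 0 \<cdot> (r 1 \<cdot> (r 0 \<cdot> chain m m')))"
        using Suc m by (simp only: r_braid0_assoc)
      also have "r 0 \<cdot> chain m m' = chain m m' \<cdot> r 0"
        using Suc m by (intro chain_comm_low) auto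
      finally show ?thesis using a 0 True c by (simp add: assoc)
    next
      case (Suc j')
      have "r i \<cdot> chain m (m + 1 + Suc j) = r j \<cdot> (r (j + 1) \<cdot> (r j \<cdot> chain m (m + j)))"
        using a True by simp
      also have "\<dots> = r (j + 1) \<cdot> (r j \<cdot> (r (j + 1) \<cdot> chain m (m + j)))"
        using Suc Suc.prems by (intro r_braid_assoc) auto
      also have "r (j + 1) \<cdot> chain m (m + j) = chain m (m + j) \<cdot> r j"
        using chain_shift_high[of j' "j + 1" m] Suc Suc.prems \<open>Suc j \<le> m\<close> by simp
      finally show ?thesis using a True by (simp add: assoc)
    qed
  next
    case False
    have "r i \<cdot> chain m (Suc (m + 1 + j)) = r (Suc j) \<cdot> (r i \<cdot> chain m (m + 1 + j))"
      using Suc.prems False r_comm_assoc[of i "Suc j" "chain m (m + 1 + j)"] by simp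
    then show ?thesis using Suc False by (simp add: assoc)
  qed
qed simp

text \<open>The index with which \<open>r i\<close> comes out on the right of
  \<open>chain m l\<close>, collecting the results of the four lemmas above.\<close>

definition passed :: "nat \<Rightarrow> nat \<Rightarrow> nat \<Rightarrow> nat" where
  "passed m l i = (if l \<le> m then if i + l < m then i else i - 1
                   else if i + m + 1 < l then i else i - 1)"

text \<open>A generator times a coset representative is either another representative, one letter
  longer or shorter, or the same one followed by a generator of the smaller subgroup. Each case also
  lists the conditions on indices that characterise it, so that the same case can be selected in a
  second system of generators.\<close>

lemma chain_step:
  assumes "i \<le> m" "l \<le> 2 * m + 1" "m < M"
  obtains (up) "l \<le> 2 * m" "r i \<cdot> chain m l = chain m (Suc l)" "i = (m - l) + (l - m)"
  | (down) l' where "l = Suc l'" "r i \<cdot> chain m l = chain m l'" "i = (m - l') + (l' - m)"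
  | (pass) "passed m l i < m" "r i \<cdot> chain m l = chain m l \<cdot> r (passed m l i)"
      "i \<noteq> (m - l) + (l - m)" "\<And>l'. l = Suc l' \<Longrightarrow> i \<noteq> (m - l') + (l' - m)"
proof (cases "l \<le> 2 * m \<and> i = (m - l) + (l - m)")
  case True
  then show thesis using up by simp
next
  case no_next: False
  show thesis
  proof (cases "\<exists>l'. l = Suc l' \<and> i = (m - l') + (l' - m)")
    case True
    then show thesis using down assms by (auto simp: r_inv_assoc)
  next
    case False
    have "passed m l i < m \<and> r i \<cdot> chain m l = chain m l \<cdot> r (passed m l i)"
    proof (cases "l \<le> m")
      case le: True
      show ?thesis
      proof (cases "i + l < m")
        case True
        then show ?thesis using le assms chain_comm_low by (simp add: passed_def)
      next
        case nl: False
        then have "m + 1 < i + l"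
          using no_next False le assms by (cases l) auto
        then show ?thesis using nl le assms chain_shift_low by (simp add: passed_def)
      qed
    next
      case gt: False
      define j where "j = l - (m + 1)"
      have l: "l = m + 1 + j" using gt j_def by simp
      have ne: "i \<noteq> j" "i \<noteq> j + 1" "j \<le> m"
        using no_next False l assms by (auto simp: le_Suc_eq)
      show ?thesis
      proof (cases "i < j")
        case True
        then show ?thesis using chain_comm_high[of i j m] l ne assms by (simp add: passed_def)
      next
        case False
        then show ?thesis using chain_shift_high[of j i m] l ne assms by (simp add: passed_def)
      qed
    qed
    moreover have "i \<noteq> (m - l) + (l - m)"
      using no_next assms by (cases "l = 2 * m + 1") auto
    ultimately show thesis using pass False by blast
  qed
qed

end

text \<open>Two systems of generators, so that a normal form found in one is the same in the other.\<close>
locale typeB_pair = A: typeB_generators f z r M + B: typeB_generators f' z' r' M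
  for f :: "'a \<Rightarrow> 'a \<Rightarrow> 'a" and z r M and f' :: "'b \<Rightarrow> 'b \<Rightarrow> 'b" and z' r'
begin

text \<open>The cases of \<open>chain_step\<close> are decided by indices alone. One induction on
  the word therefore produces the same length and the same remaining word in both systems.\<close>

lemma decompose:
  assumes "m < M" "set w \<subseteq> {..m}"
  shows "\<exists>l w'. l \<le> 2 * m + 1 \<and> set w' \<subseteq> {..<m} \<and>
    A.eval w = f (A.chain m l) (A.eval w') \<and> B.eval w = f' (B.chain m l) (B.eval w')"
  using assms(2)
proof (induction w)
  case Nil
  show ?case by (rule exI[of _ 0], rule exI[of _ "[]"]) simp
next
  case (Cons i w)
  then obtain l w' where l: "l \<le> 2 * m + 1" "set w' \<subseteq> {..<m}"
    and ev: "A.eval w = f (A.chain m l) (A.eval w')" "B.eval w = f' (B.chain m l) (B.eval w')"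
    by auto
  have i: "i \<le> m" using Cons by simp
  have evi: "A.eval (i # w) = f (f (r i) (A.chain m l)) (A.eval w')"
    "B.eval (i # w) = f' (f' (r' i) (B.chain m l)) (B.eval w')"
    using ev by (simp_all add: A.assoc B.assoc)
  from i l(1) assms(1) show ?case
  proof (cases rule: A.chain_step)
    case up
    with i l assms(1) have "f' (r' i) (B.chain m l) = B.chain m (Suc l)"
      by simp
    with up show ?thesis using evi l by (intro exI[of _ "Suc l"] exI[of _ w']) auto
  next
    case (down l')
    with i l assms(1) have "f' (r' i) (B.chain m l) = B.chain m l'"
      by (simp add: B.r_inv_assoc)
    with down show ?thesis using evi l by (intro exI[of _ l'] exI[of _ w']) auto
  next
    case pass
    have "f' (r' i) (B.chain m l) = f' (B.chain m l) (r' (A.passed m l i))"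
      by (rule B.chain_step[OF i l(1) assms(1)]) (use pass in \<open>auto simp: A.passed_def B.passed_def\<close>)
    with pass show ?thesis using evi l
      by (intro exI[of _ l] exI[of _ "A.passed m l i # w'"]) (auto simp: A.assoc B.assoc)
  qed
qed

end

section \<open>Signed permutations\<close>

definition bar :: "nat \<Rightarrow> nat \<Rightarrow> nat" where
  "bar n a = 2 * n + 1 - a"

text \<open>The reflections of the hyperoctahedral group: for \<open>b = bar n a\<close> the
  exchange of a mirrored pair, otherwise the exchange of two dots together with that of their mirror
  images.\<close>

definition refl_perm :: "nat \<Rightarrow> nat \<Rightarrow> nat \<Rightarrow> nat \<Rightarrow> nat" where
  "refl_perm n a b x = (if x = a then b else if x = b then a
     else if x = bar n a then bar n b else if x = bar n b then bar n a else x)"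

definition simple_perm :: "nat \<Rightarrow> nat \<Rightarrow> nat \<Rightarrow> nat" where
  "simple_perm n i = refl_perm n (n + i) (n + i + 1)"

text \<open>Elements are functions on all naturals that fix everything outside the dots, so that
  composition, \<open>inv\<close> and equality need no restriction to
  \<open>{1..2 * n}\<close>.\<close>

definition signed_perm :: "nat \<Rightarrow> (nat \<Rightarrow> nat) \<Rightarrow> bool" where
  "signed_perm n g \<longleftrightarrow> bij g \<and> (\<forall>x. x \<notin> {1..2 * n} \<longrightarrow> g x = x) \<and>
     (\<forall>x\<in>{1..2 * n}. g (bar n x) = bar n (g x))"

lemma bar_bar [simp]: "a \<in> {1..2 * n} \<Longrightarrow> bar n (bar n a) = a"
  by (auto simp: bar_def)

lemma bar_in [simp]: "a \<in> {1..2 * n} \<Longrightarrow> bar n a \<in> {1..2 * n}"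
  by (auto simp: bar_def)

lemma bar_neq [simp]: "bar n a \<noteq> a"  "a \<noteq> bar n a"
  unfolding bar_def by presburger+

lemma bar_inj: "a \<in> {1..2 * n} \<Longrightarrow> b \<in> {1..2 * n} \<Longrightarrow> bar n a = bar n b \<longleftrightarrow> a = b"
  by (metis bar_bar)

lemma bar_eq_swap: "a \<in> {1..2 * n} \<Longrightarrow> b \<in> {1..2 * n} \<Longrightarrow> bar n a = b \<longleftrightarrow> a = bar n b"
  by (metis bar_bar)

lemma signed_perm_in: "signed_perm n g \<Longrightarrow> g x \<in> {1..2 * n} \<longleftrightarrow> x \<in> {1..2 * n}"
  unfolding signed_perm_def by (metis bij_pointE)

lemma signed_perm_bar: "signed_perm n g \<Longrightarrow> x \<in> {1..2 * n} \<Longrightarrow> g (bar n x) = bar n (g x)"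
  unfolding signed_perm_def by auto

lemma signed_perm_eq: "signed_perm n g \<Longrightarrow> g x = g y \<longleftrightarrow> x = y"
  unfolding signed_perm_def by (auto simp: bij_def inj_eq)

lemma signed_perm_id [simp]: "signed_perm n id" "signed_perm n (\<lambda>x. x)"
  by (auto simp: signed_perm_def bij_def)

lemma signed_perm_comp: "signed_perm n g \<Longrightarrow> signed_perm n h \<Longrightarrow> signed_perm n (g \<circ> h)"
  using signed_perm_in[of n h] unfolding signed_perm_def by (auto intro: bij_comp)

lemma signed_perm_inv:
  assumes "signed_perm n g"
  shows "signed_perm n (inv g)" "g (inv g x) = x" "inv g (g x) = x"
proof -
  have b: "bij g" using assms by (simp add: signed_perm_def)
  show s: "g (inv g x) = x" and i: "inv g (g x) = x" for x
    using b by (simp_all add: bij_def surj_f_inv_f)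
  show "signed_perm n (inv g)"
    unfolding signed_perm_def
  proof (intro conjI ballI allI impI)
    show "bij (inv g)" using b by (rule bij_imp_bij_inv)
    fix x
    show "inv g x = x" if "x \<notin> {1..2 * n}"
      using assms that i[of x] by (simp add: signed_perm_def)
    show "inv g (bar n x) = bar n (inv g x)" if "x \<in> {1..2 * n}"
      by (metis assms i s signed_perm_bar signed_perm_in that)
  qed
qed

lemma refl_perm_involutive:
  assumes "a \<in> {1..2 * n}" "b \<in> {1..2 * n}"
  shows "refl_perm n a b (refl_perm n a b x) = x"
  using assms by (auto simp: refl_perm_def bar_inj bar_eq_swap)

lemma signed_refl_perm:
  assumes "a \<in> {1..2 * n}" "b \<in> {1..2 * n}" "a \<noteq> b"
  shows "signed_perm n (refl_perm n a b)"
  unfolding signed_perm_def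
proof (intro conjI ballI allI impI)
  show "bij (refl_perm n a b)"
    using refl_perm_involutive[OF assms(1,2)] by (rule involuntory_imp_bij)
qed (use assms bar_in[of a n] bar_in[of b n] in \<open>auto simp: refl_perm_def bar_inj bar_eq_swap\<close>)

lemma simple_perm_simps:
  assumes "i < n"
  shows "simple_perm n i x = (if x = n + i then n + i + 1 else if x = n + i + 1 then n + i
    else if x = n + 1 - i then n - i else if x = n - i then n + 1 - i else x)"
proof -
  have "bar n (n + i) = n + 1 - i" "bar n (n + i + 1) = n - i"
    using assms by (simp_all add: bar_def)
  then show ?thesis unfolding simple_perm_def refl_perm_def by simp
qed

lemma signed_simple_perm: "i < n \<Longrightarrow> signed_perm n (simple_perm n i)"
  unfolding simple_perm_def by (rule signed_refl_perm) auto

lemma simple_perm_involutive: "i < n \<Longrightarrow> simple_perm n i (simple_perm n i x) = x"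
  unfolding simple_perm_def by (rule refl_perm_involutive) auto

lemma simple_perm_moved:
  assumes "i < n"
  shows "simple_perm n i (n + i) = n + i + 1" "simple_perm n i (n + i + 1) = n + i"
    "simple_perm n i (n + 1 - i) = n - i" "simple_perm n i (n - i) = n + 1 - i"
  using assms by (simp_all add: simple_perm_simps) arith+

lemma simple_perm_fixed:
  "i < n \<Longrightarrow> x \<notin> {n + i, n + i + 1, n + 1 - i, n - i} \<Longrightarrow> simple_perm n i x = x"
  by (simp add: simple_perm_simps)

lemma simple_perm_commute:
  assumes "i + 1 < j" "j < n"
  shows "simple_perm n i (simple_perm n j x) = simple_perm n j (simple_perm n i x)"
proof -
  define S where "S k = {n + k, n + k + 1, n + 1 - k, n - k}" for k
  have in_S: "simple_perm n k y \<in> S k" if "k < n" "y \<in> S k" for k y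
    using that simple_perm_moved[OF that(1)] by (auto simp: S_def)
  have "S i \<inter> S j = {}" using assms by (auto simp: S_def)
  then have disj: "y \<in> S i \<Longrightarrow> y \<notin> S j" for y by auto
  have fixed: "simple_perm n k y = y" if "k < n" "y \<notin> S k" for k y
    using simple_perm_fixed that by (simp add: S_def)
  have "i < n" using assms by simp
  show ?thesis
    using disj[of x] disj[of "simple_perm n i x"] disj[of "simple_perm n j x"] in_S[OF \<open>i < n\<close>, of x] in_S[OF \<open>j < n\<close>, of x]
      fixed[OF \<open>i < n\<close>, of x] fixed[OF \<open>j < n\<close>, of x] fixed[OF \<open>i < n\<close>, of "simple_perm n j x"]
      fixed[OF \<open>j < n\<close>, of "simple_perm n i x"]
    by (cases "x \<in> S i"; cases "x \<in> S j") auto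
qed

lemma simple_perm_braid:
  assumes "0 < i" "i + 1 < n"
  shows "simple_perm n i (simple_perm n (i + 1) (simple_perm n i x)) =
    simple_perm n (i + 1) (simple_perm n i (simple_perm n (i + 1) x))"
proof -
  have i: "i < n" "i + 1 < n" using assms by auto
  note m = simple_perm_moved[OF i(1)] simple_perm_moved[OF i(2)]
  have f: "simple_perm n i (n + i + 2) = n + i + 2" "simple_perm n i (n - i - 1) = n - i - 1"
    "simple_perm n (i + 1) (n + i) = n + i" "simple_perm n (i + 1) (n + 1 - i) = n + 1 - i"
    using assms by (auto intro!: simple_perm_fixed)
  have n: "n + (i + 1) = n + i + 1" "n + i + 1 + 1 = n + i + 2" "n + 1 - (i + 1) = n - i" "n - (i + 1) = n - i - 1"
    using assms by auto
  note m = m[unfolded n]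
  consider "x = n + i" | "x = n + i + 1" | "x = n + i + 2" | "x = n + 1 - i" | "x = n - i" | "x = n - i - 1"
    | "x \<notin> {n + i, n + i + 1, n + i + 2, n + 1 - i, n - i, n - i - 1}" by blast
  then show ?thesis
  proof cases
    case 7
    then have "simple_perm n i x = x" "simple_perm n (i + 1) x = x"
      using assms by (auto intro!: simple_perm_fixed)
    then show ?thesis by simp
  qed (simp_all only: m f)
qed

lemma simple_perm_braid0:
  assumes "1 < n"
  shows "simple_perm n 0 (simple_perm n 1 (simple_perm n 0 (simple_perm n 1 x))) =
    simple_perm n 1 (simple_perm n 0 (simple_perm n 1 (simple_perm n 0 x)))"
proof -
  have i: "0 < n" "1 < n" using assms by auto
  have n: "n + 0 = n" "n + 1 + 1 = n + 2" "n + 1 - 1 = n" "n - 0 = n" "n + 1 - 0 = n + 1" by simp_all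
  note m = simple_perm_moved[OF i(1)] simple_perm_moved[OF i(2)]
  note m = m[unfolded n]
  have f: "simple_perm n 0 (n + 2) = n + 2" "simple_perm n 0 (n - 1) = n - 1"
    using assms by (auto intro!: simple_perm_fixed)
  consider "x = n + 1" | "x = n + 2" | "x = n" | "x = n - 1" | "x \<notin> {n + 1, n + 2, n, n - 1}" by blast
  then show ?thesis
  proof cases
    case 5
    then have "simple_perm n 0 x = x" "simple_perm n 1 x = x"
      using assms by (auto intro!: simple_perm_fixed)
    then show ?thesis by simp
  qed (simp_all only: m f)
qed

global_interpretation perms: typeB_generators "(\<circ>)" id "simple_perm n" n for n
proof
  fix i j :: nat
  show "simple_perm n i \<circ> simple_perm n i = id" if "i < n"
    using that by (simp add: fun_eq_iff simple_perm_involutive)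
  show "simple_perm n i \<circ> simple_perm n j = simple_perm n j \<circ> simple_perm n i" if "i + 1 < j" "j < n"
    using simple_perm_commute[OF that] by (simp add: fun_eq_iff)
  show "simple_perm n i \<circ> simple_perm n (i + 1) \<circ> simple_perm n i =
      simple_perm n (i + 1) \<circ> simple_perm n i \<circ> simple_perm n (i + 1)" if "0 < i" "i + 1 < n"
    using simple_perm_braid[OF that] by (simp add: fun_eq_iff)
  show "simple_perm n 0 \<circ> simple_perm n 1 \<circ> simple_perm n 0 \<circ> simple_perm n 1 =
      simple_perm n 1 \<circ> simple_perm n 0 \<circ> simple_perm n 1 \<circ> simple_perm n 0" if "1 < n"
    using simple_perm_braid0[OF that] by (simp add: fun_eq_iff)
qed (auto simp: fun_eq_iff)

definition word_perm :: "nat \<Rightarrow> nat list \<Rightarrow> nat \<Rightarrow> nat" where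
  "word_perm n = perms.eval n"

definition perm_chain :: "nat \<Rightarrow> nat \<Rightarrow> nat \<Rightarrow> nat \<Rightarrow> nat" where
  "perm_chain n = perms.chain n"

lemma word_perm_simps [simp]:
  "word_perm n [] = id" "word_perm n (i # w) = simple_perm n i \<circ> word_perm n w"
  unfolding word_perm_def perms.eval.simps by (rule refl)+

lemma word_perm_append: "word_perm n (u @ v) = word_perm n u \<circ> word_perm n v"
  unfolding word_perm_def by (rule perms.eval_append)

lemma perm_chain_simps [simp]:
  "perm_chain n m 0 = id"
  "perm_chain n m (Suc l) = simple_perm n ((m - l) + (l - m)) \<circ> perm_chain n m l"
  unfolding perm_chain_def perms.chain.simps by (rule refl)+

lemma signed_word_perm: "set w \<subseteq> {..<n} \<Longrightarrow> signed_perm n (word_perm n w)"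
  by (induction w) (auto intro!: signed_perm_comp signed_simple_perm)

lemma word_perm_fixes:
  assumes "set w \<subseteq> {..<m}" "m \<le> n" "x \<notin> {n - m + 1..n + m}"
  shows "word_perm n w x = x"
  using assms(1)
proof (induction w)
  case (Cons i w)
  then show ?case using assms(2,3) by (auto intro!: simple_perm_fixed)
qed simp

text \<open>Every letter of the chain moves the outermost dot of its range one place inwards, across
  the centre and on to the other side. So the length of a chain can be read off from the image of
  that dot.\<close>

lemma chain_top:
  assumes "m < n" "l \<le> 2 * m + 1"
  shows "perm_chain n m l (n + m + 1) = n + m + 1 - l"
  using assms(2)
proof (induction l)
  case (Suc l)
  then have *: "perm_chain n m l (n + m + 1) = n + m + 1 - l" by simp
  have "m - l + (l - m) < n" using assms Suc by auto
  then have "simple_perm n (m - l + (l - m)) (n + m + 1 - l) = n + m - l"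
    using Suc.prems assms by (cases "l \<le> m") (auto simp: simple_perm_simps)
  then show ?case using * Suc by simp
qed simp

lemma signed_chain: "m < n \<Longrightarrow> l \<le> 2 * m + 1 \<Longrightarrow> signed_perm n (perm_chain n m l)"
  by (induction l) (auto intro!: signed_perm_comp signed_simple_perm)

lemma chain_eq_word:
  assumes "m < n" "l \<le> 2 * m + 1"
  shows "\<exists>w. set w \<subseteq> {..m} \<and> word_perm n w = perm_chain n m l"
  using assms(2)
proof (induction l)
  case 0
  show ?case by (rule exI[of _ "[]"]) simp
next
  case (Suc l)
  then obtain w where w: "set w \<subseteq> {..m}" "word_perm n w = perm_chain n m l" by auto
  show ?case
    by (rule exI[of _ "(m - l + (l - m)) # w"]) (use w Suc in auto)
qed

lemma chain_fixes:
  assumes "m < n" "l \<le> 2 * m + 1" "x \<notin> {n - m..n + m + 1}"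
  shows "perm_chain n m l x = x"
proof -
  obtain w where "set w \<subseteq> {..m}" "word_perm n w = perm_chain n m l"
    using chain_eq_word assms by blast
  then show ?thesis using word_perm_fixes[of w "Suc m" n x] assms
    by (auto simp: lessThan_Suc_atMost)
qed

text \<open>The coset decomposition on the side of permutations: the image of the outermost dot
  \<open>n + m + 1\<close> selects the chain, and what remains fixes that dot and, by symmetry, its
  mirror image \<open>n - m\<close>.\<close>

lemma word_perm_surj:
  assumes "m \<le> n" "signed_perm n g" "\<And>x. x \<notin> {n - m + 1..n + m} \<Longrightarrow> g x = x"
  shows "\<exists>w. set w \<subseteq> {..<m} \<and> word_perm n w = g"
  using assms
proof (induction m arbitrary: g)
  case 0
  then have "g = id" by (auto simp: fun_eq_iff)
  then show ?case by (intro exI[of _ "[]"]) simp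
next
  case (Suc m)
  have top: "g (n + m + 1) \<in> {n - m..n + m + 1}"
  proof (rule ccontr)
    assume "\<not> ?thesis"
    then have "g (g (n + m + 1)) = g (n + m + 1)" using Suc by simp
    then have "g (n + m + 1) = n + m + 1" using Suc signed_perm_eq by metis
    with \<open>\<not> ?thesis\<close> show False by simp
  qed
  define l where "l = n + m + 1 - g (n + m + 1)"
  have l: "l \<le> 2 * m + 1" "g (n + m + 1) = n + m + 1 - l"
    using top Suc by (auto simp: l_def)
  define c where "c = perm_chain n m l"
  have c: "signed_perm n c" "c (n + m + 1) = g (n + m + 1)"
    using signed_chain chain_top l Suc by (auto simp: c_def)
  define g' where "g' = inv c \<circ> g"
  have g': "signed_perm n g'" unfolding g'_def
    using Suc c by (intro signed_perm_comp signed_perm_inv)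
  have t: "g' (n + m + 1) = n + m + 1"
    by (metis c comp_apply g'_def signed_perm_inv(3))
  have "g' x = x" if x: "x \<notin> {n - m + 1..n + m}" for x
  proof -
    consider "x = n + m + 1" | "x = n - m" | "x \<notin> {n - m..n + m + 1}"
      using x by fastforce
    then show ?thesis
    proof cases
      case 2
      then have "x = bar n (n + m + 1)" using Suc by (simp add: bar_def)
      then show ?thesis using signed_perm_bar[OF g', of "n + m + 1"] t Suc by simp
    next
      case 3
      then have "c x = x" "g x = x" using chain_fixes[of m n l x] l Suc by (auto simp: c_def)
      then show ?thesis by (metis c(1) comp_apply g'_def signed_perm_inv(3))
    qed (use t in simp)
  qed
  with Suc.IH[of g'] g' Suc.prems(1) obtain w where w: "set w \<subseteq> {..<m}" "word_perm n w = g'" by auto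
  obtain v where v: "set v \<subseteq> {..m}" "word_perm n v = c"
    using chain_eq_word[of m n l] l Suc by (auto simp: c_def)
  have "word_perm n (v @ w) = g"
    using v w c by (simp add: word_perm_append g'_def fun_eq_iff signed_perm_inv)
  then show ?case using v w by (intro exI[of _ "v @ w"]) auto
qed

context typeB_generators
begin

interpretation typeB_pair f z r M "(\<circ>)" id "simple_perm M" ..

lemma eval_decompose:
  assumes "m < M" "set w \<subseteq> {..m}"
  shows "\<exists>l w'. l \<le> 2 * m + 1 \<and> set w' \<subseteq> {..<m} \<and>
    eval w = chain m l \<cdot> eval w' \<and> word_perm M w = perm_chain M m l \<circ> word_perm M w'"
  using decompose[OF assms] unfolding word_perm_def perm_chain_def .

lemma decompose_length:
  assumes "m < M" "l \<le> 2 * m + 1" "set w' \<subseteq> {..<m}" "word_perm M w = perm_chain M m l \<circ> word_perm M w'"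
  shows "l = M + m + 1 - word_perm M w (M + m + 1)"
proof -
  have "word_perm M w' (M + m + 1) = M + m + 1"
    using assms by (intro word_perm_fixes) auto
  then show ?thesis using chain_top[of m M l] assms by simp
qed

text \<open>This is the faithfulness of the Coxeter presentation. Both words split off a chain; the
  chains have the same length because it is read off from the permutation, and the remainders are
  compared by induction.\<close>

theorem eval_cong_perm:
  assumes "m \<le> M" "set u \<subseteq> {..<m}" "set v \<subseteq> {..<m}" "word_perm M u = word_perm M v"
  shows "eval u = eval v"
  using assms
proof (induction m arbitrary: u v)
  case (Suc m)
  have m: "m < M" "set u \<subseteq> {..m}" "set v \<subseteq> {..m}" using Suc by (auto simp: lessThan_Suc_atMost)
  obtain l u' where u: "l \<le> 2 * m + 1" "set u' \<subseteq> {..<m}" "eval u = chain m l \<cdot> eval u'"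
      "word_perm M u = perm_chain M m l \<circ> word_perm M u'"
    using eval_decompose[OF m(1,2)] by blast
  obtain k v' where v: "k \<le> 2 * m + 1" "set v' \<subseteq> {..<m}" "eval v = chain m k \<cdot> eval v'"
      "word_perm M v = perm_chain M m k \<circ> word_perm M v'"
    using eval_decompose[OF m(1,3)] by blast
  have "l = k"
    using decompose_length[OF m(1) u(1,2,4)] decompose_length[OF m(1) v(1,2,4)] Suc.prems(4) by simp
  moreover have "word_perm M u' = word_perm M v'"
  proof
    fix x
    have "perm_chain M m l (word_perm M u' x) = perm_chain M m l (word_perm M v' x)"
      using fun_cong[OF u(4), of x] fun_cong[OF v(4), of x] \<open>l = k\<close> Suc.prems(4) by simp
    then show "word_perm M u' x = word_perm M v' x"
      using signed_perm_eq[OF signed_chain[OF m(1) u(1)]] by simp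
  qed
  then have "eval u' = eval v'" using Suc.IH[of u' v'] u(2) v(2) m(1) by simp
  ultimately show ?case using u v by simp
qed simp

text \<open>Stabilizers of the outermost dots are standard parabolic subgroups.\<close>
lemma eval_shrink:
  assumes "m < M" "set w \<subseteq> {..m}" "word_perm M w (M + m + 1) = M + m + 1"
  shows "\<exists>w'. set w' \<subseteq> {..<m} \<and> eval w = eval w' \<and> word_perm M w = word_perm M w'"
proof -
  obtain l w' where w: "l \<le> 2 * m + 1" "set w' \<subseteq> {..<m}" "eval w = chain m l \<cdot> eval w'"
      "word_perm M w = perm_chain M m l \<circ> word_perm M w'"
    using eval_decompose[OF assms(1,2)] by blast
  have "l = 0" using decompose_length[OF assms(1) w(1,2,4)] assms(3) by simp
  then show ?thesis using w by auto
qed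

end

section \<open>Monoids satisfying the relations at trivial parameter\<close>

text \<open>Dots in general position, no two equal or mirrored. Signed permutations act transitively
  on such lists of a given length.\<close>

definition indep :: "nat \<Rightarrow> nat list \<Rightarrow> bool" where
  "indep n xs \<longleftrightarrow> set xs \<subseteq> {1..2 * n} \<and> distinct xs \<and> (\<forall>x\<in>set xs. bar n x \<notin> set xs)"

lemma indep_Cons:
  "indep n (x # xs) \<longleftrightarrow> x \<in> {1..2 * n} \<and> x \<notin> set xs \<and> bar n x \<notin> set xs \<and> indep n xs"
  unfolding indep_def by (auto dest: bar_bar)

lemma indep_Nil [simp]: "indep n []"
  by (simp add: indep_def)

lemma refl_perm_left: "refl_perm n a b a = b"
  by (simp add: refl_perm_def)

lemma refl_perm_right: "refl_perm n a b b = a"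
  by (simp add: refl_perm_def)

lemma refl_perm_fixed:
  "x \<noteq> a \<Longrightarrow> x \<noteq> b \<Longrightarrow> x \<noteq> bar n a \<Longrightarrow> x \<noteq> bar n b \<Longrightarrow> refl_perm n a b x = x"
  by (simp add: refl_perm_def)

lemma signed_perm_conj_refl:
  assumes "signed_perm n g" "a \<in> {1..2 * n}" "b \<in> {1..2 * n}"
  shows "g \<circ> refl_perm n a b = refl_perm n (g a) (g b) \<circ> g"
proof
  fix x
  have "g x = g y \<longleftrightarrow> x = y" for y using assms(1) by (rule signed_perm_eq)
  moreover have "bar n (g a) = g (bar n a)" "bar n (g b) = g (bar n b)"
    using assms by (simp_all only: signed_perm_bar)
  ultimately show "(g \<circ> refl_perm n a b) x = (refl_perm n (g a) (g b) \<circ> g) x"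
    by (simp add: refl_perm_def)
qed

text \<open>A permutation found for the tail is corrected at the head by one reflection. It fixes
  the tail, since neither of its two dots nor their mirror images occur there.\<close>

lemma signed_perm_extends:
  assumes "indep n xs" "indep n ys" "length xs = length ys"
  shows "\<exists>g. signed_perm n g \<and> map g xs = ys"
  using assms
proof (induction xs arbitrary: ys)
  case Nil
  then show ?case by (auto intro!: exI[of _ id])
next
  case (Cons x xs)
  obtain y ys' where ys: "ys = y # ys'" using Cons.prems by (cases ys) auto
  then obtain g where g: "signed_perm n g" "map g xs = ys'"
    using Cons.IH[of ys'] Cons.prems by (auto simp: indep_Cons)
  have x: "x \<in> {1..2 * n}" "x \<notin> set xs" "bar n x \<notin> set xs" and y: "y \<in> {1..2 * n}" "y \<notin> set ys'" "bar n y \<notin> set ys'"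
    using Cons.prems ys by (auto simp: indep_Cons)
  have gx: "g x \<in> {1..2 * n}" using signed_perm_in[OF g(1)] x by blast
  have set_ys: "set ys' = g ` set xs" using g by auto
  have gx': "g x \<notin> set ys'" "bar n (g x) \<notin> set ys'"
    using x signed_perm_bar[OF g(1) x(1)] signed_perm_eq[OF g(1)] by (auto simp: set_ys simp flip: signed_perm_bar[OF g(1) x(1)])
  show ?case
  proof (cases "g x = y")
    case True
    then show ?thesis using g ys by auto
  next
    case False
    let ?t = "refl_perm n (g x) y"
    have "signed_perm n (?t \<circ> g)"
      using False gx y(1) g(1) by (intro signed_perm_comp signed_refl_perm) auto
    moreover have "?t z = z" if "z \<in> set ys'" for z
      using that gx' y by (intro refl_perm_fixed) auto
    then have "map ?t ys' = ys'" by (simp add: map_idI)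
    then have "map (?t \<circ> g) (x # xs) = ys"
      using g(2) ys by (simp add: refl_perm_left flip: map_map)
    ultimately show ?thesis by blast
  qed
qed

locale brauerC_monoid =
  fixes n :: nat and r e :: "nat \<Rightarrow> 'a::monoid_mult"
  assumes n2: "2 \<le> n"
    and rr: "i < n \<Longrightarrow> r i * r i = 1"
    and re: "i < n \<Longrightarrow> r i * e i = e i"
    and er: "i < n \<Longrightarrow> e i * r i = e i"
    and ee: "i < n \<Longrightarrow> e i * e i = e i"
    and rr_comm: "i < n \<Longrightarrow> j < n \<Longrightarrow> i \<noteq> j \<Longrightarrow> \<not> adj i j \<Longrightarrow> r i * r j = r j * r i"
    and er_comm: "i < n \<Longrightarrow> j < n \<Longrightarrow> i \<noteq> j \<Longrightarrow> \<not> adj i j \<Longrightarrow> e i * r j = r j * e i"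
    and ee_comm: "i < n \<Longrightarrow> j < n \<Longrightarrow> i \<noteq> j \<Longrightarrow> \<not> adj i j \<Longrightarrow> e i * e j = e j * e i"
    and rrr: "i < n \<Longrightarrow> j < n \<Longrightarrow> adj i j \<Longrightarrow> 0 < i \<Longrightarrow> 0 < j \<Longrightarrow> r i * r j * r i = r j * r i * r j"
    and rre: "i < n \<Longrightarrow> j < n \<Longrightarrow> adj i j \<Longrightarrow> 0 < i \<Longrightarrow> 0 < j \<Longrightarrow> r j * r i * e j = e i * e j"
    and rer: "i < n \<Longrightarrow> j < n \<Longrightarrow> adj i j \<Longrightarrow> 0 < i \<Longrightarrow> 0 < j \<Longrightarrow> r i * e j * r i = r j * e i * r j"
    and r1010: "r 1 * r 0 * r 1 * r 0 = r 0 * r 1 * r 0 * r 1"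
    and rre01: "r 1 * r 0 * e 1 = r 0 * e 1"
    and rere: "r 1 * e 0 * r 1 * e 0 = e 0 * e 1 * e 0"
    and rrre: "r 1 * r 0 * r 1 * e 0 = e 0 * r 1 * r 0 * r 1"
    and ere: "e 1 * r 0 * e 1 = e 1"
    and eee: "e 1 * e 0 * e 1 = e 1"
    and err: "e 1 * r 0 * r 1 = e 1 * r 0"
    and eer: "e 1 * e 0 * r 1 = e 1 * e 0"
begin

sublocale W: typeB_generators "(*)" 1 r n
proof
  fix i j
  show "r i * r j = r j * r i" if "i + 1 < j" "j < n"
    using that by (intro rr_comm) (auto simp: adj_def)
  show "r i * r (i + 1) * r i = r (i + 1) * r i * r (i + 1)" if "0 < i" "i + 1 < n"
    using that by (intro rrr) (auto simp: adj_def)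
  show "r 0 * r 1 * r 0 * r 1 = r 1 * r 0 * r 1 * r 0" by (simp only: r1010)
qed (simp_all add: rr mult.assoc)

lemma rr_assoc: "i < n \<Longrightarrow> r i * (r i * x) = x"
  by (rule W.r_inv_assoc)

text \<open>The image of a signed permutation, well defined since the simple reflections satisfy the
  Coxeter relations.\<close>
definition rep :: "(nat \<Rightarrow> nat) \<Rightarrow> 'a" where
  "rep g = W.eval (SOME w. set w \<subseteq> {..<n} \<and> word_perm n w = g)"

lemma rep_word:
  assumes "set w \<subseteq> {..<n}"
  shows "rep (word_perm n w) = W.eval w"
proof -
  have "\<exists>v. set v \<subseteq> {..<n} \<and> word_perm n v = word_perm n w" using assms by blast
  then have "set (SOME v. set v \<subseteq> {..<n} \<and> word_perm n v = word_perm n w) \<subseteq> {..<n} \<and>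
    word_perm n (SOME v. set v \<subseteq> {..<n} \<and> word_perm n v = word_perm n w) = word_perm n w"
    by (rule someI_ex)
  then show ?thesis unfolding rep_def using assms by (intro W.eval_cong_perm[OF order_refl]) auto
qed

lemma signed_perm_word: "signed_perm n g \<Longrightarrow> \<exists>w. set w \<subseteq> {..<n} \<and> word_perm n w = g"
  by (rule word_perm_surj) (auto simp: signed_perm_def)

lemma rep_id [simp]: "rep id = 1" "rep (\<lambda>x. x) = 1"
  using rep_word[of "[]"] by (simp_all add: id_def)

lemma rep_comp:
  assumes "signed_perm n g" "signed_perm n h"
  shows "rep (g \<circ> h) = rep g * rep h"
proof -
  obtain u v where "set u \<subseteq> {..<n}" "word_perm n u = g" "set v \<subseteq> {..<n}" "word_perm n v = h"
    using assms signed_perm_word by meson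
  then show ?thesis
    using rep_word[of u] rep_word[of v] rep_word[of "u @ v"] by (simp add: word_perm_append W.eval_append)
qed

lemma rep_inv:
  assumes "signed_perm n g"
  shows "rep g * rep (inv g) = 1" "rep (inv g) * rep g = 1"
    "rep g * (rep (inv g) * x) = x" "rep (inv g) * (rep g * x) = x"
proof -
  have "g \<circ> inv g = id" "inv g \<circ> g = id"
    using signed_perm_inv[OF assms] by (auto simp: fun_eq_iff)
  then show "rep g * rep (inv g) = 1" "rep (inv g) * rep g = 1"
    using rep_comp[OF assms signed_perm_inv(1)[OF assms]] rep_comp[OF signed_perm_inv(1)[OF assms] assms]
    by simp_all
  then show "rep g * (rep (inv g) * x) = x" "rep (inv g) * (rep g * x) = x"
    by (metis mult.assoc mult_1)+
qed

lemma rep_simple: "i < n \<Longrightarrow> rep (simple_perm n i) = r i"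
  using rep_word[of "[i]"] by simp

definition conj :: "(nat \<Rightarrow> nat) \<Rightarrow> 'a \<Rightarrow> 'a" where
  "conj g x = rep g * x * rep (inv g)"

lemma conj_mult: "signed_perm n g \<Longrightarrow> conj g (x * y) = conj g x * conj g y"
  by (simp add: conj_def mult.assoc rep_inv)

lemma conj_comp:
  assumes "signed_perm n g" "signed_perm n h"
  shows "conj (g \<circ> h) x = conj g (conj h x)"
proof -
  have "inv (g \<circ> h) = inv h \<circ> inv g"
    using assms by (intro o_inv_distrib) (auto simp: signed_perm_def)
  then show ?thesis
    using assms by (simp add: conj_def rep_comp signed_perm_inv(1) mult.assoc)
qed

lemma conj_eq_iff: "signed_perm n g \<Longrightarrow> conj g x = y \<longleftrightarrow> rep g * x = y * rep g"
  unfolding conj_def by (metis mult.assoc mult.right_neutral rep_inv(1,2))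

lemma conj_simple: "i < n \<Longrightarrow> conj (simple_perm n i) x = r i * x * r i"
  by (subst conj_eq_iff) (simp_all add: signed_simple_perm rep_simple mult.assoc rr)

lemma conj_commute: "signed_perm n g \<Longrightarrow> rep g * x = x * rep g \<Longrightarrow> conj g x = x"
  by (simp add: conj_eq_iff)

text \<open>The generator \<open>e 0\<close> carried outwards to the dot \<open>n + k + 1\<close>
  and its mirror image; see \<open>point_eq_cup\<close>.\<close>

fun point :: "nat \<Rightarrow> 'a" where
  "point 0 = e 0"
| "point (Suc k) = r (Suc k) * point k * r (Suc k)"

text \<open>These \<open>r i\<close> are the simple reflections that fix the dot
  \<open>n + k + 1\<close>. The case beyond far commutation is \<open>i = k - 1\<close>: for
  \<open>k = 1\<close> it is the relation \<open>rrre\<close>, otherwise \<open>r i\<close> crosses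
  both conjugating pairs of factors by the braid relation.\<close>

lemma r_point_comm:
  assumes "k < n" "i < n" "i \<noteq> k" "i \<noteq> Suc k"
  shows "r i * point k = point k * r i"
  using assms
proof (induction k arbitrary: i rule: less_induct)
  case (less k)
  show ?case
  proof (cases k)
    case 0
    then show ?thesis using less er_comm[of 0 i] by (auto simp: adj_def)
  next
    case (Suc k1)
    show ?thesis
    proof (cases "i = k1")
      case False
      have 1: "r i * r k = r k * r i" using less.prems Suc False by (intro rr_comm) (auto simp: adj_def)
      have 2: "r i * point k1 = point k1 * r i"
        using less.prems Suc False by (intro less.IH) auto
      have pk: "point k = r k * point k1 * r k" by (simp add: Suc)
      have "r i * point k = r k * (r i * point k1) * r k" by (simp add: pk 1 flip: mult.assoc)
      also have "\<dots> = r k * point k1 * (r i * r k)" by (simp only: 2 mult.assoc)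
      also have "\<dots> = point k * r i" by (simp only: 1 pk mult.assoc)
      finally show ?thesis .
    next
      case True
      show ?thesis
      proof (cases k1)
        case 0
        have "r 0 * (r 1 * e 0 * r 1) = r 1 * (r 1 * r 0 * r 1 * e 0) * r 1"
          using less.prems Suc 0 by (simp add: mult.assoc rr_assoc)
        also have "\<dots> = r 1 * e 0 * r 1 * r 0 * (r 1 * r 1)"
          unfolding rrre by (simp add: mult.assoc)
        also have "\<dots> = r 1 * e 0 * r 1 * r 0" using n2 by (simp add: rr)
        finally show ?thesis using True Suc 0 by simp
      next
        case (Suc k2)
        have c: "r k * point k2 = point k2 * r k"
          using less.prems Suc \<open>k = Suc k1\<close> by (intro less.IH) auto
        have b: "r k1 * r k * r k1 = r k * r k1 * r k"
          using less.prems Suc \<open>k = Suc k1\<close> by (intro rrr) (auto simp: adj_def)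
        have pk: "point k = r k * r k1 * point k2 * r k1 * r k"
          using Suc \<open>k = Suc k1\<close> by (simp add: mult.assoc)
        have "r k1 * point k = (r k1 * r k * r k1) * point k2 * r k1 * r k"
          by (simp only: pk mult.assoc)
        also have "\<dots> = r k * r k1 * (r k * point k2) * r k1 * r k"
          unfolding b by (simp only: mult.assoc)
        also have "\<dots> = r k * r k1 * point k2 * (r k * r k1 * r k)"
          unfolding c by (simp only: mult.assoc)
        also have "\<dots> = point k * r k1"
          unfolding b[symmetric] pk by (simp only: mult.assoc)
        finally show ?thesis using True by simp
      qed
    qed
  qed
qed

lemma eval_comm:
  assumes "\<And>i. i \<in> set w \<Longrightarrow> r i * x = x * r i"
  shows "W.eval w * x = x * W.eval w"
  using assms
proof (induction w)
  case (Cons i w)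
  then show ?case by simp (metis mult.assoc)
qed simp

lemma atMost_pred: "{..n - Suc 0} = {..<n}"
  using n2 by auto

text \<open>The outermost dot is chosen because its stabilizer is a standard parabolic subgroup: an
  element fixing \<open>2 * n\<close> is a word in \<open>r 0\<close> up to
  \<open>r (n - 2)\<close>, and each of these letters commutes with
  \<open>point (n - 1)\<close>.\<close>

lemma stabilizer_point:
  assumes "signed_perm n g" "g (2 * n) = 2 * n"
  shows "rep g * point (n - 1) = point (n - 1) * rep g"
proof -
  obtain w where w: "set w \<subseteq> {..<n}" "word_perm n w = g" using assms signed_perm_word by blast
  then obtain w' where w': "set w' \<subseteq> {..<n - 1}" "W.eval w = W.eval w'"
    using W.eval_shrink[of "n - 1" w] n2 assms atMost_pred by (auto simp: mult_2)
  show ?thesis using rep_word[OF w(1)] w(2) w' n2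
    by (auto intro!: eval_comm r_point_comm)
qed

text \<open>Fixing a second dot removes one more letter; the indices that remain are below
  \<open>n - 2\<close> and hence not adjacent to \<open>n - 1\<close>.\<close>

lemma stabilizer_e:
  assumes "signed_perm n g" "g (2 * n) = 2 * n" "g (2 * n - 1) = 2 * n - 1"
  shows "rep g * e (n - 1) = e (n - 1) * rep g"
proof -
  obtain w where w: "set w \<subseteq> {..<n}" "word_perm n w = g" using assms signed_perm_word by blast
  then obtain w' where w': "set w' \<subseteq> {..<n - 1}" "W.eval w = W.eval w'" "word_perm n w = word_perm n w'"
    using W.eval_shrink[of "n - 1" w] n2 assms atMost_pred by (auto simp: mult_2)
  have "n + (n - 2) + 1 = 2 * n - 1" "{..n - 2} = {..<n - 1}" using n2 by auto
  then have "\<exists>v. set v \<subseteq> {..<n - 2} \<and> W.eval w' = W.eval v \<and> word_perm n w' = word_perm n v"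
    using w w' n2 assms by (intro W.eval_shrink[of "n - 2" w']) simp_all
  then obtain v where v: "set v \<subseteq> {..<n - 2}" "W.eval w' = W.eval v" by blast
  have "r i * e (n - 1) = e (n - 1) * r i" if "i \<in> set v" for i
  proof -
    have "i < n - 2" using v that by auto
    then show ?thesis using er_comm[of "n - 1" i] n2 by (auto simp: adj_def)
  qed
  then show ?thesis using rep_word[OF w(1)] w(2) w' v by (simp add: eval_comm)
qed

text \<open>\<open>cup a b\<close> is the conjugate of the generators \<open>e i\<close> joining dots \<open>a\<close> and \<open>b\<close> (and their
  mirror images) by horizontal strands; a self-mirrored strand gives a conjugate of \<open>e 0\<close>.\<close>
definition cup :: "nat \<Rightarrow> nat \<Rightarrow> 'a" where
  "cup a b = (if b = bar n a
     then conj (SOME g. signed_perm n g \<and> g (2 * n) = a) (point (n - 1))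
     else conj (SOME g. signed_perm n g \<and> g (2 * n - 1) = a \<and> g (2 * n) = b) (e (n - 1)))"

text \<open>The choice of \<open>g\<close> is immaterial: two choices differ by an element fixing
  \<open>2 * n\<close>, which commutes with \<open>point (n - 1)\<close>.\<close>

lemma cup_point:
  assumes "signed_perm n g" "g (2 * n) = a"
  shows "cup a (bar n a) = conj g (point (n - 1))"
proof -
  define h where "h = (SOME g. signed_perm n g \<and> g (2 * n) = a)"
  have h: "signed_perm n h" "h (2 * n) = a"
    using someI[of "\<lambda>g. signed_perm n g \<and> g (2 * n) = a", OF conjI[OF assms]] by (auto simp: h_def)
  have i: "signed_perm n (inv g \<circ> h)" "(inv g \<circ> h) (2 * n) = 2 * n"
    using h assms signed_perm_inv(1)[OF assms(1)] signed_perm_inv(3)[OF assms(1), of "2 * n"]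
      signed_perm_inv(3)[OF assms(1), of "2 * n - 1"]
    by (auto intro: signed_perm_comp)
  have "h = g \<circ> (inv g \<circ> h)" using signed_perm_inv[OF assms(1)] by (auto simp: fun_eq_iff)
  then have "conj h (point (n - 1)) = conj g (conj (inv g \<circ> h) (point (n - 1)))"
    using conj_comp assms i by metis
  also have "conj (inv g \<circ> h) (point (n - 1)) = point (n - 1)"
    by (rule conj_commute[OF i(1) stabilizer_point[OF i]])
  finally show ?thesis by (simp add: cup_def h_def)
qed

lemma cup_arc:
  assumes "signed_perm n g" "g (2 * n - 1) = a" "g (2 * n) = b"
  shows "cup a b = conj g (e (n - 1))"
proof -
  define h where "h = (SOME g. signed_perm n g \<and> g (2 * n - 1) = a \<and> g (2 * n) = b)"
  have h: "signed_perm n h" "h (2 * n - 1) = a" "h (2 * n) = b"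
    using someI[of "\<lambda>g. signed_perm n g \<and> g (2 * n - 1) = a \<and> g (2 * n) = b" g] assms by (auto simp: h_def)
  have i: "signed_perm n (inv g \<circ> h)" "(inv g \<circ> h) (2 * n) = 2 * n" "(inv g \<circ> h) (2 * n - 1) = 2 * n - 1"
    using h assms signed_perm_inv(1)[OF assms(1)] signed_perm_inv(3)[OF assms(1), of "2 * n"]
      signed_perm_inv(3)[OF assms(1), of "2 * n - 1"]
    by (auto intro: signed_perm_comp)
  have "h = g \<circ> (inv g \<circ> h)" using signed_perm_inv[OF assms(1)] by (auto simp: fun_eq_iff)
  then have "conj h (e (n - 1)) = conj g (conj (inv g \<circ> h) (e (n - 1)))"
    using conj_comp assms i by metis
  also have "conj (inv g \<circ> h) (e (n - 1)) = e (n - 1)"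
    by (rule conj_commute[OF i(1) stabilizer_e[OF i]])
  finally have c: "conj h (e (n - 1)) = conj g (e (n - 1))" .
  \<comment> \<open>The dots \<open>2 * n - 1\<close> and \<open>2 * n\<close> are not mirrored, so
    \<open>cup a b\<close> is given by the second branch of its definition.\<close>
  have "bar n a \<noteq> b"
  proof
    assume "bar n a = b"
    then have "g (bar n (2 * n - 1)) = g (2 * n)"
      using signed_perm_bar[OF assms(1), of "2 * n - 1"] assms n2 by auto
    then show False using signed_perm_eq[OF assms(1)] n2 by (auto simp: bar_def)
  qed
  then show ?thesis using c by (auto simp: cup_def h_def)
qed

lemma indep2: "a \<in> {1..2 * n} \<Longrightarrow> b \<in> {1..2 * n} \<Longrightarrow> a \<noteq> b \<Longrightarrow> b \<noteq> bar n a \<Longrightarrow> indep n [a, b]"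
  by (auto simp: indep_Cons bar_eq_swap)

text \<open>Equivariance is the tool that extends a relation from standard dots to arbitrary ones. A
  permutation carrying the outermost dots to \<open>a\<close> and \<open>b\<close>, composed with
  \<open>g\<close>, carries them to \<open>g a\<close> and \<open>g b\<close>.\<close>

lemma conj_cup:
  assumes g: "signed_perm n g" and ab: "a \<in> {1..2 * n}" "b \<in> {1..2 * n}" "a \<noteq> b"
  shows "conj g (cup a b) = cup (g a) (g b)"
proof (cases "b = bar n a")
  case True
  have "\<exists>h. signed_perm n h \<and> map h [2 * n] = [a]"
    using ab n2 by (intro signed_perm_extends) (auto simp: indep_Cons)
  then obtain h where h: "signed_perm n h" "h (2 * n) = a" by auto
  have "cup (g a) (bar n (g a)) = conj (g \<circ> h) (point (n - 1))"
    using h g by (intro cup_point) (auto intro: signed_perm_comp)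
  then show ?thesis using cup_point[OF h] True conj_comp[OF g h(1)] signed_perm_bar[OF g ab(1)] by simp
next
  case False
  have "indep n [2 * n - 1, 2 * n]" using n2 by (intro indep2) (auto simp: bar_def)
  then have "\<exists>h. signed_perm n h \<and> map h [2 * n - 1, 2 * n] = [a, b]"
    using ab False by (intro signed_perm_extends) (auto intro: indep2)
  then obtain h where h: "signed_perm n h" "h (2 * n - 1) = a" "h (2 * n) = b" by auto
  have "cup (g a) (g b) = conj (g \<circ> h) (e (n - 1))"
    using h g by (intro cup_arc) (auto intro: signed_perm_comp)
  then show ?thesis using cup_arc[OF h] conj_comp[OF g h(1)] by simp
qed

text \<open>Descending induction on the index: \<open>rer\<close> conjugates
  \<open>e (i + 1)\<close> into \<open>e i\<close>, and the conjugating permutation carries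
  \<open>n + i + 1\<close>, \<open>n + i + 2\<close> to \<open>n + i\<close>,
  \<open>n + i + 1\<close>.\<close>

lemma e_eq_cup:
  assumes "0 < i" "i < n"
  shows "e i = cup (n + i) (n + i + 1)"
  using assms
proof (induction "n - 1 - i" arbitrary: i)
  case 0
  then have "i = n - 1" by simp
  then show ?case using cup_arc[of id "2 * n - 1" "2 * n"] n2 by (simp add: conj_def mult_2)
next
  case (Suc k)
  then have i: "i + 1 < n" by simp
  have IH: "e (i + 1) = cup (n + i + 1) (n + i + 2)" using Suc by simp
  let ?g = "simple_perm n (i + 1) \<circ> simple_perm n i"
  have g: "signed_perm n ?g" using i by (auto intro!: signed_perm_comp signed_simple_perm)
  have "r i * e (i + 1) * r i = r (i + 1) * e i * r (i + 1)"
    using i Suc.prems by (intro rer) (auto simp: adj_def)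
  then have "r (i + 1) * (r i * e (i + 1) * r i) * r (i + 1) = e i"
    using i by (simp add: mult.assoc rr rr_assoc)
  then have "e i = conj (simple_perm n (i + 1)) (conj (simple_perm n i) (e (i + 1)))"
    using i by (simp only: conj_simple)
  also have "\<dots> = conj ?g (cup (n + i + 1) (n + i + 2))"
    using i IH conj_comp[of "simple_perm n (i + 1)" "simple_perm n i"] by (simp add: signed_simple_perm)
  also have "\<dots> = cup (?g (n + i + 1)) (?g (n + i + 2))"
    using i g by (intro conj_cup) auto
  also have "?g (n + i + 1) = n + i"
    using i Suc.prems by (auto simp: simple_perm_simps)
  also have "?g (n + i + 2) = n + i + 1"
    using i Suc.prems by (auto simp: simple_perm_simps)
  finally show ?case .
qed

lemma point_eq_cup:
  assumes "k < n"
  shows "point k = cup (n + k + 1) (bar n (n + k + 1))"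
  using assms
proof (induction "n - 1 - k" arbitrary: k)
  case 0
  then have "k = n - 1" by simp
  then show ?case using cup_point[of id "2 * n"] n2 by (simp add: conj_def mult_2)
next
  case (Suc j)
  then have k: "Suc k < n" by simp
  have IH: "point (Suc k) = cup (n + k + 2) (bar n (n + k + 2))"
    using Suc.hyps(1)[of "Suc k"] Suc.hyps(2) k by simp
  have g: "signed_perm n (simple_perm n (Suc k))" using k by (rule signed_simple_perm)
  have "r (Suc k) * point (Suc k) * r (Suc k) = point k"
    using k by (simp add: mult.assoc rr rr_assoc)
  then have "point k = r (Suc k) * point (Suc k) * r (Suc k)" by simp
  also have "\<dots> = conj (simple_perm n (Suc k)) (cup (n + k + 2) (bar n (n + k + 2)))"
    unfolding IH using conj_simple[OF k] by (rule sym)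
  also have "\<dots> = cup (simple_perm n (Suc k) (n + k + 2)) (simple_perm n (Suc k) (bar n (n + k + 2)))"
    using k g by (intro conj_cup) (auto simp: bar_def)
  also have "simple_perm n (Suc k) (bar n (n + k + 2)) = bar n (simple_perm n (Suc k) (n + k + 2))"
    using g k by (intro signed_perm_bar) auto
  also have "simple_perm n (Suc k) (n + k + 2) = n + k + 1"
    using k by (auto simp: simple_perm_simps)
  finally show ?case .
qed

end

section \<open>Symmetric matchings\<close>

definition fpf_invol :: "'b set \<Rightarrow> ('b \<Rightarrow> 'b) \<Rightarrow> bool" where
  "fpf_invol V t \<longleftrightarrow> (\<forall>x\<in>V. t x \<in> V \<and> t x \<noteq> x \<and> t (t x) = x)"

definition sym_match :: "'b set \<Rightarrow> ('b \<Rightarrow> 'b) \<Rightarrow> ('b \<Rightarrow> 'b) \<Rightarrow> bool" where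
  "sym_match V \<rho> t \<longleftrightarrow> fpf_invol V \<rho> \<and> fpf_invol V t \<and> (\<forall>x\<in>V. t (\<rho> x) = \<rho> (t x))"

text \<open>The matching obtained from \<open>t\<close> by joining \<open>p\<close> and \<open>q\<close> and reconnecting their partners: the
  effect of multiplying a diagram by \<open>E\<close>.  The symmetric version also joins the mirror images.\<close>
definition join :: "'b \<Rightarrow> 'b \<Rightarrow> ('b \<Rightarrow> 'b) \<Rightarrow> 'b \<Rightarrow> 'b" where
  "join p q t = (if t p = q then t else t(p := q, q := p, t p := t q, t q := t p))"

definition sym_join :: "('b \<Rightarrow> 'b) \<Rightarrow> 'b \<Rightarrow> 'b \<Rightarrow> ('b \<Rightarrow> 'b) \<Rightarrow> 'b \<Rightarrow> 'b" where
  "sym_join \<rho> p q t = (if q = \<rho> p then join p q t else join (\<rho> p) (\<rho> q) (join p q t))"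

lemma fpf_invol_in: "fpf_invol V t \<Longrightarrow> x \<in> V \<Longrightarrow> t x \<in> V"
  and fpf_invol_neq: "fpf_invol V t \<Longrightarrow> x \<in> V \<Longrightarrow> t x \<noteq> x"
  and fpf_invol_twice: "fpf_invol V t \<Longrightarrow> x \<in> V \<Longrightarrow> t (t x) = x"
  by (auto simp: fpf_invol_def)

lemma fpf_invol_eq: "fpf_invol V t \<Longrightarrow> x \<in> V \<Longrightarrow> y \<in> V \<Longrightarrow> t x = t y \<longleftrightarrow> x = y"
  and fpf_invol_swap: "fpf_invol V t \<Longrightarrow> x \<in> V \<Longrightarrow> y \<in> V \<Longrightarrow> t x = y \<longleftrightarrow> x = t y"
  by (metis fpf_invol_twice)+

lemma fpf_invol_join:
  assumes t: "fpf_invol V t" and pq: "p \<in> V" "q \<in> V" "p \<noteq> q"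
  shows "fpf_invol V (join p q t)"
proof (cases "t p = q")
  case False
  have V: "t p \<in> V" "t q \<in> V" using assms by (auto intro: fpf_invol_in)
  have d: "t p \<noteq> p" "t p \<noteq> q" "t q \<noteq> p" "t q \<noteq> q" "t p \<noteq> t q" "t (t p) = p" "t (t q) = q"
    using assms False by (auto simp: fpf_invol_neq fpf_invol_twice fpf_invol_eq fpf_invol_swap[OF t pq(2,1)])
  show ?thesis
    unfolding fpf_invol_def
  proof
    fix x assume x: "x \<in> V"
    consider "x = p" | "x = q" | "x = t p" | "x = t q" | "x \<notin> {p, q, t p, t q}" by blast
    then show "join p q t x \<in> V \<and> join p q t x \<noteq> x \<and> join p q t (join p q t x) = x"
    proof cases
      case 5
      then have "t x \<notin> {p, q, t p, t q}"
        using fpf_invol_swap[OF t x pq(1)] fpf_invol_swap[OF t x pq(2)] fpf_invol_eq[OF t x] pq by auto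
      then show ?thesis using 5 False x t by (auto simp: join_def fpf_invol_in fpf_invol_neq fpf_invol_twice)
    qed (use False d pq V in \<open>auto simp: join_def\<close>)
  qed
qed (use t in \<open>simp add: join_def\<close>)

lemma sym_matchD:
  assumes "sym_match V \<rho> t"
  shows "fpf_invol V \<rho>" "fpf_invol V t" "\<And>x. x \<in> V \<Longrightarrow> t (\<rho> x) = \<rho> (t x)"
  using assms by (auto simp: sym_match_def)

text \<open>The cases list how the strands at \<open>p\<close> and \<open>q\<close> and their mirror
  images can coincide. In \<open>left\<close>, for example, the first join links
  \<open>\<rho> p\<close> with the partner of \<open>q\<close>, and the mirrored join then closes
  this partner up with its own mirror image.\<close>

lemma sym_join_cases:
  assumes m: "sym_match V \<rho> t" and pq: "p \<in> V" "q \<in> V" "p \<noteq> q"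
  obtains (same) "t p = q" "sym_join \<rho> p q t = t"
  | (self) "q = \<rho> p" "t p \<notin> {p, q}" "sym_join \<rho> p q t = t(p := \<rho> p, \<rho> p := p, t p := \<rho> (t p), \<rho> (t p) := t p)"
  | (crossed) "q \<noteq> \<rho> p" "t p = \<rho> q" "sym_join \<rho> p q t = t(p := q, q := p, \<rho> p := \<rho> q, \<rho> q := \<rho> p)"
  | (selves) "q \<noteq> \<rho> p" "t p = \<rho> p" "t q = \<rho> q" "sym_join \<rho> p q t = t(p := q, q := p, \<rho> p := \<rho> q, \<rho> q := \<rho> p)"
  | (left) "q \<noteq> \<rho> p" "t p = \<rho> p" "t q \<notin> {p, \<rho> p, q, \<rho> q}"
      "sym_join \<rho> p q t = t(p := q, q := p, \<rho> p := \<rho> q, \<rho> q := \<rho> p, t q := \<rho> (t q), \<rho> (t q) := t q)"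
  | (right) "q \<noteq> \<rho> p" "t q = \<rho> q" "t p \<notin> {p, \<rho> p, q, \<rho> q}"
      "sym_join \<rho> p q t = t(p := q, q := p, \<rho> p := \<rho> q, \<rho> q := \<rho> p, t p := \<rho> (t p), \<rho> (t p) := t p)"
  | (arcs) "q \<noteq> \<rho> p" "t p \<notin> {p, \<rho> p, q, \<rho> q}" "t q \<notin> {p, \<rho> p, q, \<rho> q}" "t p \<noteq> t q" "t p \<noteq> \<rho> (t q)"
      "sym_join \<rho> p q t = t(p := q, q := p, \<rho> p := \<rho> q, \<rho> q := \<rho> p,
        t p := t q, t q := t p, \<rho> (t p) := \<rho> (t q), \<rho> (t q) := \<rho> (t p))"
proof -
  note \<rho> = sym_matchD(1)[OF m] and t = sym_matchD(2)[OF m] and c = sym_matchD(3)[OF m]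
  have V: "\<rho> p \<in> V" "\<rho> q \<in> V" "t p \<in> V" "t q \<in> V" using pq \<rho> t by (auto intro: fpf_invol_in)
  have tw': "t (t (\<rho> p)) = \<rho> p" "t (t (\<rho> q)) = \<rho> q" using t V by (auto simp: fpf_invol_twice)
  have cs: "t (\<rho> p) = \<rho> (t p)" "t (\<rho> q) = \<rho> (t q)" using c pq by auto
  have tw: "\<rho> (\<rho> p) = p" "\<rho> (\<rho> q) = q" "t (t p) = p" "t (t q) = q" "\<rho> (\<rho> (t p)) = t p" "\<rho> (\<rho> (t q)) = t q"
    using \<rho> t pq V by (auto simp: fpf_invol_twice)
  have ne: "\<rho> p \<noteq> p" "\<rho> q \<noteq> q" "t p \<noteq> p" "t q \<noteq> q" "\<rho> (t p) \<noteq> t p" "\<rho> (t q) \<noteq> t q"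
    using \<rho> t pq V by (auto simp: fpf_invol_neq)
  have inj: "\<rho> p \<noteq> \<rho> q" "t p \<noteq> t q" using \<rho> t pq by (auto simp: fpf_invol_eq)
  show thesis
  proof (cases "t p = q")
    case True
    then have "t (\<rho> p) = \<rho> q" using cs by simp
    then show ?thesis using True by (intro same) (auto simp: sym_join_def join_def)
  next
    case np: False
    then have nq: "t q \<noteq> p" using tw by metis
    show ?thesis
    proof (cases "q = \<rho> p")
      case True
      then show ?thesis using np ne cs by (intro self) (auto simp: sym_join_def join_def)
    next
      case nr: False
      have nr': "p \<noteq> \<rho> q" "\<rho> p \<noteq> q" using nr tw by auto
      show ?thesis
      proof (cases "t p = \<rho> q")
        case True
        then have "t q = \<rho> p" using cs tw by metis
        then show ?thesis using True np nr nr' ne inj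
          by (intro crossed) (auto simp: sym_join_def join_def fun_eq_iff)
      next
        case ncr: False
        have ncr': "t q \<noteq> \<rho> p" using ncr cs tw by metis
        show ?thesis
        proof (cases "t p = \<rho> p")
          case tp: True
          show ?thesis
          proof (cases "t q = \<rho> q")
            case True
            then show ?thesis using tp np nr nr' ne inj
              by (intro selves) (auto simp: sym_join_def join_def fun_eq_iff)
          next
            case False
            have d: "\<rho> (t q) \<noteq> p" "\<rho> (t q) \<noteq> q" "\<rho> (t q) \<noteq> \<rho> p" "\<rho> (t q) \<noteq> \<rho> q"
              using False ncr' nq ne tw by metis+
            show ?thesis using tp np nr nr' ne inj False nq ncr' cs d
              by (intro left) (auto simp: sym_join_def join_def fun_eq_iff)
          qed
        next
          case tp: False
          have d: "\<rho> (t p) \<noteq> p" "\<rho> (t p) \<noteq> q" "\<rho> (t p) \<noteq> \<rho> p" "\<rho> (t p) \<noteq> \<rho> q"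
            using tp ncr np ne tw by metis+
          show ?thesis
          proof (cases "t q = \<rho> q")
            case True
            show ?thesis using tp np nr nr' ne inj True nq ncr ncr' cs d
              by (intro right) (auto simp: sym_join_def join_def fun_eq_iff)
          next
            case False
            have d': "\<rho> (t q) \<noteq> p" "\<rho> (t q) \<noteq> q" "\<rho> (t q) \<noteq> \<rho> p" "\<rho> (t q) \<noteq> \<rho> q"
              using False ncr' nq ne tw by metis+
            have d'': "t p \<noteq> \<rho> (t q)" "t q \<noteq> \<rho> (t p)" using cs tw tw' nr nr' by metis+
            show ?thesis using tp np nr nr' ne inj False nq ncr ncr' cs d d' d''
              by (intro arcs) (auto simp: sym_join_def join_def fun_eq_iff)
          qed
        qed
      qed
    qed
  qed
qed

text \<open>Each of the two joins preserves fixed-point free involutions, but the first alone may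
  break the symmetry. Compatibility with \<open>\<rho>\<close> is therefore checked on the combined
  update, at the few dots it changes.\<close>

lemma sym_match_sym_join:
  assumes m: "sym_match V \<rho> t" and pq: "p \<in> V" "q \<in> V" "p \<noteq> q"
  shows "sym_match V \<rho> (sym_join \<rho> p q t)"
proof -
  note \<rho> = sym_matchD(1)[OF m] and t = sym_matchD(2)[OF m] and c = sym_matchD(3)[OF m]
  have V: "\<rho> p \<in> V" "\<rho> q \<in> V" "t p \<in> V" "t q \<in> V" "\<rho> (t p) \<in> V" "\<rho> (t q) \<in> V"
    using pq \<rho> t by (auto intro: fpf_invol_in)
  have tw: "\<rho> (\<rho> p) = p" "\<rho> (\<rho> q) = q" "\<rho> (\<rho> (t p)) = t p" "\<rho> (\<rho> (t q)) = t q"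
    using \<rho> pq V by (auto simp: fpf_invol_twice)
  have sw: "\<rho> x = y \<longleftrightarrow> x = \<rho> y" if "x \<in> V" "y \<in> V" for x y
    using fpf_invol_swap[OF \<rho> that] .
  have inj: "\<rho> x = \<rho> y \<longleftrightarrow> x = y" if "x \<in> V" "y \<in> V" for x y
    using fpf_invol_eq[OF \<rho> that] .
  have "fpf_invol V (sym_join \<rho> p q t)"
    using fpf_invol_join[OF t pq] fpf_invol_join[of V "join p q t" "\<rho> p" "\<rho> q"] pq V inj[OF pq(1,2)]
    by (auto simp: sym_join_def)
  moreover have "sym_join \<rho> p q t (\<rho> x) = \<rho> (sym_join \<rho> p q t x)" if x: "x \<in> V" for x
    using m pq
  proof (cases rule: sym_join_cases)
    case same
    then show ?thesis using c x by simp
  next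
    case self
    then have ne: "\<rho> (t p) \<noteq> p" "p \<noteq> \<rho> (t p)" using sw[OF V(3) pq(1)] by auto
    consider "x = p" | "x = \<rho> p" | "x = t p" | "x = \<rho> (t p)" | "x \<notin> {p, \<rho> p, t p, \<rho> (t p)}" by blast
    then show ?thesis using self(1,2) fpf_invol_neq[OF \<rho>] ne pq V x unfolding self(3)
      by cases (auto simp: tw sw inj c)
  next
    case crossed
    consider "x = p" | "x = \<rho> p" | "x = q" | "x = \<rho> q" | "x \<notin> {p, \<rho> p, q, \<rho> q}" by blast
    then show ?thesis using crossed(1,2) fpf_invol_neq[OF \<rho>] pq V x unfolding crossed(3)
      by cases (auto simp: tw sw inj c)
  next
    case selves
    consider "x = p" | "x = \<rho> p" | "x = q" | "x = \<rho> q" | "x \<notin> {p, \<rho> p, q, \<rho> q}" by blast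
    then show ?thesis using selves(1-3) fpf_invol_neq[OF \<rho>] pq V x unfolding selves(4)
      by cases (auto simp: tw sw inj c)
  next
    case left
    then have ne: "\<rho> (t q) \<noteq> q" "q \<noteq> \<rho> (t q)" "\<rho> (t q) \<noteq> p" "p \<noteq> \<rho> (t q)"
      using sw[OF V(4) pq(2)] sw[OF V(4) pq(1)] by auto
    consider "x = p" | "x = \<rho> p" | "x = q" | "x = \<rho> q" | "x = t q" | "x = \<rho> (t q)"
      | "x \<notin> {p, \<rho> p, q, \<rho> q, t q, \<rho> (t q)}" by blast
    then show ?thesis using left(1-3) fpf_invol_neq[OF \<rho>] ne pq V x unfolding left(4)
      by cases (auto simp: tw sw inj c)
  next
    case right
    then have ne: "\<rho> (t p) \<noteq> p" "p \<noteq> \<rho> (t p)" "\<rho> (t p) \<noteq> q" "q \<noteq> \<rho> (t p)"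
      using sw[OF V(3) pq(2)] sw[OF V(3) pq(1)] by auto
    consider "x = p" | "x = \<rho> p" | "x = q" | "x = \<rho> q" | "x = t p" | "x = \<rho> (t p)"
      | "x \<notin> {p, \<rho> p, q, \<rho> q, t p, \<rho> (t p)}" by blast
    then show ?thesis using right(1-3) fpf_invol_neq[OF \<rho>] ne pq V x unfolding right(4)
      by cases (auto simp: tw sw inj c)
  next
    case arcs
    then have ne: "\<rho> (t p) \<noteq> p" "p \<noteq> \<rho> (t p)" "\<rho> (t p) \<noteq> q" "q \<noteq> \<rho> (t p)"
        "\<rho> (t q) \<noteq> q" "q \<noteq> \<rho> (t q)" "\<rho> (t q) \<noteq> p" "p \<noteq> \<rho> (t q)"
      using sw[OF V(3) pq(2)] sw[OF V(3) pq(1)] sw[OF V(4) pq(2)] sw[OF V(4) pq(1)] by auto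
    consider "x = p" | "x = \<rho> p" | "x = q" | "x = \<rho> q" | "x = t p" | "x = \<rho> (t p)" | "x = t q" | "x = \<rho> (t q)"
      | "x \<notin> {p, \<rho> p, q, \<rho> q, t p, \<rho> (t p), t q, \<rho> (t q)}" by blast
    then show ?thesis using arcs(1-5) fpf_invol_neq[OF \<rho>] ne pq V x unfolding arcs(6)
      by cases (auto simp: tw sw inj c)
  qed
  ultimately show ?thesis using \<rho> by (simp add: sym_match_def)
qed

section \<open>Relations between arcs on arbitrary dots\<close>

context brauerC_monoid
begin

context
  notes One_nat_def [simp del] and add_2_eq_Suc [simp del] and add_2_eq_Suc' [simp del]
begin

abbreviation pt :: "nat \<Rightarrow> 'a" where
  "pt a \<equiv> cup a (bar n a)"

definition tr :: "nat \<Rightarrow> nat \<Rightarrow> 'a" where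
  "tr a b = rep (refl_perm n a b)"

lemma conj_tr:
  assumes "signed_perm n g" "a \<in> {1..2 * n}" "b \<in> {1..2 * n}" "a \<noteq> b"
  shows "conj g (tr a b) = tr (g a) (g b)"
proof -
  have "signed_perm n (refl_perm n a b)" "signed_perm n (refl_perm n (g a) (g b))"
    using assms signed_refl_perm signed_perm_in signed_perm_eq by auto
  then show ?thesis using assms signed_perm_conj_refl[of n g a b]
    by (simp add: conj_eq_iff tr_def flip: rep_comp)
qed

lemma r_eq_tr: "i < n \<Longrightarrow> r i = tr (n + i) (n + i + 1)"
  unfolding tr_def simple_perm_def[symmetric] by (rule rep_simple[symmetric])

lemma dot_sums: "n + 1 + 1 = n + 2" "n + 2 + 1 = n + 3" "n + 3 + 1 = n + 4" "3 + n = n + 3" "4 + n = n + 4"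
  by simp_all

lemma dots_bar_std:
  "bar n (n + 1) \<in> {1..2 * n}" "bar n (n + 2) \<in> {1..2 * n}" "bar n (n + 1) \<noteq> bar n (n + 2)"
  "n + 1 \<noteq> bar n (n + 2)" "n + 1 \<noteq> n + 2"
  using n2 by (auto simp: bar_def)

lemma tr_std: "tr (n + 1) n = r 0"
proof -
  have "refl_perm n (n + 1) n = refl_perm n n (n + 1)"
    by (auto simp: refl_perm_def fun_eq_iff bar_def)
  then show ?thesis using r_eq_tr[of 0] n2 by (simp add: tr_def)
qed

lemma e0_eq: "e 0 = pt (n + 1)"
  using point_eq_cup[of 0] n2 by simp

lemma e1_eq: "e 1 = cup (n + 1) (n + 2)"
  using e_eq_cup[of 1] n2 by (simp add: dot_sums)

lemma dots_std:
  "k \<in> {1..n} \<Longrightarrow> n + k \<in> {1..2 * n}" "n + 1 \<in> {1..2 * n}" "n + 2 \<in> {1..2 * n}"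
  using n2 by auto

lemma ex_perm1:
  assumes "a \<in> {1..2 * n}"
  obtains g where "signed_perm n g" "g (n + 1) = a" "g (bar n (n + 1)) = bar n a"
proof -
  have "\<exists>g. signed_perm n g \<and> map g [n + 1] = [a]"
    using assms n2 by (intro signed_perm_extends) (auto simp: indep_Cons)
  then show thesis using that signed_perm_bar dots_std(2) by force
qed

lemma ex_perm2:
  assumes "indep n [a, b]"
  obtains g where "signed_perm n g" "g (n + 1) = a" "g (n + 2) = b"
    "g (bar n (n + 1)) = bar n a" "g (bar n (n + 2)) = bar n b"
proof -
  have "indep n [n + 1, n + 2]" using n2 by (auto simp: indep_Cons bar_def)
  then have "\<exists>g. signed_perm n g \<and> map g [n + 1, n + 2] = [a, b]"
    using assms by (intro signed_perm_extends) auto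
  then show thesis using that signed_perm_bar dots_std(2,3) by force
qed

text \<open>A relation on three or four dots in general position thereby provides the bound on
  \<open>n\<close> under which the generators of index 2 or 3 exist.\<close>

lemma indep_card:
  assumes "indep n xs"
  shows "length xs \<le> n"
proof -
  have "inj_on (bar n) (set xs)" using assms by (auto simp: indep_def inj_on_def bar_inj subset_iff)
  then have "card (set xs \<union> bar n ` set xs) = 2 * length xs"
    using assms by (subst card_Un_disjoint) (auto simp: indep_def card_image distinct_card)
  moreover have "set xs \<union> bar n ` set xs \<subseteq> {1..2 * n}"
    using assms bar_in unfolding indep_def by blast
  then have "card (set xs \<union> bar n ` set xs) \<le> 2 * n"
    using card_mono[of "{1..2 * n}"] by fastforce
  ultimately show ?thesis by simp
qed

lemma ex_perm3:
  assumes "indep n [a, b, c]"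
  obtains g where "signed_perm n g" "g (n + 1) = a" "g (n + 2) = b" "g (n + 3) = c"
    "g (bar n (n + 1)) = bar n a" "3 \<le> n"
proof -
  have n3: "3 \<le> n" using indep_card[OF assms] by simp
  then have "indep n [n + 1, n + 2, n + 3]" by (auto simp: indep_Cons bar_def)
  then have "\<exists>g. signed_perm n g \<and> map g [n + 1, n + 2, n + 3] = [a, b, c]"
    using assms by (intro signed_perm_extends) auto
  then show thesis using that n3 signed_perm_bar dots_std(2) by force
qed

lemma ex_perm4:
  assumes "indep n [a, b, c, d]"
  obtains g where "signed_perm n g" "g (n + 1) = a" "g (n + 2) = b" "g (n + 3) = c" "g (n + 4) = d" "4 \<le> n"
proof -
  have n4: "4 \<le> n" using indep_card[OF assms] by simp
  then have "indep n [n + 1, n + 2, n + 3, n + 4]" by (auto simp: indep_Cons bar_def)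
  then have "\<exists>g. signed_perm n g \<and> map g [n + 1, n + 2, n + 3, n + 4] = [a, b, c, d]"
    using assms by (intro signed_perm_extends) auto
  then show thesis using that n4 by force
qed

lemma bar_std: "bar n (n + 1) = n" "bar n (n + 2) = n - 1"
  by (simp_all add: bar_def)

lemma conj_point1: "signed_perm n g \<Longrightarrow> conj g (pt (n + 1)) = cup (g (n + 1)) (g (bar n (n + 1)))"
  and conj_point2: "signed_perm n g \<Longrightarrow> conj g (pt (n + 2)) = cup (g (n + 2)) (g (bar n (n + 2)))"
  using n2 by (auto intro!: conj_cup simp: bar_def)

text \<open>The reflection \<open>r 0\<close> exchanges the central dots \<open>n\<close> and
  \<open>n + 1\<close> and is absorbed by \<open>e 0\<close> on both sides. Conjugation carries the
  resulting identity to \<open>a\<close>.\<close>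

lemma pt_bar: "a \<in> {1..2 * n} \<Longrightarrow> cup (bar n a) a = pt a"
proof -
  assume a: "a \<in> {1..2 * n}"
  obtain g where g: "signed_perm n g" "g (n + 1) = a" "g (bar n (n + 1)) = bar n a"
    using ex_perm1[OF a] .
  have "conj (simple_perm n 0) (e 0) = e 0"
    using n2 by (simp add: conj_simple re er)
  then have "cup (simple_perm n 0 (n + 1)) (simple_perm n 0 (bar n (n + 1))) = pt (n + 1)"
    using n2 by (simp add: e0_eq conj_point1 signed_simple_perm)
  then have "cup n (n + 1) = cup (n + 1) n"
    using n2 by (simp add: simple_perm_simps bar_def)
  then have "conj g (cup n (n + 1)) = conj g (cup (n + 1) n)" by simp
  then show ?thesis using g n2 by (simp add: conj_cup bar_def)
qed

lemma cup_sym: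
  assumes "a \<in> {1..2 * n}" "b \<in> {1..2 * n}" "a \<noteq> b"
  shows "cup b a = cup a b"
proof (cases "b = bar n a")
  case True
  then show ?thesis using pt_bar assms by simp
next
  case False
  then obtain g where g: "signed_perm n g" "g (n + 1) = a" "g (n + 2) = b"
    using ex_perm2 indep2 assms by metis
  have "conj (simple_perm n 1) (e 1) = e 1"
    using n2 re[of 1] er[of 1] by (simp add: conj_simple)
  moreover have "conj (simple_perm n 1) (cup (n + 1) (n + 2)) = cup (n + 2) (n + 1)"
    using n2 conj_cup[of "simple_perm n 1" "n + 1" "n + 2"] by (simp add: signed_simple_perm simple_perm_simps dot_sums)
  ultimately have "cup (n + 2) (n + 1) = cup (n + 1) (n + 2)" by (simp add: e1_eq)
  then have "conj g (cup (n + 2) (n + 1)) = conj g (cup (n + 1) (n + 2))" by simp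
  then show ?thesis using g n2 by (simp add: conj_cup)
qed

lemma cup_bar:
  assumes "a \<in> {1..2 * n}" "b \<in> {1..2 * n}" "a \<noteq> b"
  shows "cup (bar n a) (bar n b) = cup a b"
proof (cases "b = bar n a")
  case True
  then show ?thesis using pt_bar assms by simp
next
  case False
  then obtain g where g: "signed_perm n g" "g (n + 1) = a" "g (n + 2) = b"
      "g (bar n (n + 1)) = bar n a" "g (bar n (n + 2)) = bar n b"
    using ex_perm2 indep2 assms by metis
  \<comment> \<open>This word sends \<open>n + 1\<close>, \<open>n + 2\<close> to their mirror
    images \<open>n\<close>, \<open>n - 1\<close>. It is absorbed by \<open>e 1\<close> on both
    sides, through \<open>rre01\<close> on the left and \<open>err\<close> on the right.\<close>
  let ?w = "[0, 1, 0, 1] :: nat list"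
  have w: "set ?w \<subseteq> {..<n}" using n2 by auto
  have s: "signed_perm n (word_perm n ?w)" using signed_word_perm[OF w] .
  have "rep (word_perm n ?w) * e 1 = e 1"
  proof -
    have "r 0 * (r 1 * (r 0 * (r 1 * e 1))) = r 0 * (r 1 * r 0 * e 1)"
      using n2 re[of 1] by (simp add: mult.assoc)
    also have "\<dots> = e 1" using n2 by (simp add: rre01 rr_assoc)
    finally show ?thesis using rep_word[OF w] by (simp add: mult.assoc)
  qed
  moreover have "e 1 * rep (word_perm n ?w) = e 1"
  proof -
    have "e 1 * rep (word_perm n ?w) = e 1 * (r 1 * r 0 * r 1 * r 0)"
      using rep_word[OF w] r1010 by (simp add: mult.assoc)
    also have "\<dots> = e 1 * r 1 * r 0 * r 1 * r 0" by (simp add: mult.assoc)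
    also have "\<dots> = e 1 * r 0 * r 0" using n2 er[of 1] err by simp
    also have "\<dots> = e 1" using n2 by (simp add: mult.assoc rr)
    finally show ?thesis .
  qed
  ultimately have "conj (word_perm n ?w) (e 1) = e 1"
    using conj_eq_iff[OF s] by simp
  moreover have "conj (word_perm n ?w) (cup (n + 1) (n + 2)) =
      cup (word_perm n ?w (n + 1)) (word_perm n ?w (n + 2))"
    using n2 by (intro conj_cup[OF s]) auto
  moreover have "word_perm n ?w (n + 1) = n" "word_perm n ?w (n + 2) = n - 1"
    using n2 by (auto simp: simple_perm_simps)
  ultimately have "cup (bar n (n + 1)) (bar n (n + 2)) = cup (n + 1) (n + 2)" by (simp add: e1_eq bar_std)
  then have "conj g (cup (bar n (n + 1)) (bar n (n + 2))) = conj g (cup (n + 1) (n + 2))" by simp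
  moreover have "conj g (cup (bar n (n + 1)) (bar n (n + 2))) = cup (bar n a) (bar n b)"
    using conj_cup[OF g(1) dots_bar_std(1-3)] g by simp
  moreover have "conj g (cup (n + 1) (n + 2)) = cup a b"
    using conj_cup[OF g(1), of "n + 1" "n + 2"] g n2 by auto
  ultimately show ?thesis by simp
qed

lemma cup_idem:
  assumes "a \<in> {1..2 * n}" "b \<in> {1..2 * n}" "a \<noteq> b"
  shows "cup a b * cup a b = cup a b"
proof (cases "b = bar n a")
  case True
  obtain g where g: "signed_perm n g" "g (n + 1) = a" "g (bar n (n + 1)) = bar n a"
    using ex_perm1 assms by metis
  have "conj g (pt (n + 1) * pt (n + 1)) = conj g (pt (n + 1))"
    using ee[of 0] n2 by (simp flip: e0_eq)
  then show ?thesis using g True by (simp add: conj_mult conj_point1)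
next
  case False
  then obtain g where g: "signed_perm n g" "g (n + 1) = a" "g (n + 2) = b"
    using ex_perm2 indep2 assms by metis
  have "conj g (cup (n + 1) (n + 2) * cup (n + 1) (n + 2)) = conj g (cup (n + 1) (n + 2))"
    using ee[of 1] n2 by (simp flip: e1_eq)
  then show ?thesis using g n2 by (simp add: conj_mult conj_cup)
qed

lemma pt2_eq: "pt (n + 2) = r 1 * e 0 * r 1"
proof -
  have "point 1 = r 1 * e 0 * r 1" by (simp add: One_nat_def)
  then show ?thesis using point_eq_cup[of 1] n2 by (simp add: dot_sums)
qed

text \<open>The right-hand side of \<open>rere\<close> absorbs \<open>r 1\<close> on the right by
  \<open>eer\<close> and \<open>e 0\<close> on the left by idempotence; the two identities are these
  facts read on its left-hand side. They identify \<open>e 0 * r 1 * e 0\<close> as the product of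
  the two self-mirrored strands on the four central dots.\<close>

lemma e0_tr_e0: "e 0 * r 1 * e 0 * r 1 = e 0 * r 1 * e 0" "r 1 * e 0 * r 1 * e 0 = e 0 * r 1 * e 0"
proof -
  have "r 1 * e 0 * r 1 * e 0 * r 1 = e 0 * (e 1 * e 0 * r 1)"
    unfolding rere by (simp add: mult.assoc)
  also have "\<dots> = r 1 * e 0 * r 1 * e 0" unfolding eer rere by (simp add: mult.assoc)
  finally have "r 1 * (r 1 * e 0 * r 1 * e 0 * r 1) = r 1 * (r 1 * e 0 * r 1 * e 0)" by simp
  then show 1: "e 0 * r 1 * e 0 * r 1 = e 0 * r 1 * e 0"
    using n2 by (simp add: mult.assoc rr_assoc)
  have "r 1 * e 0 * r 1 * e 0 = (e 0 * e 0) * e 1 * e 0" using ee[of 0] n2 by (simp add: rere)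
  also have "\<dots> = e 0 * (r 1 * e 0 * r 1 * e 0)" using rere by (simp add: mult.assoc)
  also have "\<dots> = (e 0 * r 1 * e 0 * r 1) * e 0" by (simp add: mult.assoc)
  also have "\<dots> = e 0 * r 1 * e 0" unfolding 1 using ee[of 0] n2 by (simp add: mult.assoc)
  finally show "r 1 * e 0 * r 1 * e 0 = e 0 * r 1 * e 0" .
qed

lemma pt_std:
  "pt (n + 1) * pt (n + 2) = pt (n + 2) * pt (n + 1)"
  "pt (n + 1) * pt (n + 2) * tr (n + 1) (n + 2) = pt (n + 1) * pt (n + 2)"
  "pt (n + 1) * cup (n + 1) (n + 2) * pt (n + 1) = pt (n + 1) * pt (n + 2)"
  "cup (n + 1) (n + 2) * pt (n + 1) = cup (n + 1) (n + 2) * pt (n + 2)"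
  "cup (n + 1) (n + 2) * pt (n + 1) * cup (n + 1) (n + 2) = cup (n + 1) (n + 2)"
proof -
  have p12: "pt (n + 1) * pt (n + 2) = e 0 * r 1 * e 0"
    unfolding pt2_eq e0_eq[symmetric] using e0_tr_e0(1) by (simp add: mult.assoc)
  show "pt (n + 1) * pt (n + 2) = pt (n + 2) * pt (n + 1)"
    unfolding p12 unfolding pt2_eq e0_eq[symmetric] by (rule e0_tr_e0(2)[symmetric])
  have "tr (n + 1) (n + 2) = r 1" using r_eq_tr[of 1] n2 by (simp add: dot_sums)
  then show "pt (n + 1) * pt (n + 2) * tr (n + 1) (n + 2) = pt (n + 1) * pt (n + 2)"
    unfolding p12 by (simp add: e0_tr_e0(1))
  show "pt (n + 1) * cup (n + 1) (n + 2) * pt (n + 1) = pt (n + 1) * pt (n + 2)"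
    unfolding p12 unfolding e0_eq[symmetric] e1_eq[symmetric] using rere e0_tr_e0(2) by simp
  have "e 1 * (r 1 * e 0 * r 1) = e 1 * e 0"
    using n2 er[of 1] eer by (simp flip: mult.assoc)
  then show "cup (n + 1) (n + 2) * pt (n + 1) = cup (n + 1) (n + 2) * pt (n + 2)"
    unfolding pt2_eq e0_eq[symmetric] e1_eq[symmetric] by simp
  show "cup (n + 1) (n + 2) * pt (n + 1) * cup (n + 1) (n + 2) = cup (n + 1) (n + 2)"
    unfolding e0_eq[symmetric] e1_eq[symmetric] by (rule eee)
qed

lemma pt_relations:
  assumes "a \<in> {1..2 * n}" "b \<in> {1..2 * n}" "a \<noteq> b" "b \<noteq> bar n a"
  shows "pt a * pt b = pt b * pt a"
    "pt a * pt b * tr a b = pt a * pt b"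
    "pt a * cup a b * pt a = pt a * pt b"
    "cup a b * pt a = cup a b * pt b"
    "cup a b * pt a * cup a b = cup a b"
proof -
  obtain g where g: "signed_perm n g" "g (n + 1) = a" "g (n + 2) = b"
      "g (bar n (n + 1)) = bar n a" "g (bar n (n + 2)) = bar n b"
    using ex_perm2 indep2 assms by metis
  have c: "conj g (cup (n + 1) (n + 2)) = cup a b" "conj g (tr (n + 1) (n + 2)) = tr a b"
    using conj_cup[OF g(1), of "n + 1" "n + 2"] conj_tr[OF g(1), of "n + 1" "n + 2"] g n2 by auto
  have p: "conj g (pt (n + 1)) = pt a" "conj g (pt (n + 2)) = pt b"
    using g by (simp_all add: conj_point1 conj_point2)
  note cm = conj_mult[OF g(1)] c p
  show "pt a * pt b = pt b * pt a" using arg_cong[OF pt_std(1), of "conj g"] by (simp only: cm)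
  show "pt a * pt b * tr a b = pt a * pt b" using arg_cong[OF pt_std(2), of "conj g"] by (simp only: cm)
  show "pt a * cup a b * pt a = pt a * pt b" using arg_cong[OF pt_std(3), of "conj g"] by (simp only: cm)
  show "cup a b * pt a = cup a b * pt b" using arg_cong[OF pt_std(4), of "conj g"] by (simp only: cm)
  show "cup a b * pt a * cup a b = cup a b" using arg_cong[OF pt_std(5), of "conj g"] by (simp only: cm)
qed

lemma pt_comm:
  assumes "a \<in> {1..2 * n}" "b \<in> {1..2 * n}"
  shows "pt a * pt b = pt b * pt a"
  using pt_relations(1)[OF assms] assms by (cases "b = a"; cases "b = bar n a") (auto simp: pt_bar)

text \<open>The absorption on which the normal form rests. For dots in general position it is one of
  \<open>pt_relations\<close>; for mirrored dots it comes from
  \<open>e 0 * r 0 = e 0\<close>.\<close>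

lemma pt_tr:
  assumes "a \<in> {1..2 * n}" "b \<in> {1..2 * n}" "a \<noteq> b"
  shows "pt a * pt b * tr a b = pt a * pt b"
proof (cases "b = bar n a")
  case True
  obtain g where g: "signed_perm n g" "g (n + 1) = a" "g (bar n (n + 1)) = bar n a"
    using ex_perm1 assms by metis
  have "pt (n + 1) * tr (n + 1) n = pt (n + 1)"
  proof -
    have "tr (n + 1) n = r 0" by (rule tr_std)
    then show ?thesis using er[of 0] n2 by (simp flip: e0_eq)
  qed
  then have "conj g (pt (n + 1) * tr (n + 1) (bar n (n + 1))) = conj g (pt (n + 1))" by (simp add: bar_def)
  moreover have "conj g (tr (n + 1) (bar n (n + 1))) = tr a (bar n a)"
    using conj_tr[OF g(1), of "n + 1" "bar n (n + 1)"] g n2 by (auto simp: bar_def)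
  ultimately have "pt a * tr a (bar n a) = pt a" using g by (simp add: conj_mult conj_point1)
  then show ?thesis using True assms pt_bar cup_idem[of a "bar n a"] by (simp add: mult.assoc)
next
  case False
  then show ?thesis using pt_relations(2) assms by simp
qed

text \<open>Relation \<open>ere\<close> multiplied by \<open>r 0\<close> on the right. By
  \<open>cup_bar\<close> the conjugate \<open>r 0 * e 1 * r 0\<close> is the arc from
  \<open>n + 1\<close> to the mirror image of \<open>n + 2\<close>.\<close>

lemma cup_cup_bar:
  assumes "a \<in> {1..2 * n}" "b \<in> {1..2 * n}" "a \<noteq> b" "b \<noteq> bar n a"
  shows "cup a b * cup a (bar n b) = cup a b * tr a (bar n a)"
proof -
  obtain g where g: "signed_perm n g" "g (n + 1) = a" "g (n + 2) = b"
      "g (bar n (n + 1)) = bar n a" "g (bar n (n + 2)) = bar n b"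
    using ex_perm2 indep2 assms by metis
  have "r 0 * e 1 * r 0 = conj (simple_perm n 0) (cup (n + 1) (n + 2))"
    using conj_simple[of 0 "e 1"] n2 by (simp add: e1_eq)
  also have "\<dots> = cup n (n + 2)"
    using n2 by (subst conj_cup) (auto simp: signed_simple_perm simple_perm_simps)
  also have "\<dots> = cup (bar n n) (bar n (n + 2))"
    using n2 by (intro cup_bar[symmetric]) auto
  finally have 1: "cup (n + 1) (bar n (n + 2)) = r 0 * e 1 * r 0" by (simp add: bar_def)
  have 2: "tr (n + 1) (bar n (n + 1)) = r 0" unfolding bar_std by (rule tr_std)
  have "cup (n + 1) (n + 2) * cup (n + 1) (bar n (n + 2)) = cup (n + 1) (n + 2) * tr (n + 1) (bar n (n + 1))"
    unfolding 1 2 e1_eq[symmetric] using ere by (simp flip: mult.assoc)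
  then have "conj g (cup (n + 1) (n + 2) * cup (n + 1) (bar n (n + 2))) =
    conj g (cup (n + 1) (n + 2) * tr (n + 1) (bar n (n + 1)))" by simp
  moreover have "conj g (cup (n + 1) (n + 2)) = cup a b" "conj g (cup (n + 1) (bar n (n + 2))) = cup a (bar n b)"
    "conj g (tr (n + 1) (bar n (n + 1))) = tr a (bar n a)"
    using conj_cup[OF g(1) dots_std(2,3) dots_bar_std(5)] conj_cup[OF g(1) dots_std(2) dots_bar_std(2,4)]
      conj_tr[OF g(1) dots_std(2) dots_bar_std(1) bar_neq(2)] g by simp_all
  ultimately show ?thesis using g by (simp add: conj_mult)
qed

text \<open>\<open>rer\<close> gives \<open>r 2 * r 1 * e 2 = e 1 * (r 2 * r 1)\<close>, and
  \<open>rre\<close> identifies the left side with \<open>e 1 * e 2\<close>. Behind an arc, a second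
  arc sharing a dot can thus be traded for a permutation.\<close>

lemma cup_cup_shared:
  assumes "indep n [a, b, c]"
  shows "cup a b * cup b c = cup a b * (tr b c * tr a b)"
proof -
  obtain g where g: "signed_perm n g" "g (n + 1) = a" "g (n + 2) = b" "g (n + 3) = c" "3 \<le> n"
    using ex_perm3[OF assms] by metis
  have "r 1 * e 2 * r 1 = r 2 * e 1 * r 2" using g by (intro rer) (auto simp: adj_def)
  then have "r 2 * (r 1 * e 2 * r 1) * r 1 = r 2 * (r 2 * e 1 * r 2) * r 1" by simp
  then have "r 2 * r 1 * e 2 = e 1 * (r 2 * r 1)"
    using g by (simp add: mult.assoc rr rr_assoc)
  moreover have "r 2 * r 1 * e 2 = e 1 * e 2" using g by (intro rre) (auto simp: adj_def)
  ultimately have "e 1 * e 2 = e 1 * (r 2 * r 1)" by simp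
  moreover have "e 2 = cup (n + 2) (n + 3)" using e_eq_cup[of 2] g by (simp add: dot_sums)
  moreover have "r 2 = tr (n + 2) (n + 3)" "r 1 = tr (n + 1) (n + 2)" using r_eq_tr[of 2] r_eq_tr[of 1] g by (simp_all add: dot_sums)
  ultimately have "conj g (cup (n + 1) (n + 2) * cup (n + 2) (n + 3)) =
    conj g (cup (n + 1) (n + 2) * (tr (n + 2) (n + 3) * tr (n + 1) (n + 2)))" by (simp add: e1_eq)
  then show ?thesis using g by (simp add: conj_mult conj_cup conj_tr)
qed

text \<open>Far commutation at standard dots: \<open>e 0\<close> with \<open>e 2\<close> for a
  self-mirrored strand and an arc, \<open>e 1\<close> with \<open>e 3\<close> for two arcs. Two
  self-mirrored strands are the case \<open>pt_comm\<close>.\<close>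

lemma cup_disjoint_comm:
  assumes ab: "a \<in> {1..2 * n}" "b \<in> {1..2 * n}" "a \<noteq> b" and cd: "c \<in> {1..2 * n}" "d \<in> {1..2 * n}" "c \<noteq> d"
    and disj: "c \<notin> {a, b, bar n a, bar n b}" "d \<notin> {a, b, bar n a, bar n b}"
  shows "cup a b * cup c d = cup c d * cup a b"
proof -
  have arc_pt: "cup a b * pt c = pt c * cup a b"
    if ab: "a \<in> {1..2 * n}" "b \<in> {1..2 * n}" "a \<noteq> b" "b \<noteq> bar n a" and c: "c \<in> {1..2 * n}"
      "c \<notin> {a, b, bar n a, bar n b}" for a b c
  proof -
    have "indep n [c, a, b]" using that by (auto simp: indep_Cons bar_eq_swap)
    then obtain g where g: "signed_perm n g" "g (n + 1) = c" "g (n + 2) = a" "g (n + 3) = b"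
        "g (bar n (n + 1)) = bar n c" "3 \<le> n"
      using ex_perm3 by metis
    have "e 2 * e 0 = e 0 * e 2" using g by (intro ee_comm) (auto simp: adj_def)
    moreover have "e 2 = cup (n + 2) (n + 3)" using e_eq_cup[of 2] g by (simp add: dot_sums)
    ultimately have "conj g (cup (n + 2) (n + 3) * pt (n + 1)) = conj g (pt (n + 1) * cup (n + 2) (n + 3))"
      by (simp add: e0_eq)
    then show ?thesis using g by (simp add: conj_mult conj_point1) (simp add: conj_cup)
  qed
  consider "b = bar n a" "d = bar n c" | "b \<noteq> bar n a" "d = bar n c" | "b = bar n a" "d \<noteq> bar n c"
    | "b \<noteq> bar n a" "d \<noteq> bar n c" by blast
  then show ?thesis
  proof cases
    case 1
    then show ?thesis using pt_comm ab cd by simp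
  next
    case 2
    then show ?thesis using arc_pt[of a b c] ab cd disj by simp
  next
    case 3
    moreover have "a \<noteq> bar n c" "a \<noteq> bar n d"
      using disj ab cd bar_eq_swap[of c n a] bar_eq_swap[of d n a] bar_bar[of a n] by auto
    ultimately show ?thesis using arc_pt[of c d a] ab cd disj by auto
  next
    case 4
    have "indep n [a, b, c, d]" using 4 ab cd disj by (auto simp: indep_Cons bar_eq_swap)
    then obtain g where g: "signed_perm n g" "g (n + 1) = a" "g (n + 2) = b" "g (n + 3) = c" "g (n + 4) = d" "4 \<le> n"
      using ex_perm4 by metis
    have "e 1 * e 3 = e 3 * e 1" using g by (intro ee_comm) (auto simp: adj_def)
    moreover have "e 3 = cup (n + 3) (n + 4)" using e_eq_cup[of 3] g by (simp add: dot_sums)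
    ultimately have "conj g (cup (n + 1) (n + 2) * cup (n + 3) (n + 4)) = conj g (cup (n + 3) (n + 4) * cup (n + 1) (n + 2))"
      by (simp add: e1_eq)
    then show ?thesis using g by (simp add: conj_mult conj_cup)
  qed
qed

end

end

section \<open>Products of commuting arcs\<close>

lemma bar_bounds [simp]:
  "Suc 0 \<le> a \<Longrightarrow> a \<le> 2 * n \<Longrightarrow> Suc 0 \<le> bar n a"
  "Suc 0 \<le> a \<Longrightarrow> bar n a \<le> 2 * n"
  "a \<in> {Suc 0..2 * n} \<Longrightarrow> bar n a \<in> {Suc 0..2 * n}"
  by (auto simp: bar_def)

text \<open>Products are indexed by dots, so a strand and its mirror image contribute one factor for
  each of their dots. For commuting idempotents order and repetitions are irrelevant, and no
  representatives of the strands have to be chosen.\<close>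

definition cprod :: "('b \<Rightarrow> 'm::monoid_mult) \<Rightarrow> 'b set \<Rightarrow> 'm" where
  "cprod f S = Finite_Set.fold (\<lambda>a z. f a * z) 1 S"

definition comm_idem :: "('b \<Rightarrow> 'm::monoid_mult) \<Rightarrow> 'b set \<Rightarrow> bool" where
  "comm_idem f S \<longleftrightarrow> finite S \<and> (\<forall>a\<in>S. \<forall>b\<in>S. f a * f b = f b * f a) \<and> (\<forall>a\<in>S. f a * f a = f a)"

lemma cprod_empty [simp]: "cprod f {} = 1"
  by (simp add: cprod_def)

lemma cprod_insert:
  assumes "comm_idem f (insert a S)"
  shows "cprod f (insert a S) = f a * cprod f S"
proof -
  interpret comp_fun_idem_on "insert a S" "\<lambda>a z. f a * z"
  proof
    show "(*) (f y) \<circ> (*) (f x) = (*) (f x) \<circ> (*) (f y)" if "x \<in> insert a S" "y \<in> insert a S" for x y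
      using assms that by (auto simp: comm_idem_def fun_eq_iff simp flip: mult.assoc)
    show "(*) (f x) \<circ> (*) (f x) = (*) (f x)" if "x \<in> insert a S" for x
      using assms that by (auto simp: comm_idem_def fun_eq_iff simp flip: mult.assoc)
  qed
  show ?thesis
    using assms fold_insert_idem[of a S 1] by (simp add: cprod_def comm_idem_def)
qed

lemma comm_idem_subset: "comm_idem f S \<Longrightarrow> T \<subseteq> S \<Longrightarrow> comm_idem f T"
  unfolding comm_idem_def by (meson finite_subset subsetD)

lemma cprod_comm:
  assumes "comm_idem f S" "\<And>a. a \<in> S \<Longrightarrow> y * f a = f a * y"
  shows "y * cprod f S = cprod f S * y"
proof -
  have "finite S" using assms by (simp add: comm_idem_def)
  then show ?thesis using assms
  proof (induction S)
    case (insert a S)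
    have "comm_idem f S" by (rule comm_idem_subset[OF insert.prems(1)]) blast
    then have 1: "y * cprod f S = cprod f S * y" by (rule insert.IH) (rule insert.prems(2), simp)
    have 2: "y * f a = f a * y" by (rule insert.prems(2)) simp
    have "y * (f a * cprod f S) = (y * f a) * cprod f S" by (simp only: mult.assoc)
    also have "\<dots> = f a * (y * cprod f S)" unfolding 2 by (simp only: mult.assoc)
    also have "\<dots> = f a * cprod f S * y" unfolding 1 by (simp only: mult.assoc)
    finally show ?case unfolding cprod_insert[OF insert.prems(1)] .
  qed simp
qed

lemma comm_idem_cong:
  assumes "comm_idem f S" "\<And>a. a \<in> S \<Longrightarrow> f a = f' a"
  shows "comm_idem f' S"
proof -
  have "f' a * f' b = f' b * f' a" "f' a * f' a = f' a" if "a \<in> S" "b \<in> S" for a b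
    using assms(1) that unfolding comm_idem_def
    by (metis assms(2))+
  then show ?thesis using assms(1) by (simp add: comm_idem_def)
qed

lemma cprod_cong:
  assumes eq: "\<And>a. a \<in> S \<Longrightarrow> f a = f' a" and ci: "comm_idem f S"
  shows "cprod f S = cprod f' S"
proof -
  have "finite S" using ci by (simp add: comm_idem_def)
  then show ?thesis using eq ci
  proof (induction S)
    case (insert a S)
    have ci: "comm_idem f S" by (rule comm_idem_subset[OF insert.prems(2)]) blast
    have eq: "f x = f' x" if "x \<in> insert a S" for x using that by (rule insert.prems(1))
    have "comm_idem f' (insert a S)" using comm_idem_cong[OF insert.prems(2) eq] .
    moreover have "cprod f S = cprod f' S" by (rule insert.IH[OF _ ci]) (rule eq, simp)
    moreover have "f a = f' a" by (rule eq) simp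
    ultimately show ?case by (simp only: cprod_insert insert.prems(2))
  qed simp
qed

lemma sym_match_remove:
  assumes "sym_match V \<rho> t" "a \<in> V"
  shows "sym_match (V - {a, \<rho> a, t a, \<rho> (t a)}) \<rho> t"
proof -
  note \<rho> = sym_matchD(1)[OF assms(1)] and t = sym_matchD(2)[OF assms(1)] and c = sym_matchD(3)[OF assms(1)]
  have V: "\<rho> a \<in> V" "t a \<in> V" "\<rho> (t a) \<in> V" using assms \<rho> t by (auto intro: fpf_invol_in)
  have "\<rho> x \<notin> {a, \<rho> a, t a, \<rho> (t a)}" "t x \<notin> {a, \<rho> a, t a, \<rho> (t a)}"
    if "x \<in> V" "x \<notin> {a, \<rho> a, t a, \<rho> (t a)}" for x
    using that V fpf_invol_swap[OF \<rho> that(1)] fpf_invol_swap[OF t that(1)] assms(2) c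
      fpf_invol_twice[OF \<rho>] fpf_invol_twice[OF t] by auto
  then show ?thesis using assms(1) by (simp add: sym_match_def fpf_invol_def)
qed

lemma sym_match_add:
  assumes m: "sym_match V \<rho> t" and \<rho>: "fpf_invol X \<rho>" and X: "a \<in> X" "b \<in> X" "a \<noteq> b" and V: "a \<notin> V" "b \<notin> V" "V \<subseteq> X"
  shows "sym_match (insert a (insert b (insert (\<rho> a) (insert (\<rho> b) V)))) \<rho> (t(a := b, b := a, \<rho> a := \<rho> b, \<rho> b := \<rho> a))"
proof -
  have \<rho>V: "\<rho> x \<in> V" "\<rho> x \<noteq> x" "\<rho> (\<rho> x) = x" "t x \<in> V" "t x \<noteq> x" "t (t x) = x" "t (\<rho> x) = \<rho> (t x)" if "x \<in> V" for x
    using m that by (auto simp: sym_match_def fpf_invol_def)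
  have n: "\<rho> a \<noteq> a" "\<rho> b \<noteq> b" "\<rho> (\<rho> a) = a" "\<rho> (\<rho> b) = b" "\<rho> a \<noteq> \<rho> b" "\<rho> a \<notin> V" "\<rho> b \<notin> V"
    using X \<rho> V \<rho>V fpf_invol_eq[OF \<rho>] by (auto simp: fpf_invol_neq fpf_invol_twice) (metis \<rho>V(1) fpf_invol_twice)+
  have x: "x \<notin> {a, b, \<rho> a, \<rho> b}" if "x \<in> V" for x using that V n by auto
  show ?thesis
  proof (cases "b = \<rho> a")
    case True
    show ?thesis unfolding sym_match_def fpf_invol_def using n x \<rho>V V True by auto
  next
    case False
    then have "a \<noteq> \<rho> b" "\<rho> b \<noteq> a" "b \<noteq> \<rho> a" using n by metis+
    then show ?thesis unfolding sym_match_def fpf_invol_def using n x \<rho>V V X(3) by auto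
  qed
qed

lemma fpf_bar: "fpf_invol {1..2 * n} (bar n)"
  by (auto simp: fpf_invol_def)

lemma join_commute:
  assumes "fpf_invol V t" "p \<in> V" "q \<in> V" "p \<noteq> q"
  shows "join p q t = join q p t"
proof -
  have "t p = q \<longleftrightarrow> t q = p" using assms fpf_invol_twice by metis
  moreover have "t p \<noteq> p" "t q \<noteq> q" "t p \<noteq> t q" using assms fpf_invol_neq fpf_invol_eq by metis+
  ultimately show ?thesis using assms(4) by (auto simp: join_def fun_eq_iff)
qed

lemma sym_join_commute:
  assumes m: "sym_match V \<rho> t" and pq: "p \<in> V" "q \<in> V" "p \<noteq> q"
  shows "sym_join \<rho> p q t = sym_join \<rho> q p t"
proof -
  note \<rho> = sym_matchD(1)[OF m] and t = sym_matchD(2)[OF m]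
  have "\<rho> p \<in> V" "\<rho> q \<in> V" "\<rho> p \<noteq> \<rho> q" "q = \<rho> p \<longleftrightarrow> p = \<rho> q"
    using \<rho> pq fpf_invol_in fpf_invol_eq fpf_invol_swap by metis+
  then show ?thesis
    using join_commute[OF t pq] join_commute[OF fpf_invol_join[OF t pq], of "\<rho> p" "\<rho> q"]
    unfolding sym_join_def by metis
qed

context brauerC_monoid
begin

lemma mult_eq2: "x * y = u \<Longrightarrow> x * (y * z) = u * z" for x :: 'a
  by (metis mult.assoc)

lemma mult_eq3: "x * y * w = u \<Longrightarrow> x * (y * (w * z)) = u * z" for x :: 'a
  by (metis mult.assoc)

definition half :: "nat set \<Rightarrow> (nat \<Rightarrow> nat) \<Rightarrow> bool" where
  "half S t \<longleftrightarrow> S \<subseteq> {1..2 * n} \<and> sym_match S (bar n) t"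

definition arcs :: "nat set \<Rightarrow> (nat \<Rightarrow> nat) \<Rightarrow> 'a" where
  "arcs S t = cprod (\<lambda>a. cup a (t a)) S"

definition points :: "nat set \<Rightarrow> 'a" where
  "points S = cprod pt S"

lemma halfD:
  assumes "half S t" "a \<in> S"
  shows "a \<in> {1..2 * n}" "bar n a \<in> S" "t a \<in> S" "t a \<in> {1..2 * n}" "t a \<noteq> a" "t (t a) = a" "t (bar n a) = bar n (t a)"
    "bar n (t a) \<in> S" "a \<noteq> t a"
  using assms unfolding half_def sym_match_def fpf_invol_def by (auto dest: spec[of _ a])

lemma half_in: "half S t \<Longrightarrow> a \<in> {1..2 * n} \<Longrightarrow> bar n a \<in> S \<longleftrightarrow> a \<in> S"
  by (metis bar_bar halfD(2))

lemma half_cup_eq: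
  assumes "half S t" "a \<in> S" "b \<in> {a, bar n a, t a, bar n (t a)}"
  shows "cup b (t b) = cup a (t a)"
  using assms(3) halfD[OF assms(1,2)] halfD(7)[OF assms(1) halfD(3)[OF assms(1,2)]]
    cup_sym[of a "t a"] cup_bar[of a "t a"] cup_bar[of "t a" a] by auto

lemma comm_idem_arcs:
  assumes h: "half S t"
  shows "comm_idem (\<lambda>a. cup a (t a)) S"
  unfolding comm_idem_def
proof (intro conjI ballI)
  show "finite S" using h finite_subset[of S "{1..2 * n}"] by (auto simp: half_def)
next
  fix a assume "a \<in> S"
  then show "cup a (t a) * cup a (t a) = cup a (t a)" using halfD[OF h] by (intro cup_idem) auto
  fix b assume b: "b \<in> S"
  show "cup a (t a) * cup b (t b) = cup b (t b) * cup a (t a)"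
  proof (cases "b \<in> {a, bar n a, t a, bar n (t a)}")
    case True
    then show ?thesis by (simp only: half_cup_eq[OF h \<open>a \<in> S\<close> True])
  next
    case False
    have "b = t (t b)" using halfD(6)[OF h b] by simp
    moreover have "t (bar n a) = bar n (t a)" "t (t a) = a" "t (bar n (t a)) = bar n a"
      using halfD(6,7)[OF h \<open>a \<in> S\<close>] halfD(7)[OF h halfD(3)[OF h \<open>a \<in> S\<close>]] by simp_all
    ultimately have "t b \<notin> {a, bar n a, t a, bar n (t a)}"
      using False by (metis insert_iff singletonD)
    with False show ?thesis using halfD[OF h \<open>a \<in> S\<close>] halfD[OF h b] by (intro cup_disjoint_comm) auto
  qed
qed

lemma comm_idem_points: "S \<subseteq> {1..2 * n} \<Longrightarrow> comm_idem pt S"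
  unfolding comm_idem_def
  by (intro conjI ballI pt_comm cup_idem) (auto simp: finite_subset simp del: atLeastAtMost_iff)

lemma arcs_cong: "half S t \<Longrightarrow> (\<And>a. a \<in> S \<Longrightarrow> t a = t' a) \<Longrightarrow> arcs S t = arcs S t'"
  unfolding arcs_def by (rule cprod_cong[OF _ comm_idem_arcs]) simp_all

lemma half_remove: "half S t \<Longrightarrow> a \<in> S \<Longrightarrow> half (S - {a, bar n a, t a, bar n (t a)}) t"
  unfolding half_def using sym_match_remove[of S "bar n" t a] by auto

lemma half_add:
  assumes "half S t" "a \<in> {1..2 * n}" "b \<in> {1..2 * n}" "a \<noteq> b" "a \<notin> S" "b \<notin> S"
  shows "half (insert a (insert b (insert (bar n a) (insert (bar n b) S)))) (t(a := b, b := a, bar n a := bar n b, bar n b := bar n a))"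
  unfolding half_def
proof
  show "sym_match (insert a (insert b (insert (bar n a) (insert (bar n b) S)))) (bar n)
      (t(a := b, b := a, bar n a := bar n b, bar n b := bar n a))"
    using assms by (intro sym_match_add[OF _ fpf_bar]) (auto simp: half_def)
qed (use assms in \<open>auto simp: half_def\<close>)

text \<open>The four dots of the strand and its mirror image carry the same idempotent, hence
  together contribute a single factor.\<close>

lemma arcs_extract:
  assumes h: "half S t" and a: "a \<in> S"
  shows "arcs S t = cup a (t a) * arcs (S - {a, bar n a, t a, bar n (t a)}) t"
proof -
  let ?S = "S - {a, bar n a, t a, bar n (t a)}"
  let ?f = "\<lambda>a. cup a (t a)"
  have S: "S = insert a (insert (bar n a) (insert (t a) (insert (bar n (t a)) ?S)))"
    using a halfD[OF h a] by auto
  have ci: "comm_idem ?f T" if "T \<subseteq> S" for T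
    using comm_idem_subset[OF comm_idem_arcs[OF h] that] .
  have "cprod ?f S = ?f a * (?f (bar n a) * (?f (t a) * (?f (bar n (t a)) * cprod ?f ?S)))"
    apply (subst S)
    apply (subst cprod_insert, rule ci, use S in blast)+
    apply (rule refl)
    done
  also have "?f (bar n a) = ?f a" by (rule half_cup_eq[OF h a]) simp
  also have "?f (t a) = ?f a" by (rule half_cup_eq[OF h a]) simp
  also have "?f (bar n (t a)) = ?f a" by (rule half_cup_eq[OF h a]) simp
  finally show ?thesis
    using cup_idem[of a "t a"] halfD[OF h a] by (simp add: arcs_def mult_eq2)
qed

lemma points_extract:
  assumes S: "S \<subseteq> {1..2 * n}" "a \<in> S" "bar n a \<in> S"
  shows "points S = pt a * points (S - {a, bar n a})"
proof -
  have eq: "S = insert a (insert (bar n a) (S - {a, bar n a}))" using S by auto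
  have ci: "comm_idem pt T" if "T \<subseteq> S" for T
    using comm_idem_points that S(1) by (meson subset_trans)
  have "cprod pt S = pt a * (pt (bar n a) * cprod pt (S - {a, bar n a}))"
    apply (subst eq)
    apply (subst cprod_insert, rule ci, use eq in blast)+
    apply (rule refl)
    done
  moreover have a: "a \<in> {1..2 * n}" using S by blast
  moreover have "pt (bar n a) = pt a" using pt_bar[OF a] bar_bar[OF a] by simp
  moreover have "pt a * pt a = pt a" using a by (intro cup_idem) (simp_all del: atLeastAtMost_iff)
  ultimately show ?thesis by (simp add: points_def mult_eq2)
qed

lemma pt_points_comm: "S \<subseteq> {1..2 * n} \<Longrightarrow> a \<in> {1..2 * n} \<Longrightarrow> pt a * points S = points S * pt a"
  unfolding points_def by (intro cprod_comm comm_idem_points pt_comm) auto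

lemma pt_points_absorb:
  "S \<subseteq> {1..2 * n} \<Longrightarrow> a \<in> S \<Longrightarrow> pt a * points S = points S"
  unfolding points_def
  using cprod_insert[of pt a S] comm_idem_points[of S] insert_absorb[of a S] by simp

lemma cup_points_comm:
  assumes "S \<subseteq> {1..2 * n}" "\<And>x. x \<in> S \<Longrightarrow> bar n x \<in> S" "a \<in> {1..2 * n}" "b \<in> {1..2 * n}" "a \<noteq> b" "a \<notin> S" "b \<notin> S"
  shows "cup a b * points S = points S * cup a b"
  unfolding points_def
proof (intro cprod_comm comm_idem_points cup_disjoint_comm)
  fix x assume x: "x \<in> S"
  then have "x \<in> {1..2 * n}" using assms(1) by blast
  then show "x \<notin> {a, b, bar n a, bar n b}" "bar n x \<notin> {a, b, bar n a, bar n b}"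
    using x assms by (auto simp: bar_inj simp del: atLeastAtMost_iff) (metis bar_bar assms(2-))+
qed (use assms in \<open>auto simp del: atLeastAtMost_iff\<close>)

lemma cup_arcs_comm:
  assumes h: "half S t" and ab: "a \<in> {1..2 * n}" "b \<in> {1..2 * n}" "a \<noteq> b" "a \<notin> S" "b \<notin> S"
  shows "cup a b * arcs S t = arcs S t * cup a b"
  unfolding arcs_def
proof (intro cprod_comm comm_idem_arcs[OF h] cup_disjoint_comm)
  fix x assume "x \<in> S"
  moreover have "t x \<in> S" using halfD[OF h \<open>x \<in> S\<close>] by simp
  moreover have "a \<notin> S" "b \<notin> S" "bar n a \<notin> S" "bar n b \<notin> S" using ab half_in[OF h] by auto
  ultimately show "x \<notin> {a, b, bar n a, bar n b}" "t x \<notin> {a, b, bar n a, bar n b}" by auto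
qed (use ab halfD[OF h] in auto)

lemma comm_idem_conj:
  assumes g: "signed_perm n g" and "comm_idem f S"
  shows "comm_idem (\<lambda>a. conj g (f (inv g a))) (g ` S)"
  using assms(2) unfolding comm_idem_def
  by (auto simp: signed_perm_inv[OF g] simp flip: conj_mult[OF g])

lemma conj_cprod:
  assumes g: "signed_perm n g" and "comm_idem f S"
  shows "conj g (cprod f S) = cprod (\<lambda>a. conj g (f (inv g a))) (g ` S)"
proof -
  have "finite S" using assms by (simp add: comm_idem_def)
  then show ?thesis using assms(2)
  proof (induction S)
    case empty
    then show ?case using rep_inv[OF g] by (simp add: conj_def)
  next
    case (insert a S)
    have "comm_idem f S" by (rule comm_idem_subset[OF insert.prems]) blast
    then have IH: "conj g (cprod f S) = cprod (\<lambda>a. conj g (f (inv g a))) (g ` S)" by (rule insert.IH)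
    have "conj g (cprod f (insert a S)) = conj g (f a) * conj g (cprod f S)"
      by (simp only: cprod_insert[OF insert.prems] conj_mult[OF g])
    also have "\<dots> = cprod (\<lambda>a. conj g (f (inv g a))) (insert (g a) (g ` S))"
      using cprod_insert[OF comm_idem_conj[OF g insert.prems, unfolded image_insert]]
      by (simp only: IH signed_perm_inv(3)[OF g])
    finally show ?case by simp
  qed
qed

lemma half_image:
  assumes h: "half S t" and g: "signed_perm n g"
  shows "half (g ` S) (g \<circ> t \<circ> inv g)"
proof -
  have "bar n (g x) = g (bar n x)" if "x \<in> S" for x
    using signed_perm_bar[OF g] halfD(1)[OF h that] by simp
  then show ?thesis
    using halfD[OF h] signed_perm_inv[OF g] signed_perm_eq[OF g] signed_perm_in[OF g] bar_neq
    unfolding half_def sym_match_def fpf_invol_def by (auto simp: image_iff)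
qed

lemma conj_arcs:
  assumes h: "half S t" and g: "signed_perm n g"
  shows "conj g (arcs S t) = arcs (g ` S) (g \<circ> t \<circ> inv g)"
  unfolding arcs_def conj_cprod[OF g comm_idem_arcs[OF h]]
proof (rule cprod_cong[OF _ comm_idem_conj[OF g comm_idem_arcs[OF h]]])
  fix a assume "a \<in> g ` S"
  then obtain x where x: "x \<in> S" "a = g x" by auto
  then show "conj g (cup (inv g a) (t (inv g a))) = cup a ((g \<circ> t \<circ> inv g) a)"
    using conj_cup[OF g halfD(1,4,9)[OF h x(1)]] by (simp add: signed_perm_inv(3)[OF g])
qed

lemma conj_points:
  assumes S: "S \<subseteq> {1..2 * n}" and g: "signed_perm n g"
  shows "conj g (points S) = points (g ` S)"
  unfolding points_def conj_cprod[OF g comm_idem_points[OF S]]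
proof (rule cprod_cong[OF _ comm_idem_conj[OF g comm_idem_points[OF S]]])
  fix a assume "a \<in> g ` S"
  then obtain x where x: "x \<in> S" "a = g x" "x \<in> {1..2 * n}" using S by auto
  then show "conj g (pt (inv g a)) = pt a"
    using signed_perm_inv(3)[OF g] conj_cup[OF g x(3) bar_in[OF x(3)]] signed_perm_bar[OF g x(3)] by simp
qed

lemma conj_arcs_fixed:
  assumes h: "half S t" and g: "signed_perm n g" and fixes_S: "\<And>x. x \<in> S \<Longrightarrow> g x = x"
  shows "conj g (arcs S t) = arcs S t"
proof -
  have inv: "inv g x = x" if "x \<in> S" for x using fixes_S[OF that] signed_perm_inv[OF g] by metis
  have "arcs S t = arcs S (g \<circ> t \<circ> inv g)"
    using halfD[OF h] fixes_S inv by (intro arcs_cong[OF h]) auto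
  then show ?thesis using conj_arcs[OF h g] fixes_S by simp
qed

lemma conj_points_fixed:
  assumes "S \<subseteq> {1..2 * n}" "signed_perm n g" "\<And>x. x \<in> S \<Longrightarrow> g x = x"
  shows "conj g (points S) = points S"
  using conj_points[OF assms(1,2)] assms(3) by simp

lemma tr_push:
  assumes "x \<in> {1..2 * n}" "y \<in> {1..2 * n}" "x \<noteq> y" "a \<in> {1..2 * n}" "b \<in> {1..2 * n}" "a \<noteq> b"
  shows "tr x y * cup a b = cup (refl_perm n x y a) (refl_perm n x y b) * tr x y"
  using conj_cup[OF signed_refl_perm[OF assms(1-3)] assms(4-6)] conj_eq_iff[OF signed_refl_perm[OF assms(1-3)]]
  by (simp add: tr_def)

lemma refl_perm_bar:
  assumes "x \<in> {1..2 * n}" "y \<in> {1..2 * n}" "x \<noteq> y" "a \<in> {1..2 * n}"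
  shows "refl_perm n x y (bar n a) = bar n (refl_perm n x y a)"
  using signed_perm_bar[OF signed_refl_perm[OF assms(1-3)] assms(4)] .

lemma tr_pt_left:
  assumes "a \<in> {1..2 * n}" "b \<in> {1..2 * n}" "a \<noteq> b"
  shows "tr a b * (pt a * pt b) = pt a * pt b"
proof -
  have "tr a b * pt a = pt b * tr a b" "tr a b * pt b = pt a * tr a b"
    using tr_push[OF assms, of a "bar n a"] tr_push[OF assms, of b "bar n b"] assms
    by (auto simp: refl_perm_bar refl_perm_left refl_perm_right)
  then have "tr a b * (pt a * pt b) = pt b * pt a * tr a b" by (metis mult.assoc)
  then show ?thesis using pt_comm[of a b] pt_tr[of a b] assms by simp
qed

text \<open>Permutations supported on \<open>S\<close> are absorbed by the singletons on \<open>S\<close>, because each is a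
  product of reflections there.\<close>
lemma points_absorb_perm:
  assumes "signed_perm n h" "S \<subseteq> {1..2 * n}" "\<And>x. x \<in> S \<Longrightarrow> bar n x \<in> S" "\<And>x. x \<in> {1..2 * n} - S \<Longrightarrow> h x = x"
  shows "points S * rep h = points S"
  using assms(1,4)
proof (induction "card {x. h x \<noteq> x}" arbitrary: h rule: less_induct)
  case less
  have fin: "finite {x. h x \<noteq> x}"
    by (rule finite_subset[of _ "{1..2 * n}"]) (use less.prems(1) in \<open>auto simp: signed_perm_def\<close>)
  show ?case
  proof (cases "\<exists>x. h x \<noteq> x")
    case False
    then have "h = id" by (auto simp: fun_eq_iff)
    then show ?thesis by simp
  next
    case True
    then obtain x where x: "h x \<noteq> x" by blast
    define y where "y = h x"
    have xS: "x \<in> S" using x less.prems unfolding signed_perm_def by blast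
    have yS: "y \<in> S"
    proof (rule ccontr)
      assume "y \<notin> S"
      moreover have "y \<in> {1..2 * n}" using xS assms(2) signed_perm_in[OF less.prems(1)] y_def by blast
      ultimately have "h y = y" using less.prems by auto
      then show False using x y_def signed_perm_eq[OF less.prems(1)] by metis
    qed
    have xy: "x \<in> {1..2 * n}" "y \<in> {1..2 * n}" "x \<noteq> y" using xS yS assms(2) x y_def by auto
    \<comment> \<open>The reflection takes \<open>y = h x\<close> back to \<open>x\<close>. Composed
      with \<open>h\<close> it makes \<open>x\<close> a fixed point and moves no dot that
      \<open>h\<close> fixes, so the support shrinks.\<close>
    let ?t = "refl_perm n x y"
    have t: "signed_perm n ?t" using signed_refl_perm[OF xy] .
    have s: "signed_perm n (?t \<circ> h)" using t less.prems(1) by (rule signed_perm_comp)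
    have fixed: "(?t \<circ> h) z = z" if "h z = z" for z
    proof -
      have "z \<noteq> y" "z \<noteq> x" using that x y_def signed_perm_eq[OF less.prems(1)] by metis+
      moreover have "z \<noteq> bar n x"
        using that signed_perm_bar[OF less.prems(1) xy(1)] xy bar_inj[of x n y] y_def by auto
      moreover have "z \<noteq> bar n y"
      proof
        assume "z = bar n y"
        then have "bar n (h y) = bar n y" using that signed_perm_bar[OF less.prems(1) xy(2)] by simp
        then have "h y = y" using bar_inj signed_perm_in[OF less.prems(1)] xy by blast
        then show False using xy y_def signed_perm_eq[OF less.prems(1)] by metis
      qed
      ultimately show ?thesis using that by (simp add: refl_perm_fixed)
    qed
    have "(?t \<circ> h) x = x" using y_def by (simp add: refl_perm_right)
    then have "{z. (?t \<circ> h) z \<noteq> z} \<subset> {z. h z \<noteq> z}" using fixed x by blast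
    then have "card {z. (?t \<circ> h) z \<noteq> z} < card {z. h z \<noteq> z}" using fin by (intro psubset_card_mono)
    moreover have "(?t \<circ> h) z = z" if "z \<in> {1..2 * n} - S" for z using fixed less.prems(2) that by blast
    ultimately have IH: "points S * rep (?t \<circ> h) = points S" using less.hyps[OF _ s] by blast
    have "h = ?t \<circ> (?t \<circ> h)" using refl_perm_involutive[OF xy(1,2)] by (simp add: fun_eq_iff)
    then have rep_h: "rep h = tr x y * rep (?t \<circ> h)" using rep_comp[OF t s] by (simp add: tr_def)
    have absorb: "points S * pt v = points S" if "v \<in> S" for v
      using pt_points_absorb[OF assms(2) that] pt_points_comm[OF assms(2), of v] that assms(2) by auto
    have "points S * tr x y = points S * pt x * pt y * tr x y"
      using xS yS by (simp add: absorb)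
    also have "\<dots> = points S * (pt x * pt y * tr x y)" by (simp only: mult.assoc)
    also have "\<dots> = points S * pt x * pt y" unfolding pt_tr[OF xy] by (simp only: mult.assoc)
    also have "\<dots> = points S" using xS yS by (simp add: absorb)
    finally have "points S * tr x y = points S" .
    then show ?thesis unfolding rep_h by (simp add: IH flip: mult.assoc)
  qed
qed

end

section \<open>Joining two dots that both carry horizontal strands\<close>

context brauerC_monoid
begin

lemma arcs_extract_pt:
  assumes "half S t" "a \<in> S" "t a = bar n a"
  shows "arcs S t = pt a * arcs (S - {a, bar n a}) t" "half (S - {a, bar n a}) t"
proof -
  have "{a, bar n a, t a, bar n (t a)} = {a, bar n a}"
    using assms halfD(1)[OF assms(1,2)] by auto
  then show "arcs S t = pt a * arcs (S - {a, bar n a}) t" "half (S - {a, bar n a}) t"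
    using arcs_extract[OF assms(1,2)] half_remove[OF assms(1,2)] assms(3) by simp_all
qed

lemma half_bar_closed: "half S t \<Longrightarrow> S \<subseteq> {1..2 * n}" "half S t \<Longrightarrow> x \<in> S \<Longrightarrow> bar n x \<in> S"
  using halfD by (auto simp: half_def)

lemma half_points_extract:
  assumes "half S t" "a \<in> S" "c = t a" "c \<noteq> bar n a"
  shows "points S = pt a * (pt c * points (S - {a, bar n a, c, bar n c}))"
proof -
  have c: "c \<in> S" "bar n c \<in> S" "c \<notin> {a, bar n a}" "bar n c \<notin> {a, bar n a}"
    using assms halfD[OF assms(1,2)] bar_inj[of c n a] bar_eq_swap[of c n a] by auto
  have "points S = pt a * points (S - {a, bar n a})"
    using assms halfD[OF assms(1,2)] half_bar_closed(1)[OF assms(1)] by (intro points_extract) auto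
  also have "points (S - {a, bar n a}) = pt c * points (S - {a, bar n a} - {c, bar n c})"
    using c half_bar_closed(1)[OF assms(1)] by (intro points_extract) auto
  also have "S - {a, bar n a} - {c, bar n c} = S - {a, bar n a, c, bar n c}" by auto
  finally show ?thesis .
qed

lemma pt_arcs_comm:
  assumes "half S t" "a \<in> {1..2 * n}" "a \<notin> S"
  shows "arcs S t * pt a = pt a * arcs S t"
  using cup_arcs_comm[OF assms(1,2), of "bar n a"] assms half_in[OF assms(1,2)] by simp

lemma inside_same:
  assumes h: "half S t" and a: "a \<in> S"
  shows "cup a (t a) * (arcs S t * z) = arcs S t * z"
proof -
  have "cup a (t a) * cup a (t a) = cup a (t a)" using halfD[OF h a] by (intro cup_idem) auto
  note mult_eq2[OF this]
  then show ?thesis unfolding arcs_extract[OF h a] by (simp only: mult.assoc)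
qed

text \<open>A factor \<open>pt a\<close> taken from \<open>points S\<close> stands to the right of
  the arc, and \<open>pt a * cup a c * pt a = pt a * pt c\<close> splits the arc into two
  self-mirrored strands.\<close>

lemma inside_self:
  assumes h: "half S t" and a: "a \<in> S" and c: "c = t a" "c \<noteq> bar n a"
    and t': "t' = t(a := bar n a, bar n a := a, c := bar n c, bar n c := c)" and h': "half S t'"
  shows "pt a * (arcs S t * points S) = arcs S t' * points S"
proof -
  define S1 where "S1 = S - {a, bar n a, c, bar n c}"
  note D = halfD[OF h a]
  have d: "a \<in> {1..2 * n}" "c \<in> {1..2 * n}" "c \<in> S" using D c by simp_all
  have ne: "c \<noteq> a" "bar n c \<noteq> a" "bar n c \<noteq> bar n a"
    using D c bar_inj[OF d(2,1)] bar_eq_swap[OF d(2,1)] by auto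
  have h1: "half S1 t" and A: "arcs S t = cup a c * arcs S1 t"
    using half_remove[OF h a] arcs_extract[OF h a] c by (simp_all add: S1_def)
  have P: "points S = pt a * (pt c * points S1)"
    unfolding S1_def by (rule half_points_extract[OF h a c])
  have "arcs S t' = pt a * arcs (S - {a, bar n a}) t'" "half (S - {a, bar n a}) t'"
    using arcs_extract_pt[OF h' a] ne t' c by auto
  moreover have "arcs (S - {a, bar n a}) t' = pt c * arcs (S - {a, bar n a} - {c, bar n c}) t'"
    using arcs_extract_pt(1)[OF \<open>half (S - {a, bar n a}) t'\<close>, of c] ne t' c d by auto
  moreover have "S - {a, bar n a} - {c, bar n c} = S1" by (auto simp: S1_def)
  moreover have "arcs S1 t' = arcs S1 t"
    by (rule arcs_cong[OF h1, symmetric]) (auto simp: t' S1_def)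
  ultimately have A': "arcs S t' = pt a * (pt c * arcs S1 t)" by simp
  have comm: "arcs S1 t * pt a = pt a * arcs S1 t" "arcs S1 t * pt c = pt c * arcs S1 t"
    using pt_arcs_comm[OF h1 d(1)] pt_arcs_comm[OF h1 d(2)] by (auto simp: S1_def)
  have rel: "pt a * cup a c * pt a = pt a * pt c" "pt c * pt a = pt a * pt c" "pt a * pt a = pt a" "pt c * pt c = pt c"
    using pt_relations(1,3)[of a c] d ne c cup_idem by auto
  show ?thesis unfolding A A' P
    by (simp add: mult.assoc comm[THEN mult_eq2] rel(1)[THEN mult_eq3] rel(2-)[THEN mult_eq2])
qed

text \<open>By \<open>cup_cup_bar\<close> the old arc becomes the reflection exchanging
  \<open>a\<close> with its mirror image, and \<open>pt a\<close> from \<open>points S\<close>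
  absorbs it.\<close>

lemma inside_crossed:
  assumes h: "half S t" and ab: "a \<in> S" "b \<in> S" "a \<noteq> b" "b \<noteq> bar n a" and ta: "t a = bar n b"
    and t': "t' = t(a := b, b := a, bar n a := bar n b, bar n b := bar n a)" and h': "half S t'"
  shows "cup a b * (arcs S t * points S) = arcs S t' * points S"
proof -
  define S1 where "S1 = S - {a, bar n a, b, bar n b}"
  have d: "a \<in> {1..2 * n}" "b \<in> {1..2 * n}" using halfD(1)[OF h] ab by auto
  have S1: "S - {a, bar n a, bar n b, bar n (bar n b)} = S1" using d by (auto simp: S1_def)
  have h1: "half S1 t" and A: "arcs S t = cup a (bar n b) * arcs S1 t"
    using half_remove[OF h ab(1)] arcs_extract[OF h ab(1)] unfolding ta S1 by simp_all
  have nb: "bar n b \<noteq> bar n a" "a \<noteq> bar n b" using ab bar_inj[OF d] bar_eq_swap[OF d] by auto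
  have t'a: "t' a = b" using t' nb ab by auto
  have A': "arcs S t' = cup a b * arcs S1 t"
    using arcs_extract[OF h' ab(1)] arcs_cong[OF h1, of t'] t'a by (auto simp: S1_def t')
  have P: "points S = pt a * (pt b * points S1)"
    using half_points_extract[OF h' ab(1)] t'a ab by (simp add: S1_def)
  have comm: "arcs S1 t * pt a = pt a * arcs S1 t" "arcs S1 t * pt b = pt b * arcs S1 t"
    using pt_arcs_comm[OF h1 d(1)] pt_arcs_comm[OF h1 d(2)] by (auto simp: S1_def)
  have 1: "cup a b * cup a (bar n b) = cup a b * tr a (bar n a)"
    using cup_cup_bar d ab by simp
  have "tr a (bar n a) * (pt a * pt (bar n a)) = pt a * pt (bar n a)"
    using tr_pt_left[of a "bar n a"] d by auto
  then have 2: "tr a (bar n a) * pt a = pt a"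
    using d pt_bar[OF d(1)] cup_idem[of a "bar n a"] by auto
  show ?thesis unfolding A A' P
    by (simp add: mult.assoc comm[THEN mult_eq2] 1[THEN mult_eq2] 2[THEN mult_eq2])
qed

text \<open>The two self-mirrored strands of the old matching move to the right and merge with the
  same factors of \<open>points S\<close>.\<close>

lemma inside_selves:
  assumes h: "half S t" and ab: "a \<in> S" "b \<in> S" "a \<noteq> b" "b \<noteq> bar n a" and ta: "t a = bar n a" "t b = bar n b"
    and t': "t' = t(a := b, b := a, bar n a := bar n b, bar n b := bar n a)" and h': "half S t'"
  shows "cup a b * (arcs S t * points S) = arcs S t' * points S"
proof -
  define S1 where "S1 = S - {a, bar n a, b, bar n b}"
  have d: "a \<in> {1..2 * n}" "b \<in> {1..2 * n}" using halfD(1)[OF h] ab by auto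
  have nb: "bar n b \<noteq> bar n a" "a \<noteq> bar n b" using ab bar_inj[OF d] bar_eq_swap[OF d] by auto
  have "arcs S t = pt a * arcs (S - {a, bar n a}) t" "half (S - {a, bar n a}) t"
    using arcs_extract_pt[OF h ab(1) ta(1)] by simp_all
  moreover have "arcs (S - {a, bar n a}) t = pt b * arcs (S - {a, bar n a} - {b, bar n b}) t"
    "half (S - {a, bar n a} - {b, bar n b}) t"
    using arcs_extract_pt[OF \<open>half (S - {a, bar n a}) t\<close> _ ta(2)] ab by auto
  moreover have "S - {a, bar n a} - {b, bar n b} = S1" by (auto simp: S1_def)
  ultimately have h1: "half S1 t" and A: "arcs S t = pt a * (pt b * arcs S1 t)" by simp_all
  have t'a: "t' a = b" using t' nb ab by auto
  have A': "arcs S t' = cup a b * arcs S1 t"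
    using arcs_extract[OF h' ab(1)] arcs_cong[OF h1, of t'] t'a by (auto simp: S1_def t')
  have P: "points S = pt a * (pt b * points S1)"
    using half_points_extract[OF h' ab(1)] t'a ab by (simp add: S1_def)
  have comm: "arcs S1 t * pt a = pt a * arcs S1 t" "arcs S1 t * pt b = pt b * arcs S1 t"
    using pt_arcs_comm[OF h1 d(1)] pt_arcs_comm[OF h1 d(2)] by (auto simp: S1_def)
  have rel: "pt b * pt a = pt a * pt b" "pt a * pt a = pt a" "pt b * pt b = pt b"
    using pt_comm d cup_idem by auto
  have rel': "pt b * (pt a * z) = pt a * (pt b * z)" "pt a * (pt a * z) = pt a * z" "pt b * (pt b * z) = pt b * z" for z
    by (simp_all add: rel flip: mult.assoc)
  show ?thesis unfolding A A' P
    by (simp add: mult.assoc comm[THEN mult_eq2] rel')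
qed

text \<open>By \<open>cup_cup_shared\<close> the old arc from \<open>b\<close> to \<open>d\<close>
  turns into two reflections, which the factors of \<open>points S\<close> at \<open>a\<close>,
  \<open>b\<close> and \<open>d\<close> absorb. The strand at \<open>d\<close> in the new matching
  is a copy of a factor of \<open>points S\<close>.\<close>

lemma inside_left:
  assumes h: "half S t" and ab: "a \<in> S" "b \<in> S" "a \<noteq> b" "b \<noteq> bar n a"
    and ta: "t a = bar n a" and d: "d = t b" "d \<notin> {a, bar n a, b, bar n b}"
    and t': "t' = t(a := b, b := a, bar n a := bar n b, bar n b := bar n a, d := bar n d, bar n d := d)"
    and h': "half S t'"
  shows "cup a b * (arcs S t * points S) = arcs S t' * points S"
proof -
  define S1 where "S1 = S - {a, bar n a, b, bar n b, d, bar n d}"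
  have dS: "d \<in> S" "bar n d \<in> S" using halfD[OF h ab(2)] d by auto
  have dd: "a \<in> {1..2 * n}" "b \<in> {1..2 * n}" "d \<in> {1..2 * n}" using halfD(1)[OF h] ab dS by auto
  have nb: "bar n b \<noteq> bar n a" "a \<noteq> bar n b" "bar n d \<noteq> bar n a" "bar n d \<noteq> bar n b" "bar n d \<noteq> a" "bar n d \<noteq> b"
    using ab d(2) bar_inj[OF dd(1,2)] bar_eq_swap[OF dd(1,2)] bar_inj[OF dd(3,1)] bar_inj[OF dd(3,2)]
      bar_eq_swap[OF dd(3,1)] bar_eq_swap[OF dd(3,2)] by auto
  have t'v: "t' a = b" "t' d = bar n d" using t' nb ab d by auto
  have "arcs S t = pt a * arcs (S - {a, bar n a}) t" "half (S - {a, bar n a}) t"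
    using arcs_extract_pt[OF h ab(1) ta(1)] by simp_all
  moreover have "arcs (S - {a, bar n a}) t = cup b d * arcs (S - {a, bar n a} - {b, bar n b, d, bar n d}) t"
    "half (S - {a, bar n a} - {b, bar n b, d, bar n d}) t"
    using arcs_extract[OF \<open>half (S - {a, bar n a}) t\<close>, of b] half_remove[OF \<open>half (S - {a, bar n a}) t\<close>, of b] ab d
    by auto
  moreover have "S - {a, bar n a} - {b, bar n b, d, bar n d} = S1" by (auto simp: S1_def)
  ultimately have h1: "half S1 t" and A: "arcs S t = pt a * (cup b d * arcs S1 t)" by simp_all
  have "arcs S t' = cup a b * arcs (S - {a, bar n a, b, bar n b}) t'" "half (S - {a, bar n a, b, bar n b}) t'"
    using arcs_extract[OF h' ab(1)] half_remove[OF h' ab(1)] t'v by simp_all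
  moreover have "arcs (S - {a, bar n a, b, bar n b}) t' = pt d * arcs (S - {a, bar n a, b, bar n b} - {d, bar n d}) t'"
    using arcs_extract_pt(1)[OF \<open>half (S - {a, bar n a, b, bar n b}) t'\<close> _ t'v(2)] dS d by auto
  moreover have "S - {a, bar n a, b, bar n b} - {d, bar n d} = S1" by (auto simp: S1_def)
  moreover have "arcs S1 t' = arcs S1 t"
    by (rule arcs_cong[OF h1, symmetric]) (auto simp: t' S1_def)
  ultimately have A': "arcs S t' = cup a b * (pt d * arcs S1 t)" by simp
  have "points S = pt b * (pt d * points (S - {b, bar n b, d, bar n d}))"
    using half_points_extract[OF h ab(2) d(1)] d by simp
  moreover have "points (S - {b, bar n b, d, bar n d}) = pt a * points (S - {b, bar n b, d, bar n d} - {a, bar n a})"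
  proof (rule points_extract)
    show "S - {b, bar n b, d, bar n d} \<subseteq> {1..2 * n}" using half_bar_closed(1)[OF h] by blast
    show "a \<in> S - {b, bar n b, d, bar n d}" "bar n a \<in> S - {b, bar n b, d, bar n d}"
      using ab half_bar_closed(2)[OF h ab(1)] nb d(2) by auto
  qed
  moreover have "S - {b, bar n b, d, bar n d} - {a, bar n a} = S1" by (auto simp: S1_def)
  ultimately have P0: "points S = pt b * (pt d * (pt a * points S1))" by simp
  have rel: "pt b * (pt a * z) = pt a * (pt b * z)" "pt d * (pt a * z) = pt a * (pt d * z)" "pt d * (pt b * z) = pt b * (pt d * z)"
    "pt a * (pt a * z) = pt a * z" "pt b * (pt b * z) = pt b * z" "pt d * (pt d * z) = pt d * z" for z
    using pt_comm[OF dd(2,1)] pt_comm[OF dd(3,1)] pt_comm[OF dd(3,2)] cup_idem[OF dd(1) bar_in[OF dd(1)]]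
      cup_idem[OF dd(2) bar_in[OF dd(2)]] cup_idem[OF dd(3) bar_in[OF dd(3)]] by (simp_all flip: mult.assoc)
  have P: "points S = pt a * (pt b * (pt d * points S1))" unfolding P0 by (simp only: rel)
  have comm: "arcs S1 t * (pt a * z) = pt a * (arcs S1 t * z)" "arcs S1 t * (pt b * z) = pt b * (arcs S1 t * z)"
    "arcs S1 t * (pt d * z) = pt d * (arcs S1 t * z)" for z
    using dd pt_arcs_comm[OF h1 dd(1)] pt_arcs_comm[OF h1 dd(2)] pt_arcs_comm[OF h1 dd(3)]
    by (simp_all add: S1_def flip: mult.assoc)
  have bd: "b \<noteq> d" using d by auto
  have "cup b d * pt a = pt a * cup b d"
    using d ab nb by (intro cup_disjoint_comm dd bd bar_in) auto
  then have ac: "cup b d * (pt a * z) = pt a * (cup b d * z)" for z by (simp flip: mult.assoc)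
  have "indep n [a, b, d]" using ab d dd nb by (auto simp: indep_Cons)
  then have sh: "cup a b * (cup b d * z) = cup a b * (tr b d * (tr a b * z))" for z
    using mult_eq2[OF cup_cup_shared, of a b d z] by (simp only: mult.assoc)
  have tab: "tr a b * (pt a * (pt b * z)) = pt a * (pt b * z)" for z
    using tr_pt_left[OF dd(1,2) ab(3)] by (simp flip: mult.assoc)
  have tbd: "tr b d * (pt b * (pt d * z)) = pt b * (pt d * z)" for z
    using tr_pt_left[OF dd(2,3) bd] by (simp flip: mult.assoc)
  let ?Z = "arcs S1 t * points S1"
  have "cup a b * (arcs S t * points S) = cup a b * (cup b d * (pt a * (pt b * (pt d * ?Z))))"
    unfolding A P by (simp only: mult.assoc comm rel ac)
  also have "\<dots> = cup a b * (tr b d * (pt b * (pt d * (pt a * ?Z))))"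
    by (simp only: sh tab) (simp only: rel)
  also have "\<dots> = arcs S t' * points S"
    unfolding A' P by (subst tbd) (simp only: mult.assoc comm rel)
  finally show ?thesis .
qed

text \<open>The arc \<open>cup a c\<close> turns into two reflections. On their way to
  \<open>points S\<close> they carry the other arc \<open>cup b d\<close> to \<open>cup c d\<close>;
  once there they are absorbed.\<close>

lemma inside_arcs:
  assumes h: "half S t" and ab: "a \<in> S" "b \<in> S" "a \<noteq> b" "b \<noteq> bar n a"
    and c: "c = t a" "c \<notin> {a, bar n a, b, bar n b}" and d: "d = t b" "d \<notin> {a, bar n a, b, bar n b}"
    and cd: "c \<noteq> d" "c \<noteq> bar n d"
    and t': "t' = t(a := b, b := a, bar n a := bar n b, bar n b := bar n a, c := d, d := c, bar n c := bar n d, bar n d := bar n c)"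
    and h': "half S t'"
  shows "cup a b * (arcs S t * points S) = arcs S t' * points S"
proof -
  define S1 where "S1 = S - {a, bar n a, b, bar n b, c, bar n c, d, bar n d}"
  have S: "c \<in> S" "d \<in> S" using halfD[OF h ab(2)] halfD[OF h ab(1)] c d by auto
  then have bS: "bar n a \<in> S" "bar n b \<in> S" "bar n c \<in> S" "bar n d \<in> S" using half_bar_closed[OF h] ab by auto
  have D: "a \<in> {1..2 * n}" "b \<in> {1..2 * n}" "c \<in> {1..2 * n}" "d \<in> {1..2 * n}" using halfD(1)[OF h] ab S by auto
  have nb: "bar n b \<noteq> bar n a" "a \<noteq> bar n b" "bar n d \<noteq> bar n a" "bar n d \<noteq> bar n b" "bar n d \<noteq> a" "bar n d \<noteq> b"
    "bar n c \<noteq> bar n a" "bar n c \<noteq> bar n b" "bar n c \<noteq> a" "bar n c \<noteq> b" "bar n c \<noteq> bar n d" "bar n c \<noteq> d" "d \<noteq> bar n c"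
    using ab c(2) d(2) cd bar_inj[OF D(1,2)] bar_eq_swap[OF D(1,2)] bar_inj[OF D(4,1)] bar_inj[OF D(4,2)]
      bar_eq_swap[OF D(4,1)] bar_eq_swap[OF D(4,2)] bar_inj[OF D(3,1)] bar_inj[OF D(3,2)]
      bar_eq_swap[OF D(3,1)] bar_eq_swap[OF D(3,2)] bar_inj[OF D(3,4)] bar_eq_swap[OF D(3,4)] by auto
  have t'v: "t' a = b" "t' c = d" using t' nb ab c d cd by auto
  have "arcs S t = cup a c * arcs (S - {a, bar n a, c, bar n c}) t" "half (S - {a, bar n a, c, bar n c}) t"
    using arcs_extract[OF h ab(1)] half_remove[OF h ab(1)] c by simp_all
  moreover have "arcs (S - {a, bar n a, c, bar n c}) t = cup b d * arcs (S - {a, bar n a, c, bar n c} - {b, bar n b, d, bar n d}) t"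
    "half (S - {a, bar n a, c, bar n c} - {b, bar n b, d, bar n d}) t"
    using arcs_extract[OF \<open>half (S - {a, bar n a, c, bar n c}) t\<close>, of b]
      half_remove[OF \<open>half (S - {a, bar n a, c, bar n c}) t\<close>, of b] ab c d nb by auto
  moreover have "S - {a, bar n a, c, bar n c} - {b, bar n b, d, bar n d} = S1" by (auto simp: S1_def)
  ultimately have h1: "half S1 t" and A: "arcs S t = cup a c * (cup b d * arcs S1 t)" by simp_all
  have "arcs S t' = cup a b * arcs (S - {a, bar n a, b, bar n b}) t'" "half (S - {a, bar n a, b, bar n b}) t'"
    using arcs_extract[OF h' ab(1)] half_remove[OF h' ab(1)] t'v by simp_all
  moreover have "arcs (S - {a, bar n a, b, bar n b}) t' = cup c d * arcs (S - {a, bar n a, b, bar n b} - {c, bar n c, d, bar n d}) t'"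
    using arcs_extract[OF \<open>half (S - {a, bar n a, b, bar n b}) t'\<close>, of c] t'v S c by auto
  moreover have "S - {a, bar n a, b, bar n b} - {c, bar n c, d, bar n d} = S1" by (auto simp: S1_def)
  moreover have "arcs S1 t' = arcs S1 t"
    by (rule arcs_cong[OF h1, symmetric]) (auto simp: t' S1_def)
  ultimately have A': "arcs S t' = cup a b * (cup c d * arcs S1 t)" by simp
  have "points S = pt a * (pt c * points (S - {a, bar n a, c, bar n c}))"
    using half_points_extract[OF h ab(1) c(1)] c by simp
  moreover have "points (S - {a, bar n a, c, bar n c}) = pt b * points (S - {a, bar n a, c, bar n c} - {b, bar n b})"
  proof (rule points_extract)
    show "S - {a, bar n a, c, bar n c} \<subseteq> {1..2 * n}" using half_bar_closed(1)[OF h] by blast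
    show "b \<in> S - {a, bar n a, c, bar n c}" "bar n b \<in> S - {a, bar n a, c, bar n c}"
      using ab bS nb c(2) by auto
  qed
  moreover have "S - {a, bar n a, c, bar n c} - {b, bar n b} = S1 \<union> {d, bar n d}"
    using S(2) bS(4) d(2) nb(3-6,11-13) cd unfolding S1_def by auto
  ultimately have P0: "points S = pt a * (pt c * (pt b * points (S1 \<union> {d, bar n d})))" by simp
  have rel: "pt b * (pt a * z) = pt a * (pt b * z)" "pt c * (pt a * z) = pt a * (pt c * z)" "pt c * (pt b * z) = pt b * (pt c * z)" for z
    using pt_comm[OF D(2,1)] pt_comm[OF D(3,1)] pt_comm[OF D(3,2)] by (simp_all flip: mult.assoc)
  let ?P = "points (S1 \<union> {d, bar n d})"
  have P: "points S = pt a * (pt b * (pt c * ?P))" unfolding P0 by (simp only: rel)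
  have comm: "arcs S1 t * (pt a * z) = pt a * (arcs S1 t * z)" "arcs S1 t * (pt b * z) = pt b * (arcs S1 t * z)"
    "arcs S1 t * (pt c * z) = pt c * (arcs S1 t * z)" for z
    using D pt_arcs_comm[OF h1 D(1)] pt_arcs_comm[OF h1 D(2)] pt_arcs_comm[OF h1 D(3)]
    by (simp_all add: S1_def flip: mult.assoc)
  have "indep n [b, a, c]" using ab c D nb by (auto simp: indep_Cons)
  then have "cup b a * (cup a c * z) = cup b a * (tr a c * (tr b a * z))" for z
    using mult_eq2[OF cup_cup_shared, of b a c z] by (simp only: mult.assoc)
  then have sh: "cup a b * (cup a c * z) = cup a b * (tr a c * (tr b a * z))" for z
    using cup_sym[OF D(1,2) ab(3)] by simp
  have tab: "tr b a * (pt a * (pt b * z)) = pt a * (pt b * z)" for z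
    using tr_pt_left[OF D(2,1) ab(3)[symmetric]] pt_comm[OF D(2,1)] by (simp flip: mult.assoc)
  have ne: "a \<noteq> c" "b \<noteq> d" "a \<noteq> d" using c d by auto
  have tac: "tr a c * (pt a * (pt c * z)) = pt a * (pt c * z)" for z
    using tr_pt_left[OF D(1,3) ne(1)] by (simp flip: mult.assoc)
  have "tr b a * cup b d = cup a d * tr b a"
    using tr_push[OF D(2,1) ab(3)[symmetric] D(2,4) ne(2)] d nb by (simp add: refl_perm_left refl_perm_fixed)
  then have p1: "tr b a * (cup b d * z) = cup a d * (tr b a * z)" for z by (simp flip: mult.assoc)
  have "tr a c * cup a d = cup c d * tr a c"
    using tr_push[OF D(1,3) ne(1) D(1,4) ne(3)] d cd nb by (simp add: refl_perm_left refl_perm_fixed)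
  then have p2: "tr a c * (cup a d * z) = cup c d * (tr a c * z)" for z by (simp flip: mult.assoc)
  let ?Z = "arcs S1 t * ?P"
  have "cup a b * (arcs S t * points S) = cup a b * (cup a c * (cup b d * (pt a * (pt b * (pt c * ?Z)))))"
    unfolding A P by (simp only: mult.assoc comm)
  also have "\<dots> = cup a b * (cup c d * (tr a c * (pt a * (pt b * (pt c * ?Z)))))"
    by (simp only: sh p1 p2 tab)
  also have "pt a * (pt b * (pt c * ?Z)) = pt a * (pt c * (pt b * ?Z))" by (simp only: rel)
  also have "cup a b * (cup c d * (tr a c * (pt a * (pt c * (pt b * ?Z))))) = arcs S t' * points S"
    unfolding A' P by (subst tac) (simp only: mult.assoc comm rel)
  finally show ?thesis .
qed

lemma half_sym_join:
  "half S t \<Longrightarrow> a \<in> S \<Longrightarrow> b \<in> S \<Longrightarrow> a \<noteq> b \<Longrightarrow> half S (sym_join (bar n) a b t)"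
  unfolding half_def using sym_match_sym_join[of S "bar n" t a b] by auto

theorem cup_half_inside:
  assumes h: "half S t" and ab: "a \<in> S" "b \<in> S" "a \<noteq> b"
  shows "cup a b * (arcs S t * points S) = arcs S (sym_join (bar n) a b t) * points S"
proof -
  have m: "sym_match S (bar n) t" using h by (simp add: half_def)
  note h' = half_sym_join[OF h ab]
  have D: "a \<in> {1..2 * n}" "b \<in> {1..2 * n}" using halfD(1)[OF h] ab by auto
  from m ab show ?thesis
  proof (cases rule: sym_join_cases)
    case same
    then show ?thesis using inside_same[OF h ab(1)] by simp
  next
    case self
    then show ?thesis using inside_self[OF h ab(1) refl _ self(3) h'] by auto
  next
    case crossed
    show ?thesis using inside_crossed[OF h ab crossed(1,2,3) h'] .
  next
    case selves
    show ?thesis using inside_selves[OF h ab selves(1,2,3,4) h'] .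
  next
    case left
    show ?thesis using inside_left[OF h ab left(1,2) refl _ left(4) h'] left(3) by blast
  next
    \<comment> \<open>This is \<open>left\<close> with the roles of \<open>a\<close> and
      \<open>b\<close> exchanged.\<close>
    case right
    have c: "sym_join (bar n) a b t = sym_join (bar n) b a t" using sym_join_commute[OF m ab] .
    have ba: "a \<noteq> bar n b" using right(1) bar_eq_swap[OF D] by auto
    have "cup b a * (arcs S t * points S) = arcs S (sym_join (bar n) a b t) * points S"
    proof (rule inside_left[OF h ab(2,1) ab(3)[symmetric] ba right(2) refl _ _ h'])
      show "t a \<notin> {b, bar n b, a, bar n a}" using right(3) by blast
      show "sym_join (bar n) a b t = t(b := a, a := b, bar n b := bar n a, bar n a := bar n b, t a := bar n (t a), bar n (t a) := t a)"
        unfolding right(4) using ab(3) bar_inj[OF D] ba right(1) by (auto simp: fun_eq_iff)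
    qed
    then show ?thesis using cup_sym[OF D ab(3)] by simp
  next
    case arcs
    show ?thesis using inside_arcs[OF h ab arcs(1) refl _ refl _ arcs(4,5,6) h'] arcs(2,3) by blast
  qed
qed

end

section \<open>The normal form of a diagram\<close>

definition dots_of :: "nat \<Rightarrow> dot set" where
  "dots_of n = {1..2 * n} \<times> UNIV"

definition bar_dot :: "nat \<Rightarrow> dot \<Rightarrow> dot" where
  "bar_dot n p = (bar n (fst p), snd p)"

lemma bar_dot_simps [simp]: "bar_dot n (a, s) = (bar n a, s)"
  by (simp add: bar_dot_def)

lemma fpf_bar_dot: "fpf_invol (dots_of n) (bar_dot n)"
  by (auto simp: fpf_invol_def dots_of_def)

text \<open>The matching with horizontal strands \<open>t\<close> on the top dots \<open>S\<close>, \<open>t'\<close> on the bottom dots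
  \<open>S'\<close>, and vertical strands joining each remaining bottom dot \<open>b\<close> to the top dot \<open>g b\<close>.\<close>
definition glue :: "nat set \<Rightarrow> (nat \<Rightarrow> nat) \<Rightarrow> (nat \<Rightarrow> nat) \<Rightarrow> nat set \<Rightarrow> (nat \<Rightarrow> nat) \<Rightarrow> dot \<Rightarrow> dot" where
  "glue S t g S' t' p = (if snd p
     then (if fst p \<in> S then (t (fst p), True) else (inv g (fst p), False))
     else (if fst p \<in> S' then (t' (fst p), False) else (g (fst p), True)))"

lemma glue_simps [simp]:
  "glue S t g S' t' (a, True) = (if a \<in> S then (t a, True) else (inv g a, False))"
  "glue S t g S' t' (a, False) = (if a \<in> S' then (t' a, False) else (g a, True))"
  by (simp_all add: glue_def)

lemma join_cong:
  assumes "p \<in> V" "q \<in> V" "\<And>x. x \<in> V \<Longrightarrow> t x = u x" "x \<in> V"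
  shows "join p q t x = join p q u x"
  using assms by (simp add: join_def)

lemma sym_join_cong:
  assumes m: "sym_match V \<rho> t" and pq: "p \<in> V" "q \<in> V" and eq: "\<And>x. x \<in> V \<Longrightarrow> t x = u x" and x: "x \<in> V"
  shows "sym_join \<rho> p q t x = sym_join \<rho> p q u x"
proof -
  have V: "\<rho> p \<in> V" "\<rho> q \<in> V" using m pq by (auto simp: sym_match_def fpf_invol_def)
  have j: "join p q t y = join p q u y" if "y \<in> V" for y
    by (rule join_cong[OF pq _ that]) (rule eq)
  have "join (\<rho> p) (\<rho> q) (join p q t) x = join (\<rho> p) (\<rho> q) (join p q u) x"
    by (rule join_cong[OF V _ x]) (rule j)
  then show ?thesis using j[OF x] unfolding sym_join_def by auto
qed

context brauerC_monoid
begin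

text \<open>The self-mirrored factors stand at the top only. In all uses \<open>g\<close> maps
  \<open>S'\<close> onto \<open>S\<close>, so those of the bottom row, pulled up through
  \<open>rep g\<close>, would merge with the ones present.\<close>

definition NF :: "nat set \<Rightarrow> (nat \<Rightarrow> nat) \<Rightarrow> (nat \<Rightarrow> nat) \<Rightarrow> nat set \<Rightarrow> (nat \<Rightarrow> nat) \<Rightarrow> 'a" where
  "NF S t g S' t' = arcs S t * (points S * (rep g * arcs S' t'))"

definition add_arc :: "nat \<Rightarrow> nat \<Rightarrow> (nat \<Rightarrow> nat) \<Rightarrow> nat \<Rightarrow> nat" where
  "add_arc a b t = t(a := b, b := a, bar n a := bar n b, bar n b := bar n a)"

definition orbits :: "nat \<Rightarrow> nat \<Rightarrow> nat set" where
  "orbits a b = {a, b, bar n a, bar n b}"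

lemma half_add_arc:
  assumes "half S t" "a \<in> {1..2 * n}" "b \<in> {1..2 * n}" "a \<noteq> b" "a \<notin> S" "b \<notin> S"
  shows "half (orbits a b \<union> S) (add_arc a b t)"
  using half_add[OF assms] by (simp add: orbits_def add_arc_def insert_commute)

lemma arcs_add:
  assumes h: "half S t" and ab: "a \<in> {1..2 * n}" "b \<in> {1..2 * n}" "a \<noteq> b" "a \<notin> S" "b \<notin> S"
  shows "arcs (orbits a b \<union> S) (add_arc a b t) = cup a b * arcs S t"
proof -
  note h2 = half_add_arc[OF h ab]
  have nS: "bar n a \<notin> S" "bar n b \<notin> S" using half_in[OF h] ab by auto
  have ta: "add_arc a b t a = b" using bar_inj[OF ab(1,2)] ab(3) bar_eq_swap[OF ab(1,2)] by (auto simp: add_arc_def)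
  have "arcs (orbits a b \<union> S) (add_arc a b t) = cup a b * arcs (orbits a b \<union> S - {a, bar n a, b, bar n b}) (add_arc a b t)"
    using arcs_extract[OF h2, of a] ta by (simp add: orbits_def)
  also have "orbits a b \<union> S - {a, bar n a, b, bar n b} = S" using ab nS by (auto simp: orbits_def)
  also have "arcs S (add_arc a b t) = arcs S t"
    by (rule arcs_cong[OF h, symmetric]) (use ab nS in \<open>auto simp: add_arc_def\<close>)
  finally show ?thesis .
qed

lemma points_add:
  assumes S: "S \<subseteq> {1..2 * n}" "\<And>x. x \<in> S \<Longrightarrow> bar n x \<in> S" and ab: "a \<in> {1..2 * n}" "b \<in> {1..2 * n}"
  shows "points (orbits a b \<union> S) = pt a * (pt b * points S)"
proof -
  have O: "orbits a b \<union> S \<subseteq> {1..2 * n}" using ab S by (auto simp: orbits_def)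
  have ci: "comm_idem pt T" if "T \<subseteq> orbits a b \<union> S" for T
    using comm_idem_points that O by (meson subset_trans)
  have pb: "pt (bar n a) = pt a" "pt (bar n b) = pt b" using pt_bar ab by simp_all
  have "orbits a b \<union> S = insert a (insert (bar n a) (insert b (insert (bar n b) S)))"
    by (auto simp: orbits_def)
  then have "points (orbits a b \<union> S) = cprod pt (insert a (insert (bar n a) (insert b (insert (bar n b) S))))"
    by (simp add: points_def)
  also have "\<dots> = pt a * (pt (bar n a) * (pt b * (pt (bar n b) * cprod pt S)))"
    apply (subst cprod_insert, rule ci, unfold orbits_def, blast)+
    apply (rule refl)
    done
  also have "\<dots> = pt a * (pt b * points S)"
    using cup_idem[OF ab(1) bar_in[OF ab(1)]] cup_idem[OF ab(2) bar_in[OF ab(2)]]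
    by (simp add: pb points_def mult_eq2)
  finally show ?thesis .
qed

lemma orbits_image:
  assumes "signed_perm n g" "a \<in> {1..2 * n}" "b \<in> {1..2 * n}"
  shows "g ` orbits a b = orbits (g a) (g b)"
  using assms by (simp add: orbits_def signed_perm_bar)

lemma cup_absorb_pts:
  assumes ab: "a \<in> {1..2 * n}" "b \<in> {1..2 * n}" "a \<noteq> b"
  shows "cup a b * (pt a * (pt b * (cup a b * z))) = cup a b * z"
proof -
  have i: "pt a * (pt a * z) = pt a * z" "pt b * (pt b * z) = pt b * z" for z
    using cup_idem[OF ab(1) bar_in[OF ab(1)]] cup_idem[OF ab(2) bar_in[OF ab(2)]] by (simp_all flip: mult.assoc)
  show ?thesis
  proof (cases "b = bar n a")
    case True
    then have "pt b = pt a" using pt_bar[OF ab(1)] bar_bar[OF ab(1)] by simp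
    then show ?thesis using True by (simp add: i)
  next
    case False
    note R = pt_relations[OF ab False]
    have "cup a b * pt a * pt b = cup a b * pt b"
      using R(4) i(2)[of 1] by (simp add: mult.assoc)
    then have "cup a b * pt a * pt b * cup a b = cup a b" using R(4,5) by simp
    then show ?thesis by (simp flip: mult.assoc)
  qed
qed

lemma rep_cup:
  assumes "signed_perm n g" "a \<in> {1..2 * n}" "b \<in> {1..2 * n}" "a \<noteq> b"
  shows "rep g * (cup a b * z) = cup (g a) (g b) * (rep g * z)"
  using conj_cup[OF assms] conj_eq_iff[OF assms(1)] by (simp flip: mult.assoc)

text \<open>Joining two vertical strands creates an arc in each row. The bottom one, pulled up
  through \<open>rep g\<close>, is a second copy of \<open>cup a b\<close> behind the new factors
  \<open>pt a * pt b\<close>, and \<open>cup_absorb_pts\<close> removes these surplus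
  factors.\<close>

lemma NF_outer:
  assumes h: "half S t" "half S' t'" and g: "signed_perm n g" "g ` S' = S"
    and ab: "a \<in> {1..2 * n}" "b \<in> {1..2 * n}" "a \<noteq> b" "a \<notin> S" "b \<notin> S"
    and ab': "a = g a'" "b = g b'"
  shows "cup a b * NF S t g S' t' =
    NF (orbits a b \<union> S) (add_arc a b t) g (orbits a' b' \<union> S') (add_arc a' b' t')"
proof -
  have D: "a' \<in> {1..2 * n}" "b' \<in> {1..2 * n}" "a' \<noteq> b'" "a' \<notin> S'" "b' \<notin> S'"
    using ab ab' signed_perm_in[OF g(1)] g(2) by auto
  have S: "S \<subseteq> {1..2 * n}" "\<And>x. x \<in> S \<Longrightarrow> bar n x \<in> S" using half_bar_closed[OF h(1)] by auto
  have c1: "arcs S t * (cup a b * z) = cup a b * (arcs S t * z)" for z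
    using cup_arcs_comm[OF h(1) ab] by (simp flip: mult.assoc)
  have c2: "points S * (cup a b * z) = cup a b * (points S * z)" for z
    using cup_points_comm[OF S ab] by (simp flip: mult.assoc)
  have c3: "arcs S t * (pt a * z) = pt a * (arcs S t * z)" "arcs S t * (pt b * z) = pt b * (arcs S t * z)" for z
    using pt_arcs_comm[OF h(1) ab(1,4)] pt_arcs_comm[OF h(1) ab(2,5)] by (simp_all flip: mult.assoc)
  have PA: "points (orbits a b \<union> S) = pt a * (pt b * points S)"
    by (rule points_add) (use S ab in auto)
  have "NF (orbits a b \<union> S) (add_arc a b t) g (orbits a' b' \<union> S') (add_arc a' b' t') =
      cup a b * (arcs S t * (pt a * (pt b * (points S * (rep g * (cup a' b' * arcs S' t'))))))"
    unfolding NF_def arcs_add[OF h(1) ab] PA arcs_add[OF h(2) D]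
    by (simp only: mult.assoc)
  also have "\<dots> = cup a b * (pt a * (pt b * (cup a b * (arcs S t * (points S * (rep g * arcs S' t'))))))"
    by (simp only: rep_cup[OF g(1) D(1-3)] ab'[symmetric] c1 c2 c3)
  also have "\<dots> = cup a b * NF S t g S' t'" unfolding cup_absorb_pts[OF ab(1-3)] NF_def ..
  finally show ?thesis ..
qed

text \<open>The self-mirrored strand moves from the top row to the bottom: next to
  \<open>cup a b\<close> the factor \<open>pt a\<close> may be replaced by \<open>pt b\<close>, and
  \<open>pt b\<close> passes through \<open>rep g\<close> to become the strand at
  \<open>b'\<close>.\<close>

lemma NF_mixed_self:
  assumes h: "half S t" "half S' t'" and g: "signed_perm n g" "g ` S' = S"
    and ab: "a \<in> S" "b \<in> {1..2 * n}" "b \<notin> S" and ta: "t a = bar n a" and b': "b = g b'"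
  shows "cup a b * NF S t g S' t' =
    NF (orbits a b \<union> (S - {a, bar n a})) (add_arc a b t) g (orbits b' b' \<union> S') (add_arc b' (bar n b') t')"
proof -
  have da: "a \<in> {1..2 * n}" "a \<noteq> b" using halfD(1)[OF h(1) ab(1)] ab by auto
  have D: "b' \<in> {1..2 * n}" "b' \<notin> S'" "bar n b' \<notin> S'" using ab b' signed_perm_in[OF g(1)] g(2) half_in[OF h(2)] by auto
  let ?S = "S - {a, bar n a}"
  have A: "arcs S t = pt a * arcs ?S t" and h1: "half ?S t" using arcs_extract_pt[OF h(1) ab(1) ta] by simp_all
  have S: "S \<subseteq> {1..2 * n}" "\<And>x. x \<in> S \<Longrightarrow> bar n x \<in> S" using half_bar_closed[OF h(1)] by auto
  have nb: "b \<noteq> bar n a" using S(2)[OF ab(1)] ab by auto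
  have "orbits a b \<union> ?S = orbits b b \<union> S" using ab S(2)[OF ab(1)] by (auto simp: orbits_def)
  then have P: "points (orbits a b \<union> ?S) = pt b * points S"
    using points_add[OF S ab(2,2)] cup_idem[OF ab(2) bar_in[OF ab(2)]] by (simp add: mult_eq2)
  have A2: "arcs (orbits a b \<union> ?S) (add_arc a b t) = cup a b * arcs ?S t"
    using arcs_add[OF h1 da(1) ab(2) da(2)] ab by simp
  have "orbits b' b' = orbits b' (bar n b')" using D by (auto simp: orbits_def)
  then have A3: "arcs (orbits b' b' \<union> S') (add_arc b' (bar n b') t') = pt b' * arcs S' t'"
    using arcs_add[OF h(2) D(1) bar_in[OF D(1)] _ D(2,3)] by simp
  have c: "points S * (pt b * z) = pt b * (points S * z)" "arcs ?S t * (pt b * z) = pt b * (arcs ?S t * z)" for z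
    using pt_points_comm[OF S(1) ab(2)] pt_arcs_comm[OF h1 ab(2)] ab by (simp_all flip: mult.assoc)
  have i: "pt b * (pt b * z) = pt b * z" for z
    using cup_idem[OF ab(2) bar_in[OF ab(2)]] by (simp flip: mult.assoc)
  have r: "rep g * (pt b' * z) = pt b * (rep g * z)" for z
    using rep_cup[OF g(1) D(1) bar_in[OF D(1)]] signed_perm_bar[OF g(1) D(1)] b' by simp
  have e: "cup a b * (pt b * z) = cup a b * (pt a * z)" for z
    using pt_relations(4)[OF da(1) ab(2) da(2) nb] by (simp flip: mult.assoc)
  show ?thesis unfolding NF_def A P A2 A3
    by (simp only: mult.assoc r c i e)
qed

text \<open>The vertical strand that ended at \<open>b\<close> is rerouted along the old arc: the
  two reflections send \<open>b\<close> to \<open>a\<close> and then to \<open>c\<close>. They arise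
  from \<open>cup a c\<close> by \<open>cup_cup_shared\<close>.\<close>

lemma NF_mixed_arc:
  assumes h: "half S t" "half S' t'" and g: "signed_perm n g" "g ` S' = S"
    and ab: "a \<in> S" "b \<in> {1..2 * n}" "b \<notin> S" and c: "t a = c" "c \<noteq> bar n a"
  shows "cup a b * NF S t g S' t' =
    NF (orbits a b \<union> (S - {a, bar n a, c, bar n c})) (add_arc a b t)
      (refl_perm n a c \<circ> (refl_perm n b a \<circ> g)) S' t'"
proof -
  have cS: "c \<in> S" "c \<noteq> a" using halfD[OF h(1) ab(1)] c by auto
  have S: "S \<subseteq> {1..2 * n}" "\<And>x. x \<in> S \<Longrightarrow> bar n x \<in> S" using half_bar_closed[OF h(1)] by auto
  have D: "a \<in> {1..2 * n}" "c \<in> {1..2 * n}" using S ab(1) cS by auto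
  have nb: "b \<noteq> a" "b \<noteq> c" "b \<noteq> bar n a" "b \<noteq> bar n c" using ab cS S(2) by auto
  have nb': "bar n b \<noteq> a" "bar n b \<noteq> c" "bar n c \<noteq> a"
    using nb c cS bar_eq_swap[OF ab(2) D(1)] bar_eq_swap[OF ab(2) D(2)] bar_eq_swap[OF D(2,1)] by auto
  let ?S = "S - {a, bar n a, c, bar n c}"
  have A: "arcs S t = cup a c * arcs ?S t" and h1: "half ?S t"
    using arcs_extract[OF h(1) ab(1)] half_remove[OF h(1) ab(1)] c by simp_all
  have P: "points S = pt a * (pt c * points ?S)"
    using half_points_extract[OF h(1) ab(1), of c] c by simp
  have S1: "?S \<subseteq> {1..2 * n}" "\<And>x. x \<in> ?S \<Longrightarrow> bar n x \<in> ?S" using half_bar_closed[OF h1] by auto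
  have P2: "points (orbits a b \<union> ?S) = pt a * (pt b * points ?S)"
    by (rule points_add) (use S1 D ab in auto)
  have A2: "arcs (orbits a b \<union> ?S) (add_arc a b t) = cup a b * arcs ?S t"
    using arcs_add[OF h1 D(1) ab(2) nb(1)[symmetric]] ab by simp
  have s: "signed_perm n (refl_perm n a c)" "signed_perm n (refl_perm n b a)" "signed_perm n (refl_perm n b a \<circ> g)"
    using signed_refl_perm[OF D cS(2)[symmetric]] signed_refl_perm[OF ab(2) D(1) nb(1)] g(1) signed_perm_comp by auto
  have G: "rep (refl_perm n a c \<circ> (refl_perm n b a \<circ> g)) = tr a c * (tr b a * rep g)"
    by (simp only: rep_comp[OF s(1,3)] rep_comp[OF s(2) g(1)] tr_def)
  have "indep n [b, a, c]" using ab D nb nb' c cS by (auto simp: indep_Cons)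
  then have "cup b a * (cup a c * z) = cup b a * (tr a c * (tr b a * z))" for z
    using mult_eq2[OF cup_cup_shared, of b a c z] by (simp only: mult.assoc)
  then have sh: "cup a b * (cup a c * z) = cup a b * (tr a c * (tr b a * z))" for z
    using cup_sym[OF D(1) ab(2) nb(1)[symmetric]] by simp
  have f: "refl_perm n a c x = x" "refl_perm n b a x = x" if "x \<in> ?S" for x
  proof -
    have "bar n b \<notin> S" using half_in[OF h(1) ab(2)] ab by simp
    then show "refl_perm n a c x = x" "refl_perm n b a x = x"
      using that ab by (auto intro!: refl_perm_fixed)
  qed
  have ca: "tr a c * (arcs ?S t * z) = arcs ?S t * (tr a c * z)" "tr b a * (arcs ?S t * z) = arcs ?S t * (tr b a * z)" for z
    using conj_arcs_fixed[OF h1 s(1) f(1)] conj_arcs_fixed[OF h1 s(2) f(2)]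
    by (simp_all add: conj_eq_iff s(1,2) tr_def flip: mult.assoc)
  have cp: "tr a c * (points ?S * z) = points ?S * (tr a c * z)" "tr b a * (points ?S * z) = points ?S * (tr b a * z)" for z
    using conj_points_fixed[OF S1(1) s(1) f(1)] conj_points_fixed[OF S1(1) s(2) f(2)]
    by (simp_all add: conj_eq_iff s(1,2) tr_def flip: mult.assoc)
  have tp: "tr b a * (pt a * z) = pt b * (tr b a * z)" "tr b a * (pt c * z) = pt c * (tr b a * z)"
    "tr a c * (pt b * z) = pt b * (tr a c * z)" "tr a c * (pt c * z) = pt a * (tr a c * z)" for z
    using tr_push[OF ab(2) D(1) nb(1) D(1) bar_in[OF D(1)]] tr_push[OF ab(2) D(1) nb(1) D(2) bar_in[OF D(2)]]
      tr_push[OF D cS(2)[symmetric] ab(2) bar_in[OF ab(2)]] tr_push[OF D cS(2)[symmetric] D(2) bar_in[OF D(2)]]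
      refl_perm_bar[OF ab(2) D(1) nb(1) D(1)] refl_perm_bar[OF ab(2) D(1) nb(1) D(2)]
      refl_perm_bar[OF D cS(2)[symmetric] ab(2)] refl_perm_bar[OF D cS(2)[symmetric] D(2)]
      refl_perm_left[of n b a] refl_perm_right[of n b a] refl_perm_right[of n a c]
      refl_perm_fixed[of c b a n] refl_perm_fixed[of b a c n] nb nb' cS c
    by (simp_all flip: mult.assoc)
  have comm: "pt b * (pt a * z) = pt a * (pt b * z)" for z
    using pt_comm[OF ab(2) D(1)] by (simp flip: mult.assoc)
  let ?X = "rep g * arcs S' t'"
  have "cup a b * NF S t g S' t' = cup a b * (tr a c * (tr b a * (arcs ?S t * (pt a * (pt c * (points ?S * ?X))))))"
    unfolding NF_def A P by (simp only: mult.assoc sh)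
  also have "\<dots> = cup a b * (arcs ?S t * (pt b * (pt a * (points ?S * (tr a c * (tr b a * ?X))))))"
    by (simp only: ca cp tp)
  also have "\<dots> = cup a b * (arcs ?S t * (pt a * (pt b * (points ?S * (tr a c * (tr b a * ?X))))))"
    by (simp only: comm)
  also have "\<dots> = NF (orbits a b \<union> ?S) (add_arc a b t) (refl_perm n a c \<circ> (refl_perm n b a \<circ> g)) S' t'"
    unfolding NF_def A2 P2 G by (simp only: mult.assoc)
  finally show ?thesis .
qed

lemma NF_inside:
  assumes "half S t" "a \<in> S" "b \<in> S" "a \<noteq> b"
  shows "cup a b * NF S t g S' t' = NF S (sym_join (bar n) a b t) g S' t'"
  unfolding NF_def using mult_eq2[OF cup_half_inside[OF assms]] by (simp only: mult.assoc)

end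

section \<open>Signed permutations acting on the top row, and normal forms of matchings\<close>

definition lift_top :: "(nat \<Rightarrow> nat) \<Rightarrow> dot \<Rightarrow> dot" where
  "lift_top g p = (if snd p then (g (fst p), True) else p)"

definition act_top :: "(nat \<Rightarrow> nat) \<Rightarrow> (dot \<Rightarrow> dot) \<Rightarrow> dot \<Rightarrow> dot" where
  "act_top g \<tau> p = lift_top g (\<tau> (lift_top (inv g) p))"

lemma lift_top_simps [simp]: "lift_top g (a, True) = (g a, True)" "lift_top g (a, False) = (a, False)"
  by (simp_all add: lift_top_def)

lemma dots_of_iff [simp]: "(a, s) \<in> dots_of n \<longleftrightarrow> a \<in> {1..2 * n}"
  by (simp add: dots_of_def)

lemma lift_top_in: "signed_perm n g \<Longrightarrow> lift_top g p \<in> dots_of n \<longleftrightarrow> p \<in> dots_of n"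
  using signed_perm_in[of n g "fst p"] by (cases p; cases "snd p") auto

lemma lift_top_inv:
  assumes "signed_perm n g"
  shows "lift_top g (lift_top (inv g) p) = p" "lift_top (inv g) (lift_top g p) = p"
  using signed_perm_inv[OF assms] by (cases p; cases "snd p"; simp)+

lemma lift_top_bar:
  "signed_perm n g \<Longrightarrow> p \<in> dots_of n \<Longrightarrow> lift_top g (bar_dot n p) = bar_dot n (lift_top g p)"
  by (cases p; cases "snd p") (simp_all add: signed_perm_bar del: atLeastAtMost_iff)

lemma sym_match_act_top:
  assumes m: "sym_match (dots_of n) (bar_dot n) \<tau>" and g: "signed_perm n g"
  shows "sym_match (dots_of n) (bar_dot n) (act_top g \<tau>)"
proof -
  note g' = signed_perm_inv(1)[OF g]
  have \<tau>: "\<tau> x \<in> dots_of n" "\<tau> x \<noteq> x" "\<tau> (\<tau> x) = x" "\<tau> (bar_dot n x) = bar_dot n (\<tau> x)" if "x \<in> dots_of n" for x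
    using m that by (auto simp: sym_match_def fpf_invol_def)
  have "act_top g \<tau> x \<in> dots_of n \<and> act_top g \<tau> x \<noteq> x \<and> act_top g \<tau> (act_top g \<tau> x) = x \<and>
     act_top g \<tau> (bar_dot n x) = bar_dot n (act_top g \<tau> x)" if x: "x \<in> dots_of n" for x
  proof -
    define y where "y = lift_top (inv g) x"
    have y: "y \<in> dots_of n" "x = lift_top g y"
      using x lift_top_in[OF g', of x] lift_top_inv(1)[OF g] by (simp_all add: y_def)
    have "act_top g \<tau> (lift_top g w) = lift_top g (\<tau> w)" for w
      by (simp add: act_top_def lift_top_inv[OF g])
    moreover have "lift_top g u = lift_top g w \<Longrightarrow> u = w" for u w
      using lift_top_inv(2)[OF g] by metis
    ultimately show ?thesis
      using \<tau>[OF y(1)] y \<tau>(1) lift_top_in[OF g] lift_top_bar[OF g y(1)] lift_top_bar[OF g \<tau>(1)[OF y(1)]]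
      by metis
  qed
  then show ?thesis using fpf_bar_dot unfolding sym_match_def fpf_invol_def by blast
qed

lemma join_glue:
  assumes t: "fpf_invol S t" and ab: "a \<in> S" "b \<in> S"
  shows "join (a, True) (b, True) (glue S t g S' t') = glue S (join a b t) g S' t'"
proof
  fix p :: dot
  obtain x s where p: "p = (x, s)" by (cases p)
  have "t a \<in> S" "t b \<in> S" using t ab by (auto intro: fpf_invol_in)
  then show "join (a, True) (b, True) (glue S t g S' t') p = glue S (join a b t) g S' t' p"
    using ab unfolding p by (cases s) (auto simp: join_def)
qed

lemma sym_join_glue:
  assumes m: "sym_match S (bar n) t" and ab: "a \<in> S" "b \<in> S" "a \<noteq> b"
  shows "sym_join (bar_dot n) (a, True) (b, True) (glue S t g S' t') = glue S (sym_join (bar n) a b t) g S' t'"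
proof -
  note \<rho> = sym_matchD(1)[OF m] and t = sym_matchD(2)[OF m]
  have "bar n a \<in> S" "bar n b \<in> S" using fpf_invol_in[OF \<rho>] ab by auto
  then show ?thesis
    using join_glue[OF t ab(1,2)] join_glue[OF fpf_invol_join[OF t ab], of "bar n a" "bar n b"]
    unfolding sym_join_def by auto
qed

context brauerC_monoid
begin

definition nf_data :: "(dot \<Rightarrow> dot) \<Rightarrow> nat set \<Rightarrow> (nat \<Rightarrow> nat) \<Rightarrow> (nat \<Rightarrow> nat) \<Rightarrow> nat set \<Rightarrow> (nat \<Rightarrow> nat) \<Rightarrow> bool" where
  "nf_data \<tau> S t g S' t' \<longleftrightarrow> half S t \<and> half S' t' \<and> signed_perm n g \<and> g ` S' = S \<and>
     (\<forall>p\<in>dots_of n. \<tau> p = glue S t g S' t' p)"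

text \<open>A relation, since a matching does not determine the data; that all data give the same
  element is \<open>normal_form_unique\<close>.\<close>

definition normal_form :: "(dot \<Rightarrow> dot) \<Rightarrow> 'a \<Rightarrow> bool" where
  "normal_form \<tau> z \<longleftrightarrow> (\<exists>S t g S' t'. nf_data \<tau> S t g S' t' \<and> z = NF S t g S' t')"

lemma normal_form_id: "normal_form (\<lambda>p. (fst p, \<not> snd p)) 1"
proof -
  have "nf_data (\<lambda>p. (fst p, \<not> snd p)) {} id id {} id"
    by (auto simp: nf_data_def half_def sym_match_def fpf_invol_def glue_def)
  moreover have "NF {} id id {} id = 1" by (simp add: NF_def arcs_def points_def)
  ultimately show ?thesis unfolding normal_form_def by metis
qed

lemma normal_form_perm:
  assumes "normal_form \<tau> z" and s: "signed_perm n s"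
  shows "normal_form (act_top s \<tau>) (rep s * z)"
proof -
  obtain S t g S' t' where d: "nf_data \<tau> S t g S' t'" and z: "z = NF S t g S' t'"
    using assms(1) by (auto simp: normal_form_def)
  have h: "half S t" "half S' t'" and g: "signed_perm n g" "g ` S' = S"
    and \<tau>: "\<And>p. p \<in> dots_of n \<Longrightarrow> \<tau> p = glue S t g S' t' p"
    using d by (auto simp: nf_data_def)
  note si = signed_perm_inv[OF s]
  have "inv (s \<circ> g) = inv g \<circ> inv s"
    using g s by (intro o_inv_distrib) (auto simp: signed_perm_def)
  then have isg: "inv (s \<circ> g) x = inv g (inv s x)" for x by simp
  have "act_top s \<tau> p = glue (s ` S) (s \<circ> t \<circ> inv s) (s \<circ> g) S' t' p" if p: "p \<in> dots_of n" for p
  proof -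
    obtain x b where x: "p = (x, b)" by (cases p)
    have "lift_top (inv s) p \<in> dots_of n" using p lift_top_in[OF si(1)] by simp
    moreover have "x \<in> s ` S \<longleftrightarrow> inv s x \<in> S" using si by (metis image_iff)
    ultimately show ?thesis
      unfolding act_top_def x using \<tau>[of "lift_top (inv s) (x, b)"] isg by (cases b) auto
  qed
  then have "nf_data (act_top s \<tau>) (s ` S) (s \<circ> t \<circ> inv s) (s \<circ> g) S' t'"
    using half_image[OF h(1) s] h(2) signed_perm_comp[OF s g(1)] g(2) by (auto simp: nf_data_def image_comp[symmetric])
  moreover have "rep s * NF S t g S' t' = NF (s ` S) (s \<circ> t \<circ> inv s) (s \<circ> g) S' t'"
  proof -
    have "rep s * (arcs S t * x) = arcs (s ` S) (s \<circ> t \<circ> inv s) * (rep s * x)" for x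
      using conj_arcs[OF h(1) s] conj_eq_iff[OF s] by (simp flip: mult.assoc)
    moreover have "rep s * (points S * x) = points (s ` S) * (rep s * x)" for x
      using conj_points[OF half_bar_closed(1)[OF h(1)] s] conj_eq_iff[OF s] by (simp flip: mult.assoc)
    moreover have "rep (s \<circ> g) * x = rep s * (rep g * x)" for x
      by (simp add: rep_comp[OF s g(1)] mult.assoc)
    ultimately show ?thesis unfolding NF_def by simp
  qed
  ultimately show ?thesis unfolding normal_form_def z by metis
qed

text \<open>The matching determines both sets of dots, the arcs on them, and \<open>g\<close>
  outside \<open>S'\<close>. Two choices of \<open>g\<close> differ by a permutation
  \<open>k\<close> fixing the dots outside \<open>S\<close>, and \<open>points S\<close> absorbs
  it.\<close>

lemma normal_form_unique:
  assumes "normal_form \<tau> z" "normal_form \<tau> z'"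
  shows "z = z'"
proof -
  obtain S t g S' t' where d: "nf_data \<tau> S t g S' t'" and z: "z = NF S t g S' t'"
    using assms(1) by (auto simp: normal_form_def)
  obtain T u f T' u' where d': "nf_data \<tau> T u f T' u'" and z': "z' = NF T u f T' u'"
    using assms(2) by (auto simp: normal_form_def)
  have h: "half S t" "half S' t'" "half T u" "half T' u'" and g: "signed_perm n g" "g ` S' = S"
    "signed_perm n f" "f ` T' = T"
    using d d' by (auto simp: nf_data_def)
  have eq: "glue S t g S' t' p = glue T u f T' u' p" if "p \<in> dots_of n" for p
    using d d' that by (simp add: nf_data_def)
  have sub: "S \<subseteq> {1..2 * n}" "S' \<subseteq> {1..2 * n}" "T \<subseteq> {1..2 * n}" "T' \<subseteq> {1..2 * n}"
    using half_bar_closed(1) h by auto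
  have "x \<in> S \<longleftrightarrow> x \<in> T" "x \<in> S' \<longleftrightarrow> x \<in> T'" if "x \<in> {1..2 * n}" for x
    using eq[of "(x, True)"] eq[of "(x, False)"] that by (simp_all split: if_splits)
  then have ST: "T = S" "T' = S'" using sub by blast+
  have tu: "t x = u x" if "x \<in> S" for x
    using eq[of "(x, True)"] that sub ST by auto
  have tu': "t' x = u' x" if "x \<in> S'" for x
    using eq[of "(x, False)"] that sub ST by auto
  have gf: "g x = f x" if "x \<in> {1..2 * n}" "x \<notin> S'" for x
    using eq[of "(x, False)"] that ST by auto
  note fi = signed_perm_inv[OF g(3)]
  define k where "k = g \<circ> inv f"
  have k: "signed_perm n k" "g = k \<circ> f" using signed_perm_comp[OF g(1) fi(1)] fi by (auto simp: k_def fun_eq_iff)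
  have "k x = x" if "x \<in> {1..2 * n} - S" for x
  proof -
    have "inv f x \<in> {1..2 * n}" using that signed_perm_in[OF fi(1)] by blast
    moreover have "inv f x \<notin> S'" using g(4) ST fi that by (metis DiffD2 imageI)
    ultimately show ?thesis using gf fi by (simp add: k_def)
  qed
  then have "points S * rep k = points S"
    using points_absorb_perm[OF k(1) sub(1)] half_bar_closed(2)[OF h(1)] by blast
  then have "points S * (rep g * x) = points S * (rep f * x)" for x
    using rep_comp[OF k(1) g(3)] k(2) by (simp flip: mult.assoc)
  moreover have "arcs S t = arcs S u" "arcs S' t' = arcs S' u'"
    using arcs_cong[OF h(1) tu] arcs_cong[OF h(2) tu'] by auto
  ultimately show ?thesis unfolding z z' NF_def ST by simp
qed

lemma half_remove_pt: "half S t \<Longrightarrow> a \<in> S \<Longrightarrow> t a = bar n a \<Longrightarrow> half (S - {a, bar n a}) t"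
  by (rule arcs_extract_pt)

lemma nf_data_join_outer:
  assumes m: "sym_match (dots_of n) (bar_dot n) \<tau>" and d: "nf_data \<tau> S t g S' t'"
    and ab: "a \<in> {1..2 * n}" "b \<in> {1..2 * n}" "a \<noteq> b" "a \<notin> S" "b \<notin> S"
    and ab': "a = g a'" "b = g b'"
  shows "nf_data (sym_join (bar_dot n) (a, True) (b, True) \<tau>)
    (orbits a b \<union> S) (add_arc a b t) g (orbits a' b' \<union> S') (add_arc a' b' t')"
proof -
  have h: "half S t" "half S' t'" and g: "signed_perm n g" "g ` S' = S"
    and \<tau>: "\<And>p. p \<in> dots_of n \<Longrightarrow> \<tau> p = glue S t g S' t' p"
    using d by (auto simp: nf_data_def)
  have D: "a' \<in> {1..2 * n}" "b' \<in> {1..2 * n}" "a' \<noteq> b'" "a' \<notin> S'" "b' \<notin> S'"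
    using ab ab' signed_perm_in[OF g(1)] g(2) by auto
  have ig: "inv g a = a'" "inv g b = b'" using ab' signed_perm_inv(3)[OF g(1)] by auto
  have \<tau>ab: "\<tau> (a, True) = (a', False)" "\<tau> (b, True) = (b', False)"
    using \<tau>[of "(a, True)"] \<tau>[of "(b, True)"] ab ig by auto
  have nS: "bar n a \<notin> S" "bar n b \<notin> S" "bar n a' \<notin> S'" "bar n b' \<notin> S'"
    using half_in[OF h(1)] half_in[OF h(2)] ab D by auto
  have bb: "g (bar n a') = bar n a" "g (bar n b') = bar n b" using signed_perm_bar[OF g(1)] D ab' by auto
  have inv_bar: "inv g (bar n a) = bar n a'" "inv g (bar n b) = bar n b'"
    using signed_perm_inv(3)[OF g(1), of "bar n a'"] signed_perm_inv(3)[OF g(1), of "bar n b'"] bb by auto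
  have "sym_join (bar_dot n) (a, True) (b, True) \<tau> p =
      glue (orbits a b \<union> S) (add_arc a b t) g (orbits a' b' \<union> S') (add_arc a' b' t') p" if p: "p \<in> dots_of n" for p
  proof -
    obtain x s where x: "p = (x, s)" by (cases p)
    have pq: "(a, True) \<in> dots_of n" "(b, True) \<in> dots_of n" "(a, True) \<noteq> (b, True)" using ab by auto
    from m pq show ?thesis
    proof (cases rule: sym_join_cases)
      case self
      then have b: "b = bar n a" by simp
      then have b'b: "b' = bar n a'" using ig inv_bar by simp
      show ?thesis unfolding self(3) using \<tau>[OF p] D ab nS bar_bar[OF ab(1)] bar_bar[OF D(1)]
        by (cases s) (auto simp: x \<tau>ab b b'b add_arc_def orbits_def)
    next
      case arcs
      have "bar n a \<noteq> b" "bar n a' \<noteq> b'" "a \<noteq> bar n b" "a' \<noteq> bar n b'" "bar n a \<noteq> bar n b" "bar n a' \<noteq> bar n b'"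
        using arcs(1,5) \<tau>ab bar_eq_swap[OF ab(1,2)] bar_eq_swap[OF D(1,2)] ab(3) D(3) bar_inj[OF ab(1,2)] bar_inj[OF D(1,2)]
        by auto
      then show ?thesis unfolding arcs(6) using \<tau>[OF p] D(3-5) ab(3-5) nS
        by (cases s) (auto simp: x \<tau>ab add_arc_def orbits_def)
    qed (use \<tau>ab in simp_all)
  qed
  then show ?thesis
    using half_add_arc[OF h(1) ab] half_add_arc[OF h(2) D] g orbits_image[OF g(1) D(1,2)] ab'
    by (simp add: nf_data_def image_Un)
qed

lemma nf_data_join_mixed_self:
  assumes m: "sym_match (dots_of n) (bar_dot n) \<tau>" and d: "nf_data \<tau> S t g S' t'"
    and ab: "a \<in> S" "b \<in> {1..2 * n}" "b \<notin> S" and ta: "t a = bar n a" and b': "b = g b'"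
  shows "nf_data (sym_join (bar_dot n) (a, True) (b, True) \<tau>)
    (orbits a b \<union> (S - {a, bar n a})) (add_arc a b t) g (orbits b' b' \<union> S') (add_arc b' (bar n b') t')"
proof -
  have h: "half S t" "half S' t'" and g: "signed_perm n g" "g ` S' = S"
    and \<tau>: "\<And>p. p \<in> dots_of n \<Longrightarrow> \<tau> p = glue S t g S' t' p"
    using d by (auto simp: nf_data_def)
  have da: "a \<in> {1..2 * n}" "a \<noteq> b" "bar n a \<in> S" using halfD(1,2)[OF h(1) ab(1)] ab by auto
  have D: "b' \<in> {1..2 * n}" "b' \<notin> S'" using ab b' signed_perm_in[OF g(1)] g(2) by auto
  have ig: "inv g b = b'" using b' signed_perm_inv(3)[OF g(1)] by auto
  have \<tau>ab: "\<tau> (a, True) = (bar n a, True)" "\<tau> (b, True) = (b', False)"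
    using \<tau>[of "(a, True)"] \<tau>[of "(b, True)"] ab ig ta da by auto
  have nS: "bar n b \<notin> S" "bar n b' \<notin> S'" using half_in[OF h(1)] half_in[OF h(2)] ab D by auto
  have nb: "b \<noteq> bar n a" "bar n b \<noteq> bar n a" "bar n b \<noteq> a" "a \<noteq> bar n b" using ab nS da by auto
  have gb: "g (bar n b') = bar n b" using signed_perm_bar[OF g(1) D(1)] b' by simp
  have bbb: "bar n (bar n b') = b'" using D(1) by (rule bar_bar)
  have "sym_join (bar_dot n) (a, True) (b, True) \<tau> p =
      glue (orbits a b \<union> (S - {a, bar n a})) (add_arc a b t) g (orbits b' b' \<union> S') (add_arc b' (bar n b') t') p"
    if p: "p \<in> dots_of n" for p
  proof -
    obtain x s where x: "p = (x, s)" by (cases p)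
    have pq: "(a, True) \<in> dots_of n" "(b, True) \<in> dots_of n" "(a, True) \<noteq> (b, True)" using ab da by auto
    from m pq show ?thesis
    proof (cases rule: sym_join_cases)
      case left
      show ?thesis unfolding left(4) using \<tau>[OF p] D(2) ab(1,3) nS nb da(2,3)
        by (cases s) (auto simp: x \<tau>ab add_arc_def orbits_def bbb)
    qed (use \<tau>ab nb in simp_all)
  qed
  moreover have "half (orbits a b \<union> (S - {a, bar n a})) (add_arc a b t)"
    using half_add_arc[OF half_remove_pt[OF h(1) ab(1) ta] da(1) ab(2) da(2)] ab by simp
  moreover have "half (orbits b' b' \<union> S') (add_arc b' (bar n b') t')"
  proof -
    have "orbits b' b' = orbits b' (bar n b')" by (auto simp: orbits_def bbb)
    then show ?thesis using half_add_arc[OF h(2) D(1) bar_in[OF D(1)] _ D(2) nS(2)] by simp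
  qed
  moreover have "g ` (orbits b' b' \<union> S') = orbits a b \<union> (S - {a, bar n a})"
    using orbits_image[OF g(1) D(1) D(1)] g(2) b' ab(1) da(3) by (auto simp: image_Un orbits_def)
  ultimately show ?thesis using g(1) by (simp add: nf_data_def)
qed

lemma nf_data_join_mixed_arc:
  assumes m: "sym_match (dots_of n) (bar_dot n) \<tau>" and d: "nf_data \<tau> S t g S' t'"
    and ab: "a \<in> S" "b \<in> {1..2 * n}" "b \<notin> S" and c: "t a = c" "c \<noteq> bar n a"
  shows "nf_data (sym_join (bar_dot n) (a, True) (b, True) \<tau>)
    (orbits a b \<union> (S - {a, bar n a, c, bar n c})) (add_arc a b t)
      (refl_perm n a c \<circ> (refl_perm n b a \<circ> g)) S' t'"
proof -
  have h: "half S t" "half S' t'" and g: "signed_perm n g" "g ` S' = S"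
    and \<tau>: "\<And>p. p \<in> dots_of n \<Longrightarrow> \<tau> p = glue S t g S' t' p"
    using d by (auto simp: nf_data_def)
  have S: "S \<subseteq> {1..2 * n}" "\<And>x. x \<in> S \<Longrightarrow> bar n x \<in> S" using half_bar_closed[OF h(1)] by auto
  have cS: "c \<in> S" "c \<noteq> a" "t c = a" using halfD[OF h(1) ab(1)] c by auto
  have bS: "bar n a \<in> S" "bar n c \<in> S" using S ab(1) cS by auto
  have D: "a \<in> {1..2 * n}" "c \<in> {1..2 * n}" using S ab(1) cS by auto
  define b' where "b' = inv g b"
  have b': "b = g b'" "b' \<in> {1..2 * n}" "b' \<notin> S'"
  proof -
    show 1: "b = g b'" unfolding b'_def using signed_perm_inv(2)[OF g(1)] by simp
    then show "b' \<in> {1..2 * n}" "b' \<notin> S'" using signed_perm_in[OF g(1), of b'] ab(2,3) g(2) by auto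
  qed
  have \<tau>ab: "\<tau> (a, True) = (c, True)" "\<tau> (b, True) = (b', False)"
    using \<tau>[of "(a, True)"] \<tau>[of "(b, True)"] ab c D by (auto simp: b'_def)
  have nS: "bar n b \<notin> S" "bar n b' \<notin> S'" using half_in[OF h(1)] half_in[OF h(2)] ab b' by auto
  have nb: "b \<noteq> a" "b \<noteq> c" "b \<noteq> bar n a" "b \<noteq> bar n c" "bar n b \<noteq> a" "bar n b \<noteq> c" "bar n b \<noteq> bar n a" "bar n b \<noteq> bar n c"
    using ab cS bS nS by auto
  have nc: "bar n c \<noteq> a" "bar n c \<noteq> bar n a" "c \<noteq> a"
    using c cS bar_eq_swap[OF D(2,1)] bar_inj[OF D(2,1)] by auto
  have gb: "g (bar n b') = bar n b" using signed_perm_bar[OF g(1) b'(2)] b' by simp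
  let ?k = "refl_perm n a c \<circ> refl_perm n b a"
  let ?g = "refl_perm n a c \<circ> (refl_perm n b a \<circ> g)"
  have s: "signed_perm n (refl_perm n a c)" "signed_perm n (refl_perm n b a)"
    using signed_refl_perm[OF D cS(2)[symmetric]] signed_refl_perm[OF ab(2) D(1) nb(1)] by auto
  then have sk: "signed_perm n ?k" and sg: "signed_perm n ?g" using g(1) by (auto intro: signed_perm_comp)
  have k: "?k b = c" "?k a = b" "?k c = a" "?k (bar n b) = bar n c" "?k (bar n a) = bar n b" "?k (bar n c) = bar n a"
    using nb nc c by (auto simp: refl_perm_def)
  have k_fix: "?k x = x" if "x \<notin> {a, b, c, bar n a, bar n b, bar n c}" for x
    using that by (auto simp: refl_perm_fixed)
  have gk: "?g x = ?k (g x)" for x by simp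
  have inv_g: "inv ?g x = y" if "?k (g y) = x" for x y
    using signed_perm_inv(3)[OF sg, of y] that by (simp add: comp_def)
  have inv_c: "inv ?g c = b'" "inv ?g (bar n c) = bar n b'"
    using inv_g[of b' c] inv_g[of "bar n b'" "bar n c"] k b' gb by simp_all
  have inv_fix: "inv ?g x = inv g x" if "x \<notin> {a, b, c, bar n a, bar n b, bar n c}" for x
    using inv_g[of "inv g x" x] k_fix[OF that] signed_perm_inv(2)[OF g(1)] by simp
  have g_b': "?g b' = c" "?g (bar n b') = bar n c" using k(1,4) b'(1) gb by simp_all
  have g_fix: "?g y = g y" if "y \<notin> S'" "y \<noteq> b'" "y \<noteq> bar n b'" for y
  proof -
    have "g y \<notin> S" using that g signed_perm_eq[OF g(1)] by auto
    moreover have "g y \<noteq> b" "g y \<noteq> bar n b" using that b' gb signed_perm_eq[OF g(1)] by metis+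
    ultimately show ?thesis unfolding gk using ab cS bS by (intro k_fix) auto
  qed
  have "sym_join (bar_dot n) (a, True) (b, True) \<tau> p =
      glue (orbits a b \<union> (S - {a, bar n a, c, bar n c})) (add_arc a b t) ?g S' t' p"
    if p: "p \<in> dots_of n" for p
  proof -
    obtain x s where x: "p = (x, s)" by (cases p)
    have pq: "(a, True) \<in> dots_of n" "(b, True) \<in> dots_of n" "(a, True) \<noteq> (b, True)" using ab D nb by auto
    from m pq show ?thesis
    proof (cases rule: sym_join_cases)
      case arcs
      show ?thesis
      proof (cases s)
        case True
        consider "x = a" | "x = b" | "x = bar n a" | "x = bar n b" | "x = c" | "x = bar n c"
          | "x \<notin> {a, b, c, bar n a, bar n b, bar n c}" by blast
        then show ?thesis unfolding arcs(6) x glue_simps using True nb nc cS c(2) c(2)[symmetric] \<tau>[OF p] inv_fix[of x]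
          by cases (auto simp: \<tau>ab add_arc_def orbits_def inv_c x simp del: comp_apply)
      next
        case False
        show ?thesis unfolding arcs(6) x glue_simps using False \<tau>[OF p] b'(3) nS(2) g_fix[of x]
          by (auto simp: \<tau>ab g_b' x simp del: comp_apply)
      qed
    qed (use \<tau>ab nb c cS in simp_all)
  qed
  moreover have "half (orbits a b \<union> (S - {a, bar n a, c, bar n c})) (add_arc a b t)"
    using half_add_arc[OF half_remove[OF h(1) ab(1)] D(1) ab(2) nb(1)[symmetric]] ab c by simp
  moreover have "?g ` S' = orbits a b \<union> (S - {a, bar n a, c, bar n c})"
  proof -
    have "?g ` S' = ?k ` S" using g(2) by (simp only: image_comp[symmetric])
    also have "S = {a, bar n a, c, bar n c} \<union> (S - {a, bar n a, c, bar n c})" using ab(1) cS bS by auto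
    also have "?k ` \<dots> = ?k ` {a, bar n a, c, bar n c} \<union> ?k ` (S - {a, bar n a, c, bar n c})" by (rule image_Un)
    also have "?k ` (S - {a, bar n a, c, bar n c}) = S - {a, bar n a, c, bar n c}"
    proof -
      have "?k x = x" if "x \<in> S - {a, bar n a, c, bar n c}" for x
        using that ab(3) nS(1) by (intro k_fix) auto
      then show ?thesis by (metis image_cong image_ident)
    qed
    also have "?k ` {a, bar n a, c, bar n c} = orbits a b"
      unfolding image_insert image_empty k orbits_def by auto
    finally show ?thesis .
  qed
  ultimately show ?thesis using sg h(2) unfolding nf_data_def by blast
qed

lemma normal_form_mixed:
  assumes m: "sym_match (dots_of n) (bar_dot n) \<tau>" and d: "nf_data \<tau> S t g S' t'"
    and ab: "a \<in> S" "b \<in> {1..2 * n}" "b \<notin> S"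
  shows "normal_form (sym_join (bar_dot n) (a, True) (b, True) \<tau>) (cup a b * NF S t g S' t')"
proof -
  have h: "half S t" "half S' t'" and g: "signed_perm n g" "g ` S' = S"
    using d by (auto simp: nf_data_def)
  show ?thesis
  proof (cases "t a = bar n a")
    case True
    have "b = g (inv g b)" using signed_perm_inv(2)[OF g(1)] by simp
    then show ?thesis unfolding normal_form_def
      using nf_data_join_mixed_self[OF m d ab True] NF_mixed_self[OF h g ab True] by blast
  next
    case False
    then show ?thesis unfolding normal_form_def
      using nf_data_join_mixed_arc[OF m d ab refl] NF_mixed_arc[OF h g ab refl] by blast
  qed
qed

text \<open>The computation depends on which of \<open>a\<close> and \<open>b\<close> already carry
  horizontal strands. If only \<open>b\<close> does, the symmetry of \<open>cup\<close> and of the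
  join exchanges the two dots.\<close>

theorem normal_form_join:
  assumes m: "sym_match (dots_of n) (bar_dot n) \<tau>" and nf: "normal_form \<tau> z"
    and ab: "a \<in> {1..2 * n}" "b \<in> {1..2 * n}" "a \<noteq> b"
  shows "normal_form (sym_join (bar_dot n) (a, True) (b, True) \<tau>) (cup a b * z)"
proof -
  obtain S t g S' t' where d: "nf_data \<tau> S t g S' t'" and z: "z = NF S t g S' t'"
    using nf by (auto simp: normal_form_def)
  have h: "half S t" "half S' t'" and g: "signed_perm n g" "g ` S' = S"
    and \<tau>: "\<And>p. p \<in> dots_of n \<Longrightarrow> \<tau> p = glue S t g S' t' p"
    using d by (auto simp: nf_data_def)
  have pq: "(a, True) \<in> dots_of n" "(b, True) \<in> dots_of n" "(a, True) \<noteq> (b, True)" using ab by auto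
  consider "a \<in> S" "b \<in> S" | "a \<in> S" "b \<notin> S" | "a \<notin> S" "b \<in> S" | "a \<notin> S" "b \<notin> S" by blast
  then show ?thesis
  proof cases
    case 1
    have s: "sym_match S (bar n) t" using h(1) by (simp add: half_def)
    have "sym_join (bar_dot n) (a, True) (b, True) \<tau> p = glue S (sym_join (bar n) a b t) g S' t' p"
      if "p \<in> dots_of n" for p
      using sym_join_cong[OF m pq(1,2) \<tau> that] sym_join_glue[OF s 1 ab(3)] by simp
    then have "nf_data (sym_join (bar_dot n) (a, True) (b, True) \<tau>) S (sym_join (bar n) a b t) g S' t'"
      using half_sym_join[OF h(1) 1 ab(3)] h(2) g by (simp add: nf_data_def)
    then show ?thesis unfolding normal_form_def z using NF_inside[OF h(1) 1 ab(3)] by blast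
  next
    case 2
    then show ?thesis unfolding z using normal_form_mixed[OF m d 2(1) ab(2)] by simp
  next
    case 3
    then show ?thesis unfolding z
      using normal_form_mixed[OF m d 3(2) ab(1) 3(1)] cup_sym[OF ab] sym_join_commute[OF m pq] by simp
  next
    case 4
    have "a = g (inv g a)" "b = g (inv g b)" using signed_perm_inv(2)[OF g(1)] by simp_all
    then show ?thesis unfolding normal_form_def z
      using nf_data_join_outer[OF m d ab 4] NF_outer[OF h g ab 4] by blast
  qed
qed

end

section \<open>Colourings\<close>

definition monochrome :: "('b \<Rightarrow> bool) \<Rightarrow> 'b set set \<Rightarrow> bool" where
  "monochrome c D \<longleftrightarrow> (\<forall>e\<in>D. \<forall>p\<in>e. \<forall>q\<in>e. c p = c q)"

definition mix :: "(nat \<Rightarrow> bool) \<Rightarrow> (nat \<Rightarrow> bool) \<Rightarrow> dot \<Rightarrow> bool" where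
  "mix x y p = (if snd p then x (fst p) else y (fst p))"

text \<open>Colourings vanish outside \<open>{1..N}\<close>, so there are finitely many of them, and
  two are equal as soon as they agree on the dots of a row.\<close>

definition colorings :: "nat \<Rightarrow> (nat \<Rightarrow> bool) set" where
  "colorings N = {x. \<forall>j. x j \<longrightarrow> j \<in> {1..N}}"

definition kernel :: "diagram \<Rightarrow> (nat \<Rightarrow> bool) \<Rightarrow> (nat \<Rightarrow> bool) \<Rightarrow> nat" where
  "kernel D x y = of_bool (monochrome (mix x y) D)"

lemma finite_colorings: "finite (colorings N)"
proof -
  have "colorings N \<subseteq> (\<lambda>A j. j \<in> A) ` Pow {1..N}"
  proof
    fix x assume "x \<in> colorings N"
    then show "x \<in> (\<lambda>A j. j \<in> A) ` Pow {1..N}"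
      by (intro image_eqI[of _ _ "{j. x j}"]) (auto simp: colorings_def)
  qed
  then show ?thesis by (rule finite_subset) simp
qed

lemma monochrome_image: "monochrome c ((\<lambda>e. f ` e) ` D) \<longleftrightarrow> monochrome (\<lambda>p. c (f p)) D"
  by (auto simp: monochrome_def)

lemma monochrome_Un: "monochrome c (D \<union> D') \<longleftrightarrow> monochrome c D \<and> monochrome c D'"
  by (auto simp: monochrome_def)

text \<open>The assumptions are chosen to hold also when one factor is itself a composite, for which
  \<open>pairs_on\<close> is the available information. Covering the middle row makes each of its
  dots a vertex of the concatenation graph.\<close>

locale composable =
  fixes N :: nat and a b :: diagram
  assumes a_dots: "\<And>e. e \<in> a \<Longrightarrow> e \<subseteq> dots N" and b_dots: "\<And>e. e \<in> b \<Longrightarrow> e \<subseteq> dots N"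
    and covered: "\<And>j. j \<in> {1..N} \<Longrightarrow> (j, False) \<in> \<Union>a \<or> (j, True) \<in> \<Union>b"
begin

abbreviation "conn \<equiv> comp_conn a b"
abbreviation "verts \<equiv> \<Union>(comp_graph a b)"

lemma verts_range: "u \<in> verts \<Longrightarrow> fst u \<in> {1..N} \<and> snd u \<le> 2"
  using a_dots b_dots unfolding comp_graph_def lay_top_def lay_bot_def dots_def by force

lemma middle_verts:
  assumes "j \<in> {1..N}"
  shows "(j, 1) \<in> verts"
  using covered[OF assms]
proof
  assume "(j, False) \<in> \<Union>a"
  then obtain e where e: "e \<in> a" "(j, False) \<in> e" by blast
  have "(j, 1) = lay_top (j, False)" by (simp add: lay_top_def)
  then have "(j, 1) \<in> lay_top ` e" using e(2) by (rule image_eqI)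
  then show ?thesis using e(1) unfolding comp_graph_def by blast
next
  assume "(j, True) \<in> \<Union>b"
  then obtain e where e: "e \<in> b" "(j, True) \<in> e" by blast
  have "(j, 1) = lay_bot (j, True)" by (simp add: lay_bot_def)
  then have "(j, 1) \<in> lay_bot ` e" using e(2) by (rule image_eqI)
  then show ?thesis using e(1) unfolding comp_graph_def by blast
qed

lemma conn_refl: "(u, u) \<in> conn"
  by (simp add: comp_conn_def)

lemma conn_sym: "(u, v) \<in> conn \<Longrightarrow> (v, u) \<in> conn"
proof -
  have "sym conn" unfolding comp_conn_def by (rule sym_rtrancl) (auto simp: sym_def)
  then show "(u, v) \<in> conn \<Longrightarrow> (v, u) \<in> conn" by (rule symD)
qed

lemma conn_trans: "(u, v) \<in> conn \<Longrightarrow> (v, w) \<in> conn \<Longrightarrow> (u, w) \<in> conn"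
  unfolding comp_conn_def by (rule rtrancl_trans)

lemma conn_class: "(u, v) \<in> conn \<Longrightarrow> conn `` {u} = conn `` {v}"
  using conn_sym conn_trans by blast

lemma conn_verts: "(u, v) \<in> conn \<Longrightarrow> u \<noteq> v \<Longrightarrow> u \<in> verts \<and> v \<in> verts"
  unfolding comp_conn_def
proof (induction rule: rtrancl_induct)
  case (step v w)
  then show ?case by (cases "u = v") auto
qed simp

lemma monochrome_conn:
  "monochrome c (comp_graph a b) \<longleftrightarrow> (\<forall>u v. (u, v) \<in> conn \<longrightarrow> c u = c v)"
proof
  assume c: "monochrome c (comp_graph a b)"
  show "\<forall>u v. (u, v) \<in> conn \<longrightarrow> c u = c v"
  proof (intro allI impI)
    fix u v assume "(u, v) \<in> conn"
    then show "c u = c v"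
      unfolding comp_conn_def
    proof (induction rule: rtrancl_induct)
      case (step v w)
      then show ?case using c by (auto simp: monochrome_def)
    qed simp
  qed
next
  assume "\<forall>u v. (u, v) \<in> conn \<longrightarrow> c u = c v"
  then show "monochrome c (comp_graph a b)"
    unfolding monochrome_def comp_conn_def by blast
qed

definition layered :: "(nat \<Rightarrow> bool) \<Rightarrow> (nat \<Rightarrow> bool) \<Rightarrow> (nat \<Rightarrow> bool) \<Rightarrow> nat \<times> nat \<Rightarrow> bool" where
  "layered x m y u = (if snd u = 2 then x (fst u) else if snd u = 1 then m (fst u) else y (fst u))"

lemma layered_graph:
  "monochrome (mix x m) a \<and> monochrome (mix m y) b \<longleftrightarrow> (\<forall>u v. (u, v) \<in> conn \<longrightarrow> layered x m y u = layered x m y v)"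
proof -
  have "mix x m = (\<lambda>p. layered x m y (lay_top p))" "mix m y = (\<lambda>p. layered x m y (lay_bot p))"
    by (auto simp: fun_eq_iff mix_def layered_def lay_top_def lay_bot_def)
  then show ?thesis
    unfolding monochrome_conn[symmetric] unfolding comp_graph_def monochrome_Un monochrome_image by simp
qed

definition outer :: "(nat \<Rightarrow> bool) \<Rightarrow> (nat \<Rightarrow> bool) \<Rightarrow> nat \<times> nat \<Rightarrow> bool" where
  "outer x y u = mix x y (unlayer u)"

lemma layered_outer: "snd u \<noteq> 1 \<Longrightarrow> layered x m y u = outer x y u"
  by (simp add: layered_def outer_def mix_def unlayer_def)

lemma monochrome_comp:
  "monochrome (mix x y) (diagram_comp a b) \<longleftrightarrow>
    (\<forall>u v. snd u \<noteq> 1 \<longrightarrow> snd v \<noteq> 1 \<longrightarrow> (u, v) \<in> conn \<longrightarrow> outer x y u = outer x y v)"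
proof
  assume L: "monochrome (mix x y) (diagram_comp a b)"
  show "\<forall>u v. snd u \<noteq> 1 \<longrightarrow> snd v \<noteq> 1 \<longrightarrow> (u, v) \<in> conn \<longrightarrow> outer x y u = outer x y v"
  proof (intro allI impI)
    fix u v assume uv: "snd u \<noteq> 1" "snd v \<noteq> 1" "(u, v) \<in> conn"
    show "outer x y u = outer x y v"
    proof (cases "u = v")
      case False
      then have "{unlayer u, unlayer v} \<in> diagram_comp a b"
        using uv unfolding diagram_comp_def by blast
      then show ?thesis using L by (auto simp: monochrome_def outer_def)
    qed simp
  qed
next
  assume R: "\<forall>u v. snd u \<noteq> 1 \<longrightarrow> snd v \<noteq> 1 \<longrightarrow> (u, v) \<in> conn \<longrightarrow> outer x y u = outer x y v"
  show "monochrome (mix x y) (diagram_comp a b)"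
    unfolding monochrome_def
  proof (intro ballI)
    fix e p q assume e: "e \<in> diagram_comp a b" "p \<in> e" "q \<in> e"
    then obtain u v where "e = {unlayer u, unlayer v}" "snd u \<noteq> 1" "snd v \<noteq> 1" "(u, v) \<in> conn"
      unfolding diagram_comp_def by blast
    then have "mix x y (unlayer u) = mix x y (unlayer v)" using R unfolding outer_def by blast
    then show "mix x y p = mix x y q" using e \<open>e = {unlayer u, unlayer v}\<close> by auto
  qed
qed

definition loops :: "(nat \<times> nat) set set" where
  "loops = {conn `` {u} | u. u \<in> verts \<and> snd u = 1 \<and> (\<forall>v. (u, v) \<in> conn \<longrightarrow> snd v = 1)}"

lemma finite_loops: "finite loops"
proof -
  have "verts \<subseteq> {1..N} \<times> {..2}"
  proof
    fix u assume "u \<in> verts"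
    then show "u \<in> {1..N} \<times> {..2}" using verts_range[of u] by (cases u) simp
  qed
  then have "finite verts" by (rule finite_subset) simp
  then have "finite ((\<lambda>u. conn `` {u}) ` verts)" by (rule finite_imageI)
  then show ?thesis by (rule finite_subset[rotated]) (unfold loops_def, blast)
qed

text \<open>A component that reaches an outer row has its colour prescribed there, while a closed
  loop may be coloured freely. A compatible outer colouring therefore has one extension for every
  set of loops.\<close>

lemma count_fillings:
  "card {m \<in> colorings N. monochrome (mix x m) a \<and> monochrome (mix m y) b} =
    (if monochrome (mix x y) (diagram_comp a b) then 2 ^ num_loops a b else 0)"
proof -
  let ?M = "{m \<in> colorings N. \<forall>u v. (u, v) \<in> conn \<longrightarrow> layered x m y u = layered x m y v}"
  have M: "{m \<in> colorings N. monochrome (mix x m) a \<and> monochrome (mix m y) b} = ?M"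
    by (simp add: layered_graph)
  have Mv: "layered x m y u = layered x m y v" if "m \<in> ?M" "(u, v) \<in> conn" for m u v
    using that by blast
  show ?thesis
  proof (cases "monochrome (mix x y) (diagram_comp a b)")
    case False
    then obtain u v where uv: "snd u \<noteq> 1" "snd v \<noteq> 1" "(u, v) \<in> conn" "outer x y u \<noteq> outer x y v"
      using monochrome_comp by blast
    have "m \<notin> ?M" for m
      using Mv[of m u v] uv layered_outer[OF uv(1)] layered_outer[OF uv(2)] by blast
    then have "?M = {}" by blast
    then show ?thesis unfolding M using False by (simp only: card.empty if_False)
  next
    case True
    then have outer: "outer x y u = outer x y v" if "snd u \<noteq> 1" "snd v \<noteq> 1" "(u, v) \<in> conn" for u v
      using that monochrome_comp by blast
    \<comment> \<open>The loops coloured \<open>True\<close> encode the middle colouring.\<close>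
    define f where "f m = {K \<in> loops. \<exists>j. (j, 1) \<in> K \<and> m j}" for m :: "nat \<Rightarrow> bool"
    have "bij_betw f ?M (Pow loops)"
      unfolding bij_betw_def
    proof
      show "inj_on f ?M"
      proof
        fix m m' assume m: "m \<in> ?M" "m' \<in> ?M" "f m = f m'"
        show "m = m'"
        proof
          fix j
          show "m j = m' j"
          proof (cases "j \<in> {1..N}")
            case False
            then show ?thesis using m unfolding colorings_def by blast
          next
            case j: True
            show ?thesis
            proof (cases "\<exists>v. snd v \<noteq> 1 \<and> ((j, 1), v) \<in> conn")
              case True
              then obtain v where v: "snd v \<noteq> 1" "((j, 1), v) \<in> conn" by blast
              have "m j = outer x y v" "m' j = outer x y v"
                using Mv[OF m(1) v(2)] Mv[OF m(2) v(2)] layered_outer[OF v(1)] by (auto simp: layered_def)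
              then show ?thesis by simp
            next
              case False
              let ?K = "conn `` {(j, 1)}"
              have K: "?K \<in> loops"
                unfolding loops_def using middle_verts[OF j] False
                by (intro CollectI exI[of _ "(j, 1)"] conjI) (rule refl, assumption, simp, blast)
              have iff: "?K \<in> f w \<longleftrightarrow> w j" if "w \<in> ?M" for w
              proof
                assume "?K \<in> f w"
                then obtain i where "((j, 1), (i, 1)) \<in> conn" "w i" by (auto simp: f_def)
                then show "w j" using Mv[OF that] by (fastforce simp: layered_def)
              next
                assume "w j"
                then show "?K \<in> f w" using K conn_refl by (auto simp: f_def)
              qed
              show ?thesis using iff[OF m(1)] iff[OF m(2)] m(3) by simp
            qed
          qed
        qed
      qed
      show "f ` ?M = Pow loops"
      proof
        show "f ` ?M \<subseteq> Pow loops" by (auto simp: f_def)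
        show "Pow loops \<subseteq> f ` ?M"
        proof
          fix T assume "T \<in> Pow loops"
          then have T: "T \<subseteq> loops" by simp
          \<comment> \<open>The colour of the component of \<open>u\<close>: inherited from some
            outer vertex if it contains one, otherwise decided by whether the loop belongs to
            \<open>T\<close>.\<close>
          define val where "val u = (if \<exists>v. snd v \<noteq> 1 \<and> (u, v) \<in> conn
            then outer x y (SOME v. snd v \<noteq> 1 \<and> (u, v) \<in> conn) else conn `` {u} \<in> T)" for u
          have val_conn: "val u = val v" if "(u, v) \<in> conn" for u v
          proof -
            have "(u, w) \<in> conn \<longleftrightarrow> (v, w) \<in> conn" for w using conn_class[OF that] by blast
            then show ?thesis unfolding val_def by (simp only: conn_class[OF that])
          qed
          have val_outer: "val u = outer x y u" if "snd u \<noteq> 1" for u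
          proof -
            have "\<exists>v. snd v \<noteq> 1 \<and> (u, v) \<in> conn" using that conn_refl by blast
            then have "snd (SOME v. snd v \<noteq> 1 \<and> (u, v) \<in> conn) \<noteq> 1 \<and> (u, SOME v. snd v \<noteq> 1 \<and> (u, v) \<in> conn) \<in> conn"
              by (rule someI_ex)
            then have "outer x y u = outer x y (SOME v. snd v \<noteq> 1 \<and> (u, v) \<in> conn)"
              using outer that by blast
            then show ?thesis using \<open>\<exists>v. snd v \<noteq> 1 \<and> (u, v) \<in> conn\<close>
              unfolding val_def by (simp only: if_True)
          qed
          define m where "m j = (j \<in> {1..N} \<and> val (j, 1))" for j
          have lm: "layered x m y u = val u" if "u \<in> verts" for u
          proof (cases "snd u = 1")
            case True
            then show ?thesis using verts_range[OF that] by (cases u) (simp add: layered_def m_def)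
          next
            case False
            then show ?thesis using layered_outer val_outer by simp
          qed
          have "layered x m y u = layered x m y v" if "(u, v) \<in> conn" for u v
          proof (cases "u = v")
            case False
            then show ?thesis using lm val_conn[OF that] conn_verts[OF that] by simp
          qed simp
          moreover have "m \<in> colorings N" by (auto simp: colorings_def m_def)
          ultimately have "m \<in> ?M" by blast
          moreover have "f m = T"
          proof -
            have "(\<exists>j. (j, 1) \<in> K \<and> m j) \<longleftrightarrow> K \<in> T" if K: "K \<in> loops" for K
            proof -
              obtain u where u: "K = conn `` {u}" "u \<in> verts" "snd u = 1" "\<forall>v. (u, v) \<in> conn \<longrightarrow> snd v = 1"
                using K unfolding loops_def by blast
              have val_K: "val v \<longleftrightarrow> K \<in> T" if "v \<in> K" for v
              proof -
                have uv: "(u, v) \<in> conn" using that u(1) by simp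
                have "\<not> (\<exists>v. snd v \<noteq> 1 \<and> (u, v) \<in> conn)" using u(4) by blast
                then have "val u \<longleftrightarrow> K \<in> T" unfolding val_def u(1) by (simp only: if_False)
                then show ?thesis using val_conn[OF uv] by simp
              qed
              have uK: "u \<in> K" using u conn_refl by simp
              have u1: "u = (fst u, 1)" "fst u \<in> {1..N}" using u(3) verts_range[OF u(2)] by (cases u; simp)+
              show ?thesis
              proof
                assume "\<exists>j. (j, 1) \<in> K \<and> m j"
                then show "K \<in> T" using val_K by (auto simp: m_def)
              next
                assume "K \<in> T"
                then have "m (fst u)" using val_K[OF uK] u1 by (simp add: m_def)
                then show "\<exists>j. (j, 1) \<in> K \<and> m j" using uK u1 by metis
              qed
            qed
            then show ?thesis using T by (auto simp: f_def)
          qed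
          ultimately show "T \<in> f ` ?M" by blast
        qed
      qed
    qed
    then have "card ?M = card (Pow loops)" by (rule bij_betw_same_card)
    also have "\<dots> = 2 ^ num_loops a b"
      using card_Pow[OF finite_loops] by (simp add: num_loops_def loops_def)
    finally show ?thesis unfolding M using True by (simp only: if_True)
  qed
qed

lemma kernel_comp:
  "(\<Sum>m\<in>colorings N. kernel a x m * kernel b m y) = 2 ^ num_loops a b * kernel (diagram_comp a b) x y"
proof -
  have "(\<Sum>m\<in>colorings N. kernel a x m * kernel b m y) =
      (\<Sum>m\<in>colorings N. of_bool (monochrome (mix x m) a \<and> monochrome (mix m y) b))"
    by (intro sum.cong) (auto simp: kernel_def)
  also have "\<dots> = card {m \<in> colorings N. monochrome (mix x m) a \<and> monochrome (mix m y) b}"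
    using finite_colorings by (simp add: Int_def)
  finally show ?thesis by (simp add: count_fillings kernel_def)
qed

end

text \<open>The edges are the pairs of distinct elements in the classes of an equivalence relation.
  This property passes to composites directly from connectivity, and it allows a diagram to be
  recovered from its kernel.\<close>

definition pairs_on :: "nat \<Rightarrow> diagram \<Rightarrow> bool" where
  "pairs_on N D \<longleftrightarrow> (\<forall>e\<in>D. \<exists>p q. p \<noteq> q \<and> p \<in> dots N \<and> q \<in> dots N \<and> e = {p, q}) \<and>
    (\<forall>p q r. {p, q} \<in> D \<longrightarrow> {q, r} \<in> D \<longrightarrow> p \<noteq> r \<longrightarrow> {p, r} \<in> D)"

lemma pairs_on_edge:
  assumes "pairs_on N D" "e \<in> D"
  obtains p q where "p \<noteq> q" "p \<in> dots N" "q \<in> dots N" "e = {p, q}"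
  using bspec[OF conjunct1[OF assms(1)[unfolded pairs_on_def]] assms(2)] that by blast

lemma pairs_on_trans:
  assumes "pairs_on N D" "{p, q} \<in> D" "{q, r} \<in> D" "p \<noteq> r"
  shows "{p, r} \<in> D"
  using conjunct2[OF assms(1)[unfolded pairs_on_def], THEN spec, THEN spec, THEN spec, THEN mp, THEN mp, THEN mp]
    assms(2-4) .

lemma pairs_on_dots: "pairs_on N D \<Longrightarrow> e \<in> D \<Longrightarrow> e \<subseteq> dots N"
  by (erule (1) pairs_on_edge) simp

text \<open>The test colouring is the indicator of the class of \<open>p\<close> in
  \<open>D\<close>. It is constant on the edges of \<open>D\<close>, hence on those of
  \<open>D'\<close>, so an edge of \<open>D'\<close> at \<open>p\<close> stays inside the
  class.\<close>

lemma kernel_determines_subset: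
  assumes D: "pairs_on N D" "pairs_on N D'"
    and le: "\<And>x y. x \<in> colorings N \<Longrightarrow> y \<in> colorings N \<Longrightarrow> kernel D x y = kernel D' x y"
  shows "D' \<subseteq> D"
proof
  fix e assume e: "e \<in> D'"
  then obtain p q where pq: "p \<noteq> q" "p \<in> dots N" "q \<in> dots N" "e = {p, q}"
    by (rule pairs_on_edge[OF D(2)])
  define c where "c r = (r = p \<or> {p, r} \<in> D)" for r
  define x where "x j = c (j, True)" for j
  define y where "y j = c (j, False)" for j
  have c: "c = mix x y"
  proof
    fix r :: dot
    show "c r = mix x y r" by (cases r; cases "snd r") (simp_all add: mix_def x_def y_def)
  qed
  have c_dots: "r \<in> dots N" if "c r" for r
    using that pq(2) pairs_on_dots[OF D(1), of "{p, r}"] unfolding c_def by auto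
  have xy: "x \<in> colorings N" "y \<in> colorings N"
    using c_dots by (auto simp: colorings_def x_def y_def dots_def)
  have step: "c s" if "c r" "{r, s} \<in> D" for r s
    using that pairs_on_trans[OF D(1), of p r s] unfolding c_def by auto
  have "monochrome c D"
    unfolding monochrome_def
  proof (intro ballI)
    fix d r s assume d: "d \<in> D" "r \<in> d" "s \<in> d"
    obtain u v where "d = {u, v}" by (rule pairs_on_edge[OF D(1) d(1)])
    then have "r = s \<or> d = {r, s}" using d by auto
    then show "c r = c s" using step[of r s] step[of s r] d(1) by (auto simp: insert_commute)
  qed
  then have "monochrome c D'" using le[OF xy] by (cases "monochrome (mix x y) D'") (simp_all add: kernel_def c)
  then have "c p = c q" using e pq(4) by (auto simp: monochrome_def)
  then have "{p, q} \<in> D" using pq(1) by (auto simp: c_def)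
  then show "e \<in> D" using pq(4) by simp
qed

lemma kernel_determines:
  assumes "pairs_on N D" "pairs_on N D'"
    and "\<And>x y. x \<in> colorings N \<Longrightarrow> y \<in> colorings N \<Longrightarrow> kernel D x y = kernel D' x y"
  shows "D = D'"
  using kernel_determines_subset[OF assms] kernel_determines_subset[OF assms(2,1)] assms(3) by auto

lemma zero_coloring: "(\<lambda>_. False) \<in> colorings N" "kernel D (\<lambda>_. False) (\<lambda>_. False) = 1"
  by (auto simp: colorings_def kernel_def monochrome_def mix_def)

text \<open>The all-\<open>False\<close> colouring is compatible with every diagram and so isolates
  the powers of 2; once they are cancelled, the kernels agree.\<close>

lemma scaled_kernel_determines:
  assumes "pairs_on N D" "pairs_on N D'"
    and eq: "\<And>x y. x \<in> colorings N \<Longrightarrow> y \<in> colorings N \<Longrightarrow> 2 ^ k * kernel D x y = 2 ^ l * kernel D' x y"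
  shows "D = D' \<and> k = l"
proof -
  have "(2::nat) ^ k = 2 ^ l"
    using eq[OF zero_coloring(1) zero_coloring(1)] zero_coloring(2) by simp
  then have "k = l" by simp
  then show ?thesis using kernel_determines[OF assms(1,2)] eq by simp
qed

lemma (in composable) pairs_on_comp: "pairs_on N (diagram_comp a b)"
proof -
  have inj: "unlayer u = unlayer v \<Longrightarrow> u = v" if "u \<in> verts" "v \<in> verts" "snd u \<noteq> 1" "snd v \<noteq> 1" for u v
  proof -
    have "snd u = 0 \<or> snd u = 2" "snd v = 0 \<or> snd v = 2"
      using that(3,4) verts_range[OF that(1)] verts_range[OF that(2)] by linarith+
    moreover assume "unlayer u = unlayer v"
    ultimately show "u = v" unfolding unlayer_def prod_eq_iff by auto
  qed
  have dots: "unlayer u \<in> dots N" if "u \<in> verts" for u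
    using verts_range[OF that] by (simp add: unlayer_def dots_def)
  have edge: "\<exists>u v. u \<noteq> v \<and> snd u \<noteq> 1 \<and> snd v \<noteq> 1 \<and> (u, v) \<in> conn \<and> p = unlayer u \<and> q = unlayer v"
    if pq: "{p, q} \<in> diagram_comp a b" for p q
  proof -
    obtain u v where uv: "{p, q} = {unlayer u, unlayer v}" "u \<noteq> v" "snd u \<noteq> 1" "snd v \<noteq> 1" "(u, v) \<in> conn"
      using pq unfolding diagram_comp_def by blast
    then consider "p = unlayer u" "q = unlayer v" | "p = unlayer v" "q = unlayer u"
      by (auto simp: doubleton_eq_iff)
    then show ?thesis
    proof cases
      case 1
      then show ?thesis using uv by blast
    next
      case 2
      then show ?thesis using uv(2-4) conn_sym[OF uv(5)] by (intro exI[of _ v] exI[of _ u]) simp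
    qed
  qed
  show ?thesis
    unfolding pairs_on_def
  proof (intro conjI ballI allI impI)
    fix e assume "e \<in> diagram_comp a b"
    then obtain u v where uv: "e = {unlayer u, unlayer v}" "u \<noteq> v" "snd u \<noteq> 1" "snd v \<noteq> 1" "(u, v) \<in> conn"
      unfolding diagram_comp_def by blast
    have V: "u \<in> verts" "v \<in> verts" using conn_verts[OF uv(5,2)] by simp_all
    have "unlayer u \<noteq> unlayer v" using inj[OF V uv(3,4)] uv(2) by blast
    then show "\<exists>p q. p \<noteq> q \<and> p \<in> dots N \<and> q \<in> dots N \<and> e = {p, q}"
      using uv(1) dots[OF V(1)] dots[OF V(2)] by blast
  next
    fix p q r assume pq: "{p, q} \<in> diagram_comp a b" and qr: "{q, r} \<in> diagram_comp a b" and "p \<noteq> r"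
    obtain u v where uv: "u \<noteq> v" "snd u \<noteq> 1" "snd v \<noteq> 1" "(u, v) \<in> conn" "p = unlayer u" "q = unlayer v"
      using edge[OF pq] by blast
    obtain v' w where vw: "v' \<noteq> w" "snd v' \<noteq> 1" "snd w \<noteq> 1" "(v', w) \<in> conn" "q = unlayer v'" "r = unlayer w"
      using edge[OF qr] by blast
    have "v \<in> verts" "v' \<in> verts" using conn_verts[OF uv(4,1)] conn_verts[OF vw(4,1)] by simp_all
    then have "v = v'" using inj[OF _ _ uv(3) vw(2)] uv(6) vw(5) by metis
    then have "(u, w) \<in> conn" using conn_trans[OF uv(4)] vw(4) by simp
    moreover have "u \<noteq> w" using \<open>p \<noteq> r\<close> uv vw by blast
    ultimately show "{p, r} \<in> diagram_comp a b"
      unfolding diagram_comp_def using uv vw by blast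
  qed
qed

section \<open>Diagrams and fixed-point free involutions\<close>

definition diag :: "nat \<Rightarrow> (dot \<Rightarrow> dot) \<Rightarrow> diagram" where
  "diag N \<tau> = {{p, \<tau> p} | p. p \<in> dots N}"

lemma dots_of_eq: "dots_of n = dots (2 * n)"
  by (simp add: dots_of_def dots_def)

lemma dots_iff [simp]: "(a, s) \<in> dots N \<longleftrightarrow> a \<in> {1..N}"
  by (simp add: dots_def)

lemma diag_member: "p \<in> dots N \<Longrightarrow> {p, \<tau> p} \<in> diag N \<tau>"
  unfolding diag_def by blast

lemma diag_elem:
  assumes "e \<in> diag N \<tau>"
  obtains k s where "k \<in> {1..N}" "e = {(k, s), \<tau> (k, s)}"
proof -
  obtain p where "p \<in> dots N" "e = {p, \<tau> p}" using assms unfolding diag_def by blast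
  then show thesis using that[of "fst p" "snd p"] by (simp add: dots_def mem_Times_iff)
qed

lemma diag_edge:
  assumes "fpf_invol (dots N) \<tau>" "{p, q} \<in> diag N \<tau>"
  shows "p \<in> dots N" "q = \<tau> p"
proof -
  obtain r where r: "r \<in> dots N" "{p, q} = {r, \<tau> r}" using assms(2) by (auto simp: diag_def)
  have "p = r \<and> q = \<tau> r \<or> p = \<tau> r \<and> q = r" using r(2) unfolding doubleton_eq_iff .
  then show "p \<in> dots N" "q = \<tau> p"
    using r(1) fpf_invol_in[OF assms(1) r(1)] fpf_invol_twice[OF assms(1) r(1)] by auto
qed

lemma pairs_on_diag: "fpf_invol (dots N) \<tau> \<Longrightarrow> pairs_on N (diag N \<tau>)"
  unfolding pairs_on_def
proof (intro conjI ballI allI impI)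
  assume \<tau>: "fpf_invol (dots N) \<tau>"
  show "\<exists>p q. p \<noteq> q \<and> p \<in> dots N \<and> q \<in> dots N \<and> e = {p, q}" if "e \<in> diag N \<tau>" for e
    using that \<tau> unfolding diag_def fpf_invol_def by blast
  fix p q r assume "{p, q} \<in> diag N \<tau>" "{q, r} \<in> diag N \<tau>" "p \<noteq> r"
  then show "{p, r} \<in> diag N \<tau>"
    using diag_edge[OF \<tau>, of p q] diag_edge[OF \<tau>, of q r] fpf_invol_twice[OF \<tau>, of p] by simp
qed

lemma monochrome_diag: "monochrome c (diag N \<tau>) \<longleftrightarrow> (\<forall>p\<in>dots N. c p = c (\<tau> p))"
  unfolding monochrome_def diag_def Setcompr_eq_image ball_simps by (simp add: eq_commute)

lemma diag_cong: "(\<And>p. p \<in> dots N \<Longrightarrow> \<tau> p = \<sigma> p) \<Longrightarrow> diag N \<tau> = diag N \<sigma>"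
  unfolding diag_def Setcompr_eq_image by (rule image_cong) simp_all

lemma diag_inject:
  assumes "fpf_invol (dots N) \<sigma>" "diag N \<tau> = diag N \<sigma>" "p \<in> dots N"
  shows "\<tau> p = \<sigma> p"
proof -
  have "{p, \<tau> p} \<in> diag N \<tau>" using assms(3) by (rule diag_member)
  then show ?thesis using diag_edge(2)[OF assms(1), of p "\<tau> p"] assms(2) by simp
qed

lemma brauer_diagram_diag:
  assumes \<tau>: "fpf_invol (dots N) \<tau>"
  shows "brauer_diagram N (diag N \<tau>)"
  unfolding brauer_diagram_def perfect_matching_def
proof (intro conjI ballI)
  show "\<exists>x y. x \<noteq> y \<and> x \<in> dots N \<and> y \<in> dots N \<and> e = {x, y}" if "e \<in> diag N \<tau>" for e
    using that \<tau> unfolding diag_def fpf_invol_def by blast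
  fix v assume v: "v \<in> dots N"
  show "\<exists>!e. e \<in> diag N \<tau> \<and> v \<in> e"
  proof (rule ex1I[of _ "{v, \<tau> v}"])
    show "{v, \<tau> v} \<in> diag N \<tau> \<and> v \<in> {v, \<tau> v}" using diag_member[OF v] by simp
    fix e assume e: "e \<in> diag N \<tau> \<and> v \<in> e"
    then obtain p where "p \<in> dots N" "e = {p, \<tau> p}" by (auto simp: diag_def)
    then show "e = {v, \<tau> v}" using e fpf_invol_twice[OF \<tau>, of p] by auto
  qed
qed

lemma brauer_diagram_obtain:
  assumes D: "brauer_diagram N D"
  obtains \<tau> where "fpf_invol (dots N) \<tau>" "D = diag N \<tau>"
proof -
  have edge: "\<exists>x y. x \<noteq> y \<and> x \<in> dots N \<and> y \<in> dots N \<and> e = {x, y}" if "e \<in> D" for e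
    using D that unfolding brauer_diagram_def perfect_matching_def by blast
  have uniq: "\<exists>!e. e \<in> D \<and> v \<in> e" if "v \<in> dots N" for v
    using D that unfolding brauer_diagram_def perfect_matching_def by blast
  have "\<exists>q. {p, q} \<in> D" if p: "p \<in> dots N" for p
  proof -
    obtain e where e: "e \<in> D" "p \<in> e" using uniq[OF p] by blast
    then obtain x y where "e = {x, y}" using edge by blast
    then have "e = {p, if p = x then y else x}" using e(2) by auto
    then show ?thesis using e(1) by blast
  qed
  then have "\<exists>\<tau>. \<forall>p\<in>dots N. {p, \<tau> p} \<in> D" by metis
  then obtain \<tau> where \<tau>: "\<And>p. p \<in> dots N \<Longrightarrow> {p, \<tau> p} \<in> D" by blast
  have inD: "\<tau> p \<in> dots N" "\<tau> p \<noteq> p" if p: "p \<in> dots N" for p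
  proof -
    obtain x y where "x \<noteq> y" "x \<in> dots N" "y \<in> dots N" "{p, \<tau> p} = {x, y}" using edge[OF \<tau>[OF p]] by blast
    then show "\<tau> p \<in> dots N" "\<tau> p \<noteq> p" by (auto simp: doubleton_eq_iff)
  qed
  have fpf: "fpf_invol (dots N) \<tau>"
    unfolding fpf_invol_def
  proof (intro ballI conjI inD)
    fix p assume p: "p \<in> dots N"
    have "{\<tau> p, \<tau> (\<tau> p)} = {p, \<tau> p}"
      using uniq[OF inD(1)[OF p]] \<tau>[OF p] \<tau>[OF inD(1)[OF p]] by blast
    then show "\<tau> (\<tau> p) = p" using inD(2)[OF p] by (auto simp: doubleton_eq_iff)
  qed
  have "D = diag N \<tau>"
  proof
    show "diag N \<tau> \<subseteq> D" using \<tau> by (auto simp: diag_def)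
    show "D \<subseteq> diag N \<tau>"
    proof
      fix e assume e: "e \<in> D"
      then obtain x y where xy: "x \<in> dots N" "e = {x, y}" using edge by blast
      then have "e = {x, \<tau> x}" using uniq[OF xy(1)] \<tau>[OF xy(1)] e by blast
      then show "e \<in> diag N \<tau>" using diag_member[OF xy(1)] by simp
    qed
  qed
  then show thesis using that fpf by blast
qed

lemma bar_dot_eq: "bar_dot n p = reflect (2 * n) p"
  by (simp add: bar_dot_def reflect_def bar_def)

lemma symmetric_diag:
  assumes \<tau>: "fpf_invol (dots_of n) \<tau>"
  shows "symmetric_diagram (2 * n) (diag (2 * n) \<tau>) \<longleftrightarrow> sym_match (dots_of n) (bar_dot n) \<tau>"
proof -
  have \<rho>: "fpf_invol (dots_of n) (bar_dot n)" by (rule fpf_bar_dot)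
  have im: "(\<lambda>e. reflect (2 * n) ` e) ` diag (2 * n) \<tau> = {{bar_dot n p, bar_dot n (\<tau> p)} | p. p \<in> dots_of n}"
  proof -
    have "reflect (2 * n) = bar_dot n" by (rule ext) (simp add: bar_dot_eq)
    then show ?thesis unfolding diag_def Setcompr_eq_image image_image dots_of_eq by simp
  qed
  show ?thesis
  proof
    assume "symmetric_diagram (2 * n) (diag (2 * n) \<tau>)"
    then have eq: "{{bar_dot n p, bar_dot n (\<tau> p)} | p. p \<in> dots_of n} = diag (2 * n) \<tau>"
      by (simp add: symmetric_diagram_def im)
    have "\<tau> (bar_dot n p) = bar_dot n (\<tau> p)" if "p \<in> dots_of n" for p
    proof -
      have "{bar_dot n p, bar_dot n (\<tau> p)} \<in> diag (2 * n) \<tau>" unfolding eq[symmetric] using that by blast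
      then show ?thesis using diag_edge(2)[of "2 * n" \<tau>] \<tau> by (simp add: dots_of_eq)
    qed
    then show "sym_match (dots_of n) (bar_dot n) \<tau>" using \<tau> \<rho> by (simp add: sym_match_def)
  next
    assume m: "sym_match (dots_of n) (bar_dot n) \<tau>"
    have "{{bar_dot n p, bar_dot n (\<tau> p)} | p. p \<in> dots_of n} = {{p, \<tau> p} | p. p \<in> dots_of n}"
    proof -
      have "{{bar_dot n p, bar_dot n (\<tau> p)} | p. p \<in> dots_of n} = (\<lambda>p. {p, \<tau> p}) ` (bar_dot n ` dots_of n)"
        unfolding Setcompr_eq_image image_image by (rule image_cong) (simp_all add: sym_matchD(3)[OF m])
      also have "bar_dot n ` dots_of n = dots_of n"
      proof
        show "bar_dot n ` dots_of n \<subseteq> dots_of n" using fpf_invol_in[OF \<rho>] by blast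
        show "dots_of n \<subseteq> bar_dot n ` dots_of n"
        proof
          fix p assume p: "p \<in> dots_of n"
          show "p \<in> bar_dot n ` dots_of n"
            using fpf_invol_twice[OF \<rho> p, symmetric] fpf_invol_in[OF \<rho> p] by (rule image_eqI)
        qed
      qed
      finally show ?thesis unfolding Setcompr_eq_image .
    qed
    then show "symmetric_diagram (2 * n) (diag (2 * n) \<tau>)"
      unfolding symmetric_diagram_def im by (simp add: diag_def dots_of_eq)
  qed
qed

lemma composable_diag:
  assumes "pairs_on N a" "fpf_invol (dots N) \<tau>"
  shows "composable N a (diag N \<tau>)" "composable N (diag N \<tau>) a"
proof -
  have d: "e \<subseteq> dots N" if "e \<in> a" for e using pairs_on_dots[OF assms(1) that] .
  have d': "e \<subseteq> dots N" if "e \<in> diag N \<tau>" for e using pairs_on_dots[OF pairs_on_diag[OF assms(2)] that] .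
  have c: "p \<in> \<Union>(diag N \<tau>)" if "p \<in> dots N" for p
    using diag_member[OF that, of \<tau>] by (rule UnionI) simp
  show "composable N a (diag N \<tau>)"
  proof
    fix j assume "j \<in> {1..N}"
    then show "(j, False) \<in> \<Union>a \<or> (j, True) \<in> \<Union>(diag N \<tau>)" using c[of "(j, True)"] by simp
  qed (rule d d', assumption)+
  show "composable N (diag N \<tau>) a"
  proof
    fix j assume "j \<in> {1..N}"
    then show "(j, False) \<in> \<Union>(diag N \<tau>) \<or> (j, True) \<in> \<Union>a" using c[of "(j, False)"] by simp
  qed (rule d d', assumption)+
qed

lemma diagram_comp_eqI:
  assumes "composable N a b" "pairs_on N D"
    and "\<And>x y. x \<in> colorings N \<Longrightarrow> y \<in> colorings N \<Longrightarrow>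
      (\<Sum>m\<in>colorings N. kernel a x m * kernel b m y) = 2 ^ k * kernel D x y"
  shows "diagram_comp a b = D" "num_loops a b = k"
  using scaled_kernel_determines[OF composable.pairs_on_comp[OF assms(1)] assms(2), of "num_loops a b" k]
    assms(3) composable.kernel_comp[OF assms(1)] by simp_all

text \<open>Matrix multiplication is associative, and powers of 2 record the loops; paths through
  three stacked diagrams are never traced. The outer factors are matchings, which makes all four
  compositions \<open>composable\<close>.\<close>

lemma diagram_comp_assoc:
  assumes "fpf_invol (dots N) \<alpha>" "fpf_invol (dots N) \<gamma>" and b: "pairs_on N b"
  defines "a \<equiv> diag N \<alpha>" and "c \<equiv> diag N \<gamma>"
  shows "diagram_comp (diagram_comp a b) c = diagram_comp a (diagram_comp b c)"
    "num_loops a b + num_loops (diagram_comp a b) c = num_loops b c + num_loops a (diagram_comp b c)"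
proof -
  have ab: "composable N a b" and bc: "composable N b c"
    using composable_diag[OF b] assms(1,2) by (simp_all add: a_def c_def)
  note pab = composable.pairs_on_comp[OF ab] and pbc = composable.pairs_on_comp[OF bc]
  have ab_c: "composable N (diagram_comp a b) c" and a_bc: "composable N a (diagram_comp b c)"
    using composable_diag(1)[OF pab assms(2)] composable_diag(2)[OF pbc assms(1)] by (simp_all add: a_def c_def)
  have "2 ^ (num_loops a b + num_loops (diagram_comp a b) c) * kernel (diagram_comp (diagram_comp a b) c) x y =
      2 ^ (num_loops b c + num_loops a (diagram_comp b c)) * kernel (diagram_comp a (diagram_comp b c)) x y" for x y
  proof -
    let ?C = "colorings N"
    have "2 ^ (num_loops a b + num_loops (diagram_comp a b) c) * kernel (diagram_comp (diagram_comp a b) c) x y =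
        2 ^ num_loops a b * (\<Sum>k\<in>?C. kernel (diagram_comp a b) x k * kernel c k y)"
      by (simp add: composable.kernel_comp[OF ab_c] power_add)
    also have "\<dots> = (\<Sum>k\<in>?C. (\<Sum>m\<in>?C. kernel a x m * kernel b m k) * kernel c k y)"
      unfolding composable.kernel_comp[OF ab] by (simp add: sum_distrib_left mult.assoc)
    also have "\<dots> = (\<Sum>k\<in>?C. \<Sum>m\<in>?C. kernel a x m * (kernel b m k * kernel c k y))"
      by (simp add: sum_distrib_right mult.assoc)
    also have "\<dots> = (\<Sum>m\<in>?C. \<Sum>k\<in>?C. kernel a x m * (kernel b m k * kernel c k y))"
      by (rule sum.swap)
    also have "\<dots> = (\<Sum>m\<in>?C. kernel a x m * (\<Sum>k\<in>?C. kernel b m k * kernel c k y))"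
      by (simp add: sum_distrib_left)
    also have "\<dots> = 2 ^ num_loops b c * (\<Sum>m\<in>?C. kernel a x m * kernel (diagram_comp b c) m y)"
      unfolding composable.kernel_comp[OF bc] by (simp add: sum_distrib_left mult.left_commute)
    finally show ?thesis by (simp add: composable.kernel_comp[OF a_bc] power_add)
  qed
  then show "diagram_comp (diagram_comp a b) c = diagram_comp a (diagram_comp b c)"
    "num_loops a b + num_loops (diagram_comp a b) c = num_loops b c + num_loops a (diagram_comp b c)"
    using scaled_kernel_determines[OF composable.pairs_on_comp[OF ab_c] composable.pairs_on_comp[OF a_bc]] by blast+
qed

section \<open>Left multiplication by the diagrams \<open>R\<close> and \<open>E\<close>\<close>

definition sw :: "nat \<Rightarrow> nat \<Rightarrow> nat" where
  "sw j k = (if k = j then j + 1 else if k = j + 1 then j else k)"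

lemma sw_sw [simp]: "sw j (sw j k) = k"
  by (simp add: sw_def)

lemma inv_sw [simp]: "inv (sw j) = sw j"
  by (rule inv_equality) simp_all

lemma sw_in: "1 \<le> j \<Longrightarrow> j < N \<Longrightarrow> sw j k \<in> {1..N} \<longleftrightarrow> k \<in> {1..N}"
  by (auto simp: sw_def)

definition R_match :: "nat \<Rightarrow> dot \<Rightarrow> dot" where
  "R_match j p = (sw j (fst p), \<not> snd p)"

definition E_match :: "nat \<Rightarrow> dot \<Rightarrow> dot" where
  "E_match j p = (sw j (fst p), if fst p \<in> {j, j + 1} then snd p else \<not> snd p)"

lemma fpf_R_match: "1 \<le> j \<Longrightarrow> j < N \<Longrightarrow> fpf_invol (dots N) (R_match j)"
  unfolding fpf_invol_def
proof
  fix p assume j: "1 \<le> j" "j < N" and p: "p \<in> dots N"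
  obtain k s where ks: "p = (k, s)" by (cases p)
  show "R_match j p \<in> dots N \<and> R_match j p \<noteq> p \<and> R_match j (R_match j p) = p"
    using p j sw_in[OF j, of k] unfolding ks by (auto simp: R_match_def)
qed

lemma fpf_E_match: "1 \<le> j \<Longrightarrow> j < N \<Longrightarrow> fpf_invol (dots N) (E_match j)"
  unfolding fpf_invol_def
proof
  fix p assume j: "1 \<le> j" "j < N" and p: "p \<in> dots N"
  obtain k s where ks: "p = (k, s)" by (cases p)
  show "E_match j p \<in> dots N \<and> E_match j p \<noteq> p \<and> E_match j (E_match j p) = p"
    using p j sw_in[OF j, of k] unfolding ks by (auto simp: E_match_def sw_def)
qed

lemma R_diag_eq:
  assumes "1 \<le> j" "j < N"
  shows "R_diag N j = diag N (R_match j)"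
proof
  show "R_diag N j \<subseteq> diag N (R_match j)"
  proof
    fix e assume "e \<in> R_diag N j"
    then consider "e = {(j, True), (j + 1, False)}" | "e = {(j + 1, True), (j, False)}"
      | k where "e = {(k, True), (k, False)}" "k \<in> {1..N}" "k \<noteq> j" "k \<noteq> j + 1"
      by (auto simp: R_diag_def)
    then show "e \<in> diag N (R_match j)"
    proof cases
      case 1
      then show ?thesis using diag_member[of "(j, True)" N "R_match j"] assms by (simp add: R_match_def sw_def)
    next
      case 2
      then show ?thesis using diag_member[of "(j + 1, True)" N "R_match j"] assms by (simp add: R_match_def sw_def)
    next
      case (3 k)
      then show ?thesis using diag_member[of "(k, True)" N "R_match j"] by (simp add: R_match_def sw_def)
    qed
  qed
  show "diag N (R_match j) \<subseteq> R_diag N j"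
  proof
    fix e assume "e \<in> diag N (R_match j)"
    then obtain k s where k: "k \<in> {1..N}" "e = {(k, s), R_match j (k, s)}" by (rule diag_elem)
    consider "k = j" | "k = j + 1" | "k \<noteq> j" "k \<noteq> j + 1" by blast
    then show "e \<in> R_diag N j"
      using k by cases (cases s; auto simp: R_diag_def R_match_def sw_def insert_commute)+
  qed
qed

lemma E_diag_eq:
  assumes "1 \<le> j" "j < N"
  shows "E_diag N j = diag N (E_match j)"
proof
  show "E_diag N j \<subseteq> diag N (E_match j)"
  proof
    fix e assume "e \<in> E_diag N j"
    then consider "e = {(j, True), (j + 1, True)}" | "e = {(j, False), (j + 1, False)}"
      | k where "e = {(k, True), (k, False)}" "k \<in> {1..N}" "k \<noteq> j" "k \<noteq> j + 1"
      by (auto simp: E_diag_def)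
    then show "e \<in> diag N (E_match j)"
    proof cases
      case 1
      then show ?thesis using diag_member[of "(j, True)" N "E_match j"] assms by (simp add: E_match_def sw_def)
    next
      case 2
      then show ?thesis using diag_member[of "(j, False)" N "E_match j"] assms by (simp add: E_match_def sw_def)
    next
      case (3 k)
      then show ?thesis using diag_member[of "(k, True)" N "E_match j"] by (simp add: E_match_def sw_def)
    qed
  qed
  show "diag N (E_match j) \<subseteq> E_diag N j"
  proof
    fix e assume "e \<in> diag N (E_match j)"
    then obtain k s where k: "k \<in> {1..N}" "e = {(k, s), E_match j (k, s)}" by (rule diag_elem)
    consider "k = j" | "k = j + 1" | "k \<noteq> j" "k \<noteq> j + 1" by blast
    then show "e \<in> E_diag N j"
      using k by cases (cases s; auto simp: E_diag_def E_match_def sw_def insert_commute)+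
  qed
qed

lemma id_diag_eq: "id_diag N = diag N (\<lambda>p. (fst p, \<not> snd p))"
proof
  show "id_diag N \<subseteq> diag N (\<lambda>p. (fst p, \<not> snd p))"
  proof
    fix e assume "e \<in> id_diag N"
    then obtain k where "k \<in> {1..N}" "e = {(k, True), (k, False)}" by (auto simp: id_diag_def)
    then show "e \<in> diag N (\<lambda>p. (fst p, \<not> snd p))"
      using diag_member[of "(k, True)" N "\<lambda>p. (fst p, \<not> snd p)"] by simp
  qed
  show "diag N (\<lambda>p. (fst p, \<not> snd p)) \<subseteq> id_diag N"
  proof
    fix e assume "e \<in> diag N (\<lambda>p. (fst p, \<not> snd p))"
    then obtain k s where "k \<in> {1..N}" "e = {(k, s), (\<lambda>p. (fst p, \<not> snd p)) (k, s)}" by (rule diag_elem)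
    then show "e \<in> id_diag N" by (cases s) (auto simp: id_diag_def insert_commute)
  qed
qed

lemma all_dots: "(\<forall>p\<in>dots N. P p) \<longleftrightarrow> (\<forall>k\<in>{1..N}. P (k, True) \<and> P (k, False))"
  by (metis (full_types) dots_iff surj_pair)

definition swap_op :: "nat \<Rightarrow> ((nat \<Rightarrow> bool) \<Rightarrow> nat) \<Rightarrow> (nat \<Rightarrow> bool) \<Rightarrow> nat" where
  "swap_op j \<psi> x = \<psi> (x(j := x (j + 1), j + 1 := x j))"

definition cap_op :: "nat \<Rightarrow> ((nat \<Rightarrow> bool) \<Rightarrow> nat) \<Rightarrow> (nat \<Rightarrow> bool) \<Rightarrow> nat" where
  "cap_op j \<psi> x = (if x j = x (j + 1)
     then \<psi> (x(j := False, j + 1 := False)) + \<psi> (x(j := True, j + 1 := True)) else 0)"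

lemma swap_coloring: "x(j := x (j + 1), j + 1 := x j) = x \<circ> sw j"
  by (auto simp: fun_eq_iff sw_def)

lemma colorings_swap: "1 \<le> j \<Longrightarrow> j < N \<Longrightarrow> x \<in> colorings N \<Longrightarrow> x(j := x (j + 1), j + 1 := x j) \<in> colorings N"
  by (auto simp: colorings_def)

lemma colorings_upd: "1 \<le> j \<Longrightarrow> j < N \<Longrightarrow> x \<in> colorings N \<Longrightarrow> x(j := u, j + 1 := v) \<in> colorings N"
  by (auto simp: colorings_def)

lemma swap_op_kernel:
  assumes j: "1 \<le> j" "j < N" and x: "x \<in> colorings N"
  shows "(\<Sum>m\<in>colorings N. kernel (R_diag N j) x m * \<psi> m) = swap_op j \<psi> x"
proof -
  have "kernel (R_diag N j) x m = of_bool (m = x \<circ> sw j)" if m: "m \<in> colorings N" for m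
  proof -
    have "monochrome (mix x m) (R_diag N j) \<longleftrightarrow> (\<forall>k\<in>{1..N}. x k = m (sw j k) \<and> m k = x (sw j k))"
      unfolding R_diag_eq[OF j] monochrome_diag all_dots by (simp add: mix_def R_match_def)
    also have "\<dots> \<longleftrightarrow> (\<forall>k\<in>{1..N}. m k = x (sw j k))"
    proof
      assume *: "\<forall>k\<in>{1..N}. m k = x (sw j k)"
      show "\<forall>k\<in>{1..N}. x k = m (sw j k) \<and> m k = x (sw j k)"
      proof
        fix k assume k: "k \<in> {1..N}"
        then have "m (sw j k) = x (sw j (sw j k))" using bspec[OF *] sw_in[OF j] by blast
        then show "x k = m (sw j k) \<and> m k = x (sw j k)" using bspec[OF * k] by simp
      qed
    qed simp
    also have "\<dots> \<longleftrightarrow> m = x \<circ> sw j"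
    proof
      assume *: "\<forall>k\<in>{1..N}. m k = x (sw j k)"
      show "m = x \<circ> sw j"
      proof
        fix k
        show "m k = (x \<circ> sw j) k"
        proof (cases "k \<in> {1..N}")
          case True
          then show ?thesis using bspec[OF * True] by simp
        next
          case False
          then have "\<not> m k" "\<not> x (sw j k)" using m x sw_in[OF j, of k] unfolding colorings_def by blast+
          then show ?thesis by simp
        qed
      qed
    qed simp
    finally show ?thesis by (simp add: kernel_def)
  qed
  then have "(\<Sum>m\<in>colorings N. kernel (R_diag N j) x m * \<psi> m) = (\<Sum>m\<in>colorings N. if m = x \<circ> sw j then \<psi> m else 0)"
    by (intro sum.cong) auto
  also have "\<dots> = \<psi> (x \<circ> sw j)"
    using colorings_swap[OF j x] finite_colorings unfolding swap_coloring by simp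
  finally show ?thesis unfolding swap_op_def swap_coloring .
qed

text \<open>The arcs of \<open>E\<close> force equal colours on the two dots in each row. For a
  given \<open>x\<close> this leaves the two middle colourings with a common value on
  \<open>j\<close> and \<open>j + 1\<close>.\<close>

lemma cap_op_kernel:
  assumes j: "1 \<le> j" "j < N" and x: "x \<in> colorings N"
  shows "(\<Sum>m\<in>colorings N. kernel (E_diag N j) x m * \<psi> m) = cap_op j \<psi> x"
proof -
  let ?m = "\<lambda>b. x(j := b, j + 1 := b)"
  have "kernel (E_diag N j) x m = of_bool (x j = x (j + 1)) * (of_bool (m = ?m False) + of_bool (m = ?m True))"
    if m: "m \<in> colorings N" for m
  proof -
    have "monochrome (mix x m) (E_diag N j) \<longleftrightarrow> (\<forall>k\<in>{1..N}.
        if k \<in> {j, j + 1} then x k = x (sw j k) \<and> m k = m (sw j k) else x k = m k)"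
      unfolding E_diag_eq[OF j] monochrome_diag all_dots by (rule ball_cong) (auto simp: mix_def E_match_def sw_def)
    also have "\<dots> \<longleftrightarrow> x j = x (j + 1) \<and> m j = m (j + 1) \<and> (\<forall>k\<in>{1..N} - {j, j + 1}. m k = x k)"
    proof
      assume *: "\<forall>k\<in>{1..N}. if k \<in> {j, j + 1} then x k = x (sw j k) \<and> m k = m (sw j k) else x k = m k"
      have "j \<in> {1..N}" using j by simp
      from bspec[OF * this] have "x j = x (j + 1)" "m j = m (j + 1)" by (simp_all add: sw_def)
      moreover have "m k = x k" if "k \<in> {1..N} - {j, j + 1}" for k
        using bspec[OF *, of k] that by auto
      ultimately show "x j = x (j + 1) \<and> m j = m (j + 1) \<and> (\<forall>k\<in>{1..N} - {j, j + 1}. m k = x k)" by blast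
    next
      assume *: "x j = x (j + 1) \<and> m j = m (j + 1) \<and> (\<forall>k\<in>{1..N} - {j, j + 1}. m k = x k)"
      then have rest: "m k = x k" if "k \<in> {1..N}" "k \<noteq> j" "k \<noteq> j + 1" for k using that by blast
      show "\<forall>k\<in>{1..N}. if k \<in> {j, j + 1} then x k = x (sw j k) \<and> m k = m (sw j k) else x k = m k"
      proof
        fix k assume "k \<in> {1..N}"
        then show "if k \<in> {j, j + 1} then x k = x (sw j k) \<and> m k = m (sw j k) else x k = m k"
          using conjunct1[OF *] conjunct1[OF conjunct2[OF *]] rest[of k]
          by (cases "k = j"; cases "k = j + 1") (simp_all add: sw_def)
      qed
    qed
    also have "\<dots> \<longleftrightarrow> x j = x (j + 1) \<and> m = ?m (m j)"
    proof
      assume *: "x j = x (j + 1) \<and> m j = m (j + 1) \<and> (\<forall>k\<in>{1..N} - {j, j + 1}. m k = x k)"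
      have "m k = (?m (m j)) k" for k
      proof -
        have "m k = x k" if "k \<noteq> j" "k \<noteq> j + 1"
        proof (cases "k \<in> {1..N}")
          case False
          then have "\<not> m k" "\<not> x k" using m x unfolding colorings_def by blast+
          then show ?thesis by simp
        qed (use * that in blast)
        then show ?thesis using conjunct1[OF conjunct2[OF *]] by simp
      qed
      then show "x j = x (j + 1) \<and> m = ?m (m j)" using conjunct1[OF *] by blast
    next
      assume *: "x j = x (j + 1) \<and> m = ?m (m j)"
      have "m (j + 1) = m j" using fun_cong[OF conjunct2[OF *], of "j + 1"] by (simp only: fun_upd_same)
      moreover have "m k = x k" if "k \<in> {1..N} - {j, j + 1}" for k
      proof -
        have "k \<noteq> j" "k \<noteq> j + 1" using that by auto
        with fun_cong[OF conjunct2[OF *], of k] show ?thesis by (simp only: fun_upd_other not_False_eq_True)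
      qed
      ultimately show "x j = x (j + 1) \<and> m j = m (j + 1) \<and> (\<forall>k\<in>{1..N} - {j, j + 1}. m k = x k)"
        using conjunct1[OF *] by metis
    qed
    also have "\<dots> \<longleftrightarrow> x j = x (j + 1) \<and> (m = ?m False \<or> m = ?m True)"
      by (cases "m j") auto
    finally have "monochrome (mix x m) (E_diag N j) \<longleftrightarrow> x j = x (j + 1) \<and> (m = ?m False \<or> m = ?m True)" .
    moreover have "?m False \<noteq> ?m True" by (metis fun_upd_same)
    ultimately show ?thesis by (auto simp: kernel_def)
  qed
  then have "(\<Sum>m\<in>colorings N. kernel (E_diag N j) x m * \<psi> m) =
      of_bool (x j = x (j + 1)) * ((\<Sum>m\<in>colorings N. if m = ?m False then \<psi> m else 0) + (\<Sum>m\<in>colorings N. if m = ?m True then \<psi> m else 0))"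
    unfolding sum.distrib[symmetric] sum_distrib_left by (intro sum.cong) auto
  also have "\<dots> = of_bool (x j = x (j + 1)) * (\<psi> (?m False) + \<psi> (?m True))"
    using colorings_upd[OF j x] finite_colorings by simp
  finally show ?thesis by (simp add: cap_op_def)
qed

lemma fpf_act_sw:
  assumes j: "1 \<le> j" "j < N" and \<tau>: "fpf_invol (dots N) \<tau>"
  shows "fpf_invol (dots N) (act_top (sw j) \<tau>)"
proof -
  have L: "lift_top (sw j) (lift_top (sw j) p) = p" for p by (cases p; cases "snd p") auto
  have Ld: "lift_top (sw j) p \<in> dots N \<longleftrightarrow> p \<in> dots N" for p
    using sw_in[OF j, of "fst p"] by (cases p; cases "snd p") auto
  have Li: "lift_top (sw j) p = q \<longleftrightarrow> p = lift_top (sw j) q" for p q using L by metis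
  show ?thesis
    unfolding fpf_invol_def act_top_def inv_sw
  proof
    fix p assume "p \<in> dots N"
    then have p: "lift_top (sw j) p \<in> dots N" using Ld by simp
    show "lift_top (sw j) (\<tau> (lift_top (sw j) p)) \<in> dots N \<and> lift_top (sw j) (\<tau> (lift_top (sw j) p)) \<noteq> p \<and>
      lift_top (sw j) (\<tau> (lift_top (sw j) (lift_top (sw j) (\<tau> (lift_top (sw j) p))))) = p"
      using fpf_invol_in[OF \<tau> p] fpf_invol_neq[OF \<tau> p] fpf_invol_twice[OF \<tau> p] by (simp only: Ld L Li) simp
  qed
qed

text \<open>Composite and number of loops are found by comparing kernels: permuting the colours of
  the top row has the same effect as moving the top endpoints of \<open>\<tau>\<close>.\<close>

lemma R_step:
  assumes j: "1 \<le> j" "j < N" and \<tau>: "fpf_invol (dots N) \<tau>"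
  shows "diagram_comp (R_diag N j) (diag N \<tau>) = diag N (act_top (sw j) \<tau>)"
    "num_loops (R_diag N j) (diag N \<tau>) = 0"
proof -
  have c: "composable N (R_diag N j) (diag N \<tau>)"
    using composable_diag(1)[OF pairs_on_diag[OF fpf_R_match[OF j]] \<tau>] R_diag_eq[OF j] by simp
  have p: "pairs_on N (diag N (act_top (sw j) \<tau>))" using fpf_act_sw[OF j \<tau>] by (rule pairs_on_diag)
  have k: "(\<Sum>m\<in>colorings N. kernel (R_diag N j) x m * kernel (diag N \<tau>) m y) = 2 ^ 0 * kernel (diag N (act_top (sw j) \<tau>)) x y"
    if x: "x \<in> colorings N" for x y
  proof -
    let ?L = "lift_top (sw j)"
    have L: "?L (?L p) = p" for p by (cases p; cases "snd p") auto
    have Ld: "?L p \<in> dots N \<longleftrightarrow> p \<in> dots N" for p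
      using sw_in[OF j, of "fst p"] by (cases p; cases "snd p") auto
    have m: "mix (x \<circ> sw j) y p = mix x y (?L p)" for p by (cases p; cases "snd p") (auto simp: mix_def)
    have "monochrome (mix (x \<circ> sw j) y) (diag N \<tau>) \<longleftrightarrow> (\<forall>p\<in>dots N. mix x y (?L p) = mix x y (?L (\<tau> p)))"
      by (simp add: monochrome_diag m)
    also have "\<dots> \<longleftrightarrow> (\<forall>p\<in>dots N. mix x y p = mix x y (?L (\<tau> (?L p))))"
    proof
      assume *: "\<forall>p\<in>dots N. mix x y (?L p) = mix x y (?L (\<tau> p))"
      show "\<forall>p\<in>dots N. mix x y p = mix x y (?L (\<tau> (?L p)))"
      proof
        fix p assume "p \<in> dots N"
        then have "?L p \<in> dots N" using Ld by simp
        from bspec[OF * this] show "mix x y p = mix x y (?L (\<tau> (?L p)))" by (simp only: L)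
      qed
    next
      assume *: "\<forall>p\<in>dots N. mix x y p = mix x y (?L (\<tau> (?L p)))"
      show "\<forall>p\<in>dots N. mix x y (?L p) = mix x y (?L (\<tau> p))"
      proof
        fix p assume "p \<in> dots N"
        then have "?L p \<in> dots N" using Ld by simp
        from bspec[OF * this] show "mix x y (?L p) = mix x y (?L (\<tau> p))" by (simp only: L)
      qed
    qed
    also have "\<dots> \<longleftrightarrow> monochrome (mix x y) (diag N (act_top (sw j) \<tau>))"
      by (simp add: monochrome_diag act_top_def)
    finally show ?thesis
      unfolding swap_op_kernel[OF j x] swap_op_def swap_coloring by (simp add: kernel_def)
  qed
  show "diagram_comp (R_diag N j) (diag N \<tau>) = diag N (act_top (sw j) \<tau>)"
    "num_loops (R_diag N j) (diag N \<tau>) = 0"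
    using diagram_comp_eqI[OF c p k] by blast+
qed

text \<open>Kernels are compared again. The sum over the common colour of the two middle dots has
  two equal terms if \<open>\<tau>\<close> joins them, which is the loop; otherwise it expresses
  that the partners of the two dots have the same colour.\<close>

lemma E_step:
  assumes j: "1 \<le> j" "j < N" and \<tau>: "fpf_invol (dots N) \<tau>"
  shows "diagram_comp (E_diag N j) (diag N \<tau>) = diag N (join (j, True) (j + 1, True) \<tau>)"
    "num_loops (E_diag N j) (diag N \<tau>) = (if \<tau> (j, True) = (j + 1, True) then 1 else 0)"
proof -
  let ?P = "(j, True)" and ?Q = "(j + 1, True)"
  let ?t = "join ?P ?Q \<tau>"
  have PQ: "?P \<in> dots N" "?Q \<in> dots N" "?P \<noteq> ?Q" using j by auto
  have c: "composable N (E_diag N j) (diag N \<tau>)"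
    using composable_diag(1)[OF pairs_on_diag[OF fpf_E_match[OF j]] \<tau>] E_diag_eq[OF j] by simp
  have p: "pairs_on N (diag N ?t)" using fpf_invol_join[OF \<tau> PQ] by (rule pairs_on_diag)
  have k: "(\<Sum>m\<in>colorings N. kernel (E_diag N j) x m * kernel (diag N \<tau>) m y) =
      2 ^ (if \<tau> ?P = ?Q then 1 else 0) * kernel (diag N ?t) x y"
    if x: "x \<in> colorings N" for x y
  proof -
    let ?c = "mix x y"
    have m: "mix (x(j := b, j + 1 := b)) y = ?c(?P := b, ?Q := b)" for b
      by (auto simp: mix_def fun_eq_iff)
    have cPQ: "?c ?P = x j" "?c ?Q = x (j + 1)" by (simp_all add: mix_def)
    have tP: "?t ?P = ?Q"
    proof (cases "\<tau> ?P = ?Q")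
      case False
      then have "\<tau> ?Q \<noteq> ?P" using fpf_invol_swap[OF \<tau> PQ(2,1)] by auto
      then show ?thesis using False fpf_invol_neq[OF \<tau> PQ(1)] unfolding join_def by auto
    qed (simp add: join_def)
    show ?thesis
    proof (cases "x j = x (j + 1)")
      case False
      have "\<not> monochrome ?c (diag N ?t)"
      proof
        assume "monochrome ?c (diag N ?t)"
        then have "?c ?P = ?c (?t ?P)" using PQ(1) unfolding monochrome_diag by blast
        then show False using False unfolding tP cPQ by simp
      qed
      then show ?thesis unfolding cap_op_kernel[OF j x] using False by (simp add: cap_op_def kernel_def)
    next
      case eq: True
      show ?thesis
      proof (cases "\<tau> ?P = ?Q")
        case True
        then have tQ: "\<tau> ?Q = ?P" using fpf_invol_twice[OF \<tau> PQ(1)] by simp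
        have o: "\<tau> p \<noteq> ?P" "\<tau> p \<noteq> ?Q" if "p \<in> dots N" "p \<noteq> ?P" "p \<noteq> ?Q" for p
          using that True tQ fpf_invol_twice[OF \<tau> that(1)] by metis+
        have "monochrome (?c(?P := b, ?Q := b)) (diag N \<tau>) \<longleftrightarrow> monochrome ?c (diag N \<tau>)" for b
          unfolding monochrome_diag
        proof (rule ball_cong)
          fix p assume p: "p \<in> dots N"
          consider "p = ?P" | "p = ?Q" | "p \<noteq> ?P" "p \<noteq> ?Q" by blast
          then show "((?c(?P := b, ?Q := b)) p = (?c(?P := b, ?Q := b)) (\<tau> p)) \<longleftrightarrow> (?c p = ?c (\<tau> p))"
            using True tQ eq cPQ o[OF p] by cases simp_all
        qed simp
        moreover have "?t = \<tau>" using True by (simp add: join_def)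
        ultimately show ?thesis
          unfolding cap_op_kernel[OF j x] unfolding cap_op_def kernel_def m using eq True by simp
      next
        case False
        define u where "u = \<tau> ?P"
        define v where "v = \<tau> ?Q"
        have uv: "u \<in> dots N" "v \<in> dots N" "u \<noteq> ?P" "u \<noteq> ?Q" "v \<noteq> ?P" "v \<noteq> ?Q" "\<tau> u = ?P" "\<tau> v = ?Q" "u \<noteq> v"
          using \<tau> PQ False fpf_invol_swap[OF \<tau> PQ(2,1)] fpf_invol_eq[OF \<tau> PQ(1,2)]
          by (auto simp: u_def v_def fpf_invol_in fpf_invol_neq fpf_invol_twice)
        have o: "\<tau> p \<notin> {?P, ?Q, u, v}" if "p \<in> dots N" "p \<notin> {?P, ?Q, u, v}" for p
          using that u_def v_def uv(7,8) fpf_invol_twice[OF \<tau> that(1)] by auto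
        let ?rest = "\<forall>p\<in>dots N - {?P, ?Q, u, v}. ?c p = ?c (\<tau> p)"
        have split: "(\<forall>p\<in>dots N. F p) \<longleftrightarrow> F ?P \<and> F ?Q \<and> F u \<and> F v \<and> (\<forall>p\<in>dots N - {?P, ?Q, u, v}. F p)" for F
          using PQ uv by blast
        have 1: "monochrome (?c(?P := b, ?Q := b)) (diag N \<tau>) \<longleftrightarrow> ?c u = b \<and> ?c v = b \<and> ?rest" for b
        proof -
          have "(\<forall>p\<in>dots N - {?P, ?Q, u, v}. (?c(?P := b, ?Q := b)) p = (?c(?P := b, ?Q := b)) (\<tau> p)) \<longleftrightarrow> ?rest"
            by (rule ball_cong) (use o in auto)
          then show ?thesis unfolding monochrome_diag split using uv u_def v_def by auto
        qed
        have t: "?t = \<tau>(?P := ?Q, ?Q := ?P, u := v, v := u)" using False by (simp add: join_def u_def v_def)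
        have 2: "monochrome ?c (diag N ?t) \<longleftrightarrow> ?c u = ?c v \<and> ?rest"
        proof -
          have tr: "?t p = \<tau> p" if "p \<in> dots N - {?P, ?Q, u, v}" for p
            using that unfolding t by simp
          have tv: "?t ?Q = ?P" "?t u = v" "?t v = u"
            using uv PQ(3) unfolding t by simp_all
          have "(\<forall>p\<in>dots N - {?P, ?Q, u, v}. ?c p = ?c (?t p)) \<longleftrightarrow> ?rest"
            by (rule ball_cong) (simp_all only: tr)
          then show ?thesis unfolding monochrome_diag split tP tv using eq cPQ by simp blast
        qed
        show ?thesis
          unfolding cap_op_kernel[OF j x] unfolding cap_op_def kernel_def m 1 2 using eq False by auto
      qed
    qed
  qed
  show "diagram_comp (E_diag N j) (diag N \<tau>) = diag N ?t"
    "num_loops (E_diag N j) (diag N \<tau>) = (if \<tau> ?P = ?Q then 1 else 0)"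
    using diagram_comp_eqI[OF c p k] by blast+
qed

section \<open>The relations in the colouring representation\<close>

text \<open>\<open>swap_op\<close> and \<open>cap_op\<close> for two arbitrary dots: the relations
  are proved for distinct named dots and specialised to adjacent positions afterwards.\<close>

definition swp :: "nat \<Rightarrow> nat \<Rightarrow> ((nat \<Rightarrow> bool) \<Rightarrow> nat) \<Rightarrow> (nat \<Rightarrow> bool) \<Rightarrow> nat" where
  "swp a b \<psi> x = \<psi> (x(a := x b, b := x a))"

definition cap :: "nat \<Rightarrow> nat \<Rightarrow> ((nat \<Rightarrow> bool) \<Rightarrow> nat) \<Rightarrow> (nat \<Rightarrow> bool) \<Rightarrow> nat" where
  "cap a b \<psi> x = (if x a = x b then \<psi> (x(a := False, b := False)) + \<psi> (x(a := True, b := True)) else 0)"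

lemma swp_sym: "swp a b = swp b a"
  by (cases "a = b") (auto simp: swp_def fun_eq_iff fun_upd_twist)

lemma cap_sym: "cap a b = cap b a"
  by (cases "a = b") (auto simp: cap_def fun_eq_iff fun_upd_twist)

lemma cap_scale: "cap a b (\<lambda>x. k * \<psi> x) = (\<lambda>x. k * cap a b \<psi> x)"
  by (auto simp: cap_def fun_eq_iff algebra_simps)

lemma swp_scale: "swp a b (\<lambda>x. k * \<psi> x) = (\<lambda>x. k * swp a b \<psi> x)"
  by (auto simp: swp_def fun_eq_iff)

text \<open>The identities below only involve the values of the colouring at the named dots, so it
  suffices to evaluate both sides on \<open>y(a := p, b := q, \<dots>)\<close> for all Booleans \<open>p, q, \<dots>\<close>.\<close>

lemma two_dots:
  assumes "a \<noteq> b" "\<And>y p q. F (y(a := p, b := q)) = G (y(a := p, b := q))"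
  shows "F = G"
proof
  fix x
  show "F x = G x" using assms(2)[of x "x a" "x b"] by simp
qed

lemma three_dots:
  assumes "\<And>y p q r. F (y(a := p, b := q, c := r)) = G (y(a := p, b := q, c := r))"
  shows "F = G"
proof
  fix x
  show "F x = G x" using assms[of x "x a" "x b" "x c"] by simp
qed

lemma four_dots:
  assumes "\<And>y p q r s. F (y(a := p, b := q, c := r, d := s)) = G (y(a := p, b := q, c := r, d := s))"
  shows "F = G"
proof
  fix x
  show "F x = G x" using assms[of x "x a" "x b" "x c" "x d"] by simp
qed

lemma two_dot_relations:
  assumes ab: "a \<noteq> b"
  shows "swp a b (swp a b \<psi>) = \<psi>" "swp a b (cap a b \<psi>) = cap a b \<psi>" "cap a b (swp a b \<psi>) = cap a b \<psi>"
    "cap a b (cap a b \<psi>) = (\<lambda>x. 2 * cap a b \<psi> x)"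
proof -
  have t: "f(b := u, a := v) = f(a := v, b := u)" for f :: "nat \<Rightarrow> bool" and u v using ab[symmetric] by (rule fun_upd_twist)
  note s = swp_def cap_def t ab ab[symmetric]
  show "swp a b (swp a b \<psi>) = \<psi>" by (rule two_dots[OF ab]) (simp add: s)
  show "swp a b (cap a b \<psi>) = cap a b \<psi>" by (rule two_dots[OF ab]) (auto simp: s)
  show "cap a b (swp a b \<psi>) = cap a b \<psi>" by (rule two_dots[OF ab]) (auto simp: s)
  show "cap a b (cap a b \<psi>) = (\<lambda>x. 2 * cap a b \<psi> x)" by (rule two_dots[OF ab]) (auto simp: s)
qed

lemma disjoint_relations:
  assumes d: "a \<noteq> b" "a \<noteq> c" "a \<noteq> d" "b \<noteq> c" "b \<noteq> d" "c \<noteq> d"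
  shows "swp a b (swp c d \<psi>) = swp c d (swp a b \<psi>)" "swp a b (cap c d \<psi>) = cap c d (swp a b \<psi>)"
    "cap a b (cap c d \<psi>) = cap c d (cap a b \<psi>)"
proof -
  have t: "f(b := u, a := v) = f(a := v, b := u)" "f(c := u, a := v) = f(a := v, c := u)"
    "f(d := u, a := v) = f(a := v, d := u)" "f(c := u, b := v) = f(b := v, c := u)"
    "f(d := u, b := v) = f(b := v, d := u)" "f(d := u, c := v) = f(c := v, d := u)"
    for f :: "nat \<Rightarrow> bool" and u v by (rule fun_upd_twist, use d in blast)+
  note s = swp_def cap_def t d d[symmetric]
  show "swp a b (swp c d \<psi>) = swp c d (swp a b \<psi>)" by (rule four_dots[of _ a b c d]) (simp add: s)
  show "swp a b (cap c d \<psi>) = cap c d (swp a b \<psi>)" by (rule four_dots[of _ a b c d]) (auto simp: s)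
  show "cap a b (cap c d \<psi>) = cap c d (cap a b \<psi>)" by (rule four_dots[of _ a b c d]) (auto simp: s)
qed

lemma three_dot_relations:
  assumes d: "a \<noteq> b" "a \<noteq> c" "b \<noteq> c"
  shows "swp a b (swp b c (swp a b \<psi>)) = swp b c (swp a b (swp b c \<psi>))"
    "swp b c (swp a b (cap b c \<psi>)) = cap a b (cap b c \<psi>)"
    "swp a b (cap b c (swp a b \<psi>)) = swp b c (cap a b (swp b c \<psi>))"
proof -
  have t: "f(b := u, a := v) = f(a := v, b := u)" "f(c := u, a := v) = f(a := v, c := u)"
    "f(c := u, b := v) = f(b := v, c := u)"
    for f :: "nat \<Rightarrow> bool" and u v by (rule fun_upd_twist, use d in blast)+
  note s = swp_def cap_def t d d[symmetric]
  show "swp a b (swp b c (swp a b \<psi>)) = swp b c (swp a b (swp b c \<psi>))"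
    by (rule three_dots[of _ a b c]) (simp add: s)
  show "swp b c (swp a b (cap b c \<psi>)) = cap a b (cap b c \<psi>)"
    by (rule three_dots[of _ a b c]) (auto simp: s)
  show "swp a b (cap b c (swp a b \<psi>)) = swp b c (cap a b (swp b c \<psi>))"
    by (rule three_dots[of _ a b c]) (auto simp: s)
qed

text \<open>The relations between indices 0 and 1 take place on the four central dots, with
  \<open>a\<close>, \<open>b\<close>, \<open>c\<close>, \<open>d\<close> standing for
  \<open>n - 1\<close>, \<open>n\<close>, \<open>n + 1\<close>, \<open>n + 2\<close>. The factor 2
  is the value that a closed loop, hence \<open>\<delta>\<close>, takes in this
  representation.\<close>

lemma four_dot_relations:
  fixes \<psi> :: "(nat \<Rightarrow> bool) \<Rightarrow> nat"
  assumes d: "a \<noteq> b" "a \<noteq> c" "a \<noteq> d" "b \<noteq> c" "b \<noteq> d" "c \<noteq> d"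
  defines "r1 \<equiv> \<lambda>\<phi>. swp a b (swp c d \<phi>)" and "e1 \<equiv> \<lambda>\<phi>. cap a b (cap c d \<phi>)"
    and "r0 \<equiv> swp b c" and "e0 \<equiv> cap b c"
  shows "r1 (r0 (r1 (r0 \<psi>))) = r0 (r1 (r0 (r1 \<psi>)))" "r1 (r0 (e1 \<psi>)) = r0 (e1 \<psi>)"
    "r1 (e0 (r1 (e0 \<psi>))) = e0 (e1 (e0 \<psi>))" "r1 (r0 (r1 (e0 \<psi>))) = e0 (r1 (r0 (r1 \<psi>)))"
    "e1 (r0 (e1 \<psi>)) = (\<lambda>x. 2 * e1 \<psi> x)" "e1 (e0 (e1 \<psi>)) = (\<lambda>x. 2 * e1 \<psi> x)"
    "e1 (r0 (r1 \<psi>)) = e1 (r0 \<psi>)" "e1 (e0 (r1 \<psi>)) = e1 (e0 \<psi>)"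
proof -
  have t: "f(b := u, a := v) = f(a := v, b := u)" "f(c := u, a := v) = f(a := v, c := u)"
    "f(d := u, a := v) = f(a := v, d := u)" "f(c := u, b := v) = f(b := v, c := u)"
    "f(d := u, b := v) = f(b := v, d := u)" "f(d := u, c := v) = f(c := v, d := u)"
    for f :: "nat \<Rightarrow> bool" and u v by (rule fun_upd_twist, use d in blast)+
  note s = r1_def e1_def r0_def e0_def swp_def cap_def t d d[symmetric]
  note I = four_dots[of _ a b c d]
  show "r1 (r0 (r1 (r0 \<psi>))) = r0 (r1 (r0 (r1 \<psi>)))" by (rule I) (simp add: s)
  show "r1 (r0 (e1 \<psi>)) = r0 (e1 \<psi>)" by (rule I, rename_tac y p q r s, case_tac p; case_tac q; case_tac r; case_tac s) (simp_all add: s)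
  show "r1 (e0 (r1 (e0 \<psi>))) = e0 (e1 (e0 \<psi>))"
    by (rule I, rename_tac y p q r s, case_tac p; case_tac q; case_tac r; case_tac s) (simp_all add: s)
  show "r1 (r0 (r1 (e0 \<psi>))) = e0 (r1 (r0 (r1 \<psi>)))"
    by (rule I, rename_tac y p q r s, case_tac p; case_tac q; case_tac r; case_tac s) (simp_all add: s)
  show "e1 (r0 (e1 \<psi>)) = (\<lambda>x. 2 * e1 \<psi> x)"
    by (rule I, rename_tac y p q r s, case_tac p; case_tac q; case_tac r; case_tac s) (simp_all add: s)
  show "e1 (e0 (e1 \<psi>)) = (\<lambda>x. 2 * e1 \<psi> x)"
    by (rule I, rename_tac y p q r s, case_tac p; case_tac q; case_tac r; case_tac s) (simp_all add: s)
  show "e1 (r0 (r1 \<psi>)) = e1 (r0 \<psi>)"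
    by (rule I, rename_tac y p q r s, case_tac p; case_tac q; case_tac r; case_tac s) (simp_all add: s)
  show "e1 (e0 (r1 \<psi>)) = e1 (e0 \<psi>)"
    by (rule I, rename_tac y p q r s, case_tac p; case_tac q; case_tac r; case_tac s) (simp_all add: s)
qed

text \<open>The mirrored pair is written as \<open>n + 1 - i\<close>, \<open>n - i\<close>, running
  outwards like \<open>n + i\<close>, \<open>n + i + 1\<close>, so that both halves satisfy the same
  relations letter by letter.\<close>

fun gen_op :: "nat \<Rightarrow> genC \<Rightarrow> ((nat \<Rightarrow> bool) \<Rightarrow> nat) \<Rightarrow> (nat \<Rightarrow> bool) \<Rightarrow> nat" where
  "gen_op n (gr i) \<psi> = (if i = 0 then swp n (n + 1) \<psi> else swp (n + 1 - i) (n - i) (swp (n + i) (n + i + 1) \<psi>))"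
| "gen_op n (ge i) \<psi> = (if i = 0 then cap n (n + 1) \<psi> else cap (n + 1 - i) (n - i) (cap (n + i) (n + i + 1) \<psi>))"

fun word_op :: "nat \<Rightarrow> genC list \<Rightarrow> ((nat \<Rightarrow> bool) \<Rightarrow> nat) \<Rightarrow> (nat \<Rightarrow> bool) \<Rightarrow> nat" where
  "word_op n [] \<psi> = \<psi>"
| "word_op n (g # u) \<psi> = gen_op n g (word_op n u \<psi>)"

lemma gen_op_scale: "gen_op n g (\<lambda>x. k * \<psi> x) = (\<lambda>x. k * gen_op n g \<psi> x)"
  by (cases g) (simp_all add: swp_scale cap_scale)

text \<open>Every defining relation equates a word with \<open>\<delta> ^ j\<close> times a word.
  Recording \<open>j\<close> separately turns the presentation into a relation between words, to be
  checked on operators and reused with the exponent forgotten.\<close>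

inductive word_rel :: "nat \<Rightarrow> genC list \<Rightarrow> genC list \<Rightarrow> nat \<Rightarrow> bool" for n where
  rr: "i < n \<Longrightarrow> word_rel n [gr i, gr i] [] 0"
| re: "i < n \<Longrightarrow> word_rel n [gr i, ge i] [ge i] 0"
| er: "i < n \<Longrightarrow> word_rel n [ge i, gr i] [ge i] 0"
| ee: "0 < i \<Longrightarrow> i < n \<Longrightarrow> word_rel n [ge i, ge i] [ge i] 2"
| ee0: "word_rel n [ge 0, ge 0] [ge 0] 1"
| rr_comm: "i < n \<Longrightarrow> j < n \<Longrightarrow> i \<noteq> j \<Longrightarrow> \<not> adj i j \<Longrightarrow> word_rel n [gr i, gr j] [gr j, gr i] 0"
| er_comm: "i < n \<Longrightarrow> j < n \<Longrightarrow> i \<noteq> j \<Longrightarrow> \<not> adj i j \<Longrightarrow> word_rel n [ge i, gr j] [gr j, ge i] 0"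
| ee_comm: "i < n \<Longrightarrow> j < n \<Longrightarrow> i \<noteq> j \<Longrightarrow> \<not> adj i j \<Longrightarrow> word_rel n [ge i, ge j] [ge j, ge i] 0"
| rrr: "i < n \<Longrightarrow> j < n \<Longrightarrow> adj i j \<Longrightarrow> 0 < i \<Longrightarrow> 0 < j \<Longrightarrow> word_rel n [gr i, gr j, gr i] [gr j, gr i, gr j] 0"
| rre: "i < n \<Longrightarrow> j < n \<Longrightarrow> adj i j \<Longrightarrow> 0 < i \<Longrightarrow> 0 < j \<Longrightarrow> word_rel n [gr j, gr i, ge j] [ge i, ge j] 0"
| rer: "i < n \<Longrightarrow> j < n \<Longrightarrow> adj i j \<Longrightarrow> 0 < i \<Longrightarrow> 0 < j \<Longrightarrow> word_rel n [gr i, ge j, gr i] [gr j, ge i, gr j] 0"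
| r1010: "word_rel n [gr 1, gr 0, gr 1, gr 0] [gr 0, gr 1, gr 0, gr 1] 0"
| rre01: "word_rel n [gr 1, gr 0, ge 1] [gr 0, ge 1] 0"
| rere: "word_rel n [gr 1, ge 0, gr 1, ge 0] [ge 0, ge 1, ge 0] 0"
| rrre: "word_rel n [gr 1, gr 0, gr 1, ge 0] [ge 0, gr 1, gr 0, gr 1] 0"
| ere: "word_rel n [ge 1, gr 0, ge 1] [ge 1] 1"
| eee: "word_rel n [ge 1, ge 0, ge 1] [ge 1] 1"
| err: "word_rel n [ge 1, gr 0, gr 1] [ge 1, gr 0] 0"
| eer: "word_rel n [ge 1, ge 0, gr 1] [ge 1, ge 0] 0"

lemma word_rel_relC:
  "word_rel n u v j \<Longrightarrow> (W u, Poly_Mapping.single v (delta ^ j)) \<in> relC n"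
proof (induction rule: word_rel.induct)
  case (rr i)
  then show ?case unfolding relC_def power_0
    by - (rule UnI1, rule UnI1, rule UnI1, rule UnI1, rule UnI1, rule UnI1, rule UnI1, rule UnI1, rule UnI1, rule UnI1, rule UnI1, rule CollectI, intro exI conjI, rule refl)
next
  case (re i)
  then show ?case unfolding relC_def power_0
    by - (rule UnI1, rule UnI1, rule UnI1, rule UnI1, rule UnI1, rule UnI1, rule UnI1, rule UnI1, rule UnI1, rule UnI1, rule UnI2, rule CollectI, intro exI conjI, rule refl)
next
  case (er i)
  then show ?case unfolding relC_def power_0
    by - (rule UnI1, rule UnI1, rule UnI1, rule UnI1, rule UnI1, rule UnI1, rule UnI1, rule UnI1, rule UnI1, rule UnI2, rule CollectI, intro exI conjI, rule refl)
next
  case (ee i)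
  then show ?case unfolding relC_def power_0
    by - (rule UnI1, rule UnI1, rule UnI1, rule UnI1, rule UnI1, rule UnI1, rule UnI1, rule UnI1, rule UnI2, rule CollectI, intro exI conjI, rule refl)
next
  case ee0
  show ?case unfolding relC_def power_one_right by (rule UnI1, rule UnI1, rule UnI1, rule UnI1, rule UnI1, rule UnI1, rule UnI1, rule UnI2, rule singletonI)
next
  case (rr_comm i k)
  then show ?case unfolding relC_def power_0
    by - (rule UnI1, rule UnI1, rule UnI1, rule UnI1, rule UnI1, rule UnI1, rule UnI2, rule CollectI, intro exI conjI, rule refl)
next
  case (er_comm i k)
  then show ?case unfolding relC_def power_0
    by - (rule UnI1, rule UnI1, rule UnI1, rule UnI1, rule UnI1, rule UnI2, rule CollectI, intro exI conjI, rule refl)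
next
  case (ee_comm i k)
  then show ?case unfolding relC_def power_0
    by - (rule UnI1, rule UnI1, rule UnI1, rule UnI1, rule UnI2, rule CollectI, intro exI conjI, rule refl)
next
  case (rrr i k)
  then show ?case unfolding relC_def power_0
    by - (rule UnI1, rule UnI1, rule UnI1, rule UnI2, rule CollectI, intro exI conjI, rule refl)
next
  case (rre i k)
  then show ?case unfolding relC_def power_0
    by - (rule UnI1, rule UnI1, rule UnI2, rule CollectI, intro exI conjI, rule refl)
next
  case (rer i k)
  then show ?case unfolding relC_def power_0
    by - (rule UnI1, rule UnI2, rule CollectI, intro exI conjI, rule refl)
next
  case r1010
  show ?case unfolding relC_def power_0 power_one_right by (rule UnI2) (simp only: insert_iff simp_thms)
next
  case rre01
  show ?case unfolding relC_def power_0 power_one_right by (rule UnI2) (simp only: insert_iff simp_thms)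
next
  case rere
  show ?case unfolding relC_def power_0 power_one_right by (rule UnI2) (simp only: insert_iff simp_thms)
next
  case rrre
  show ?case unfolding relC_def power_0 power_one_right by (rule UnI2) (simp only: insert_iff simp_thms)
next
  case ere
  show ?case unfolding relC_def power_0 power_one_right by (rule UnI2) (simp only: insert_iff simp_thms)
next
  case eee
  show ?case unfolding relC_def power_0 power_one_right by (rule UnI2) (simp only: insert_iff simp_thms)
next
  case err
  show ?case unfolding relC_def power_0 power_one_right by (rule UnI2) (simp only: insert_iff simp_thms)
next
  case eer
  show ?case unfolding relC_def power_0 power_one_right by (rule UnI2) (simp only: insert_iff simp_thms)
qed

lemma relC_word_rel:
  assumes "(x, y) \<in> relC n"
  obtains u v j where "word_rel n u v j" "x = W u" "y = Poly_Mapping.single v (delta ^ j)"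
proof -
  define R where "R = {(W u, Poly_Mapping.single v (delta ^ j)) | u v j. word_rel n u v j}"
  have I: "(W u, Poly_Mapping.single v (delta ^ j)) \<in> R" if "word_rel n u v j" for u v j
    using that unfolding R_def by blast
  have I0: "(W u, W v) \<in> R" if "word_rel n u v 0" for u v using I[OF that] by simp
  have I1: "(W u, Poly_Mapping.single v delta) \<in> R" if "word_rel n u v 1" for u v using I[OF that] by simp
  have "relC n \<subseteq> R"
    unfolding relC_def
    apply (intro Un_least)
    apply (rule subsetI, elim CollectE exE conjE, simp only:, rule I0, rule word_rel.rr; assumption)
    apply (rule subsetI, elim CollectE exE conjE, simp only:, rule I0, rule word_rel.re; assumption)
    apply (rule subsetI, elim CollectE exE conjE, simp only:, rule I0, rule word_rel.er; assumption)
    apply (rule subsetI, elim CollectE exE conjE, simp only:, rule I, rule word_rel.ee; assumption)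
    apply (simp only: insert_subset empty_subsetI simp_thms, rule I1, rule word_rel.ee0)
    apply (rule subsetI, elim CollectE exE conjE, simp only:, rule I0, rule word_rel.rr_comm; assumption)
    apply (rule subsetI, elim CollectE exE conjE, simp only:, rule I0, rule word_rel.er_comm; assumption)
    apply (rule subsetI, elim CollectE exE conjE, simp only:, rule I0, rule word_rel.ee_comm; assumption)
    apply (rule subsetI, elim CollectE exE conjE, simp only:, rule I0, rule word_rel.rrr; assumption)
    apply (rule subsetI, elim CollectE exE conjE, simp only:, rule I0, rule word_rel.rre; assumption)
    apply (rule subsetI, elim CollectE exE conjE, simp only:, rule I0, rule word_rel.rer; assumption)
    apply (simp only: insert_subset empty_subsetI simp_thms, intro conjI)
    apply (rule I0, rule word_rel.r1010)
    apply (rule I0, rule word_rel.rre01)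
    apply (rule I0, rule word_rel.rere)
    apply (rule I0, rule word_rel.rrre)
    apply (rule I1, rule word_rel.ere)
    apply (rule I1, rule word_rel.eee)
    apply (rule I0, rule word_rel.err)
    apply (rule I0, rule word_rel.eer)
    done
  then show thesis using assms that unfolding R_def by blast
qed

definition valid_word :: "nat \<Rightarrow> genC list \<Rightarrow> bool" where
  "valid_word n u \<longleftrightarrow> (\<forall>g\<in>set u. gen_idx g < n)"

lemma word_rel_valid: "word_rel n u v j \<Longrightarrow> 2 \<le> n \<Longrightarrow> valid_word n u \<and> valid_word n v"
  by (cases rule: word_rel.cases) (auto simp: valid_word_def)

lemma adj_cases: "adj i j \<Longrightarrow> (j = i + 1 \<Longrightarrow> P) \<Longrightarrow> (i = j + 1 \<Longrightarrow> P) \<Longrightarrow> P"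
  by (auto simp: adj_def)

text \<open>For \<open>i > 0\<close> a generator is a product of two commuting copies of the same operation on the
  upper and the lower half; relations between generators with positive index therefore follow
  from the relation in each half.\<close>
lemma mirrored_relations:
  assumes d: "a \<noteq> b" "a \<noteq> c" "b \<noteq> c" "a' \<noteq> b'" "a' \<noteq> c'" "b' \<noteq> c'"
    and disj: "{a, b, c} \<inter> {a', b', c'} = {}"
  defines "r1 \<equiv> \<lambda>\<phi>. swp a' b' (swp a b \<phi>)" and "r2 \<equiv> \<lambda>\<phi>. swp b' c' (swp b c \<phi>)"
    and "e1 \<equiv> \<lambda>\<phi>. cap a' b' (cap a b \<phi>)" and "e2 \<equiv> \<lambda>\<phi>. cap b' c' (cap b c \<phi>)"
  shows "r1 (r2 (r1 \<psi>)) = r2 (r1 (r2 \<psi>))" "r2 (r1 (e2 \<psi>)) = e1 (e2 \<psi>)" "r1 (e2 (r1 \<psi>)) = r2 (e1 (r2 \<psi>))"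
proof -
  have n: "x \<noteq> y" if "x \<in> {a, b, c}" "y \<in> {a', b', c'}" for x y using that disj by auto
  have ne: "a \<noteq> a'" "a \<noteq> b'" "a \<noteq> c'" "b \<noteq> a'" "b \<noteq> b'" "b \<noteq> c'" "c \<noteq> a'" "c \<noteq> b'" "c \<noteq> c'"
    by (rule n; simp)+
  have ss: "swp x y (swp x' y' \<phi>) = swp x' y' (swp x y \<phi>)"
    and sc: "swp x y (cap x' y' \<phi>) = cap x' y' (swp x y \<phi>)"
    and cs: "cap x y (swp x' y' \<phi>) = swp x' y' (cap x y \<phi>)"
    and cc: "cap x y (cap x' y' \<phi>) = cap x' y' (cap x y \<phi>)"
    if "(x, y) \<in> {(a, b), (b, c)}" "(x', y') \<in> {(a', b'), (b', c')}" for x y x' y' \<phi>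
  proof -
    have "x \<noteq> y" "x \<noteq> x'" "x \<noteq> y'" "y \<noteq> x'" "y \<noteq> y'" "x' \<noteq> y'" using that d ne by auto
    then show "swp x y (swp x' y' \<phi>) = swp x' y' (swp x y \<phi>)" "swp x y (cap x' y' \<phi>) = cap x' y' (swp x y \<phi>)"
      "cap x y (swp x' y' \<phi>) = swp x' y' (cap x y \<phi>)" "cap x y (cap x' y' \<phi>) = cap x' y' (cap x y \<phi>)"
      using disjoint_relations[of x y x' y' \<phi>] disjoint_relations[of x' y' x y \<phi>] by auto
  qed
  have m: "(a, b) \<in> {(a, b), (b, c)}" "(b, c) \<in> {(a, b), (b, c)}"
    "(a', b') \<in> {(a', b'), (b', c')}" "(b', c') \<in> {(a', b'), (b', c')}" by simp_all
  note push = ss[OF m(1) m(3)] ss[OF m(1) m(4)] ss[OF m(2) m(3)] ss[OF m(2) m(4)]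
    sc[OF m(1) m(3)] sc[OF m(1) m(4)] sc[OF m(2) m(3)] sc[OF m(2) m(4)]
    cs[OF m(1) m(3)] cs[OF m(1) m(4)] cs[OF m(2) m(3)] cs[OF m(2) m(4)]
    cc[OF m(1) m(3)] cc[OF m(1) m(4)] cc[OF m(2) m(3)] cc[OF m(2) m(4)]
  note T = three_dot_relations[OF d(1-3)] and T' = three_dot_relations[OF d(4-6)]
  show "r1 (r2 (r1 \<psi>)) = r2 (r1 (r2 \<psi>))"
    unfolding r1_def r2_def by (simp only: push T(1) T'(1))
  show "r2 (r1 (e2 \<psi>)) = e1 (e2 \<psi>)"
    unfolding r1_def r2_def e1_def e2_def by (simp only: push T(2) T'(2))
  show "r1 (e2 (r1 \<psi>)) = r2 (e1 (r2 \<psi>))"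
    unfolding r1_def r2_def e1_def e2_def by (simp only: push T(3) T'(3))
qed

lemma gen_op_disjoint:
  assumes ij: "i < n" "j < n" "i \<noteq> j" "\<not> adj i j"
  shows "gen_op n (gr i) (gen_op n (gr j) \<psi>) = gen_op n (gr j) (gen_op n (gr i) \<psi>)"
    "gen_op n (ge i) (gen_op n (gr j) \<psi>) = gen_op n (gr j) (gen_op n (ge i) \<psi>)"
    "gen_op n (ge i) (gen_op n (ge j) \<psi>) = gen_op n (ge j) (gen_op n (ge i) \<psi>)"
proof -
  have far: "i + 1 < j \<or> j + 1 < i" using ij by (auto simp: adj_def)
  define P where "P i = {(n + i, n + i + 1), (n + 1 - i, n - i)}" for i
  have push: "swp x y (swp x' y' \<phi>) = swp x' y' (swp x y \<phi>)" "swp x y (cap x' y' \<phi>) = cap x' y' (swp x y \<phi>)"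
    "cap x y (swp x' y' \<phi>) = swp x' y' (cap x y \<phi>)" "cap x y (cap x' y' \<phi>) = cap x' y' (cap x y \<phi>)"
    if "(x, y) \<in> P i" "(x', y') \<in> P j" for x y x' y' \<phi>
  proof -
    have "x \<noteq> y" "x \<noteq> x'" "x \<noteq> y'" "y \<noteq> x'" "y \<noteq> y'" "x' \<noteq> y'" using that far ij(1,2) by (auto simp: P_def)
    then show "swp x y (swp x' y' \<phi>) = swp x' y' (swp x y \<phi>)" "swp x y (cap x' y' \<phi>) = cap x' y' (swp x y \<phi>)"
      "cap x y (swp x' y' \<phi>) = swp x' y' (cap x y \<phi>)" "cap x y (cap x' y' \<phi>) = cap x' y' (cap x y \<phi>)"
      using disjoint_relations[of x y x' y' \<phi>] disjoint_relations[of x' y' x y \<phi>] by auto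
  qed
  have m: "(n + i, n + i + 1) \<in> P i" "(n + 1 - i, n - i) \<in> P i" "(n + j, n + j + 1) \<in> P j" "(n + 1 - j, n - j) \<in> P j"
    for i j by (simp_all add: P_def)
  \<comment> \<open>Naming the conditions \<open>i = 0\<close> and \<open>j = 0\<close> keeps the
    index 0 in the uniform shape \<open>swp (n + i) (n + i + 1)\<close>, so that the same
    commutation rules serve in all four cases.\<close>
  define zi zj where "zi \<longleftrightarrow> i = 0" and "zj \<longleftrightarrow> j = 0"
  have g: "gen_op n (gr i) \<phi> = (if zi then swp (n + i) (n + i + 1) \<phi> else swp (n + 1 - i) (n - i) (swp (n + i) (n + i + 1) \<phi>))"
    "gen_op n (ge i) \<phi> = (if zi then cap (n + i) (n + i + 1) \<phi> else cap (n + 1 - i) (n - i) (cap (n + i) (n + i + 1) \<phi>))"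
    "gen_op n (gr j) \<phi> = (if zj then swp (n + j) (n + j + 1) \<phi> else swp (n + 1 - j) (n - j) (swp (n + j) (n + j + 1) \<phi>))"
    "gen_op n (ge j) \<phi> = (if zj then cap (n + j) (n + j + 1) \<phi> else cap (n + 1 - j) (n - j) (cap (n + j) (n + j + 1) \<phi>))" for \<phi>
    by (simp_all add: zi_def zj_def)
  note all = push[OF m(1) m(3)] push[OF m(1) m(4)] push[OF m(2) m(3)] push[OF m(2) m(4)]
  show "gen_op n (gr i) (gen_op n (gr j) \<psi>) = gen_op n (gr j) (gen_op n (gr i) \<psi>)"
    unfolding g by (cases zi; cases zj; simp only: if_True if_False simp_thms all)
  show "gen_op n (ge i) (gen_op n (gr j) \<psi>) = gen_op n (gr j) (gen_op n (ge i) \<psi>)"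
    unfolding g by (cases zi; cases zj; simp only: if_True if_False simp_thms all)
  show "gen_op n (ge i) (gen_op n (ge j) \<psi>) = gen_op n (ge j) (gen_op n (ge i) \<psi>)"
    unfolding g by (cases zi; cases zj; simp only: if_True if_False simp_thms all)
qed

lemma gen_op_same:
  assumes "i < n"
  shows "gen_op n (gr i) (gen_op n (gr i) \<psi>) = \<psi>" "gen_op n (gr i) (gen_op n (ge i) \<psi>) = gen_op n (ge i) \<psi>"
    "gen_op n (ge i) (gen_op n (gr i) \<psi>) = gen_op n (ge i) \<psi>"
    "gen_op n (ge i) (gen_op n (ge i) \<psi>) = (\<lambda>x. 2 ^ (if i = 0 then 1 else 2) * gen_op n (ge i) \<psi> x)"
proof -
  have 0: "n \<noteq> n + 1" by simp
  note Z = two_dot_relations[OF 0]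
  have "gen_op n (gr i) (gen_op n (gr i) \<psi>) = \<psi> \<and> gen_op n (gr i) (gen_op n (ge i) \<psi>) = gen_op n (ge i) \<psi> \<and>
      gen_op n (ge i) (gen_op n (gr i) \<psi>) = gen_op n (ge i) \<psi> \<and>
      gen_op n (ge i) (gen_op n (ge i) \<psi>) = (\<lambda>x. 2 ^ (if i = 0 then 1 else 2) * gen_op n (ge i) \<psi> x)"
  proof (cases "i = 0")
    case True
    then show ?thesis
            using Z by simp
  next
    case False
    define a b a' b' where "a = n + i" "b = n + i + 1" "a' = n + 1 - i" "b' = n - i"
    note v = this
    have d: "a' \<noteq> a" "a' \<noteq> b" "b' \<noteq> a" "b' \<noteq> b" "a' \<noteq> b'" "a \<noteq> b" "a \<noteq> a'" "b \<noteq> a'" "a \<noteq> b'" "b \<noteq> b'"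
      using False assms by (auto simp: v)
    have c: "swp a b (swp a' b' \<phi>) = swp a' b' (swp a b \<phi>)" "swp a b (cap a' b' \<phi>) = cap a' b' (swp a b \<phi>)"
      "cap a b (swp a' b' \<phi>) = swp a' b' (cap a b \<phi>)" "cap a b (cap a' b' \<phi>) = cap a' b' (cap a b \<phi>)" for \<phi>
      using disjoint_relations[of a b a' b' \<phi>] disjoint_relations[of a' b' a b \<phi>] d by auto
    have g: "gen_op n (gr i) \<phi> = swp a' b' (swp a b \<phi>)" "gen_op n (ge i) \<phi> = cap a' b' (cap a b \<phi>)" for \<phi>
      using False by (simp_all add: v)
    note T = two_dot_relations[OF d(5)] two_dot_relations[OF d(6)]
    have "cap a' b' (cap a b (cap a' b' (cap a b \<psi>))) = (\<lambda>x. 4 * cap a' b' (cap a b \<psi>) x)"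
      by (simp only: c T cap_scale) (simp add: fun_eq_iff)
    then show ?thesis
            unfolding g using False by (simp add: c T)
  qed
  then show "gen_op n (gr i) (gen_op n (gr i) \<psi>) = \<psi>" "gen_op n (gr i) (gen_op n (ge i) \<psi>) = gen_op n (ge i) \<psi>"
    "gen_op n (ge i) (gen_op n (gr i) \<psi>) = gen_op n (ge i) \<psi>"
    "gen_op n (ge i) (gen_op n (ge i) \<psi>) = (\<lambda>x. 2 ^ (if i = 0 then 1 else 2) * gen_op n (ge i) \<psi> x)"
    by blast+
qed

lemma gen_op_adj:
  assumes ij: "i < n" "j < n" "adj i j" "0 < i" "0 < j"
  shows "gen_op n (gr i) (gen_op n (gr j) (gen_op n (gr i) \<psi>)) = gen_op n (gr j) (gen_op n (gr i) (gen_op n (gr j) \<psi>))"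
    "gen_op n (gr j) (gen_op n (gr i) (gen_op n (ge j) \<psi>)) = gen_op n (ge i) (gen_op n (ge j) \<psi>)"
    "gen_op n (gr i) (gen_op n (ge j) (gen_op n (gr i) \<psi>)) = gen_op n (gr j) (gen_op n (ge i) (gen_op n (gr j) \<psi>))"
proof -
  obtain a b c a' b' c' where d: "a \<noteq> b" "a \<noteq> c" "b \<noteq> c" "a' \<noteq> b'" "a' \<noteq> c'" "b' \<noteq> c'"
      "{a, b, c} \<inter> {a', b', c'} = {}"
    and g: "\<And>\<phi>. gen_op n (gr i) \<phi> = swp a' b' (swp a b \<phi>)" "\<And>\<phi>. gen_op n (ge i) \<phi> = cap a' b' (cap a b \<phi>)"
      "\<And>\<phi>. gen_op n (gr j) \<phi> = swp b' c' (swp b c \<phi>)" "\<And>\<phi>. gen_op n (ge j) \<phi> = cap b' c' (cap b c \<phi>)"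
    using ij(3)
  proof (rule adj_cases)
    assume j: "j = i + 1"
    show thesis
    proof (rule that[of "n + i" "n + i + 1" "n + i + 2" "n + 1 - i" "n - i" "n - i - 1"])
      show "{n + i, n + i + 1, n + i + 2} \<inter> {n + 1 - i, n - i, n - i - 1} = {}" using ij by auto
    qed (use ij j in auto)
  next
    \<comment> \<open>With the larger index first, the dots of both halves are listed from the
      outside inwards; \<open>swp\<close> and \<open>cap\<close> are symmetric in their two
      dots.\<close>
    assume i: "i = j + 1"
    show thesis
    proof (rule that[of "n + j + 2" "n + j + 1" "n + j" "n - j - 1" "n - j" "n + 1 - j"])
      show "{n + j + 2, n + j + 1, n + j} \<inter> {n - j - 1, n - j, n + 1 - j} = {}" using ij by auto
      show "gen_op n (gr i) \<phi> = swp (n - j - 1) (n - j) (swp (n + j + 2) (n + j + 1) \<phi>)"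
        "gen_op n (ge i) \<phi> = cap (n - j - 1) (n - j) (cap (n + j + 2) (n + j + 1) \<phi>)"
        "gen_op n (gr j) \<phi> = swp (n - j) (n + 1 - j) (swp (n + j + 1) (n + j) \<phi>)"
        "gen_op n (ge j) \<phi> = cap (n - j) (n + 1 - j) (cap (n + j + 1) (n + j) \<phi>)" for \<phi>
        using ij i swp_sym[of "n - j" "n - j - 1"] swp_sym[of "n + j + 1" "n + j + 2"]
          cap_sym[of "n - j" "n - j - 1"] cap_sym[of "n + j + 1" "n + j + 2"]
          swp_sym[of "n + 1 - j" "n - j"] swp_sym[of "n + j" "n + j + 1"]
          cap_sym[of "n + 1 - j" "n - j"] cap_sym[of "n + j" "n + j + 1"] by simp_all
    qed (use ij i in auto)
  qed
  show "gen_op n (gr i) (gen_op n (gr j) (gen_op n (gr i) \<psi>)) = gen_op n (gr j) (gen_op n (gr i) (gen_op n (gr j) \<psi>))"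
    "gen_op n (gr j) (gen_op n (gr i) (gen_op n (ge j) \<psi>)) = gen_op n (ge i) (gen_op n (ge j) \<psi>)"
    "gen_op n (gr i) (gen_op n (ge j) (gen_op n (gr i) \<psi>)) = gen_op n (gr j) (gen_op n (ge i) (gen_op n (gr j) \<psi>))"
    unfolding g using mirrored_relations[OF d, of \<psi>] by simp_all
qed

theorem word_op_rel:
  assumes "word_rel n u v j" "2 \<le> n"
  shows "word_op n u \<psi> = (\<lambda>x. 2 ^ j * word_op n v \<psi> x)"
proof -
  define a b c d where "a = n - 1" "b = n" "c = n + 1" "d = n + 2"
  note v = this
  have ne: "a \<noteq> b" "a \<noteq> c" "a \<noteq> d" "b \<noteq> c" "b \<noteq> d" "c \<noteq> d" using assms(2) by (auto simp: v)
  have r1: "gen_op n (gr 1) \<phi> = swp a b (swp c d \<phi>)" "gen_op n (gr (Suc 0)) \<phi> = swp a b (swp c d \<phi>)"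
    "gen_op n (ge 1) \<phi> = cap a b (cap c d \<phi>)" "gen_op n (ge (Suc 0)) \<phi> = cap a b (cap c d \<phi>)"
    "gen_op n (gr 0) \<phi> = swp b c \<phi>" "gen_op n (ge 0) \<phi> = cap b c \<phi>" for \<phi>
    using swp_sym[of "n - 1" n] cap_sym[of "n - 1" n] by (simp_all add: v)
  note F = four_dot_relations[OF ne, of \<psi>]
  have n0: "0 < n" using assms(2) by simp
  from assms(1) show ?thesis
  proof cases
    case r1010 then show ?thesis using F(1) by (simp only: word_op.simps r1 power_0 mult_1)
  next
    case rre01 then show ?thesis using F(2) by (simp only: word_op.simps r1 power_0 mult_1)
  next
    case rere then show ?thesis using F(3) by (simp only: word_op.simps r1 power_0 mult_1)
  next
    case rrre then show ?thesis using F(4) by (simp only: word_op.simps r1 power_0 mult_1)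
  next
    case ere then show ?thesis using F(5) by (simp only: word_op.simps r1 power_one_right)
  next
    case eee then show ?thesis using F(6) by (simp only: word_op.simps r1 power_one_right)
  next
    case err then show ?thesis using F(7) by (simp only: word_op.simps r1 power_0 mult_1)
  next
    case eer then show ?thesis using F(8) by (simp only: word_op.simps r1 power_0 mult_1)
  next
    case (rr i) then show ?thesis using gen_op_same(1) by (simp only: word_op.simps power_0 mult_1)
  next
    case (re i) then show ?thesis using gen_op_same(2) by (simp only: word_op.simps power_0 mult_1)
  next
    case (er i) then show ?thesis using gen_op_same(3) by (simp only: word_op.simps power_0 mult_1)
  next
    case (ee i)
    then have "i < n" "i \<noteq> 0" by auto
    with gen_op_same(4)[OF \<open>i < n\<close>, of \<psi>] show ?thesis unfolding ee by (simp only: word_op.simps if_False)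
  next
    case ee0
    with gen_op_same(4)[OF n0, of \<psi>] show ?thesis by (simp only: word_op.simps if_True refl)
  next
    case (rr_comm i k) then show ?thesis using gen_op_disjoint(1) by (simp only: word_op.simps power_0 mult_1)
  next
    case (er_comm i k) then show ?thesis using gen_op_disjoint(2) by (simp only: word_op.simps power_0 mult_1)
  next
    case (ee_comm i k) then show ?thesis using gen_op_disjoint(3) by (simp only: word_op.simps power_0 mult_1)
  next
    case (rrr i k) then show ?thesis using gen_op_adj(1)[of i n k \<psi>] by (simp only: word_op.simps power_0 mult_1)
  next
    case (rre i k) then show ?thesis using gen_op_adj(2)[of i n k \<psi>] by (simp only: word_op.simps power_0 mult_1)
  next
    case (rer i k) then show ?thesis using gen_op_adj(3)[of i n k \<psi>] by (simp only: word_op.simps power_0 mult_1)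
  qed
qed

section \<open>The homomorphism on words\<close>

lemma bmult_single:
  "bmult (Poly_Mapping.single D c) (Poly_Mapping.single D' c') =
    Poly_Mapping.single (diagram_comp D D') (c * c' * delta ^ num_loops D D')"
  by (cases "c = 0"; cases "c' = 0") (simp_all add: bmult_def)

lemma bscale_single: "bscale c (Poly_Mapping.single D d) = Poly_Mapping.single D (c * d)"
  by (simp add: bscale_def)

text \<open>Left multiplication by the diagram \<open>A\<close> acts on matchings by \<open>f\<close> and on kernels by \<open>P\<close>.\<close>
definition acts_as :: "nat \<Rightarrow> diagram \<Rightarrow> ((dot \<Rightarrow> dot) \<Rightarrow> dot \<Rightarrow> dot) \<Rightarrow>
    (((nat \<Rightarrow> bool) \<Rightarrow> nat) \<Rightarrow> (nat \<Rightarrow> bool) \<Rightarrow> nat) \<Rightarrow> bool" where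
  "acts_as N A f P \<longleftrightarrow> (\<exists>\<alpha>. fpf_invol (dots N) \<alpha> \<and> A = diag N \<alpha>) \<and>
    (\<forall>\<tau>. fpf_invol (dots N) \<tau> \<longrightarrow> fpf_invol (dots N) (f \<tau>) \<and> diagram_comp A (diag N \<tau>) = diag N (f \<tau>)) \<and>
    (\<forall>\<psi>. \<forall>x\<in>colorings N. P \<psi> x = (\<Sum>m\<in>colorings N. kernel A x m * \<psi> m))"

lemma acts_as_kernel:
  assumes "acts_as N A f P" "fpf_invol (dots N) \<tau>" "x \<in> colorings N"
  shows "2 ^ num_loops A (diag N \<tau>) * kernel (diag N (f \<tau>)) x y = P (\<lambda>m. kernel (diag N \<tau>) m y) x"
proof -
  obtain \<alpha> where \<alpha>: "fpf_invol (dots N) \<alpha>" "A = diag N \<alpha>" using assms(1) unfolding acts_as_def by blast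
  have "composable N A (diag N \<tau>)" using composable_diag(1)[OF pairs_on_diag[OF \<alpha>(1)] assms(2)] \<alpha>(2) by simp
  then show ?thesis
    using composable.kernel_comp[of N A "diag N \<tau>" x y] assms unfolding acts_as_def by auto
qed

lemma acts_as_cong:
  assumes "acts_as N A f P" "\<And>m. m \<in> colorings N \<Longrightarrow> \<psi> m = \<psi>' m" "x \<in> colorings N"
  shows "P \<psi> x = P \<psi>' x"
proof -
  have "P \<psi> x = (\<Sum>m\<in>colorings N. kernel A x m * \<psi> m)" "P \<psi>' x = (\<Sum>m\<in>colorings N. kernel A x m * \<psi>' m)"
    using assms(1,3) unfolding acts_as_def by blast+
  then show ?thesis using assms(2) by simp
qed

lemma acts_as_R: "1 \<le> j \<Longrightarrow> j < N \<Longrightarrow> acts_as N (R_diag N j) (act_top (sw j)) (swp j (j + 1))"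
  unfolding acts_as_def
  using fpf_R_match R_diag_eq fpf_act_sw R_step(1) swap_op_kernel
  by (auto simp: swap_op_def[abs_def] swp_def[abs_def])

lemma acts_as_E:
  assumes j: "1 \<le> j" "j < N"
  shows "acts_as N (E_diag N j) (join (j, True) (j + 1, True)) (cap j (j + 1))"
  unfolding acts_as_def
proof (intro conjI allI ballI impI)
  show "\<exists>\<alpha>. fpf_invol (dots N) \<alpha> \<and> E_diag N j = diag N \<alpha>" using fpf_E_match[OF j] E_diag_eq[OF j] by blast
  fix \<tau> assume \<tau>: "fpf_invol (dots N) \<tau>"
  show "fpf_invol (dots N) (join (j, True) (j + 1, True) \<tau>)" using j by (intro fpf_invol_join[OF \<tau>]) auto
  show "diagram_comp (E_diag N j) (diag N \<tau>) = diag N (join (j, True) (j + 1, True) \<tau>)" by (rule E_step(1)[OF j \<tau>])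
next
  fix \<psi> x assume "x \<in> colorings N"
  from cap_op_kernel[OF j this] show "cap j (j + 1) \<psi> x = (\<Sum>m\<in>colorings N. kernel (E_diag N j) x m * \<psi> m)"
    by (simp add: cap_op_def cap_def)
qed

definition gen_act :: "nat \<Rightarrow> genC \<Rightarrow> (dot \<Rightarrow> dot) \<Rightarrow> dot \<Rightarrow> dot" where
  "gen_act n g = (case g of gr i \<Rightarrow> act_top (simple_perm n i)
     | ge i \<Rightarrow> sym_join (bar_dot n) (n + i, True) (n + i + 1, True))"

text \<open>One \<open>l\<close> serves as exponent of \<open>delta\<close> in the product and of 2
  in the action on kernels. This link lets identities between operators on colourings decide
  exponents of \<open>delta\<close>.\<close>

definition gen_step :: "nat \<Rightarrow> genC \<Rightarrow> (dot \<Rightarrow> dot) \<Rightarrow> bool" where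
  "gen_step n g \<tau> \<longleftrightarrow> (\<exists>l. (\<forall>c. bmult (phi_gen n g) (Poly_Mapping.single (diag (2 * n) \<tau>) c) =
       Poly_Mapping.single (diag (2 * n) (gen_act n g \<tau>)) (c * delta ^ l)) \<and>
     (\<forall>x\<in>colorings (2 * n). \<forall>y. 2 ^ l * kernel (diag (2 * n) (gen_act n g \<tau>)) x y =
       gen_op n g (\<lambda>m. kernel (diag (2 * n) \<tau>) m y) x))"

lemma gen_stepI1:
  assumes a: "acts_as (2 * n) A f P" and \<tau>: "fpf_invol (dots (2 * n)) \<tau>"
    and g: "phi_gen n g = Poly_Mapping.single A 1" "gen_op n g = P" "diag (2 * n) (gen_act n g \<tau>) = diag (2 * n) (f \<tau>)"
  shows "gen_step n g \<tau>"
  unfolding gen_step_def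
proof (intro exI[of _ "num_loops A (diag (2 * n) \<tau>)"] conjI allI ballI)
  have "diagram_comp A (diag (2 * n) \<tau>) = diag (2 * n) (f \<tau>)" using a \<tau> unfolding acts_as_def by blast
  then show "bmult (phi_gen n g) (Poly_Mapping.single (diag (2 * n) \<tau>) c) =
      Poly_Mapping.single (diag (2 * n) (gen_act n g \<tau>)) (c * delta ^ num_loops A (diag (2 * n) \<tau>))" for c
    unfolding g by (simp add: bmult_single)
  show "2 ^ num_loops A (diag (2 * n) \<tau>) * kernel (diag (2 * n) (gen_act n g \<tau>)) x y =
      gen_op n g (\<lambda>m. kernel (diag (2 * n) \<tau>) m y) x" if "x \<in> colorings (2 * n)" for x y
    unfolding g by (rule acts_as_kernel[OF a \<tau> that])
qed

text \<open>A generator of positive index is a product of two diagrams. Associativity replaces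
  multiplication by this product with two successive left multiplications, whose loops add
  up.\<close>

lemma gen_stepI2:
  assumes a: "acts_as (2 * n) A f P" and b: "acts_as (2 * n) B h Q" and \<tau>: "fpf_invol (dots (2 * n)) \<tau>"
    and g: "phi_gen n g = bmult (Poly_Mapping.single A 1) (Poly_Mapping.single B 1)"
      "gen_op n g = (\<lambda>\<psi>. P (Q \<psi>))" "diag (2 * n) (gen_act n g \<tau>) = diag (2 * n) (f (h \<tau>))"
    and scale: "\<And>k \<psi>. P (\<lambda>x. k * \<psi> x) = (\<lambda>x. k * P \<psi> x)"
  shows "gen_step n g \<tau>"
proof -
  let ?N = "2 * n" let ?D = "diag (2 * n) \<tau>"
  obtain \<alpha> where \<alpha>: "fpf_invol (dots ?N) \<alpha>" "A = diag ?N \<alpha>" using a unfolding acts_as_def by blast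
  obtain \<beta> where \<beta>: "fpf_invol (dots ?N) \<beta>" "B = diag ?N \<beta>" using b unfolding acts_as_def by blast
  have h: "fpf_invol (dots ?N) (h \<tau>)" "diagram_comp B ?D = diag ?N (h \<tau>)" using b \<tau> unfolding acts_as_def by blast+
  have f: "diagram_comp A (diag ?N (h \<tau>)) = diag ?N (f (h \<tau>))" using a h unfolding acts_as_def by blast
  note assoc = diagram_comp_assoc[OF \<alpha>(1) \<tau> pairs_on_diag[OF \<beta>(1)], folded \<alpha>(2) \<beta>(2), unfolded h(2)]
  let ?l = "num_loops B ?D + num_loops A (diag ?N (h \<tau>))"
  show ?thesis
    unfolding gen_step_def
  proof (intro exI[of _ ?l] conjI allI ballI)
    show "bmult (phi_gen n g) (Poly_Mapping.single ?D c) = Poly_Mapping.single (diag ?N (gen_act n g \<tau>)) (c * delta ^ ?l)" for c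
      unfolding g bmult_single assoc(1) f assoc(2)[symmetric] by (simp add: power_add mult_ac)
    fix x y assume x: "x \<in> colorings ?N"
    have "2 ^ ?l * kernel (diag ?N (f (h \<tau>))) x y = 2 ^ num_loops B ?D * P (\<lambda>m. kernel (diag ?N (h \<tau>)) m y) x"
      unfolding acts_as_kernel[OF a h(1) x, symmetric] by (simp add: power_add)
    also have "\<dots> = P (\<lambda>m. 2 ^ num_loops B ?D * kernel (diag ?N (h \<tau>)) m y) x" by (simp only: scale)
    also have "\<dots> = P (Q (\<lambda>m. kernel ?D m y)) x"
      by (rule acts_as_cong[OF a _ x]) (rule acts_as_kernel[OF b \<tau>])
    finally show "2 ^ ?l * kernel (diag ?N (gen_act n g \<tau>)) x y = gen_op n g (\<lambda>m. kernel ?D m y) x"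
      unfolding g .
  qed
qed

lemma simple_perm_sw:
  assumes "i < n" "0 < i"
  shows "simple_perm n i x = sw (n - i) (sw (n + i) x)" "simple_perm n i x = sw (n + i) (sw (n - i) x)"
proof -
  obtain k where n: "n = i + k" and k: "0 < k" using assms(1) less_imp_add_positive by blast
  have e: "n - i = k" "n + 1 - i = k + 1" by (simp_all add: n)
  note s = simple_perm_simps[OF assms(1)] sw_def
  consider "x = n + i" | "x = n + i + 1" | "x = k" | "x = k + 1" | "x \<notin> {n + i, n + i + 1, k, k + 1}" by blast
  then show "simple_perm n i x = sw (n - i) (sw (n + i) x)"
    unfolding s e by cases (use assms n in simp_all)
  consider "x = n + i" | "x = n + i + 1" | "x = k" | "x = k + 1" | "x \<notin> {n + i, n + i + 1, k, k + 1}" by blast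
  then show "simple_perm n i x = sw (n + i) (sw (n - i) x)"
    unfolding s e by cases (use assms n in simp_all)
qed

lemma simple_perm_0_sw: "0 < n \<Longrightarrow> simple_perm n 0 = sw n"
  by (rule ext) (simp add: simple_perm_simps sw_def)

lemma inv_simple_perm: "i < n \<Longrightarrow> inv (simple_perm n i) = simple_perm n i"
  by (rule inv_equality) (simp_all add: simple_perm_involutive)

theorem gen_step:
  assumes g: "gen_idx g < n" and m: "sym_match (dots_of n) (bar_dot n) \<tau>"
  shows "gen_step n g \<tau>"
proof -
  have \<tau>: "fpf_invol (dots (2 * n)) \<tau>" using sym_matchD(2)[OF m] by (simp add: dots_of_eq)
  show ?thesis
  proof (cases g)
    case (gr i)
    then have i: "i < n" using g by simp
    show ?thesis
    proof (cases "i = 0")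
      case True
      have n: "1 \<le> n" "n < 2 * n" using i by auto
      show ?thesis
      proof (rule gen_stepI1[OF acts_as_R[OF n] \<tau>])
        show "phi_gen n g = Poly_Mapping.single (R_diag (2 * n) n) 1" by (simp add: gr True R_el_def)
        show "gen_op n g = swp n (n + 1)" by (simp add: gr True fun_eq_iff)
        show "diag (2 * n) (gen_act n g \<tau>) = diag (2 * n) (act_top (sw n) \<tau>)"
          using i by (simp add: gr True gen_act_def simple_perm_0_sw)
      qed
    next
      case False
      have j: "1 \<le> n - i" "n - i < 2 * n" "1 \<le> n + i" "n + i < 2 * n" using i False by auto
      have L: "lift_top (simple_perm n i) p = lift_top (sw (n - i)) (lift_top (sw (n + i)) p)"
        "lift_top (simple_perm n i) p = lift_top (sw (n + i)) (lift_top (sw (n - i)) p)" for p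
        using simple_perm_sw(1,2)[OF i] False by (cases p; cases "snd p"; simp)+
      have "gen_act n g \<tau> p = act_top (sw (n - i)) (act_top (sw (n + i)) \<tau>) p" for p
      proof -
        have "act_top (sw (n - i)) (act_top (sw (n + i)) \<tau>) p =
            lift_top (sw (n - i)) (lift_top (sw (n + i)) (\<tau> (lift_top (sw (n + i)) (lift_top (sw (n - i)) p))))"
          unfolding act_top_def inv_sw ..
        also have "\<dots> = lift_top (simple_perm n i) (\<tau> (lift_top (simple_perm n i) p))"
          unfolding L(1)[symmetric] L(2)[symmetric] ..
        finally show ?thesis unfolding gr gen_act_def genC.case act_top_def inv_simple_perm[OF i] by (rule sym)
      qed
      then have ga: "gen_act n g \<tau> = act_top (sw (n - i)) (act_top (sw (n + i)) \<tau>)" by (rule ext)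
      have e: "n + 1 - i = n - i + 1" using i by simp
      show ?thesis
      proof (rule gen_stepI2[OF acts_as_R[OF j(1,2)] acts_as_R[OF j(3,4)] \<tau>])
        show "gen_op n g = (\<lambda>\<psi>. swp (n - i) (n - i + 1) (swp (n + i) (n + i + 1) \<psi>))"
          unfolding gr gen_op.simps e swp_sym[of "n - i + 1" "n - i"] if_not_P[OF False] by (rule ext) (rule refl)
        show "phi_gen n g = bmult (Poly_Mapping.single (R_diag (2 * n) (n - i)) 1) (Poly_Mapping.single (R_diag (2 * n) (n + i)) 1)"
          unfolding gr phi_gen.simps if_not_P[OF False] R_el_def ..
        show "diag (2 * n) (gen_act n g \<tau>) = diag (2 * n) (act_top (sw (n - i)) (act_top (sw (n + i)) \<tau>))" unfolding ga ..
        show "swp (n - i) (n - i + 1) (\<lambda>x. k * \<psi> x) = (\<lambda>x. k * swp (n - i) (n - i + 1) \<psi> x)" for k \<psi>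
          by (rule swp_scale)
      qed
    qed
  next
    case (ge i)
    then have i: "i < n" using g by simp
    show ?thesis
    proof (cases "i = 0")
      case True
      have n: "1 \<le> n" "n < 2 * n" using i by auto
      have "n + 1 = bar n n" by (simp add: bar_def)
      then have ga: "gen_act n g \<tau> = join (n, True) (n + 1, True) \<tau>"
        unfolding ge True gen_act_def genC.case sym_join_def by simp
      show ?thesis
      proof (rule gen_stepI1[OF acts_as_E[OF n] \<tau>])
        show "phi_gen n g = Poly_Mapping.single (E_diag (2 * n) n) 1" by (simp add: ge True E_el_def)
        show "gen_op n g = cap n (n + 1)" by (simp add: ge True fun_eq_iff)
        show "diag (2 * n) (gen_act n g \<tau>) = diag (2 * n) (join (n, True) (n + 1, True) \<tau>)" unfolding ga ..
      qed
    next
      case False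
      have j: "1 \<le> n - i" "n - i < 2 * n" "1 \<le> n + i" "n + i < 2 * n" using i False by auto
      have b: "bar n (n + i) = n - i + 1" "bar n (n + i + 1) = n - i" "n + i + 1 \<noteq> bar n (n + i)"
        using i False by (auto simp: bar_def)
      let ?t = "join (n + i, True) (n + i + 1, True) \<tau>"
      have t: "fpf_invol (dots (2 * n)) ?t" using i by (intro fpf_invol_join[OF \<tau>]) auto
      have "join (n - i + 1, True) (n - i, True) ?t = join (n - i, True) (n - i + 1, True) ?t"
        using i by (intro join_commute[OF t]) auto
      then have ga: "gen_act n g \<tau> = join (n - i, True) (n - i + 1, True) ?t"
        unfolding ge gen_act_def genC.case sym_join_def bar_dot_simps b(1,2) using b(3)
        unfolding b(1) by simp
      have e: "n + 1 - i = n - i + 1" using i by simp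
      show ?thesis
      proof (rule gen_stepI2[OF acts_as_E[OF j(1,2)] acts_as_E[OF j(3,4)] \<tau>])
        show "gen_op n g = (\<lambda>\<psi>. cap (n - i) (n - i + 1) (cap (n + i) (n + i + 1) \<psi>))"
          unfolding ge gen_op.simps e cap_sym[of "n - i + 1" "n - i"] if_not_P[OF False] by (rule ext) (rule refl)
        show "phi_gen n g = bmult (Poly_Mapping.single (E_diag (2 * n) (n - i)) 1) (Poly_Mapping.single (E_diag (2 * n) (n + i)) 1)"
          unfolding ge phi_gen.simps if_not_P[OF False] E_el_def ..
        show "diag (2 * n) (gen_act n g \<tau>) = diag (2 * n) (join (n - i, True) (n - i + 1, True) ?t)" unfolding ga ..
        show "cap (n - i) (n - i + 1) (\<lambda>x. k * \<psi> x) = (\<lambda>x. k * cap (n - i) (n - i + 1) \<psi> x)" for k \<psi>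
          by (rule cap_scale)
      qed
    qed
  qed
qed

lemma sym_match_gen_act:
  assumes g: "gen_idx g < n" and m: "sym_match (dots_of n) (bar_dot n) \<tau>"
  shows "sym_match (dots_of n) (bar_dot n) (gen_act n g \<tau>)"
proof (cases g)
  case (gr i)
  then show ?thesis using sym_match_act_top[OF m signed_simple_perm] g by (simp add: gen_act_def)
next
  case (ge i)
  then show ?thesis using sym_match_sym_join[OF m, of "(n + i, True)" "(n + i + 1, True)"] g by (simp add: gen_act_def)
qed

fun word_match :: "nat \<Rightarrow> genC list \<Rightarrow> dot \<Rightarrow> dot" where
  "word_match n [] = (\<lambda>p. (fst p, \<not> snd p))"
| "word_match n (g # u) = gen_act n g (word_match n u)"

abbreviation word_diag :: "nat \<Rightarrow> genC list \<Rightarrow> diagram" where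
  "word_diag n u \<equiv> diag (2 * n) (word_match n u)"

lemma sym_match_id: "sym_match (dots_of n) (bar_dot n) (\<lambda>p. (fst p, \<not> snd p))"
  using fpf_bar_dot by (auto simp: sym_match_def fpf_invol_def dots_of_def bar_dot_def)

lemma sym_match_word: "valid_word n u \<Longrightarrow> sym_match (dots_of n) (bar_dot n) (word_match n u)"
  by (induction u) (auto simp: valid_word_def sym_match_id intro: sym_match_gen_act)

lemma fpf_word: "valid_word n u \<Longrightarrow> fpf_invol (dots (2 * n)) (word_match n u)"
  using sym_matchD(2)[OF sym_match_word] by (simp add: dots_of_eq)

lemma phi_word_Nil: "phi_word n [] = Poly_Mapping.single (word_diag n []) 1"
  by (simp add: phi_word_def brauer_one_def id_diag_eq)

lemma phi_word_Cons: "phi_word n (g # u) = bmult (phi_gen n g) (phi_word n u)"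
  by (simp add: phi_word_def)

lemma gen_op_cong:
  assumes "gen_idx g < n" "\<And>m. m \<in> colorings (2 * n) \<Longrightarrow> \<psi> m = \<psi>' m" "x \<in> colorings (2 * n)"
  shows "gen_op n g \<psi> x = gen_op n g \<psi>' x"
proof -
  have s: "swp j (j + 1) \<psi> x = swp j (j + 1) \<psi>' x" "cap j (j + 1) \<psi> x = cap j (j + 1) \<psi>' x"
    if "1 \<le> j" "j < 2 * n" "\<And>m. m \<in> colorings (2 * n) \<Longrightarrow> \<psi> m = \<psi>' m" "x \<in> colorings (2 * n)" for j \<psi> \<psi>' x
    using acts_as_cong[OF acts_as_R[OF that(1,2)] that(3,4)] acts_as_cong[OF acts_as_E[OF that(1,2)] that(3,4)] by simp_all
  show ?thesis
  proof (cases "gen_idx g = 0")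
    case True
    then show ?thesis using s[of n \<psi> \<psi>' x] assms by (cases g) simp_all
  next
    case False
    define i where "i = gen_idx g"
    have i: "1 \<le> n - i" "n - i < 2 * n" "1 \<le> n + i" "n + i < 2 * n" and e: "n + 1 - i = n - i + 1"
      using False assms(1) by (auto simp: i_def)
    show ?thesis
      using False s(1)[OF i(1,2) s(1)[OF i(3,4) assms(2)] assms(3)] s(2)[OF i(1,2) s(2)[OF i(3,4) assms(2)] assms(3)]
        swp_sym[of "n - i" "n - i + 1"] cap_sym[of "n - i" "n - i + 1"] e
      by (cases g) (simp_all add: i_def)
  qed
qed

text \<open>Each generator sends a symmetric diagram to a power of \<open>delta\<close> times a
  symmetric diagram, so a word yields a single term. The second half ties its exponent to the action
  on the kernel of the identity diagram, from which diagram and exponent can be recovered.\<close>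

theorem phi_word_single:
  assumes "valid_word n u"
  shows "\<exists>k. phi_word n u = Poly_Mapping.single (word_diag n u) (delta ^ k) \<and>
    (\<forall>x\<in>colorings (2 * n). \<forall>y. 2 ^ k * kernel (word_diag n u) x y = word_op n u (\<lambda>m. kernel (word_diag n []) m y) x)"
  using assms
proof (induction u)
  case Nil
  show ?case by (rule exI[of _ 0]) (simp add: phi_word_Nil)
next
  case (Cons g u)
  then have g: "gen_idx g < n" and u: "valid_word n u" by (auto simp: valid_word_def)
  obtain k where k: "phi_word n u = Poly_Mapping.single (word_diag n u) (delta ^ k)"
    "\<And>x y. x \<in> colorings (2 * n) \<Longrightarrow> 2 ^ k * kernel (word_diag n u) x y = word_op n u (\<lambda>m. kernel (word_diag n []) m y) x"
    using Cons.IH[OF u] by blast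
  obtain l where l: "\<And>c. bmult (phi_gen n g) (Poly_Mapping.single (word_diag n u) c) =
       Poly_Mapping.single (word_diag n (g # u)) (c * delta ^ l)"
    "\<And>x y. x \<in> colorings (2 * n) \<Longrightarrow> 2 ^ l * kernel (word_diag n (g # u)) x y =
       gen_op n g (\<lambda>m. kernel (word_diag n u) m y) x"
    using gen_step[OF g sym_match_word[OF u]] unfolding gen_step_def word_match.simps by blast
  show ?case
  proof (intro exI[of _ "k + l"] conjI ballI allI)
    show "phi_word n (g # u) = Poly_Mapping.single (word_diag n (g # u)) (delta ^ (k + l))"
      unfolding phi_word_Cons k(1) l(1) by (simp only: power_add)
    fix x y assume x: "x \<in> colorings (2 * n)"
    have "2 ^ (k + l) * kernel (word_diag n (g # u)) x y = 2 ^ k * gen_op n g (\<lambda>m. kernel (word_diag n u) m y) x"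
      unfolding l(2)[OF x, symmetric] by (simp only: power_add mult.assoc)
    also have "\<dots> = gen_op n g (\<lambda>m. 2 ^ k * kernel (word_diag n u) m y) x" by (simp only: gen_op_scale)
    also have "\<dots> = word_op n (g # u) (\<lambda>m. kernel (word_diag n []) m y) x"
      unfolding word_op.simps by (rule gen_op_cong[OF g _ x]) (rule k(2))
    finally show "2 ^ (k + l) * kernel (word_diag n (g # u)) x y = word_op n (g # u) (\<lambda>m. kernel (word_diag n []) m y) x" .
  qed
qed

text \<open>The operators of the two words differ by the factor \<open>2 ^ j\<close>. A scaled
  kernel determines both the diagram and the exponent, so the images differ by
  \<open>delta ^ j\<close>.\<close>

theorem phi_word_rel:
  assumes r: "word_rel n u v j" and n: "2 \<le> n"
  shows "phi_word n u = bscale (delta ^ j) (phi_word n v)"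
proof -
  have V: "valid_word n u" "valid_word n v" using word_rel_valid[OF r n] by auto
  obtain k where k: "phi_word n u = Poly_Mapping.single (word_diag n u) (delta ^ k)"
    "\<And>x y. x \<in> colorings (2 * n) \<Longrightarrow> 2 ^ k * kernel (word_diag n u) x y = word_op n u (\<lambda>m. kernel (word_diag n []) m y) x"
    using phi_word_single[OF V(1)] by blast
  obtain l where l: "phi_word n v = Poly_Mapping.single (word_diag n v) (delta ^ l)"
    "\<And>x y. x \<in> colorings (2 * n) \<Longrightarrow> 2 ^ l * kernel (word_diag n v) x y = word_op n v (\<lambda>m. kernel (word_diag n []) m y) x"
    using phi_word_single[OF V(2)] by blast
  have "2 ^ k * kernel (word_diag n u) x y = 2 ^ (j + l) * kernel (word_diag n v) x y" if x: "x \<in> colorings (2 * n)" for x y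
  proof -
    have "2 ^ k * kernel (word_diag n u) x y = 2 ^ j * word_op n v (\<lambda>m. kernel (word_diag n []) m y) x"
      unfolding k(2)[OF x] word_op_rel[OF r n] ..
    then show ?thesis unfolding l(2)[OF x, symmetric] by (simp only: power_add mult.assoc)
  qed
  then have "word_diag n u = word_diag n v \<and> k = j + l"
    by (intro scaled_kernel_determines[OF pairs_on_diag[OF fpf_word[OF V(1)]] pairs_on_diag[OF fpf_word[OF V(2)]]])
  then show ?thesis unfolding k(1) l(1) bscale_single by (simp add: power_add)
qed

lemma bmult_assoc_diag:
  assumes "fpf_invol (dots N) \<alpha>" "fpf_invol (dots N) \<beta>" "fpf_invol (dots N) \<gamma>"
  shows "bmult (bmult (Poly_Mapping.single (diag N \<alpha>) a) (Poly_Mapping.single (diag N \<beta>) b)) (Poly_Mapping.single (diag N \<gamma>) c) =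
    bmult (Poly_Mapping.single (diag N \<alpha>) a) (bmult (Poly_Mapping.single (diag N \<beta>) b) (Poly_Mapping.single (diag N \<gamma>) c))"
proof -
  note A = diagram_comp_assoc[OF assms(1,3) pairs_on_diag[OF assms(2)]]
  have "a * b * delta ^ p * c * delta ^ q = a * (b * c * delta ^ r) * delta ^ s" if "p + q = r + s" for p q r s
  proof -
    have "a * b * delta ^ p * c * delta ^ q = a * b * c * delta ^ (p + q)" by (simp add: power_add mult_ac)
    also have "\<dots> = a * (b * c * delta ^ r) * delta ^ s" unfolding that by (simp add: power_add mult_ac)
    finally show ?thesis .
  qed
  from this[OF A(2)] show ?thesis unfolding bmult_single A(1) by (rule arg_cong)
qed

lemma phi_gen_single:
  assumes "gen_idx g < n"
  shows "\<exists>\<alpha> a. fpf_invol (dots (2 * n)) \<alpha> \<and> phi_gen n g = Poly_Mapping.single (diag (2 * n) \<alpha>) a"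
proof -
  have R: "R_el (2 * n) j = Poly_Mapping.single (diag (2 * n) (R_match j)) 1" "fpf_invol (dots (2 * n)) (R_match j)"
    "E_el (2 * n) j = Poly_Mapping.single (diag (2 * n) (E_match j)) 1" "fpf_invol (dots (2 * n)) (E_match j)"
    if "1 \<le> j" "j < 2 * n" for j
    using that by (simp_all add: R_el_def E_el_def R_diag_eq E_diag_eq fpf_R_match fpf_E_match)
  show ?thesis
  proof (cases "gen_idx g = 0")
    case True
    then show ?thesis using R[of n] assms by (cases g) auto
  next
    case False
    define i where "i = gen_idx g"
    have i: "1 \<le> n - i" "n - i < 2 * n" "1 \<le> n + i" "n + i < 2 * n" using False assms by (auto simp: i_def)
    note R1 = R[OF i(1,2)] and R2 = R[OF i(3,4)]
    have "R_match (n - i) p = R_match (n - i) p" for p ..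
    have r: "diagram_comp (diag (2 * n) (R_match (n - i))) (diag (2 * n) (R_match (n + i))) =
        diag (2 * n) (act_top (sw (n - i)) (R_match (n + i)))"
      using R_step(1)[OF i(1,2) R2(2)] R_diag_eq[OF i(1,2)] by simp
    have e: "diagram_comp (diag (2 * n) (E_match (n - i))) (diag (2 * n) (E_match (n + i))) =
        diag (2 * n) (join (n - i, True) (n - i + 1, True) (E_match (n + i)))"
      using E_step(1)[OF i(1,2) R2(4)] E_diag_eq[OF i(1,2)] by simp
    have f: "fpf_invol (dots (2 * n)) (join (n - i, True) (n - i + 1, True) (E_match (n + i)))"
      using i by (intro fpf_invol_join[OF R2(4)]) auto
    show ?thesis
    proof (cases g)
      case (gr k)
      have "phi_gen n g = bmult (R_el (2 * n) (n - i)) (R_el (2 * n) (n + i))"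
        using False by (simp add: i_def gr)
      then show ?thesis unfolding R1(1) R2(1) bmult_single r by (intro exI conjI) (rule fpf_act_sw[OF i(1,2) R2(2)])
    next
      case (ge k)
      have "phi_gen n g = bmult (E_el (2 * n) (n - i)) (E_el (2 * n) (n + i))"
        using False by (simp add: i_def ge)
      then show ?thesis unfolding R1(3) R2(3) bmult_single e by (intro exI conjI) (rule f)
    qed
  qed
qed

lemma colorings_ext:
  assumes x: "x \<in> colorings N" and m: "m \<in> colorings N" and eq: "\<forall>k\<in>{1..N}. m k = x k"
  shows "m = x"
proof
  have out: "y k = False" if y: "y \<in> colorings N" and k: "k \<notin> {1..N}" for y k
  proof (rule ccontr)
    assume "y k \<noteq> False"
    then have "y k" by simp
    then have "k \<in> {1..N}" using y unfolding colorings_def by blast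
    then show False using k by contradiction
  qed
  fix k show "m k = x k"
  proof (cases "k \<in> {1..N}")
    case True
    then show ?thesis by (rule bspec[OF eq])
  next
    case False
    show ?thesis unfolding out[OF x False] out[OF m False] ..
  qed
qed

theorem phi_word_append:
  assumes "valid_word n u" "valid_word n v"
  shows "phi_word n (u @ v) = bmult (phi_word n u) (phi_word n v)"
  using assms(1)
proof (induction u)
  case Nil
  obtain k where k: "phi_word n v = Poly_Mapping.single (word_diag n v) (delta ^ k)"
    using phi_word_single[OF assms(2)] by blast
  have "diagram_comp (word_diag n []) (word_diag n v) = word_diag n v \<and> num_loops (word_diag n []) (word_diag n v) = 0"
  proof -
    have c: "composable (2 * n) (word_diag n []) (word_diag n v)"
      using composable_diag(1)[OF pairs_on_diag[OF fpf_word] fpf_word[OF assms(2)], of "[]"] by (simp add: valid_word_def)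
    \<comment> \<open>The kernel of the identity diagram is the identity matrix, so this diagram is
      neutral and closes no loop.\<close>
    have k: "kernel (word_diag n []) x m = of_bool (m = x)" if "x \<in> colorings (2 * n)" "m \<in> colorings (2 * n)" for x m
    proof -
      have "monochrome (mix x m) (word_diag n []) \<longleftrightarrow> (\<forall>k\<in>{1..2 * n}. m k = x k)"
        unfolding monochrome_diag all_dots by (auto simp: mix_def)
      also have "\<dots> \<longleftrightarrow> m = x"
        by (rule iffI, rule colorings_ext[OF that], assumption, simp)
      finally show ?thesis by (simp add: kernel_def)
    qed
    have "(\<Sum>m\<in>colorings (2 * n). kernel (word_diag n []) x m * kernel (word_diag n v) m y) = 2 ^ 0 * kernel (word_diag n v) x y"
      if x: "x \<in> colorings (2 * n)" for x y
    proof -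
      have "(\<Sum>m\<in>colorings (2 * n). kernel (word_diag n []) x m * kernel (word_diag n v) m y) =
          (\<Sum>m\<in>colorings (2 * n). if m = x then kernel (word_diag n v) m y else 0)"
        by (rule sum.cong[OF refl]) (simp only: k[OF x] of_bool_def, simp)
      then show ?thesis using x finite_colorings by simp
    qed
    then show ?thesis using diagram_comp_eqI[OF c pairs_on_diag[OF fpf_word[OF assms(2)]]] by blast
  qed
  then show ?case unfolding phi_word_Nil k bmult_single append_Nil by simp
next
  case (Cons g u)
  then have g: "gen_idx g < n" and u: "valid_word n u" by (auto simp: valid_word_def)
  obtain k where k: "phi_word n v = Poly_Mapping.single (word_diag n v) (delta ^ k)"
    using phi_word_single[OF assms(2)] by blast
  obtain l where l: "phi_word n u = Poly_Mapping.single (word_diag n u) (delta ^ l)"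
    using phi_word_single[OF u] by blast
  obtain \<alpha> a where a: "fpf_invol (dots (2 * n)) \<alpha>" "phi_gen n g = Poly_Mapping.single (diag (2 * n) \<alpha>) a"
    using phi_gen_single[OF g] by blast
  show ?case
    unfolding append_Cons phi_word_Cons Cons.IH[OF u] unfolding k l a(2)
    by (rule bmult_assoc_diag[OF a(1) fpf_word[OF u] fpf_word[OF assms(2)], symmetric])
qed

section \<open>The presented monoid\<close>

context brauerC_monoid
begin

definition gen_val :: "genC \<Rightarrow> 'a" where
  "gen_val g = (case g of gr i \<Rightarrow> r i | ge i \<Rightarrow> e i)"

lemma e_cup:
  assumes "i < n"
  shows "e i = cup (n + i) (n + i + 1)"
proof (cases "i = 0")
  case True
  have d: "n + 1 \<in> {1..2 * n}" "n \<in> {1..2 * n}" using n2 by auto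
  have "e i = cup (n + 1) n" unfolding True e0_eq bar_std(1) ..
  also have "\<dots> = cup n (n + 1)" using cup_sym[OF d(2,1)] by simp
  finally show ?thesis using True by simp
qed (use assms e_eq_cup in simp)

lemma normal_form_cong:
  assumes "normal_form \<tau> z" "\<And>p. p \<in> dots_of n \<Longrightarrow> \<tau> p = \<sigma> p"
  shows "normal_form \<sigma> z"
  using assms unfolding normal_form_def nf_data_def by auto

lemma normal_form_gen:
  assumes g: "gen_idx g < n" and m: "sym_match (dots_of n) (bar_dot n) \<tau>" and nf: "normal_form \<tau> z"
  shows "normal_form (gen_act n g \<tau>) (gen_val g * z)"
proof (cases g)
  case (gr i)
  then have i: "i < n" using g by simp
  show ?thesis using normal_form_perm[OF nf signed_simple_perm[OF i]]
    unfolding gr gen_act_def gen_val_def genC.case rep_simple[OF i] .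
next
  case (ge i)
  then have i: "i < n" using g by simp
  have "n + i \<in> {1..2 * n}" "n + i + 1 \<in> {1..2 * n}" "n + i \<noteq> n + i + 1" using i by auto
  from normal_form_join[OF m nf this] show ?thesis
    unfolding ge gen_act_def gen_val_def genC.case e_cup[OF i] .
qed

lemma normal_form_word: "valid_word n u \<Longrightarrow> normal_form (word_match n u) (prod_list (map gen_val u))"
proof (induction u)
  case (Cons g u)
  then have "gen_idx g < n" "valid_word n u" by (auto simp: valid_word_def)
  then show ?case using normal_form_gen[OF _ sym_match_word] Cons.IH by simp
qed (simp add: normal_form_id)

text \<open>Equal diagrams mean matchings that agree on the dots. Both products are then normal
  forms of one matching, and normal forms are unique.\<close>

lemma word_product_eqI:
  assumes "valid_word n u" "valid_word n v" "word_diag n u = word_diag n v"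
  shows "prod_list (map gen_val u) = prod_list (map gen_val v)"
proof -
  have "word_match n u p = word_match n v p" if "p \<in> dots_of n" for p
    using diag_inject[OF fpf_word[OF assms(2)] assms(3)] that by (simp add: dots_of_eq)
  then have "normal_form (word_match n v) (prod_list (map gen_val u))"
    by (rule normal_form_cong[OF normal_form_word[OF assms(1)]])
  then show ?thesis using normal_form_word[OF assms(2)] by (rule normal_form_unique)
qed

end

text \<open>The exponent of \<open>\<delta>\<close> is dropped here; \<open>word_cong_ideal\<close>
  restores it as some integer power.\<close>

inductive word_cong :: "nat \<Rightarrow> genC list \<Rightarrow> genC list \<Rightarrow> bool" for n where
  rel: "word_rel n u v j \<Longrightarrow> word_cong n u v"
| word_refl: "word_cong n u u"
| word_sym: "word_cong n u v \<Longrightarrow> word_cong n v u"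
| word_trans: "word_cong n u v \<Longrightarrow> word_cong n v w \<Longrightarrow> word_cong n u w"
| frame: "word_cong n u v \<Longrightarrow> word_cong n (a @ u @ b) (a @ v @ b)"

lemma word_cong_append:
  assumes "word_cong n u u'" "word_cong n v v'"
  shows "word_cong n (u @ v) (u' @ v')"
proof -
  have "word_cong n ([] @ u @ v) ([] @ u' @ v)" "word_cong n (u' @ v @ []) (u' @ v' @ [])"
    by (rule word_cong.frame, rule assms)+
  then show ?thesis using word_cong.word_trans[of n "u @ v" "u' @ v" "u' @ v'"] by simp
qed

text \<open>The monoids presented by the relations at \<open>\<delta> = 1\<close>, for all \<open>n\<close> at once: elements are
  families of words indexed by \<open>n\<close>, as a type cannot depend on \<open>n\<close>.\<close>
quotient_type word_monoid = "nat \<Rightarrow> genC list" / "\<lambda>f g. \<forall>m. word_cong m (f m) (g m)"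
  by (rule equivpI) (auto intro!: reflpI sympI transpI intro: word_cong.word_refl word_cong.word_sym word_cong.word_trans)

instantiation word_monoid :: monoid_mult
begin

lift_definition one_word_monoid :: word_monoid is "\<lambda>_. []" .

lift_definition times_word_monoid :: "word_monoid \<Rightarrow> word_monoid \<Rightarrow> word_monoid" is "\<lambda>f g m. f m @ g m"
  by (simp add: word_cong_append)

instance
  by standard (transfer, simp add: word_cong.word_refl)+

end

text \<open>The family is the empty word at every index other than \<open>n\<close>, so equality of
  two classes amounts to congruence for this one \<open>n\<close>.\<close>

lift_definition word_class :: "nat \<Rightarrow> genC list \<Rightarrow> word_monoid" is "\<lambda>n u m. if m = n then u else []" .

lemma word_class_mult: "word_class n u * word_class n v = word_class n (u @ v)"
  by transfer (simp add: word_cong.word_refl)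

lemma word_class_one: "1 = word_class n []"
  by transfer (simp add: word_cong.word_refl)

lemma word_class_eq: "word_class n u = word_class n v \<longleftrightarrow> word_cong n u v"
  by transfer (auto simp: word_cong.word_refl split: if_splits)

lemma word_class_rel: "word_rel n u v j \<Longrightarrow> word_class n u = word_class n v"
  unfolding word_class_eq by (rule word_cong.rel)

lemma brauerC_word_monoid:
  assumes n: "2 \<le> n"
  shows "brauerC_monoid n (\<lambda>i. word_class n [gr i]) (\<lambda>i. word_class n [ge i])"
proof -
  note s = word_class_mult append_Cons append_Nil word_class_one[of n]
  note r = word_class_rel
  show ?thesis
  proof (rule brauerC_monoid.intro, goal_cases)
    case 1 then show ?case by (rule n)
  next case (2 i) then show ?case unfolding s by (rule r[OF word_rel.rr])
  next case (3 i) then show ?case unfolding s by (rule r[OF word_rel.re])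
  next case (4 i) then show ?case unfolding s by (rule r[OF word_rel.er])
  next case (5 i)
    then show ?case unfolding s using r[OF word_rel.ee0[of n]] r[OF word_rel.ee[of i n]] by (cases "i = 0") simp_all
  next case (6 i j) then show ?case unfolding s by (rule r[OF word_rel.rr_comm])
  next case (7 i j) then show ?case unfolding s by (rule r[OF word_rel.er_comm])
  next case (8 i j) then show ?case unfolding s by (rule r[OF word_rel.ee_comm])
  next case (9 i j) then show ?case unfolding s by (rule r[OF word_rel.rrr])
  next case (10 i j) then show ?case unfolding s by (rule r[OF word_rel.rre])
  next case (11 i j) then show ?case unfolding s by (rule r[OF word_rel.rer])
  next case 12 show ?case unfolding s by (rule r[OF word_rel.r1010])
  next case 13 show ?case unfolding s by (rule r[OF word_rel.rre01])
  next case 14 show ?case unfolding s by (rule r[OF word_rel.rere])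
  next case 15 show ?case unfolding s by (rule r[OF word_rel.rrre])
  next case 16 show ?case unfolding s by (rule r[OF word_rel.ere])
  next case 17 show ?case unfolding s by (rule r[OF word_rel.eee])
  next case 18 show ?case unfolding s by (rule r[OF word_rel.err])
  next case 19 show ?case unfolding s by (rule r[OF word_rel.eer])
  qed
qed

text \<open>The word monoid is the universal instance of the locale: the value of a word in it is
  its own congruence class, so an equality of products is a congruence.\<close>

theorem word_cong_of_diag:
  assumes n: "2 \<le> n" and uv: "valid_word n u" "valid_word n v" "word_diag n u = word_diag n v"
  shows "word_cong n u v"
proof -
  interpret M: brauerC_monoid n "\<lambda>i. word_class n [gr i]" "\<lambda>i. word_class n [ge i]"
    by (rule brauerC_word_monoid[OF n])
  have g: "M.gen_val g = word_class n [g]" for g by (cases g) (simp_all add: M.gen_val_def)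
  have "prod_list (map M.gen_val w) = word_class n w" for w
    by (induction w) (simp_all add: g word_class_mult word_class_one[of n])
  then show ?thesis using M.word_product_eqI[OF uv] by (simp add: word_class_eq)
qed

section \<open>Counting symmetric matchings\<close>

text \<open>Fixing the values outside \<open>V\<close> makes functions correspond one to one to
  matchings, so that they can be counted.\<close>

definition sym_matchings :: "'b set \<Rightarrow> ('b \<Rightarrow> 'b) \<Rightarrow> ('b \<Rightarrow> 'b) set" where
  "sym_matchings V \<rho> = {t. sym_match V \<rho> t \<and> (\<forall>x. x \<notin> V \<longrightarrow> t x = x)}"

text \<open>Prescribing the partner of \<open>v\<close> settles the mirrored strand as well.
  Deleting the dots involved, two if \<open>w = \<rho> v\<close> and four otherwise, leaves an
  arbitrary symmetric matching of the rest.\<close>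

lemma sym_matchings_fix_pair:
  assumes \<rho>: "fpf_invol V \<rho>" and vw: "v \<in> V" "w \<in> V" "v \<noteq> w"
  defines "Q \<equiv> {v, w, \<rho> v, \<rho> w}"
  shows "bij_betw (\<lambda>t x. if x \<in> Q then x else t x) {t \<in> sym_matchings V \<rho>. t v = w} (sym_matchings (V - Q) \<rho>)"
proof (rule bij_betw_byWitness[where f' = "\<lambda>s. s(v := w, w := v, \<rho> v := \<rho> w, \<rho> w := \<rho> v)"])
  have \<rho>V: "\<rho> x \<in> V" "\<rho> x \<noteq> x" "\<rho> (\<rho> x) = x" if "x \<in> V" for x using \<rho> that by (auto simp: fpf_invol_def)
  have ne: "\<rho> v \<noteq> \<rho> w" using fpf_invol_eq[OF \<rho> vw(1,2)] vw(3) by simp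
  have sw: "\<rho> v = w \<longleftrightarrow> \<rho> w = v" using \<rho>V(3) vw by metis
  have QV: "Q \<subseteq> V" using vw \<rho>V(1) by (auto simp: Q_def)
  have \<rho>Q: "\<rho> x \<in> Q \<longleftrightarrow> x \<in> Q" if "x \<in> V" for x
  proof -
    have *: "\<rho> y \<in> Q" if "y \<in> Q" for y using that \<rho>V(3) vw by (auto simp: Q_def)
    show ?thesis using *[of x] *[of "\<rho> x"] \<rho>V(3)[OF that] by auto
  qed
  have T: "t w = v \<and> t (\<rho> v) = \<rho> w \<and> t (\<rho> w) = \<rho> v" if "t \<in> sym_matchings V \<rho>" "t v = w" for t
  proof -
    have m: "fpf_invol V t" "\<And>x. x \<in> V \<Longrightarrow> t (\<rho> x) = \<rho> (t x)" using that by (auto simp: sym_matchings_def sym_match_def)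
    have "t w = v" using fpf_invol_twice[OF m(1) vw(1)] that(2) by simp
    then show ?thesis using m(2)[OF vw(1)] m(2)[OF vw(2)] that(2) by simp
  qed
  show "\<forall>t\<in>{t \<in> sym_matchings V \<rho>. t v = w}.
      (\<lambda>x. if x \<in> Q then x else t x)(v := w, w := v, \<rho> v := \<rho> w, \<rho> w := \<rho> v) = t"
  proof
    fix t assume "t \<in> {t \<in> sym_matchings V \<rho>. t v = w}"
    then have "t v = w" "t w = v" "t (\<rho> v) = \<rho> w" "t (\<rho> w) = \<rho> v" using T by auto
    then show "(\<lambda>x. if x \<in> Q then x else t x)(v := w, w := v, \<rho> v := \<rho> w, \<rho> w := \<rho> v) = t"
      by (intro ext) (simp add: Q_def)
  qed
  show "\<forall>s\<in>sym_matchings (V - Q) \<rho>. (\<lambda>x. if x \<in> Q then x else (s(v := w, w := v, \<rho> v := \<rho> w, \<rho> w := \<rho> v)) x) = s"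
  proof
    fix s assume "s \<in> sym_matchings (V - Q) \<rho>"
    then have "s x = x" if "x \<in> Q" for x using that by (auto simp: sym_matchings_def)
    then show "(\<lambda>x. if x \<in> Q then x else (s(v := w, w := v, \<rho> v := \<rho> w, \<rho> w := \<rho> v)) x) = s"
      by (intro ext) (simp add: Q_def)
  qed
  show "(\<lambda>t x. if x \<in> Q then x else t x) ` {t \<in> sym_matchings V \<rho>. t v = w} \<subseteq> sym_matchings (V - Q) \<rho>"
  proof (intro image_subsetI, elim CollectE conjE)
    fix t assume t: "t \<in> sym_matchings V \<rho>" "t v = w"
    have m: "t x \<in> V" "t x \<noteq> x" "t (t x) = x" "t (\<rho> x) = \<rho> (t x)" if "x \<in> V" for x
      using t(1) that by (auto simp: sym_matchings_def sym_match_def fpf_invol_def)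
    have tQ: "t x \<in> Q \<longleftrightarrow> x \<in> Q" if "x \<in> V" for x
    proof -
      have *: "t y \<in> Q" if "y \<in> Q" for y using that T[OF t] t(2) by (auto simp: Q_def)
      show ?thesis using *[of x] *[of "t x"] m(3)[OF that] by auto
    qed
    have "t x \<in> V - Q" "\<rho> x \<in> V - Q" if "x \<in> V - Q" for x using that m(1) tQ \<rho>V(1) \<rho>Q by auto
    then show "(\<lambda>x. if x \<in> Q then x else t x) \<in> sym_matchings (V - Q) \<rho>"
      using m \<rho>V t(1) unfolding sym_matchings_def sym_match_def fpf_invol_def by simp
  qed
  show "(\<lambda>s. s(v := w, w := v, \<rho> v := \<rho> w, \<rho> w := \<rho> v)) ` sym_matchings (V - Q) \<rho> \<subseteq> {t \<in> sym_matchings V \<rho>. t v = w}"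
  proof (intro image_subsetI CollectI conjI)
    fix s assume s: "s \<in> sym_matchings (V - Q) \<rho>"
    let ?t = "s(v := w, w := v, \<rho> v := \<rho> w, \<rho> w := \<rho> v)"
    have m: "s x \<in> V - Q" "s x \<noteq> x" "s (s x) = x" "s (\<rho> x) = \<rho> (s x)" if "x \<in> V - Q" for x
      using s that by (auto simp: sym_matchings_def sym_match_def fpf_invol_def)
    have tv: "?t v = w" "?t w = v" "?t (\<rho> v) = \<rho> w" "?t (\<rho> w) = \<rho> v"
      using vw \<rho>V(2)[OF vw(1)] \<rho>V(2)[OF vw(2)] ne sw by (auto simp: fun_upd_apply \<rho>V(3))
    have tout: "?t x = s x" if "x \<notin> Q" for x using that by (simp add: Q_def)
    have "?t x \<in> V \<and> ?t x \<noteq> x \<and> ?t (?t x) = x \<and> ?t (\<rho> x) = \<rho> (?t x)" if x: "x \<in> V" for x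
    proof (cases "x \<in> Q")
      case True
      then consider "x = v" | "x = w" | "x = \<rho> v" | "x = \<rho> w" unfolding Q_def by blast
      then show ?thesis
      proof cases
        case 1 show ?thesis unfolding 1 tv using vw by simp
      next
        case 2 show ?thesis unfolding 2 tv using vw by simp
      next
        case 3 show ?thesis unfolding 3 tv \<rho>V(3)[OF vw(1)] \<rho>V(3)[OF vw(2)] using vw ne \<rho>V(1) by simp
      next
        case 4 show ?thesis unfolding 4 tv \<rho>V(3)[OF vw(1)] \<rho>V(3)[OF vw(2)] using vw ne \<rho>V(1) by simp
      qed
    next
      case False
      then have x': "x \<in> V - Q" "\<rho> x \<notin> Q" using x \<rho>Q by auto
      have "s x \<notin> Q" using m(1)[OF x'(1)] by simp
      then show ?thesis unfolding tout[OF False] tout[OF x'(2)] using m[OF x'(1)] tout[of "s x"] by simp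
    qed
    moreover have "?t x = x" if "x \<notin> V" for x
    proof -
      have "x \<notin> Q" using that QV by auto
      then show ?thesis using tout[of x] s that by (simp add: sym_matchings_def)
    qed
    ultimately show "?t \<in> sym_matchings V \<rho>"
      unfolding sym_matchings_def sym_match_def fpf_invol_def using \<rho>V by simp
    show "?t v = w" by (rule tv(1))
  qed
qed

lemma fpf_invol_subset:
  assumes "fpf_invol V \<rho>" "U \<subseteq> V" "\<And>x. x \<in> U \<Longrightarrow> \<rho> x \<in> U"
  shows "fpf_invol U \<rho>"
  using assms unfolding fpf_invol_def by blast

lemma a_seq_rec: "2 \<le> m \<Longrightarrow> a_seq m = a_seq (m - 1) + 2 * (m - 1) * a_seq (m - 2)"
  by (cases m rule: a_seq.cases) auto

text \<open>The partner of \<open>v\<close> is either its mirror image, which leaves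
  \<open>2 * (m - 1)\<close> dots, or one of the other \<open>2 * (m - 1)\<close> dots, which leaves
  \<open>2 * (m - 2)\<close>. For diagrams \<open>V\<close> has \<open>4 * n\<close> dots, whence
  the index \<open>2 * n\<close>.\<close>

theorem card_sym_matchings:
  assumes "finite V" "card V = 2 * m" "fpf_invol V \<rho>"
  shows "finite (sym_matchings V \<rho>) \<and> card (sym_matchings V \<rho>) = a_seq m"
  using assms
proof (induction m arbitrary: V rule: less_induct)
  case (less m)
  note \<rho> = less.prems(3)
  show ?case
  proof (cases "m = 0")
    case True
    then have "V = {}" using less.prems by simp
    then have "sym_matchings V \<rho> = {\<lambda>x. x}"
      by (auto simp: sym_matchings_def sym_match_def fpf_invol_def)
    then show ?thesis using True by simp
  next
    case False
    then obtain v where v: "v \<in> V" using less.prems by fastforce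
    have \<rho>V: "\<rho> x \<in> V" "\<rho> x \<noteq> x" "\<rho> (\<rho> x) = x" if "x \<in> V" for x using \<rho> that by (auto simp: fpf_invol_def)
    define T where "T w = {t \<in> sym_matchings V \<rho>. t v = w}" for w
    have part: "sym_matchings V \<rho> = (\<Union>w\<in>V - {v}. T w)"
      using v by (auto simp: T_def sym_matchings_def sym_match_def fpf_invol_def)
    have disj: "T w \<inter> T w' = {}" if "w \<noteq> w'" for w w' using that by (auto simp: T_def)
    have closed: "fpf_invol (V - {v, w, \<rho> v, \<rho> w}) \<rho>" if "w \<in> V" for w
    proof (rule fpf_invol_subset[OF \<rho>])
      fix x assume x: "x \<in> V - {v, w, \<rho> v, \<rho> w}"
      then have "\<rho> x \<noteq> v" "\<rho> x \<noteq> w" "\<rho> x \<noteq> \<rho> v" "\<rho> x \<noteq> \<rho> w"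
        using \<rho>V(3)[of x] fpf_invol_eq[OF \<rho>, of x v] fpf_invol_eq[OF \<rho>, of x w] v that by auto
      then show "\<rho> x \<in> V - {v, w, \<rho> v, \<rho> w}" using x \<rho>V(1) by simp
    qed auto
    have step: "finite (T w) \<and> card (T w) = a_seq k"
      if w: "w \<in> V" "w \<noteq> v" and k: "k < m" "card (V - {v, w, \<rho> v, \<rho> w}) = 2 * k" for w k
    proof -
      let ?O = "{v, w, \<rho> v, \<rho> w}"
      have IH: "finite (sym_matchings (V - ?O) \<rho>)" "card (sym_matchings (V - ?O) \<rho>) = a_seq k"
        using less.IH[OF k(1) _ k(2) closed[OF w(1)]] less.prems(1) by auto
      have b: "bij_betw (\<lambda>t x. if x \<in> ?O then x else t x) (T w) (sym_matchings (V - ?O) \<rho>)"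
        unfolding T_def by (rule sym_matchings_fix_pair[OF \<rho> v w(1)]) (use w(2) in auto)
      show ?thesis using bij_betw_finite[OF b] bij_betw_same_card[OF b] IH by simp
    qed
    have self: "finite (T (\<rho> v)) \<and> card (T (\<rho> v)) = a_seq (m - 1)"
    proof (rule step[OF \<rho>V(1,2)[OF v]])
      have "{v, \<rho> v, \<rho> v, \<rho> (\<rho> v)} = {v, \<rho> v}" using \<rho>V(3)[OF v] by auto
      then show "card (V - {v, \<rho> v, \<rho> v, \<rho> (\<rho> v)}) = 2 * (m - 1)"
        using less.prems(1,2) v \<rho>V(1,2)[OF v] by (simp add: card_Diff_subset)
    qed (use False in simp)
    have other: "finite (T w) \<and> card (T w) = a_seq (m - 2)" "2 \<le> m" if w: "w \<in> V - {v, \<rho> v}" for w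
    proof -
      have d: "w \<in> V" "w \<noteq> v" "w \<noteq> \<rho> v" "\<rho> w \<noteq> v" "\<rho> w \<noteq> \<rho> v" "\<rho> w \<noteq> w"
        using w \<rho>V(3)[of w] \<rho>V(2)[of w] fpf_invol_eq[OF \<rho>, of w v] v by auto
      have c: "card {v, w, \<rho> v, \<rho> w} = 4" using d \<rho>V(2)[OF v] by simp
      have s: "{v, w, \<rho> v, \<rho> w} \<subseteq> V" using d(1) v \<rho>V(1) by simp
      have "4 \<le> 2 * m" using card_mono[OF less.prems(1) s] c less.prems(2) by simp
      then show m2: "2 \<le> m" by simp
      show "finite (T w) \<and> card (T w) = a_seq (m - 2)"
      proof (rule step[OF d(1,2)])
        show "card (V - {v, w, \<rho> v, \<rho> w}) = 2 * (m - 2)"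
          using card_Diff_subset[OF finite_subset[OF s less.prems(1)] s] c less.prems(2) by simp
      qed (use m2 in simp)
    qed
    have dec: "V - {v} = insert (\<rho> v) (V - {v, \<rho> v})" using \<rho>V(1,2)[OF v] by auto
    have fin: "finite (T w)" if "w \<in> V - {v}" for w
      using that other(1)[of w] self by (cases "w = \<rho> v") auto
    have "card (sym_matchings V \<rho>) = (\<Sum>w\<in>V - {v}. card (T w))"
      unfolding part using less.prems(1) fin disj by (intro card_UN_disjoint) auto
    also have "\<dots> = a_seq (m - 1) + (\<Sum>w\<in>V - {v, \<rho> v}. card (T w))"
      unfolding dec using less.prems(1) self by (subst sum.insert) auto
    also have "(\<Sum>w\<in>V - {v, \<rho> v}. card (T w)) = (\<Sum>w\<in>V - {v, \<rho> v}. a_seq (m - 2))"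
      by (rule sum.cong[OF refl]) (use other(1) in blast)
    also have "\<dots> = 2 * (m - 1) * a_seq (m - 2)"
    proof -
      have "card (V - {v, \<rho> v}) = 2 * (m - 1)"
        using less.prems(1,2) v \<rho>V(1,2)[OF v] by (simp add: card_Diff_subset)
      then show ?thesis by simp
    qed
    finally have "card (sym_matchings V \<rho>) = a_seq (m - 1) + 2 * (m - 1) * a_seq (m - 2)" .
    moreover have "a_seq m = a_seq (m - 1) + 2 * (m - 1) * a_seq (m - 2)"
    proof (cases "2 \<le> m")
      case False
      then have "m = 1" using \<open>m \<noteq> 0\<close> by simp
      then show ?thesis by simp
    qed (rule a_seq_rec)
    moreover have "finite (sym_matchings V \<rho>)" unfolding part using less.prems(1) fin by blast
    ultimately show ?thesis by simp
  qed
qed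

definition sym_diagrams :: "nat \<Rightarrow> diagram set" where
  "sym_diagrams N = {D. brauer_diagram N D \<and> symmetric_diagram N D}"

lemma sym_diagram_obtain:
  assumes "D \<in> sym_diagrams (2 * n)"
  obtains \<tau> where "sym_match (dots_of n) (bar_dot n) \<tau>" "D = diag (2 * n) \<tau>"
proof -
  obtain \<tau> where \<tau>: "fpf_invol (dots (2 * n)) \<tau>" "D = diag (2 * n) \<tau>"
    using assms brauer_diagram_obtain unfolding sym_diagrams_def by blast
  then have "sym_match (dots_of n) (bar_dot n) \<tau>"
    using symmetric_diag[of n \<tau>] assms by (simp add: sym_diagrams_def dots_of_eq)
  then show thesis using that \<tau>(2) by blast
qed

lemma diag_sym_diagram:
  assumes "sym_match (dots_of n) (bar_dot n) \<tau>"
  shows "diag (2 * n) \<tau> \<in> sym_diagrams (2 * n)"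
  using assms sym_matchD(2)[OF assms] symmetric_diag[of n \<tau>] brauer_diagram_diag[of "2 * n" \<tau>]
  by (simp add: sym_diagrams_def dots_of_eq)

theorem card_sym_diagrams: "finite (sym_diagrams (2 * n))" "card (sym_diagrams (2 * n)) = a_seq (2 * n)"
proof -
  have "bij_betw (diag (2 * n)) (sym_matchings (dots_of n) (bar_dot n)) (sym_diagrams (2 * n))"
    unfolding bij_betw_def
  proof
    show "inj_on (diag (2 * n)) (sym_matchings (dots_of n) (bar_dot n))"
    proof (rule inj_onI)
      fix s t assume st: "s \<in> sym_matchings (dots_of n) (bar_dot n)" "t \<in> sym_matchings (dots_of n) (bar_dot n)"
        "diag (2 * n) s = diag (2 * n) t"
      then have m: "sym_match (dots_of n) (bar_dot n) t" by (simp add: sym_matchings_def)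
      show "s = t"
      proof
        fix p
        show "s p = t p"
        proof (cases "p \<in> dots_of n")
          case True
          then show ?thesis using diag_inject[OF _ st(3), of p] sym_matchD(2)[OF m] by (simp add: dots_of_eq)
        next
          case False
          have "s p = p" "t p = p" using st(1,2) False unfolding sym_matchings_def by blast+
          then show ?thesis by simp
        qed
      qed
    qed
    show "diag (2 * n) ` sym_matchings (dots_of n) (bar_dot n) = sym_diagrams (2 * n)"
    proof
      show "diag (2 * n) ` sym_matchings (dots_of n) (bar_dot n) \<subseteq> sym_diagrams (2 * n)"
        using diag_sym_diagram by (auto simp: sym_matchings_def)
      show "sym_diagrams (2 * n) \<subseteq> diag (2 * n) ` sym_matchings (dots_of n) (bar_dot n)"
      proof
        fix D assume "D \<in> sym_diagrams (2 * n)"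
        then obtain \<tau> where \<tau>: "sym_match (dots_of n) (bar_dot n) \<tau>" "D = diag (2 * n) \<tau>"
          by (rule sym_diagram_obtain)
        let ?t = "\<lambda>p. if p \<in> dots_of n then \<tau> p else p"
        have "?t \<in> sym_matchings (dots_of n) (bar_dot n)"
          using \<tau>(1) unfolding sym_matchings_def sym_match_def fpf_invol_def by simp
        moreover have "D = diag (2 * n) ?t"
          unfolding \<tau>(2) by (rule diag_cong) (simp add: dots_of_eq)
        ultimately show "D \<in> diag (2 * n) ` sym_matchings (dots_of n) (bar_dot n)" by blast
      qed
    qed
  qed
  moreover have "finite (dots_of n)" "card (dots_of n) = 2 * (2 * n)" by (simp_all add: dots_of_def card_cartesian_product)
  ultimately show "finite (sym_diagrams (2 * n))" "card (sym_diagrams (2 * n)) = a_seq (2 * n)"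
    using card_sym_matchings[OF _ _ fpf_bar_dot, of n "2 * n"] bij_betw_finite bij_betw_same_card by metis+
qed

section \<open>Generation of the symmetric diagrams\<close>

lemma join_conjugate:
  assumes fh: "\<And>x. f (h x) = x" and hf: "\<And>x. h (f x) = x"
  shows "join (f p) (f q) (\<lambda>x. f (t (h x))) = (\<lambda>x. f (join p q t (h x)))"
proof -
  have e: "x = f y \<longleftrightarrow> h x = y" for x y using assms by metis
  show ?thesis by (rule ext) (simp add: join_def hf e)
qed

lemma lift_top_comp: "lift_top (g \<circ> h) p = lift_top g (lift_top h p)"
  by (cases p; cases "snd p") simp_all

lemma act_top_comp:
  assumes "signed_perm n g" "signed_perm n h"
  shows "act_top (g \<circ> h) \<tau> = act_top g (act_top h \<tau>)"
proof
  fix p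
  have "inv (g \<circ> h) = inv h \<circ> inv g"
    using assms by (intro o_inv_distrib) (auto simp: signed_perm_def)
  then show "act_top (g \<circ> h) \<tau> p = act_top g (act_top h \<tau>) p" by (simp add: act_top_def lift_top_comp)
qed

lemma act_top_id: "act_top id \<tau> = \<tau>"
proof
  fix p
  have "lift_top id q = q" for q by (cases q; cases "snd q") simp_all
  then show "act_top id \<tau> p = \<tau> p" by (simp add: act_top_def)
qed

lemma sym_join_act_top:
  assumes s: "signed_perm n s" and pq: "p \<in> dots_of n" "q \<in> dots_of n"
  shows "sym_join (bar_dot n) (lift_top s p) (lift_top s q) (act_top s \<tau>) = act_top s (sym_join (bar_dot n) p q \<tau>)"
proof -
  note l = lift_top_inv[OF s]
  have i: "lift_top s x = lift_top s y \<longleftrightarrow> x = y" for x y using l(2) by metis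
  have j: "join (lift_top s x) (lift_top s y) (act_top s \<sigma>) = act_top s (join x y \<sigma>)" for x y \<sigma>
    using join_conjugate[of "lift_top s" "lift_top (inv s)" x y \<sigma>] l unfolding act_top_def[abs_def] by blast
  show ?thesis
    unfolding sym_join_def lift_top_bar[OF s pq(1), symmetric] lift_top_bar[OF s pq(2), symmetric] i j by simp
qed

definition realized :: "nat \<Rightarrow> (dot \<Rightarrow> dot) \<Rightarrow> bool" where
  "realized n \<tau> \<longleftrightarrow> (\<exists>u. valid_word n u \<and> (\<forall>p\<in>dots_of n. word_match n u p = \<tau> p))"

lemma realized_gen:
  assumes g: "gen_idx g < n" and r: "realized n \<tau>"
  shows "realized n (gen_act n g \<tau>)"
proof -
  obtain u where u: "valid_word n u" "\<And>p. p \<in> dots_of n \<Longrightarrow> word_match n u p = \<tau> p"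
    using r by (auto simp: realized_def)
  have "gen_act n g (word_match n u) p = gen_act n g \<tau> p" if p: "p \<in> dots_of n" for p
  proof (cases g)
    case (gr i)
    have "lift_top (inv (simple_perm n i)) p \<in> dots_of n"
      using lift_top_in[OF signed_perm_inv(1)[OF signed_simple_perm[of i n]]] g gr p by simp
    then show ?thesis by (simp add: gr gen_act_def act_top_def u(2))
  next
    case (ge i)
    have "sym_join (bar_dot n) (n + i, True) (n + i + 1, True) (word_match n u) p =
        sym_join (bar_dot n) (n + i, True) (n + i + 1, True) \<tau> p"
      using g ge by (intro sym_join_cong[OF sym_match_word[OF u(1)] _ _ u(2) p]) auto
    then show ?thesis by (simp add: ge gen_act_def)
  qed
  moreover have "valid_word n (g # u)" using u(1) g by (simp add: valid_word_def)
  ultimately show ?thesis unfolding realized_def by (intro exI[of _ "g # u"]) simp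
qed

lemma realized_perm:
  assumes g: "signed_perm n g" and r: "realized n \<tau>"
  shows "realized n (act_top g \<tau>)"
proof -
  have "\<exists>w. set w \<subseteq> {..<n} \<and> word_perm n w = g"
    by (rule word_perm_surj[OF order_refl g]) (use g in \<open>auto simp: signed_perm_def\<close>)
  then obtain w where w: "set w \<subseteq> {..<n}" "word_perm n w = g" by blast
  have "realized n (act_top (word_perm n w) \<tau>)"
    using w(1)
  proof (induction w)
    case Nil
    show ?case unfolding word_perm_simps act_top_id by (rule r)
  next
    case (Cons i w)
    then have i: "i < n" and w: "set w \<subseteq> {..<n}" by auto
    have "realized n (gen_act n (gr i) (act_top (word_perm n w) \<tau>))"
      using i by (intro realized_gen Cons.IH w) simp
    then show ?case
      unfolding word_perm_simps act_top_comp[OF signed_simple_perm[OF i] signed_word_perm[OF w]]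
      by (simp add: gen_act_def)
  qed
  then show ?thesis by (simp add: w(2))
qed

text \<open>A mirrored pair is reached from the central dots \<open>n\<close>, \<open>n + 1\<close>,
  that is with index 0; every other pair from \<open>n + 1\<close>, \<open>n + 2\<close>, with index
  1.\<close>

lemma ex_signed_perm_adjacent:
  assumes n: "2 \<le> n" and ab: "a \<in> {1..2 * n}" "b \<in> {1..2 * n}" "a \<noteq> b"
  obtains s i where "signed_perm n s" "i < n" "s (n + i) = a" "s (n + i + 1) = b"
proof -
  \<comment> \<open>The instance gives access to the existence lemmas for signed permutations proved
    in the locale.\<close>
  interpret M: brauerC_monoid n "\<lambda>i. word_class n [gr i]" "\<lambda>i. word_class n [ge i]"
    by (rule brauerC_word_monoid[OF n])
  show thesis
  proof (cases "b = bar n a")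
    case True
    obtain g where g: "signed_perm n g" "g (n + 1) = b" "g (bar n (n + 1)) = bar n b"
      using M.ex_perm1[OF ab(2)] by blast
    have "bar n (n + 1) = n" by (simp add: bar_def)
    moreover have "bar n b = a" unfolding True using ab(1) by (rule bar_bar)
    ultimately show ?thesis using that[OF g(1), of 0] g n by simp
  next
    case False
    obtain g where "signed_perm n g" "g (n + 1) = a" "g (n + 2) = b"
      using M.ex_perm2[OF M.indep2[OF ab False]] by blast
    then show ?thesis using that[of g 1] n by simp
  qed
qed

text \<open>Conjugation by a signed permutation reduces joining arbitrary top dots to multiplication
  by a single generator \<open>ge i\<close>.\<close>

lemma realized_join:
  assumes n: "2 \<le> n" and ab: "a \<in> {1..2 * n}" "b \<in> {1..2 * n}" "a \<noteq> b" and r: "realized n \<tau>"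
  shows "realized n (sym_join (bar_dot n) (a, True) (b, True) \<tau>)"
proof -
  obtain s i where s: "signed_perm n s" and i: "i < n" and si: "s (n + i) = a" "s (n + i + 1) = b"
    using ex_signed_perm_adjacent[OF n ab] .
  note s' = signed_perm_inv[OF s]
  let ?\<sigma> = "act_top (inv s) \<tau>"
  have "s \<circ> inv s = id" using s'(2) by (simp add: fun_eq_iff)
  then have \<tau>: "\<tau> = act_top s ?\<sigma>" using act_top_comp[OF s s'(1), of \<tau>] by (simp add: act_top_id)
  have d: "(n + i, True) \<in> dots_of n" "(n + i + 1, True) \<in> dots_of n" using i by auto
  have "sym_join (bar_dot n) (a, True) (b, True) \<tau> = act_top s (gen_act n (ge i) ?\<sigma>)"
    using sym_join_act_top[OF s d, of ?\<sigma>] unfolding lift_top_simps si \<tau>[symmetric] gen_act_def genC.case .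
  then show ?thesis using realized_perm[OF s realized_gen[OF _ realized_perm[OF s'(1) r], of "ge i"]] i by simp
qed

text \<open>A join can be undone by a join. The first identity shows that \<open>t1\<close> is again
  a symmetric matching; the second recovers \<open>t\<close> from the simpler \<open>t1\<close>,
  which is the direction that yields realizability.\<close>

lemma unpair:
  assumes d: "distinct [P, \<rho> P, Q, \<rho> Q]" and \<rho>: "\<rho> (\<rho> P) = P" "\<rho> (\<rho> Q) = Q"
    and t: "t P = Q" "t Q = P" "t (\<rho> P) = \<rho> Q" "t (\<rho> Q) = \<rho> P"
  defines "t1 \<equiv> t(P := \<rho> P, \<rho> P := P, Q := \<rho> Q, \<rho> Q := Q)"
  shows "sym_join \<rho> P (\<rho> P) t = t1" "sym_join \<rho> P Q t1 = t"
proof -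
  show "sym_join \<rho> P (\<rho> P) t = t1"
    unfolding t1_def by (rule ext) (use d \<rho> t in \<open>simp add: sym_join_def join_def\<close>)
  show "sym_join \<rho> P Q t1 = t"
    unfolding t1_def by (rule ext) (use d \<rho> t in \<open>simp add: sym_join_def join_def\<close>)
qed

lemma split_selves:
  assumes d: "distinct [P, \<rho> P, X, \<rho> X]" and \<rho>: "\<rho> (\<rho> P) = P" "\<rho> (\<rho> X) = X"
    and t: "t P = \<rho> P" "t (\<rho> P) = P" "t X = \<rho> X" "t (\<rho> X) = X"
  defines "t1 \<equiv> t(P := X, X := P, \<rho> P := \<rho> X, \<rho> X := \<rho> P)"
  shows "sym_join \<rho> P X t = t1" "sym_join \<rho> P (\<rho> P) t1 = t"
proof -
  show "sym_join \<rho> P X t = t1"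
    unfolding t1_def by (rule ext) (use d \<rho> t in \<open>simp add: sym_join_def join_def\<close>)
  show "sym_join \<rho> P (\<rho> P) t1 = t"
    unfolding t1_def by (rule ext) (use d \<rho> t in \<open>simp add: sym_join_def join_def\<close>)
qed

lemma split_arcs:
  assumes d: "distinct [P, \<rho> P, Q, \<rho> Q, X, \<rho> X, Y, \<rho> Y]"
    and \<rho>: "\<rho> (\<rho> P) = P" "\<rho> (\<rho> Q) = Q" "\<rho> (\<rho> X) = X" "\<rho> (\<rho> Y) = Y"
    and t: "t P = \<rho> P" "t (\<rho> P) = P" "t Q = \<rho> Q" "t (\<rho> Q) = Q" "t X = Y" "t Y = X" "t (\<rho> X) = \<rho> Y" "t (\<rho> Y) = \<rho> X"
  defines "t1 \<equiv> t(P := X, X := P, \<rho> P := \<rho> X, \<rho> X := \<rho> P, Q := Y, Y := Q, \<rho> Q := \<rho> Y, \<rho> Y := \<rho> Q)"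
  shows "sym_join \<rho> Q Y (sym_join \<rho> P X t) = t1" "sym_join \<rho> P (\<rho> P) (sym_join \<rho> P Q t1) = t"
proof -
  have d': "distinct [\<rho> Y, Y, \<rho> X, X, \<rho> Q, Q, \<rho> P, P]" using distinct_rev[of "[P, \<rho> P, Q, \<rho> Q, X, \<rho> X, Y, \<rho> Y]"] d by (simp only: rev.simps append_Cons append_Nil simp_thms)
  have "sym_join \<rho> P X t = t(P := X, X := P, \<rho> P := \<rho> X, \<rho> X := \<rho> P, Y := \<rho> Y, \<rho> Y := Y)"
    by (rule ext) (use d d' \<rho> t in \<open>simp add: sym_join_def join_def\<close>)
  then show "sym_join \<rho> Q Y (sym_join \<rho> P X t) = t1"
    unfolding t1_def by (intro ext) (use d d' \<rho> t in \<open>simp add: sym_join_def join_def\<close>)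
  have "sym_join \<rho> P Q t1 = t(P := Q, Q := P, \<rho> P := \<rho> Q, \<rho> Q := \<rho> P)"
    unfolding t1_def by (rule ext) (use d d' \<rho> t in \<open>simp add: sym_join_def join_def\<close>)
  then show "sym_join \<rho> P (\<rho> P) (sym_join \<rho> P Q t1) = t"
    by (intro ext) (use d d' \<rho> t in \<open>simp add: sym_join_def join_def\<close>)
qed

definition top_arcs :: "nat \<Rightarrow> (dot \<Rightarrow> dot) \<Rightarrow> nat set" where
  "top_arcs n \<tau> = {a \<in> {1..2 * n}. snd (\<tau> (a, True))}"

definition bottom_arcs :: "nat \<Rightarrow> (dot \<Rightarrow> dot) \<Rightarrow> nat set" where
  "bottom_arcs n \<tau> = {a \<in> {1..2 * n}. \<not> snd (\<tau> (a, False))}"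

definition top_pairs :: "nat \<Rightarrow> (dot \<Rightarrow> dot) \<Rightarrow> nat set" where
  "top_pairs n \<tau> = {a \<in> {1..2 * n}. snd (\<tau> (a, True)) \<and> \<tau> (a, True) \<noteq> bar_dot n (a, True)}"

text \<open>The vertical strands match the remaining dots of the two rows bijectively.\<close>

lemma card_arcs:
  assumes m: "sym_match (dots_of n) (bar_dot n) \<tau>"
  shows "card (top_arcs n \<tau>) = card (bottom_arcs n \<tau>)"
proof -
  have \<tau>: "\<tau> p \<in> dots_of n" "\<tau> (\<tau> p) = p" if "p \<in> dots_of n" for p
    using m that by (auto simp: sym_match_def fpf_invol_def)
  have st: "\<tau> (a, True) = (fst (\<tau> (a, True)), False)" "fst (\<tau> (a, True)) \<in> {1..2 * n}"
    if "a \<in> {1..2 * n}" "a \<notin> top_arcs n \<tau>" for a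
    using that \<tau>(1)[of "(a, True)"] by (simp_all add: top_arcs_def prod_eq_iff dots_of_def mem_Times_iff)
  have sb: "\<tau> (a, False) = (fst (\<tau> (a, False)), True)" "fst (\<tau> (a, False)) \<in> {1..2 * n}"
    if "a \<in> {1..2 * n}" "a \<notin> bottom_arcs n \<tau>" for a
    using that \<tau>(1)[of "(a, False)"] by (simp_all add: bottom_arcs_def prod_eq_iff dots_of_def mem_Times_iff)
  let ?f = "\<lambda>a. fst (\<tau> (a, True))" and ?g = "\<lambda>a. fst (\<tau> (a, False))"
  have f: "?g (?f a) = a" "?f a \<in> {1..2 * n} - bottom_arcs n \<tau>" if "a \<in> {1..2 * n} - top_arcs n \<tau>" for a
    using st[of a] \<tau>(2)[of "(a, True)"] that by (simp_all add: bottom_arcs_def)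
  have g: "?f (?g a) = a" "?g a \<in> {1..2 * n} - top_arcs n \<tau>" if "a \<in> {1..2 * n} - bottom_arcs n \<tau>" for a
    using sb[of a] \<tau>(2)[of "(a, False)"] that by (simp_all add: top_arcs_def)
  have "bij_betw ?f ({1..2 * n} - top_arcs n \<tau>) ({1..2 * n} - bottom_arcs n \<tau>)"
    by (rule bij_betw_byWitness[where f' = ?g]) (use f g in blast)+
  then have "card ({1..2 * n} - top_arcs n \<tau>) = card ({1..2 * n} - bottom_arcs n \<tau>)" by (rule bij_betw_same_card)
  moreover have s: "top_arcs n \<tau> \<subseteq> {1..2 * n}" "bottom_arcs n \<tau> \<subseteq> {1..2 * n}" by (auto simp: top_arcs_def bottom_arcs_def)
  moreover have "finite (top_arcs n \<tau>)" "finite (bottom_arcs n \<tau>)" using s finite_subset by blast+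
  moreover have "card (top_arcs n \<tau>) \<le> 2 * n" "card (bottom_arcs n \<tau>) \<le> 2 * n"
    using card_mono[OF _ s(1)] card_mono[OF _ s(2)] by simp_all
  ultimately show ?thesis by (simp add: card_Diff_subset)
qed

text \<open>Without top arcs there are no bottom arcs either, by \<open>card_arcs\<close>. The
  vertical strands then form a signed permutation, applied to the identity diagram.\<close>

lemma realized_vertical:
  assumes m: "sym_match (dots_of n) (bar_dot n) \<tau>" and A: "top_arcs n \<tau> = {}"
  shows "realized n \<tau>"
proof -
  have \<tau>: "\<tau> p \<in> dots_of n" "\<tau> (\<tau> p) = p" "\<tau> (bar_dot n p) = bar_dot n (\<tau> p)" if "p \<in> dots_of n" for p
    using m that by (auto simp: sym_match_def fpf_invol_def)
  have "finite (bottom_arcs n \<tau>)" by (simp add: bottom_arcs_def)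
  then have B: "bottom_arcs n \<tau> = {}" using card_arcs[OF m] A by simp
  have s: "snd (\<tau> (a, True)) = False" "snd (\<tau> (a, False)) = True" if "a \<in> {1..2 * n}" for a
    using A B that unfolding top_arcs_def bottom_arcs_def by blast+
  define g where "g a = (if a \<in> {1..2 * n} then fst (\<tau> (a, False)) else a)" for a
  define h where "h a = (if a \<in> {1..2 * n} then fst (\<tau> (a, True)) else a)" for a
  have tg: "\<tau> (a, False) = (g a, True)" "g a \<in> {1..2 * n}" if "a \<in> {1..2 * n}" for a
    using that s(2)[OF that] \<tau>(1)[of "(a, False)"] unfolding g_def dots_of_def by (auto simp: prod_eq_iff mem_Times_iff)
  have th: "\<tau> (a, True) = (h a, False)" "h a \<in> {1..2 * n}" if "a \<in> {1..2 * n}" for a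
    using that s(1)[OF that] \<tau>(1)[of "(a, True)"] unfolding h_def dots_of_def by (auto simp: prod_eq_iff mem_Times_iff)
  have hg: "h (g a) = a" for a
  proof (cases "a \<in> {1..2 * n}")
    case True
    have "\<tau> (\<tau> (a, False)) = (a, False)" using True by (intro \<tau>(2)) (simp add: dots_of_def)
    then show ?thesis using th(1)[OF tg(2)[OF True]] unfolding tg(1)[OF True] by simp
  next
    case False
    then have "g a = a" "h a = a" unfolding g_def h_def by (rule if_not_P)+
    then show ?thesis by simp
  qed
  have gh: "g (h a) = a" for a
  proof (cases "a \<in> {1..2 * n}")
    case True
    have "\<tau> (\<tau> (a, True)) = (a, True)" using True by (intro \<tau>(2)) (simp add: dots_of_def)
    then show ?thesis using tg(1)[OF th(2)[OF True]] unfolding th(1)[OF True] by simp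
  next
    case False
    then have "h a = a" "g a = a" unfolding g_def h_def by (rule if_not_P)+
    then show ?thesis by simp
  qed
  have ig: "inv g = h" by (rule inv_equality) (simp_all add: hg gh)
  have sg: "signed_perm n g"
    unfolding signed_perm_def
  proof (intro conjI allI ballI impI)
    show "bij g" by (rule bij_betw_byWitness[where f' = h]) (simp_all add: hg gh)
    show "g x = x" if "x \<notin> {1..2 * n}" for x using that unfolding g_def by (rule if_not_P)
    fix x assume x: "x \<in> {1..2 * n}"
    have "\<tau> (bar n x, False) = bar_dot n (\<tau> (x, False))"
      using \<tau>(3)[of "(x, False)"] x by (simp add: dots_of_def)
    then show "g (bar n x) = bar n (g x)" using tg(1)[OF bar_in[OF x]] tg(1)[OF x] by simp
  qed
  have "realized n (\<lambda>p. (fst p, \<not> snd p))"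
    unfolding realized_def by (intro exI[of _ "[]"]) (simp add: valid_word_def)
  then have "realized n (act_top g (\<lambda>p. (fst p, \<not> snd p)))" by (rule realized_perm[OF sg])
  moreover have "act_top g (\<lambda>p. (fst p, \<not> snd p)) p = \<tau> p" if p: "p \<in> dots_of n" for p
  proof -
    obtain a b where ab: "p = (a, b)" by (cases p)
    then have "a \<in> {1..2 * n}" using p by (simp add: dots_of_def)
    then show ?thesis unfolding ab using tg(1) th(1) by (cases b) (simp_all add: act_top_def ig)
  qed
  ultimately show ?thesis unfolding realized_def by auto
qed

text \<open>Mirrored pairs of top arcs are first turned into self-mirrored arcs; then each remaining top
  arc is cut open together with bottom arcs until the diagram is a signed permutation.\<close>
theorem realized_sym_match:
  assumes n: "2 \<le> n" and "sym_match (dots_of n) (bar_dot n) \<tau>"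
  shows "realized n \<tau>"
  using assms(2)
\<comment> \<open>Turning a mirrored pair of arcs into self-mirrored ones keeps the first summand
  and lowers the second. Cutting arcs open lowers the first and keeps the second at 0.\<close>
proof (induction "card (top_arcs n \<tau>) + card (top_pairs n \<tau>)" arbitrary: \<tau> rule: less_induct)
  case less
  note m = less.prems
  let ?\<rho> = "bar_dot n"
  have fin: "finite (top_arcs n \<sigma>)" "finite (top_pairs n \<sigma>)" for \<sigma> by (simp_all add: top_arcs_def top_pairs_def)
  have \<tau>: "\<tau> p \<in> dots_of n" "\<tau> p \<noteq> p" "\<tau> (\<tau> p) = p" "\<tau> (?\<rho> p) = ?\<rho> (\<tau> p)" if "p \<in> dots_of n" for p
    using m that by (auto simp: sym_match_def fpf_invol_def)
  have \<rho>: "?\<rho> p \<in> dots_of n" "?\<rho> p \<noteq> p" "?\<rho> (?\<rho> p) = p" if "p \<in> dots_of n" for p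
    using fpf_bar_dot that by (auto simp: fpf_invol_def)
  note \<rho>eq = fpf_invol_eq[OF fpf_bar_dot] and \<tau>eq = fpf_invol_eq[OF sym_matchD(2)[OF m]]
  have dots: "(a, s) \<in> dots_of n" if "a \<in> {1..2 * n}" for a s using that by (simp add: dots_of_def)
  show ?case
  proof (cases "top_pairs n \<tau> = {}")
    case False
    then obtain a where a: "a \<in> {1..2 * n}" "snd (\<tau> (a, True))" "\<tau> (a, True) \<noteq> ?\<rho> (a, True)"
      unfolding top_pairs_def by blast
    define P where "P = (a, True)"
    define c where "c = fst (\<tau> P)"
    define Q where "Q = (c, True)"
    have tP: "\<tau> P = Q" using a(2) by (simp add: P_def Q_def c_def prod_eq_iff)
    have P: "P \<in> dots_of n" using dots[OF a(1)] by (simp add: P_def)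
    have Q: "Q \<in> dots_of n" using \<tau>(1)[OF P] tP by simp
    have c: "c \<in> {1..2 * n}" using Q by (simp add: Q_def dots_of_def)
    have tQ: "\<tau> Q = P" "\<tau> (?\<rho> P) = ?\<rho> Q" "\<tau> (?\<rho> Q) = ?\<rho> P" using \<tau>(3,4)[OF P] \<tau>(4)[OF Q] tP by auto
    have QP: "Q \<noteq> P" "Q \<noteq> ?\<rho> P" using \<tau>(2)[OF P] tP a(3) by (auto simp: P_def)
    have d: "distinct [P, ?\<rho> P, Q, ?\<rho> Q]"
      using QP \<rho>(2,3)[OF P] \<rho>(2,3)[OF Q] \<rho>eq[OF P Q] by auto
    define t1 where "t1 = \<tau>(P := ?\<rho> P, ?\<rho> P := P, Q := ?\<rho> Q, ?\<rho> Q := Q)"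
    note U = unpair[OF d \<rho>(3)[OF P] \<rho>(3)[OF Q] tP tQ, folded t1_def]
    have m1: "sym_match (dots_of n) ?\<rho> t1"
      unfolding U(1)[symmetric] using \<rho>(2)[OF P] by (intro sym_match_sym_join[OF m P \<rho>(1)[OF P]]) simp
    have on: "t1 p = ?\<rho> p \<and> snd (\<tau> p) = True \<and> snd (?\<rho> p) = True" if "p \<in> {P, ?\<rho> P, Q, ?\<rho> Q}" for p
      using that d \<rho>(3)[OF P] \<rho>(3)[OF Q] tP tQ by (auto simp: t1_def P_def Q_def)
    have off: "t1 p = \<tau> p" if "p \<notin> {P, ?\<rho> P, Q, ?\<rho> Q}" for p using that by (simp add: t1_def)
    have "snd (t1 p) = snd (\<tau> p)" for p using on[of p] off[of p] by metis
    then have A: "top_arcs n t1 = top_arcs n \<tau>" by (simp add: top_arcs_def)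
    have "top_pairs n t1 \<subset> top_pairs n \<tau>"
    proof
      show "top_pairs n t1 \<subseteq> top_pairs n \<tau>"
      proof
        fix x assume "x \<in> top_pairs n t1"
        then have x: "x \<in> {1..2 * n}" "snd (t1 (x, True))" "t1 (x, True) \<noteq> ?\<rho> (x, True)" by (auto simp: top_pairs_def)
        then have "t1 (x, True) = \<tau> (x, True)" using on[of "(x, True)"] off[of "(x, True)"] by blast
        then show "x \<in> top_pairs n \<tau>" using x by (simp add: top_pairs_def)
      qed
      have "a \<in> top_pairs n \<tau>" using a by (simp add: top_pairs_def)
      moreover have "a \<notin> top_pairs n t1" using on[of P] by (simp add: top_pairs_def P_def)
      ultimately show "top_pairs n t1 \<noteq> top_pairs n \<tau>" by blast
    qed
    then have "card (top_pairs n t1) < card (top_pairs n \<tau>)" by (rule psubset_card_mono[OF fin(2)])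
    then have "realized n t1" using A by (intro less.hyps m1) simp
    moreover have "a \<noteq> c" using QP by (auto simp: P_def Q_def)
    ultimately have "realized n (sym_join ?\<rho> P Q t1)" unfolding P_def Q_def by (intro realized_join[OF n a(1) c]) simp_all
    then show ?thesis unfolding U(2) .
  next
    case pairs: True
    show ?thesis
    proof (cases "top_arcs n \<tau> = {}")
      case True
      then show ?thesis by (rule realized_vertical[OF m])
    next
      case False
      then obtain a where a: "a \<in> {1..2 * n}" "snd (\<tau> (a, True))" unfolding top_arcs_def by blast
      have self: "\<tau> (x, True) = ?\<rho> (x, True)" if "x \<in> top_arcs n \<tau>" for x
        using that pairs unfolding top_arcs_def top_pairs_def by blast
      define P where "P = (a, True)"
      have P: "P \<in> dots_of n" using dots[OF a(1)] by (simp add: P_def)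
      have aA: "a \<in> top_arcs n \<tau>" using a by (simp add: top_arcs_def)
      have tP: "\<tau> P = ?\<rho> P" "\<tau> (?\<rho> P) = P" using self[OF aA] \<tau>(3)[OF P] by (simp_all add: P_def)
      have less1: "card (top_arcs n t1) + card (top_pairs n t1) < card (top_arcs n \<tau>) + card (top_pairs n \<tau>)"
        if "snd (t1 P) = False" "\<And>x. snd (t1 (x, True)) \<Longrightarrow> t1 (x, True) = \<tau> (x, True)" for t1
      proof -
        have sub: "top_arcs n t1 \<subseteq> top_arcs n \<tau>"
        proof
          fix x assume "x \<in> top_arcs n t1"
          then have x: "x \<in> {1..2 * n}" "snd (t1 (x, True))" by (auto simp: top_arcs_def)
          then show "x \<in> top_arcs n \<tau>" using that(2)[OF x(2)] by (simp add: top_arcs_def)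
        qed
        have "a \<notin> top_arcs n t1" using that(1) by (simp add: top_arcs_def P_def)
        then have "top_arcs n t1 \<subset> top_arcs n \<tau>" using sub aA by blast
        then have "card (top_arcs n t1) < card (top_arcs n \<tau>)" by (rule psubset_card_mono[OF fin(1)])
        moreover have "top_pairs n t1 = {}"
        proof (rule ccontr)
          assume "top_pairs n t1 \<noteq> {}"
          then obtain x where x: "x \<in> {1..2 * n}" "snd (t1 (x, True))" "t1 (x, True) \<noteq> ?\<rho> (x, True)"
            unfolding top_pairs_def by blast
          then have "x \<in> top_pairs n \<tau>" using that(2)[OF x(2)] by (simp add: top_pairs_def)
          then show False using pairs by simp
        qed
        ultimately show ?thesis by simp
      qed
      have "card (top_arcs n \<tau>) \<noteq> 0" using False fin(1) by simp
      then have "bottom_arcs n \<tau> \<noteq> {}" using card_arcs[OF m] by auto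
      then obtain b where b: "b \<in> {1..2 * n}" "\<not> snd (\<tau> (b, False))" unfolding bottom_arcs_def by blast
      define X where "X = (b, False)"
      have X: "X \<in> dots_of n" using dots[OF b(1)] by (simp add: X_def)
      have abar: "bar n a \<in> {1..2 * n}" "a \<noteq> bar n a" by (rule bar_in[OF a(1)]) simp
      have PX: "P \<noteq> X" by (simp add: P_def X_def)
      show ?thesis
      proof (cases "\<tau> X = ?\<rho> X")
        case tX: True
        have d: "distinct [P, ?\<rho> P, X, ?\<rho> X]"
          using \<rho>(2)[OF P] \<rho>(2)[OF X] by (auto simp: P_def X_def)
        define t1 where "t1 = \<tau>(P := X, X := P, ?\<rho> P := ?\<rho> X, ?\<rho> X := ?\<rho> P)"
        have tX': "\<tau> (?\<rho> X) = X" using \<tau>(3)[OF X] tX by simp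
        note U = split_selves[OF d \<rho>(3)[OF P] \<rho>(3)[OF X] tP tX tX', folded t1_def]
        have m1: "sym_match (dots_of n) ?\<rho> t1"
          unfolding U(1)[symmetric] by (rule sym_match_sym_join[OF m P X PX])
        have "snd (t1 P) = False" using d by (simp add: t1_def X_def)
        moreover have "t1 (x, True) = \<tau> (x, True)" if "snd (t1 (x, True))" for x
          using that by (auto simp: t1_def P_def X_def split: if_splits)
        ultimately have "realized n t1" by (intro less.hyps[OF less1] m1)
        then have "realized n (sym_join ?\<rho> P (?\<rho> P) t1)"
          unfolding P_def bar_dot_simps by (rule realized_join[OF n a(1) abar])
        then show ?thesis unfolding U(2) .
      next
        case tX: False
        define e where "e = fst (\<tau> X)"
        define Y where "Y = (e, False)"
        have tXY: "\<tau> X = Y" using b(2) by (simp add: X_def Y_def e_def prod_eq_iff)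
        have Y: "Y \<in> dots_of n" using \<tau>(1)[OF X] tXY by simp
        have e: "e \<in> {1..2 * n}" using Y by (simp add: Y_def dots_of_def)
        have tY: "\<tau> Y = X" "\<tau> (?\<rho> X) = ?\<rho> Y" "\<tau> (?\<rho> Y) = ?\<rho> X" using \<tau>(3,4)[OF X] \<tau>(4)[OF Y] tXY by auto
        have YX: "Y \<noteq> X" "Y \<noteq> ?\<rho> X" using \<tau>(2)[OF X] tXY tX by auto
        have dXY: "distinct [X, ?\<rho> X, Y, ?\<rho> Y]"
          using YX \<rho>(2,3)[OF X] \<rho>(2,3)[OF Y] \<rho>eq[OF X Y] by auto
        have "{b, bar n b, e, bar n e} \<subseteq> bottom_arcs n \<tau>"
          using b(1) e bar_in[OF b(1)] bar_in[OF e] tXY tY unfolding bottom_arcs_def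
          by (simp add: X_def Y_def)
        moreover have "card {b, bar n b, e, bar n e} = 4" using dXY by (auto simp: X_def Y_def)
        moreover have "finite (bottom_arcs n \<tau>)" by (simp add: bottom_arcs_def)
        \<comment> \<open>The bottom arc from \<open>X\<close> to \<open>Y\<close> and its mirror
          image occupy four dots, so the top row has at least four as well. Hence there is a second
          self-mirrored top arc \<open>Q\<close>, to be cut open together with the one at
          \<open>P\<close>.\<close>
        ultimately have "4 \<le> card (top_arcs n \<tau>)" unfolding card_arcs[OF m] by (metis card_mono)
        moreover have "card {a, bar n a} \<le> 2" by (simp add: card_insert_if)
        ultimately have "\<not> top_arcs n \<tau> \<subseteq> {a, bar n a}" using card_mono[of "{a, bar n a}" "top_arcs n \<tau>"] by fastforce
        then obtain c where cA: "c \<in> top_arcs n \<tau>" and ca: "c \<noteq> a" "c \<noteq> bar n a" by blast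
        then have c: "c \<in> {1..2 * n}" unfolding top_arcs_def by blast
        define Q where "Q = (c, True)"
        have Q: "Q \<in> dots_of n" using dots[OF c] by (simp add: Q_def)
        have tQ: "\<tau> Q = ?\<rho> Q" "\<tau> (?\<rho> Q) = Q" using self[OF cA] \<tau>(3)[OF Q] by (simp_all add: Q_def)
        have QP: "Q \<noteq> P" "Q \<noteq> ?\<rho> P" using ca by (simp_all add: P_def Q_def)
        have dPQ: "distinct [P, ?\<rho> P, Q, ?\<rho> Q]"
          using QP \<rho>(2,3)[OF P] \<rho>(2,3)[OF Q] \<rho>eq[OF P Q] by auto
        have "distinct [P, ?\<rho> P, Q, ?\<rho> Q, X, ?\<rho> X, Y, ?\<rho> Y]"
          using dPQ dXY by (simp add: P_def Q_def X_def Y_def)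
        note d = this
        define t1 where "t1 = \<tau>(P := X, X := P, ?\<rho> P := ?\<rho> X, ?\<rho> X := ?\<rho> P, Q := Y, Y := Q, ?\<rho> Q := ?\<rho> Y, ?\<rho> Y := ?\<rho> Q)"
        note U = split_arcs[OF d \<rho>(3)[OF P] \<rho>(3)[OF Q] \<rho>(3)[OF X] \<rho>(3)[OF Y] tP tQ tXY tY, folded t1_def]
        have QY: "Q \<noteq> Y" by (simp add: Q_def Y_def)
        have m1: "sym_match (dots_of n) ?\<rho> t1"
          unfolding U(1)[symmetric] by (rule sym_match_sym_join[OF sym_match_sym_join[OF m P X PX] Q Y QY])
        have "snd (t1 P) = False" using d by (simp add: t1_def X_def)
        moreover have "t1 (x, True) = \<tau> (x, True)" if "snd (t1 (x, True))" for x
          using that by (auto simp: t1_def P_def Q_def X_def Y_def split: if_splits)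
        ultimately have r: "realized n t1" by (intro less.hyps[OF less1] m1)
        have "realized n (sym_join ?\<rho> P Q t1)"
          using ca unfolding P_def Q_def by (intro realized_join[OF n a(1) c _ r]) simp
        then have "realized n (sym_join ?\<rho> P (?\<rho> P) (sym_join ?\<rho> P Q t1))"
          unfolding P_def bar_dot_simps by (rule realized_join[OF n a(1) abar])
        then show ?thesis unfolding U(2) .
      qed
    qed
  qed
qed

section \<open>The free algebra and the ideal of relations\<close>

text \<open>Sums over \<open>keys\<close> are not visibly additive, since the support of a sum may
  shrink. The argument is given once here and applied to \<open>fmult\<close>, \<open>bmult\<close>
  and \<open>phi\<close>.\<close>

definition linear_sum :: "('a \<Rightarrow> 'b::zero \<Rightarrow> 'c::comm_monoid_add) \<Rightarrow> ('a \<Rightarrow>\<^sub>0 'b) \<Rightarrow> 'c" where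
  "linear_sum h x = (\<Sum>u\<in>Poly_Mapping.keys x. h u (Poly_Mapping.lookup x u))"

lemma linear_sum_single: "h k 0 = 0 \<Longrightarrow> linear_sum h (Poly_Mapping.single k c) = h k c"
  by (simp add: linear_sum_def)

lemma linear_sum_superset:
  assumes "\<And>u. h u 0 = 0" "finite A" "Poly_Mapping.keys x \<subseteq> A"
  shows "linear_sum h x = (\<Sum>u\<in>A. h u (Poly_Mapping.lookup x u))"
  unfolding linear_sum_def
  by (rule sum.mono_neutral_left[OF assms(2,3)]) (use assms(1) in \<open>auto simp: Poly_Mapping.in_keys_iff\<close>)

lemma linear_sum_add:
  fixes h :: "'a \<Rightarrow> 'b::monoid_add \<Rightarrow> 'c::comm_monoid_add"
  assumes h: "\<And>u. h u 0 = 0" "\<And>u a b. h u (a + b) = h u a + h u b"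
  shows "linear_sum h (x + y) = linear_sum h x + linear_sum h y"
proof -
  let ?A = "Poly_Mapping.keys x \<union> Poly_Mapping.keys y"
  have "Poly_Mapping.keys (x + y) \<subseteq> ?A" by (rule Poly_Mapping.keys_add)
  then show ?thesis
    using linear_sum_superset[of h ?A x] linear_sum_superset[of h ?A y] linear_sum_superset[of h ?A "x + y"] h
    by (simp add: lookup_add sum.distrib)
qed

lemma poly_mapping_add_induct:
  assumes z: "P 0" and a: "\<And>x y. P x \<Longrightarrow> P y \<Longrightarrow> P (x + y)"
    and s: "\<And>u c. u \<in> Poly_Mapping.keys x \<Longrightarrow> P (Poly_Mapping.single u c)"
  shows "P (x :: 'a \<Rightarrow>\<^sub>0 'b::comm_monoid_add)"
proof -
  have "P (\<Sum>u\<in>A. Poly_Mapping.single u (Poly_Mapping.lookup x u))" if "finite A" "A \<subseteq> Poly_Mapping.keys x" for A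
    using that by (induction A rule: finite_induct) (auto intro: z a s)
  from this[of "Poly_Mapping.keys x"]
  have "P (\<Sum>u\<in>Poly_Mapping.keys x. Poly_Mapping.single u (Poly_Mapping.lookup x u))" by simp
  also have "(\<Sum>u\<in>Poly_Mapping.keys x. Poly_Mapping.single u (Poly_Mapping.lookup x u)) = x"
    by (rule poly_mapping_eqI) (simp add: lookup_sum lookup_single when_def Poly_Mapping.in_keys_iff)
  finally show ?thesis .
qed

lemma additive_diff:
  fixes f :: "'a::ab_group_add \<Rightarrow> 'b::ab_group_add"
  assumes "\<And>x y. f (x + y) = f x + f y"
  shows "f (x - y) = f x - f y"
  using assms[of "x - y" y] by simp

lemma fmult_linear: "fmult x y = linear_sum (\<lambda>u a. linear_sum (\<lambda>v b. Poly_Mapping.single (u @ v) (a * b)) y) x"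
  by (simp add: fmult_def linear_sum_def)

lemma bmult_linear: "bmult x y = linear_sum (\<lambda>u a. linear_sum (\<lambda>v b. Poly_Mapping.single (diagram_comp u v) (a * b * delta ^ num_loops u v)) y) x"
  by (simp add: bmult_def linear_sum_def)

lemma linear_sum_fun_add: "linear_sum (\<lambda>u a. f u a + g u a) x = linear_sum f x + linear_sum g x"
  by (simp add: linear_sum_def sum.distrib)

lemma linear_sum_fun_zero: "linear_sum (\<lambda>u a. 0) x = 0"
  by (simp add: linear_sum_def)

lemma fmult_add: "fmult (x + x') y = fmult x y + fmult x' y" "fmult x (y + y') = fmult x y + fmult x y'"
proof -
  have r: "linear_sum (\<lambda>v b. Poly_Mapping.single (u @ v) (a * b)) (y + y') =
      linear_sum (\<lambda>v b. Poly_Mapping.single (u @ v) (a * b)) y + linear_sum (\<lambda>v b. Poly_Mapping.single (u @ v) (a * b)) y'"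
    for u a and y y' :: free_elt by (rule linear_sum_add) (simp_all add: single_add distrib_left)
  show "fmult x (y + y') = fmult x y + fmult x y'" unfolding fmult_linear r by (rule linear_sum_fun_add)
  show "fmult (x + x') y = fmult x y + fmult x' y"
    unfolding fmult_linear
    by (rule linear_sum_add) (simp_all add: linear_sum_fun_zero single_add distrib_right linear_sum_fun_add)
qed

lemma bmult_add: "bmult (x + x') y = bmult x y + bmult x' y" "bmult x (y + y') = bmult x y + bmult x y'"
proof -
  have r: "linear_sum (\<lambda>v b. Poly_Mapping.single (diagram_comp u v) (a * b * delta ^ num_loops u v)) (y + y') =
      linear_sum (\<lambda>v b. Poly_Mapping.single (diagram_comp u v) (a * b * delta ^ num_loops u v)) y +
      linear_sum (\<lambda>v b. Poly_Mapping.single (diagram_comp u v) (a * b * delta ^ num_loops u v)) y'"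
    for u a and y y' :: brauer_elt by (rule linear_sum_add) (simp_all add: single_add distrib_left distrib_right)
  show "bmult x (y + y') = bmult x y + bmult x y'" unfolding bmult_linear r by (rule linear_sum_fun_add)
  show "bmult (x + x') y = bmult x y + bmult x' y"
    unfolding bmult_linear
    by (rule linear_sum_add) (simp_all add: linear_sum_fun_zero single_add distrib_right linear_sum_fun_add)
qed

lemma fmult_zero [simp]: "fmult 0 y = 0" "fmult x 0 = 0"
  and bmult_zero [simp]: "bmult 0 z = 0" "bmult w 0 = 0"
  by (simp_all add: fmult_def bmult_def)

lemma fmult_single: "fmult (Poly_Mapping.single u c) (Poly_Mapping.single v d) = Poly_Mapping.single (u @ v) (c * d)"
  unfolding fmult_linear by (simp add: linear_sum_single)

lemma lookup_bscale: "Poly_Mapping.lookup (bscale c x) k = c * Poly_Mapping.lookup x k"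
  by (simp add: bscale_def map.rep_eq when_def)

lemma bscale_add: "bscale (c + d) x = bscale c x + bscale d x" "bscale c (x + y) = bscale c x + bscale c y"
  by (rule poly_mapping_eqI; simp add: lookup_bscale lookup_add algebra_simps)+

lemma bscale_zero [simp]: "bscale 0 x = 0"
  by (rule poly_mapping_eqI) (simp add: lookup_bscale)

lemma phi_linear: "phi n x = linear_sum (\<lambda>u c. bscale c (phi_word n u)) x"
  by (simp add: phi_def linear_sum_def)

lemma phi_add: "phi n (x + y) = phi n x + phi n y"
  unfolding phi_linear by (rule linear_sum_add) (simp_all add: bscale_add)

lemma phi_zero [simp]: "phi n 0 = 0"
  by (simp add: phi_def)

lemma phi_single: "phi n (Poly_Mapping.single u c) = bscale c (phi_word n u)"
  unfolding phi_linear by (rule linear_sum_single) simp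

lemma phi_sum: "phi n (\<Sum>i\<in>I. f i) = (\<Sum>i\<in>I. phi n (f i))"
  by (induction I rule: infinite_finite_induct) (simp_all add: phi_add)

lemma phi_diff: "phi n (x - y) = phi n x - phi n y"
  by (rule additive_diff) (rule phi_add)

lemma freeC_iff: "x \<in> freeC n \<longleftrightarrow> (\<forall>u\<in>Poly_Mapping.keys x. valid_word n u)"
  by (simp add: freeC_def valid_word_def)

lemma freeC_zero: "0 \<in> freeC n"
  and freeC_single: "valid_word n u \<Longrightarrow> Poly_Mapping.single u c \<in> freeC n"
  by (simp_all add: freeC_iff)

lemma freeC_add: "x \<in> freeC n \<Longrightarrow> y \<in> freeC n \<Longrightarrow> x + y \<in> freeC n"
  using Poly_Mapping.keys_add[of x y] unfolding freeC_iff by blast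

lemma freeC_diff: "x \<in> freeC n \<Longrightarrow> y \<in> freeC n \<Longrightarrow> x - y \<in> freeC n"
  using Poly_Mapping.keys_diff[of x y] unfolding freeC_iff by blast

lemma freeC_induct [consumes 1, case_names zero add single]:
  assumes "x \<in> freeC n" "P 0" "\<And>x y. P x \<Longrightarrow> P y \<Longrightarrow> P (x + y)"
    "\<And>u c. valid_word n u \<Longrightarrow> P (Poly_Mapping.single u c)"
  shows "P x"
  using assms(1) by (intro poly_mapping_add_induct[of P x] assms(2-4)) (simp_all add: freeC_iff)

lemma valid_word_append: "valid_word n (u @ v) \<longleftrightarrow> valid_word n u \<and> valid_word n v"
  by (auto simp: valid_word_def)

lemma freeC_fmult:
  assumes "x \<in> freeC n" "y \<in> freeC n"
  shows "fmult x y \<in> freeC n"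
  using assms(1)
proof (induction x rule: freeC_induct)
  case (single u c)
  note u = this
  show ?case using assms(2)
    by (induction y rule: freeC_induct)
      (simp_all add: freeC_zero fmult_add freeC_add fmult_single freeC_single valid_word_append u)
qed (simp_all add: freeC_zero fmult_add freeC_add)

lemma phi_mult:
  assumes "x \<in> freeC n" "y \<in> freeC n"
  shows "phi n (fmult x y) = bmult (phi n x) (phi n y)"
  using assms(1)
proof (induction x rule: freeC_induct)
  case (single u c)
  note u = this
  show ?case using assms(2)
  proof (induction y rule: freeC_induct)
    case (single v d)
    obtain k where k: "phi_word n u = Poly_Mapping.single (word_diag n u) (delta ^ k)"
      using phi_word_single[OF u] by blast
    obtain l where l: "phi_word n v = Poly_Mapping.single (word_diag n v) (delta ^ l)"
      using phi_word_single[OF single] by blast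
    have "c * d * (p * q * r) = c * p * (d * q) * r" for p q r :: laurent by (simp only: mult_ac)
    then show ?case
      unfolding fmult_single phi_single phi_word_append[OF u single] k l bscale_single bmult_single by (rule arg_cong)
  qed (simp_all add: fmult_add phi_add bmult_add)
qed (simp_all add: fmult_add phi_add bmult_add)

text \<open>Membership in \<open>freeC n\<close> is proved along with the vanishing, because the
  multiplicativity of \<open>phi\<close> used for products is stated for
  \<open>freeC n\<close>.\<close>

lemma idealC_phi:
  assumes n: "2 \<le> n" and x: "x \<in> idealC n"
  shows "x \<in> freeC n \<and> phi n x = 0"
  using x
proof induction
  case (rel x y)
  obtain u v j where r: "word_rel n u v j" "x = W u" "y = Poly_Mapping.single v (delta ^ j)"
    using relC_word_rel[OF rel] .
  have "valid_word n u" "valid_word n v" using word_rel_valid[OF r(1) n] by auto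
  moreover have "bscale 1 z = z" for z by (rule poly_mapping_eqI) (simp add: lookup_bscale)
  ultimately show ?case
    unfolding r(2,3) phi_diff phi_single phi_word_rel[OF r(1) n] by (simp add: freeC_diff freeC_single)
qed (simp_all add: freeC_zero freeC_add phi_add freeC_fmult phi_mult)

text \<open>Scalars act through the empty word, so closure under scalars is a case of closure under
  left multiplication.\<close>

lemma idealC_scale:
  assumes "x \<in> idealC n"
  shows "fmult (Poly_Mapping.single [] c) x \<in> idealC n"
  by (rule idealC.lmul[OF assms]) (simp add: freeC_single valid_word_def)

lemma idealC_diff: "x \<in> idealC n \<Longrightarrow> y \<in> idealC n \<Longrightarrow> x - y \<in> idealC n"
proof -
  assume xy: "x \<in> idealC n" "y \<in> idealC n"
  have m: "fmult (Poly_Mapping.single [] (- 1)) z = - z" for z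
  proof (rule poly_mapping_add_induct[of "\<lambda>z. fmult (Poly_Mapping.single [] (- 1)) z = - z"])
    show "fmult (Poly_Mapping.single [] (- 1)) (Poly_Mapping.single u c) = - Poly_Mapping.single u c" for u c
      unfolding fmult_single by (simp add: single_uminus)
  qed (simp_all add: fmult_add)
  have "x + fmult (Poly_Mapping.single [] (- 1)) y \<in> idealC n"
    by (rule idealC.add[OF xy(1) idealC_scale[OF xy(2)]])
  then show "x - y \<in> idealC n" unfolding m by simp
qed

text \<open>The integer powers of \<open>\<delta>\<close>; negative ones arise when a congruence is
  read backwards.\<close>

abbreviation unit :: "int \<Rightarrow> laurent" where
  "unit k \<equiv> Poly_Mapping.single k 1"

lemma unit_mult: "unit j * unit k = unit (j + k)"
  by (simp add: mult_single)

lemma delta_power: "delta ^ k = unit (int k)"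
  by (induction k) (simp_all add: delta_def mult_single flip: single_one)

lemma unit_cancel: "c * unit k = d * unit k \<longleftrightarrow> c = d"
proof
  assume "c * unit k = d * unit k"
  then have "c * (unit k * unit (- k)) = d * (unit k * unit (- k))" by (simp flip: mult.assoc)
  then show "c = d" by (simp add: unit_mult)
qed simp

text \<open>Reversing a congruence requires the inverse power, which exists because
  \<open>\<delta>\<close> is a unit. Validity is carried along so that the factors multiplied on in
  the case \<open>frame\<close> lie in \<open>freeC n\<close>.\<close>

lemma word_cong_ideal:
  assumes n: "2 \<le> n" and uv: "word_cong n u v"
  shows "(valid_word n u \<longleftrightarrow> valid_word n v) \<and> (valid_word n u \<longrightarrow> (\<exists>k. W u - Poly_Mapping.single v (unit k) \<in> idealC n))"
  using uv
proof induction
  case (rel u v j)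
  have "W u - Poly_Mapping.single v (unit (int j)) \<in> idealC n"
    using idealC.rel[OF word_rel_relC[OF rel]] by (simp add: delta_power)
  then show ?case using word_rel_valid[OF rel n] by blast
next
  case (word_refl u)
  have "W u - Poly_Mapping.single u (unit 0) \<in> idealC n" using idealC.zero by (simp flip: single_one)
  then show ?case by blast
next
  case (word_sym u v)
  have "\<exists>k. W v - Poly_Mapping.single u (unit k) \<in> idealC n" if v: "valid_word n v"
  proof -
    obtain k where k: "W u - Poly_Mapping.single v (unit k) \<in> idealC n" using word_sym.IH v by blast
    have "0 - fmult (Poly_Mapping.single [] (unit (- k))) (W u - Poly_Mapping.single v (unit k)) \<in> idealC n"
      by (rule idealC_diff[OF idealC.zero idealC_scale[OF k]])
    moreover have "fmult z (x - y) = fmult z x - fmult z y" for z x y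
      by (rule additive_diff) (rule fmult_add)
    ultimately have "W v - Poly_Mapping.single u (unit (- k)) \<in> idealC n"
      by (simp add: fmult_single unit_mult flip: single_one)
    then show ?thesis by blast
  qed
  then show ?case using word_sym.IH by blast
next
  case (word_trans u v w)
  have "\<exists>k. W u - Poly_Mapping.single w (unit k) \<in> idealC n" if u: "valid_word n u"
  proof -
    obtain k l where kl: "W u - Poly_Mapping.single v (unit k) \<in> idealC n" "W v - Poly_Mapping.single w (unit l) \<in> idealC n"
      using word_trans.IH u by blast
    have "fmult z (x - y) = fmult z x - fmult z y" for z x y
      by (rule additive_diff) (rule fmult_add)
    then have "fmult (Poly_Mapping.single [] (unit k)) (W v - Poly_Mapping.single w (unit l)) =
        Poly_Mapping.single v (unit k) - Poly_Mapping.single w (unit (k + l))"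
      by (simp add: fmult_single unit_mult)
    then have "(W u - Poly_Mapping.single v (unit k)) + (Poly_Mapping.single v (unit k) - Poly_Mapping.single w (unit (k + l))) \<in> idealC n"
      using idealC.add[OF kl(1) idealC_scale[OF kl(2), of "unit k"]] by simp
    then have "W u - Poly_Mapping.single w (unit (k + l)) \<in> idealC n" by simp
    then show ?thesis by blast
  qed
  then show ?case using word_trans.IH by blast
next
  case (frame u v a b)
  have "\<exists>k. W (a @ u @ b) - Poly_Mapping.single (a @ v @ b) (unit k) \<in> idealC n" if ab: "valid_word n (a @ u @ b)"
  proof -
    obtain k where k: "W u - Poly_Mapping.single v (unit k) \<in> idealC n" using frame.IH ab by (auto simp: valid_word_append)
    have "fmult (W a) (fmult (W u - Poly_Mapping.single v (unit k)) (W b)) \<in> idealC n"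
      using ab by (intro idealC.lmul idealC.rmul k freeC_single) (simp_all add: valid_word_append)
    moreover have "fmult z (x - y) = fmult z x - fmult z y" for z x y
      by (rule additive_diff) (rule fmult_add)
    moreover have "fmult (x - y) z = fmult x z - fmult y z" for z x y
      by (rule additive_diff[of "\<lambda>x. fmult x z"]) (rule fmult_add)
    ultimately have "W (a @ u @ b) - Poly_Mapping.single (a @ v @ b) (unit k) \<in> idealC n"
      by (simp add: fmult_single)
    then show ?thesis by blast
  qed
  then show ?case using frame.IH by (auto simp: valid_word_append)
qed

section \<open>The isomorphism\<close>

lemma sym_diagram_word:
  assumes "2 \<le> n" "D \<in> sym_diagrams (2 * n)"
  shows "\<exists>u. valid_word n u \<and> word_diag n u = D"
proof -
  obtain \<tau> where \<tau>: "sym_match (dots_of n) (bar_dot n) \<tau>" "D = diag (2 * n) \<tau>"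
    using sym_diagram_obtain[OF assms(2)] .
  obtain u where u: "valid_word n u" "\<And>p. p \<in> dots_of n \<Longrightarrow> word_match n u p = \<tau> p"
    using realized_sym_match[OF assms(1) \<tau>(1)] by (auto simp: realized_def)
  have "word_diag n u = D" unfolding \<tau>(2) by (rule diag_cong) (use u(2) in \<open>simp add: dots_of_eq\<close>)
  then show ?thesis using u(1) by blast
qed

definition diagram_word :: "nat \<Rightarrow> diagram \<Rightarrow> genC list" where
  "diagram_word n D = (SOME u. valid_word n u \<and> word_diag n u = D)"

definition loop_degree :: "nat \<Rightarrow> genC list \<Rightarrow> int" where
  "loop_degree n u = (SOME k. phi_word n u = Poly_Mapping.single (word_diag n u) (unit k))"

lemma diagram_word:
  assumes "2 \<le> n" "D \<in> sym_diagrams (2 * n)"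
  shows "valid_word n (diagram_word n D)" "word_diag n (diagram_word n D) = D"
  using someI_ex[OF sym_diagram_word[OF assms]] unfolding diagram_word_def by blast+

lemma phi_word_degree: "valid_word n u \<Longrightarrow> phi_word n u = Poly_Mapping.single (word_diag n u) (unit (loop_degree n u))"
  unfolding loop_degree_def by (rule someI_ex) (use phi_word_single[of n u] in \<open>auto simp: delta_power\<close>)

lemma word_diag_sym: "valid_word n u \<Longrightarrow> word_diag n u \<in> sym_diagrams (2 * n)"
  by (rule diag_sym_diagram[OF sym_match_word])

lemma phi_diagram_word:
  assumes "2 \<le> n" "D \<in> sym_diagrams (2 * n)"
  shows "phi n (Poly_Mapping.single (diagram_word n D) c) =
    Poly_Mapping.single D (c * unit (loop_degree n (diagram_word n D)))"
  using phi_word_degree[OF diagram_word(1)[OF assms]] diagram_word(2)[OF assms]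
  by (simp add: phi_single bscale_single)

lemma SBr_iff: "y \<in> SBr (2 * n) \<longleftrightarrow> Poly_Mapping.keys y \<subseteq> sym_diagrams (2 * n)"
  by (simp add: SBr_def sym_diagrams_def)

lemma phi_image:
  assumes n: "2 \<le> n"
  shows "phi n ` freeC n = SBr (2 * n)"
proof
  have closed: "x + y \<in> SBr (2 * n)" if "x \<in> SBr (2 * n)" "y \<in> SBr (2 * n)" for x y
    using that Poly_Mapping.keys_add[of x y] unfolding SBr_iff by blast
  show "phi n ` freeC n \<subseteq> SBr (2 * n)"
  proof
    fix y assume "y \<in> phi n ` freeC n"
    then obtain x where x: "x \<in> freeC n" "y = phi n x" by blast
    from x(1) have "phi n x \<in> SBr (2 * n)"
    proof (induction rule: freeC_induct)
      case zero
      show ?case by (simp add: SBr_iff)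
    next
      case (add x y)
      then show ?case unfolding phi_add by (rule closed)
    next
      case (single u c)
      then show ?case unfolding phi_single phi_word_degree[OF single] bscale_single SBr_iff
        using word_diag_sym[OF single] by simp
    qed
    then show "y \<in> SBr (2 * n)" unfolding x(2) .
  qed
  show "SBr (2 * n) \<subseteq> phi n ` freeC n"
  proof
    fix y assume "y \<in> SBr (2 * n)"
    then have y: "Poly_Mapping.keys y \<subseteq> sym_diagrams (2 * n)" by (simp add: SBr_iff)
    show "y \<in> phi n ` freeC n"
    proof (rule poly_mapping_add_induct[of "\<lambda>y. y \<in> phi n ` freeC n"])
      show "0 \<in> phi n ` freeC n" using freeC_zero by (intro image_eqI[of _ _ 0]) simp_all
      show "a + b \<in> phi n ` freeC n" if ab: "a \<in> phi n ` freeC n" "b \<in> phi n ` freeC n" for a b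
      proof -
        obtain x x' where x: "x \<in> freeC n" "a = phi n x" "x' \<in> freeC n" "b = phi n x'" using ab by blast
        show ?thesis unfolding x(2,4) phi_add[symmetric] by (rule imageI[OF freeC_add[OF x(1,3)]])
      qed
      fix D c assume "D \<in> Poly_Mapping.keys y"
      then have D: "D \<in> sym_diagrams (2 * n)" using y by blast
      let ?k = "loop_degree n (diagram_word n D)"
      \<comment> \<open>The chosen word maps to \<open>D\<close> times a power of
        \<open>\<delta>\<close>, and the coefficient compensates for this power.\<close>
      have "c * unit (- ?k) * unit ?k = c" by (simp add: mult.assoc unit_mult)
      then have "Poly_Mapping.single D c = phi n (Poly_Mapping.single (diagram_word n D) (c * unit (- ?k)))"
        unfolding phi_diagram_word[OF n D] by (simp only:)
      then show "Poly_Mapping.single D c \<in> phi n ` freeC n"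
        using freeC_single[OF diagram_word(1)[OF n D]] by blast
    qed
  qed
qed

text \<open>The spanning half of the basis property: by \<open>word_cong_of_diag\<close> a word is
  congruent to the chosen word with the same diagram, so modulo the ideal the two differ by a power
  of \<open>\<delta>\<close>.\<close>

lemma reduce_mod_ideal:
  assumes n: "2 \<le> n" and x: "x \<in> freeC n"
  shows "\<exists>c. x - (\<Sum>D\<in>sym_diagrams (2 * n). Poly_Mapping.single (diagram_word n D) (c D)) \<in> idealC n"
  using x
proof (induction rule: freeC_induct)
  case zero
  show ?case by (rule exI[of _ "\<lambda>_. 0"]) (simp add: idealC.zero)
next
  case (add x y)
  then obtain c d where "x - (\<Sum>D\<in>sym_diagrams (2 * n). Poly_Mapping.single (diagram_word n D) (c D)) \<in> idealC n"
    "y - (\<Sum>D\<in>sym_diagrams (2 * n). Poly_Mapping.single (diagram_word n D) (d D)) \<in> idealC n" by blast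
  from idealC.add[OF this] show ?case
    by (intro exI[of _ "\<lambda>D. c D + d D"]) (simp add: single_add sum.distrib algebra_simps)
next
  case (single u c)
  let ?D = "word_diag n u"
  note D = word_diag_sym[OF single]
  note w = diagram_word[OF n D]
  have "word_cong n u (diagram_word n ?D)" by (rule word_cong_of_diag[OF n single w(1) w(2)[symmetric]])
  then obtain k where k: "W u - Poly_Mapping.single (diagram_word n ?D) (unit k) \<in> idealC n"
    using word_cong_ideal[OF n] single by blast
  have "fmult z (x - y) = fmult z x - fmult z y" for z x y
    by (rule additive_diff) (rule fmult_add)
  then have "Poly_Mapping.single u c - Poly_Mapping.single (diagram_word n ?D) (c * unit k) \<in> idealC n"
    using idealC_scale[OF k, of c] by (simp add: fmult_single)
  moreover have "(\<Sum>D\<in>sym_diagrams (2 * n). Poly_Mapping.single (diagram_word n D) (if D = ?D then c * unit k else 0)) =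
      Poly_Mapping.single (diagram_word n ?D) (c * unit k)"
  proof -
    have "(\<Sum>D\<in>sym_diagrams (2 * n). Poly_Mapping.single (diagram_word n D) (if D = ?D then c * unit k else 0)) =
        (\<Sum>D\<in>sym_diagrams (2 * n). if D = ?D then Poly_Mapping.single (diagram_word n D) (c * unit k) else 0)"
      by (rule sum.cong) simp_all
    then show ?thesis using D card_sym_diagrams(1)[of n] by simp
  qed
  ultimately show ?case by (intro exI[of _ "\<lambda>D. if D = ?D then c * unit k else 0"]) (simp only:)
qed

lemma lookup_phi_sum:
  assumes n: "2 \<le> n" and D: "D \<in> sym_diagrams (2 * n)"
  shows "Poly_Mapping.lookup (phi n (\<Sum>D\<in>sym_diagrams (2 * n). Poly_Mapping.single (diagram_word n D) (c D))) D =
    c D * unit (loop_degree n (diagram_word n D))"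
proof -
  have "phi n (\<Sum>D\<in>sym_diagrams (2 * n). Poly_Mapping.single (diagram_word n D) (c D)) =
      (\<Sum>D\<in>sym_diagrams (2 * n). Poly_Mapping.single D (c D * unit (loop_degree n (diagram_word n D))))"
    unfolding phi_sum by (rule sum.cong[OF refl]) (rule phi_diagram_word[OF n])
  then have "Poly_Mapping.lookup (phi n (\<Sum>D\<in>sym_diagrams (2 * n). Poly_Mapping.single (diagram_word n D) (c D))) D =
      (\<Sum>D'\<in>sym_diagrams (2 * n). if D' = D then c D' * unit (loop_degree n (diagram_word n D')) else 0)"
    by (simp add: lookup_sum lookup_single when_def)
  then show ?thesis using D card_sym_diagrams(1)[of n] by simp
qed

text \<open>Modulo the ideal \<open>x\<close> is a combination of the chosen words, whose images are
  unit multiples of distinct diagrams. If \<open>phi\<close> kills \<open>x\<close>, all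
  coefficients therefore vanish.\<close>

lemma phi_kernel:
  assumes n: "2 \<le> n" and x: "x \<in> freeC n" and z: "phi n x = 0"
  shows "x \<in> idealC n"
proof -
  obtain c where c: "x - (\<Sum>D\<in>sym_diagrams (2 * n). Poly_Mapping.single (diagram_word n D) (c D)) \<in> idealC n"
    using reduce_mod_ideal[OF n x] by blast
  have p: "phi n (\<Sum>D\<in>sym_diagrams (2 * n). Poly_Mapping.single (diagram_word n D) (c D)) = 0"
    using idealC_phi[OF n c] z by (simp add: phi_diff)
  have "c D = 0" if D: "D \<in> sym_diagrams (2 * n)" for D
  proof -
    have "c D * unit (loop_degree n (diagram_word n D)) = 0 * unit (loop_degree n (diagram_word n D))"
      using lookup_phi_sum[OF n D, of c] unfolding p by simp
    then show ?thesis unfolding unit_cancel .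
  qed
  then have "(\<Sum>D\<in>sym_diagrams (2 * n). Poly_Mapping.single (diagram_word n D) (c D)) = 0" by simp
  then show ?thesis using c by simp
qed

text \<open>Existence is \<open>reduce_mod_ideal\<close>. For uniqueness, \<open>phi\<close> kills
  the ideal, so the coefficients can be read off at the diagrams; the remaining work translates
  between positions in the list and diagrams.\<close>

lemma diagram_words_basis:
  assumes n: "2 \<le> n" and L: "distinct Ds" "set Ds = sym_diagrams (2 * n)" and x: "x \<in> freeC n"
  defines "B \<equiv> map (diagram_word n) Ds"
  shows "\<exists>!c :: nat \<Rightarrow> laurent. (\<forall>i\<ge>length B. c i = 0) \<and>
    x - (\<Sum>i<length B. Poly_Mapping.single (B ! i) (c i)) \<in> idealC n"
proof -
  have b: "bij_betw ((!) Ds) {..<length Ds} (sym_diagrams (2 * n))"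
    using bij_betw_nth[OF L(1) refl L(2)[symmetric]] .
  define idx where "idx = the_inv_into {..<length Ds} ((!) Ds)"
  have idx: "idx (Ds ! i) = i" if "i < length Ds" for i
    unfolding idx_def using b that by (intro the_inv_into_f_f) (auto simp: bij_betw_def)
  have len: "length B = length Ds" by (simp add: B_def)
  have reindex: "(\<Sum>i<length B. Poly_Mapping.single (B ! i) (d (Ds ! i))) =
      (\<Sum>D\<in>sym_diagrams (2 * n). Poly_Mapping.single (diagram_word n D) (d D))" for d :: "diagram \<Rightarrow> laurent"
    unfolding len using sum.reindex_bij_betw[OF b, of "\<lambda>D. Poly_Mapping.single (diagram_word n D) (d D)"]
    by (simp add: B_def)
  have by_idx: "(\<Sum>i<length B. Poly_Mapping.single (B ! i) (c i)) =
      (\<Sum>D\<in>sym_diagrams (2 * n). Poly_Mapping.single (diagram_word n D) (c (idx D)))" for c :: "nat \<Rightarrow> laurent"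
    unfolding reindex[of "\<lambda>D. c (idx D)", symmetric] by (rule sum.cong) (simp_all add: idx len)
  show ?thesis
  proof (rule ex_ex1I)
    obtain c where c: "x - (\<Sum>D\<in>sym_diagrams (2 * n). Poly_Mapping.single (diagram_word n D) (c D)) \<in> idealC n"
      using reduce_mod_ideal[OF n x] by blast
    \<comment> \<open>Coefficients beyond the length of the list are set to 0, the value prescribed
      there to make \<open>c\<close> unique as a function on all naturals.\<close>
    have "(\<Sum>i<length B. Poly_Mapping.single (B ! i) (if i < length B then c (Ds ! i) else 0)) =
        (\<Sum>i<length B. Poly_Mapping.single (B ! i) (c (Ds ! i)))"
      by (rule sum.cong) simp_all
    then show "\<exists>c :: nat \<Rightarrow> laurent. (\<forall>i\<ge>length B. c i = 0) \<and>
        x - (\<Sum>i<length B. Poly_Mapping.single (B ! i) (c i)) \<in> idealC n"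
      using c by (intro exI[of _ "\<lambda>i. if i < length B then c (Ds ! i) else 0"]) (simp add: reindex)
  next
    fix c d :: "nat \<Rightarrow> laurent"
    assume c: "(\<forall>i\<ge>length B. c i = 0) \<and> x - (\<Sum>i<length B. Poly_Mapping.single (B ! i) (c i)) \<in> idealC n"
      and d: "(\<forall>i\<ge>length B. d i = 0) \<and> x - (\<Sum>i<length B. Poly_Mapping.single (B ! i) (d i)) \<in> idealC n"
    have p: "phi n (\<Sum>D\<in>sym_diagrams (2 * n). Poly_Mapping.single (diagram_word n D) (f (idx D))) = phi n x"
      if "x - (\<Sum>i<length B. Poly_Mapping.single (B ! i) (f i)) \<in> idealC n" for f
      using idealC_phi[OF n that] unfolding by_idx by (simp add: phi_diff)
    show "c = d"
    proof
      fix i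
      show "c i = d i"
      proof (cases "i < length B")
        case True
        then have i: "i < length Ds" by (simp add: len)
        have D: "Ds ! i \<in> sym_diagrams (2 * n)" using i L(2) nth_mem by blast
        have "c i * unit (loop_degree n (diagram_word n (Ds ! i))) = d i * unit (loop_degree n (diagram_word n (Ds ! i)))"
          using lookup_phi_sum[OF n D, of "\<lambda>D. c (idx D)"] lookup_phi_sum[OF n D, of "\<lambda>D. d (idx D)"]
          unfolding p[OF conjunct2[OF c]] p[OF conjunct2[OF d]] idx[OF i] by simp
        then show ?thesis unfolding unit_cancel .
      next
        case False
        then show ?thesis using c d by simp
      qed
    qed
  qed
qed

theorem theorem1p1:
  fixes n :: nat
  assumes "n \<ge> 2"
  shows "phi n (W []) = brauer_one (2 * n)
    \<and> (\<forall>x\<in>freeC n. \<forall>y\<in>freeC n. phi n (fmult x y) = bmult (phi n x) (phi n y))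
    \<and> (\<forall>x\<in>freeC n. phi n x = 0 \<longleftrightarrow> x \<in> idealC n)
    \<and> phi n ` freeC n = SBr (2 * n)
    \<and> (\<exists>B :: genC list list. length B = a_seq (2 * n)
         \<and> (\<forall>w\<in>set B. W w \<in> freeC n)
         \<and> (\<forall>x\<in>freeC n. \<exists>!c :: nat \<Rightarrow> laurent. (\<forall>i\<ge>length B. c i = 0)
               \<and> x - (\<Sum>i<length B. Poly_Mapping.single (B ! i) (c i)) \<in> idealC n))"
proof (intro conjI)
  show "phi n (W []) = brauer_one (2 * n)"
    by (rule poly_mapping_eqI) (simp add: phi_single lookup_bscale phi_word_def)
  show "\<forall>x\<in>freeC n. \<forall>y\<in>freeC n. phi n (fmult x y) = bmult (phi n x) (phi n y)"
    using phi_mult by blast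
  show "\<forall>x\<in>freeC n. phi n x = 0 \<longleftrightarrow> x \<in> idealC n"
    using phi_kernel[OF assms] idealC_phi[OF assms] by blast
  show "phi n ` freeC n = SBr (2 * n)" by (rule phi_image[OF assms])
  obtain Ds where Ds: "distinct Ds" "set Ds = sym_diagrams (2 * n)"
    using finite_distinct_list[OF card_sym_diagrams(1)[of n]] by blast
  show "\<exists>B :: genC list list. length B = a_seq (2 * n)
         \<and> (\<forall>w\<in>set B. W w \<in> freeC n)
         \<and> (\<forall>x\<in>freeC n. \<exists>!c :: nat \<Rightarrow> laurent. (\<forall>i\<ge>length B. c i = 0)
               \<and> x - (\<Sum>i<length B. Poly_Mapping.single (B ! i) (c i)) \<in> idealC n)"
  proof (intro exI[of _ "map (diagram_word n) Ds"] conjI ballI)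
    show "length (map (diagram_word n) Ds) = a_seq (2 * n)"
      using distinct_card[OF Ds(1)] card_sym_diagrams(2)[of n] by (simp add: Ds(2))
    show "W w \<in> freeC n" if "w \<in> set (map (diagram_word n) Ds)" for w
      using that diagram_word(1)[OF assms] by (auto simp: Ds(2) intro!: freeC_single)
  qed (rule diagram_words_basis[OF assms Ds])
qed

end
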